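(* The nonsymmetric operads in chain complexes $S_*(\mathcal{A}s_{S^1},\mathbb Q)$ and $S_*(\mathcal{A}s_{S^1}\rtimes S^1,\mathbb Q)$ are formal.
   Context: The nonsymmetric operads $\mathcal As_{S^1}$ and $\mathcal As_{S^1}\rtimes S^1$ are those of Dotsenko–Shadrin–Vallette (noncommutative analogues of the little disks and framed little disks operads), considered as operads in smooth complex algebraic varieties by using $\mathbb C^*=\mathbb C\setminus\{0\}$ as an algebraic model of the circle. Explicitly, for $n\ge1$, $\mathcal As_{S^1}(n)=(\mathbb C^* )^{n-1}$ (a point for $n=1$, which is the operadic unit), $\mathcal As_{S^1}(0)=\emptyset$, with partial compositions ($1\le i\le n$) $$(z_1,\dots,z_{n-1})\circ_i(w_1,\dots,w_{m-1})=(z_1,\dots,z_{i-1},w_1,\dots,w_{m-1},z_i,\dots,z_{n-1}).$$ The group $\mathbb C^*$ acts on $\mathcal As_{S^1}(n)$ by diagonal multiplication on all coordinates, compatibly with the operad structure. The operad $\mathcal As_{S^1}\rtimes S^1$ is the resulting semidirect product: $(\mathcal As_{S^1}\rtimes S^1)(n)=\mathcal As_{S^1}(n)\times(\mathbb C^* )^n$ with $$(p;g_1,\dots,g_n)\circ_i(q;h_1,\dots,h_m)=(p\circ_i(g_i\cdot q);g_1,\dots,g_{i-1},g_ih_1,\dots,g_ih_m,g_{i+1},\dots,g_n).$$ For a topological operad $P$, $S_*(P,\mathbb Q)$ is the operad in rational chain complexes obtained by applying the lax symmetric monoidal functor of singular chains (to the complex points with the analytic topology). A (nonsymmetric) operad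 $P$ in chain complexes is formal if it is connected to its homology $H_*(P)$ (with zero differential) by a zig-zag of quasi-isomorphisms of (nonsymmetric) operads in chain complexes. *)

theory Defs
  imports
    "HOL-Homology.Homology"
    "HOL-Algebra.Module"
    "HOL-Algebra.AbelCoset"
    "HOL-Algebra.Algebraic_Closure_Type"
begin

section \<open>Nonsymmetric operads in rational chain complexes\<close>

abbreviation rat_ring :: "rat ring" where
  "rat_ring \<equiv> ring_of_type_algebra"

text \<open>
  Complexes are homologically graded by the integers. \<open>obj P n d\<close> is the rational vector space
  \<open>P(n)\<^sub>d\<close> (only the module part of the record \<open>module\<close> matters, its ring multiplication and one are
  ignored), \<open>bdry P n d : P(n)\<^sub>d \<rightarrow> P(n)\<^sub>d\<^sub>-\<^sub>1\<close> is the differential, and \<open>pcomp P n m i d e x y\<close> is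
  \<open>x \<circ>\<^sub>i y\<close> for \<open>x \<in> P(n)\<^sub>d\<close>, \<open>y \<in> P(m)\<^sub>e\<close> and \<open>1 \<le> i \<le> n\<close>.
\<close>

record 'a dg_operad =
  obj :: "nat \<Rightarrow> int \<Rightarrow> (rat, 'a) module"
  bdry :: "nat \<Rightarrow> int \<Rightarrow> 'a \<Rightarrow> 'a"
  pcomp :: "nat \<Rightarrow> nat \<Rightarrow> nat \<Rightarrow> int \<Rightarrow> int \<Rightarrow> 'a \<Rightarrow> 'a \<Rightarrow> 'a"
  opunit :: 'a

definition rat_linear :: "(rat, 'a) module \<Rightarrow> (rat, 'b) module \<Rightarrow> ('a \<Rightarrow> 'b) \<Rightarrow> bool" where
  "rat_linear M N f \<longleftrightarrow>
     f \<in> carrier M \<rightarrow> carrier N \<and>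
     (\<forall>x\<in>carrier M. \<forall>y\<in>carrier M. f (x \<oplus>\<^bsub>M\<^esub> y) = f x \<oplus>\<^bsub>N\<^esub> f y) \<and>
     (\<forall>r. \<forall>x\<in>carrier M. f (r \<odot>\<^bsub>M\<^esub> x) = r \<odot>\<^bsub>N\<^esub> f x)"

definition koszul_sign :: "int \<Rightarrow> rat" where
  "koszul_sign d = (if even d then 1 else -1)"

locale dg_ns_operad =
  fixes P :: "'a dg_operad"
  assumes obj_module: "Module.module rat_ring (obj P n d)"
    and bdry_linear: "rat_linear (obj P n d) (obj P n (d - 1)) (bdry P n d)"
    and bdry_bdry: "x \<in> carrier (obj P n d) \<Longrightarrow>
      bdry P n (d - 1) (bdry P n d x) = \<zero>\<^bsub>obj P n (d - 2)\<^esub>"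
    and pcomp_linear_left: "\<lbrakk>1 \<le> i; i \<le> n; y \<in> carrier (obj P m e)\<rbrakk> \<Longrightarrow>
      rat_linear (obj P n d) (obj P (n + m - 1) (d + e)) (\<lambda>x. pcomp P n m i d e x y)"
    and pcomp_linear_right: "\<lbrakk>1 \<le> i; i \<le> n; x \<in> carrier (obj P n d)\<rbrakk> \<Longrightarrow>
      rat_linear (obj P m e) (obj P (n + m - 1) (d + e)) (pcomp P n m i d e x)"
    and bdry_pcomp: "\<lbrakk>1 \<le> i; i \<le> n; x \<in> carrier (obj P n d); y \<in> carrier (obj P m e)\<rbrakk> \<Longrightarrow>
      bdry P (n + m - 1) (d + e) (pcomp P n m i d e x y) =
        pcomp P n m i (d - 1) e (bdry P n d x) y
        \<oplus>\<^bsub>obj P (n + m - 1) (d + e - 1)\<^esub>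
        koszul_sign d \<odot>\<^bsub>obj P (n + m - 1) (d + e - 1)\<^esub> pcomp P n m i d (e - 1) x (bdry P m e y)"
    and opunit_closed: "opunit P \<in> carrier (obj P 1 0)"
    and bdry_opunit: "bdry P 1 0 (opunit P) = \<zero>\<^bsub>obj P 1 (-1)\<^esub>"
    and opunit_left: "x \<in> carrier (obj P n d) \<Longrightarrow> pcomp P 1 n 1 0 d (opunit P) x = x"
    and opunit_right: "\<lbrakk>1 \<le> i; i \<le> n; x \<in> carrier (obj P n d)\<rbrakk> \<Longrightarrow>
      pcomp P n 1 i d 0 x (opunit P) = x"
    and pcomp_sequential: "\<lbrakk>1 \<le> i; i \<le> n; 1 \<le> j; j \<le> m;
        x \<in> carrier (obj P n d); y \<in> carrier (obj P m e); z \<in> carrier (obj P l f)\<rbrakk> \<Longrightarrow>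
      pcomp P (n + m - 1) l (i + j - 1) (d + e) f (pcomp P n m i d e x y) z =
        pcomp P n (m + l - 1) i d (e + f) x (pcomp P m l j e f y z)"
    and pcomp_parallel: "\<lbrakk>1 \<le> i; i < k; k \<le> n;
        x \<in> carrier (obj P n d); y \<in> carrier (obj P m e); z \<in> carrier (obj P l f)\<rbrakk> \<Longrightarrow>
      pcomp P (n + m - 1) l (k + m - 1) (d + e) f (pcomp P n m i d e x y) z =
        koszul_sign (e * f) \<odot>\<^bsub>obj P (n + m + l - 2) (d + e + f)\<^esub>
        pcomp P (n + l - 1) m i (d + f) e (pcomp P n l k d f x z) y"

definition op_morphism ::
    "'a dg_operad \<Rightarrow> 'b dg_operad \<Rightarrow> (nat \<Rightarrow> int \<Rightarrow> 'a \<Rightarrow> 'b) \<Rightarrow> bool" where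
  "op_morphism P Q f \<longleftrightarrow>
     (\<forall>n d. rat_linear (obj P n d) (obj Q n d) (f n d)) \<and>
     (\<forall>n d. \<forall>x\<in>carrier (obj P n d). f n (d - 1) (bdry P n d x) = bdry Q n d (f n d x)) \<and>
     (\<forall>n m d e. \<forall>i\<in>{1..n}. \<forall>x\<in>carrier (obj P n d). \<forall>y\<in>carrier (obj P m e).
        f (n + m - 1) (d + e) (pcomp P n m i d e x y) = pcomp Q n m i d e (f n d x) (f m e y)) \<and>
     f 1 0 (opunit P) = opunit Q"

definition cycles :: "'a dg_operad \<Rightarrow> nat \<Rightarrow> int \<Rightarrow> 'a set" where
  "cycles P n d = {x \<in> carrier (obj P n d). bdry P n d x = \<zero>\<^bsub>obj P n (d - 1)\<^esub>}"

definition boundaries :: "'a dg_operad \<Rightarrow> nat \<Rightarrow> int \<Rightarrow> 'a set" where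
  "boundaries P n d = bdry P n (d + 1) ` carrier (obj P n (d + 1))"

definition homology_class :: "'a dg_operad \<Rightarrow> nat \<Rightarrow> int \<Rightarrow> 'a \<Rightarrow> 'a set" where
  "homology_class P n d x = boundaries P n d +>\<^bsub>obj P n d\<^esub> x"

text \<open>
  Operations on homology are induced from those on representatives; the unions below are over
  families of equal cosets when \<open>P\<close> is an operad.
\<close>

definition homology_operad :: "'a dg_operad \<Rightarrow> 'a set dg_operad" where
  "homology_operad P =
     \<lparr> obj = (\<lambda>n d.
         \<lparr> carrier = homology_class P n d ` cycles P n d,
           monoid.mult = undefined, one = undefined,
           zero = boundaries P n d,
           add = set_add (obj P n d),
           module.smult = (\<lambda>r U. \<Union>x\<in>U. homology_class P n d (r \<odot>\<^bsub>obj P n d\<^esub> x)) \<rparr>),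
       bdry = (\<lambda>n d U. boundaries P n (d - 1)),
       pcomp = (\<lambda>n m i d e U V.
         \<Union>x\<in>U. \<Union>y\<in>V. homology_class P (n + m - 1) (d + e) (pcomp P n m i d e x y)),
       opunit = homology_class P 1 0 (opunit P) \<rparr>"

definition induced_map ::
    "'b dg_operad \<Rightarrow> (nat \<Rightarrow> int \<Rightarrow> 'a \<Rightarrow> 'b) \<Rightarrow> nat \<Rightarrow> int \<Rightarrow> 'a set \<Rightarrow> 'b set" where
  "induced_map Q f n d U = (\<Union>x\<in>U. homology_class Q n d (f n d x))"

definition quasi_iso :: "'a dg_operad \<Rightarrow> 'b dg_operad \<Rightarrow> bool" where
  "quasi_iso P Q \<longleftrightarrow> dg_ns_operad P \<and> dg_ns_operad Q \<and>
     (\<exists>f. op_morphism P Q f \<and>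
        (\<forall>n d. bij_betw (induced_map Q f n d)
           (carrier (obj (homology_operad P) n d)) (carrier (obj (homology_operad Q) n d))))"

text \<open>
  The intermediate operads of a zig-zag have to live on some fixed type. Here it is \<open>'a set\<close>, the
  type of the homology. This loses nothing: \<open>P\<close> itself has an isomorphic copy on \<open>'a set\<close> (through
  singletons), and any zig-zag can be replaced by one through a cofibrant resolution of \<open>P\<close>, whose
  cardinality is at most that of \<open>P\<close> if \<open>P\<close> is infinite. Since \<open>P\<close> has type \<open>'a dg_operad\<close> and the
  other operads \<open>'a set dg_operad\<close>, the first arrow (in either direction) is split off.
\<close>

definition formal_operad :: "'a dg_operad \<Rightarrow> bool" where
  "formal_operad P \<longleftrightarrow>
     (\<exists>Q :: 'a set dg_operad. (quasi_iso P Q \<or> quasi_iso Q P) \<and>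
        equivclp quasi_iso Q (homology_operad P))"


section \<open>Rational singular chains and the Eilenberg--Zilber product\<close>

type_synonym 'a rat_chain = "((nat \<Rightarrow> real) \<Rightarrow> 'a) \<Rightarrow>\<^sub>0 rat"

definition rat_scale :: "rat \<Rightarrow> ('k \<Rightarrow>\<^sub>0 rat) \<Rightarrow> ('k \<Rightarrow>\<^sub>0 rat)" where
  "rat_scale r = Poly_Mapping.map ((*) r)"

definition rat_extend :: "('k \<Rightarrow> ('l \<Rightarrow>\<^sub>0 rat)) \<Rightarrow> ('k \<Rightarrow>\<^sub>0 rat) \<Rightarrow> ('l \<Rightarrow>\<^sub>0 rat)" where
  "rat_extend f c = (\<Sum>s\<in>Poly_Mapping.keys c. rat_scale (Poly_Mapping.lookup c s) (f s))"

definition rat_singular_chains :: "int \<Rightarrow> 'a topology \<Rightarrow> (rat, 'a rat_chain) module" where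
  "rat_singular_chains d U =
     \<lparr> carrier = {c. Poly_Mapping.keys c \<subseteq> (if d < 0 then {} else singular_simplex_set (nat d) U)},
       monoid.mult = undefined, one = undefined, zero = 0, add = (+), module.smult = rat_scale \<rparr>"

definition rat_boundary :: "int \<Rightarrow> 'a rat_chain \<Rightarrow> 'a rat_chain" where
  "rat_boundary d c =
     (if d \<le> 0 then 0
      else rat_extend (\<lambda>s. \<Sum>k\<le>nat d. Poly_Mapping.single (singular_face (nat d) k s) ((-1) ^ k)) c)"

definition rat_chain_map :: "nat \<Rightarrow> ('a \<Rightarrow> 'b) \<Rightarrow> 'a rat_chain \<Rightarrow> 'b rat_chain" where
  "rat_chain_map p g = rat_extend (\<lambda>s. Poly_Mapping.single (simplex_map p g s) 1)"

text \<open>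
  A \<open>(p,q)\<close>-shuffle is given by the set \<open>A \<subseteq> {..<p+q}\<close> of its \<open>p\<close> steps in the first direction. The
  corresponding \<open>(p+q)\<close>-simplex of the product of the standard simplices is affine with \<open>k\<close>-th vertex
  \<open>(e\<^sub>a, e\<^sub>b)\<close>, where \<open>a\<close> and \<open>b\<close> are the numbers of steps before \<open>k\<close> in the first and second direction.
\<close>

definition shuffle_simplex ::
    "nat \<Rightarrow> nat \<Rightarrow> nat set \<Rightarrow> ((nat \<Rightarrow> real) \<Rightarrow> 'a) \<Rightarrow> ((nat \<Rightarrow> real) \<Rightarrow> 'b) \<Rightarrow> (nat \<Rightarrow> real) \<Rightarrow> 'a \<times> 'b"
  where
  "shuffle_simplex p q A s t =
     (\<lambda>x\<in>standard_simplex (p + q).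
        (s (oriented_simplex (p + q) (\<lambda>k j. if j = card (A \<inter> {..<k}) then 1 else 0) x),
         t (oriented_simplex (p + q) (\<lambda>k j. if j = card ({..<k} - A) then 1 else 0) x)))"

definition shuffle_sign :: "nat \<Rightarrow> nat \<Rightarrow> nat set \<Rightarrow> rat" where
  "shuffle_sign p q A = (-1) ^ card {(a, b). a \<in> A \<and> b \<in> {..<p + q} - A \<and> b < a}"

definition eilenberg_zilber ::
    "nat \<Rightarrow> nat \<Rightarrow> 'a rat_chain \<Rightarrow> 'b rat_chain \<Rightarrow> ('a \<times> 'b) rat_chain" where
  "eilenberg_zilber p q c c' =
     rat_extend (\<lambda>s. rat_extend (\<lambda>t.
       \<Sum>A | A \<subseteq> {..<p + q} \<and> card A = p.
         Poly_Mapping.single (shuffle_simplex p q A s t) (shuffle_sign p q A)) c') c"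

record 'a top_operad =
  tspace :: "nat \<Rightarrow> 'a topology"
  tcomp :: "nat \<Rightarrow> nat \<Rightarrow> nat \<Rightarrow> 'a \<Rightarrow> 'a \<Rightarrow> 'a"
  tunit :: 'a

definition singular_operad :: "'a top_operad \<Rightarrow> 'a rat_chain dg_operad" where
  "singular_operad T =
     \<lparr> obj = (\<lambda>n d. rat_singular_chains d (tspace T n)),
       bdry = (\<lambda>n d. rat_boundary d),
       pcomp = (\<lambda>n m i d e c c'.
         rat_chain_map (nat (d + e)) (\<lambda>(x, y). tcomp T n m i x y)
           (eilenberg_zilber (nat d) (nat e) c c')),
       opunit = Poly_Mapping.single (\<lambda>x\<in>standard_simplex 0. tunit T) 1 \<rparr>"


section \<open>The operads \<open>As\<^sub>S\<^sub>1\<close> and \<open>As\<^sub>S\<^sub>1 \<rtimes> S\<^sup>1\<close>\<close>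

text \<open>
  A point \<open>(z\<^sub>1, \<dots>, z\<^sub>n\<^sub>-\<^sub>1)\<close> of arity \<open>n\<close> is an extensional function on \<open>{1..<n}\<close>; for \<open>n = 1\<close> the only
  one is \<open>\<lambda>_. undefined\<close>.
\<close>

abbreviation Cstar :: "complex topology" where
  "Cstar \<equiv> top_of_set (- {0})"

definition AsS1_space :: "nat \<Rightarrow> (nat \<Rightarrow> complex) topology" where
  "AsS1_space n = (if n = 0 then trivial_topology else product_topology (\<lambda>_. Cstar) {1..<n})"

definition AsS1_comp ::
    "nat \<Rightarrow> nat \<Rightarrow> nat \<Rightarrow> (nat \<Rightarrow> complex) \<Rightarrow> (nat \<Rightarrow> complex) \<Rightarrow> (nat \<Rightarrow> complex)" where
  "AsS1_comp n m i z w =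
     (\<lambda>k\<in>{1..<n + m - 1}.
        if k < i then z k else if k < i + m - 1 then w (k + 1 - i) else z (k + 1 - m))"

definition AsS1 :: "(nat \<Rightarrow> complex) top_operad" where
  "AsS1 = \<lparr> tspace = AsS1_space, tcomp = AsS1_comp, tunit = (\<lambda>_. undefined) \<rparr>"

definition AsS1_action :: "nat \<Rightarrow> complex \<Rightarrow> (nat \<Rightarrow> complex) \<Rightarrow> (nat \<Rightarrow> complex)" where
  "AsS1_action n g z = (\<lambda>k\<in>{1..<n}. g * z k)"

definition AsS1_semidirect :: "((nat \<Rightarrow> complex) \<times> (nat \<Rightarrow> complex)) top_operad" where
  "AsS1_semidirect =
     \<lparr> tspace = (\<lambda>n. prod_topology (AsS1_space n) (product_topology (\<lambda>_. Cstar) {1..n})),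
       tcomp = (\<lambda>n m i (p, g) (q, h).
         (AsS1_comp n m i p (AsS1_action m (g i) q),
          \<lambda>k\<in>{1..n + m - 1}.
            if k < i then g k else if k < i + m then g i * h (k + 1 - i) else g (k + 1 - m))),
       tunit = (\<lambda>_. undefined, \<lambda>k\<in>{1}. 1) \<rparr>"

end

theory Submission
  imports Defs "HOL-Combinatorics.Permutations" "HOL-Analysis.Complex_Transcendental" "HOL-Analysis.Abstract_Limits"
begin

text \<open>
  In both operads the partial compositions are homomorphisms of algebraic tori. Fix an additive map
  \<open>\<theta>\<close> from the complex numbers to the rationals with \<open>\<theta> (2 \<pi> \<i>) = 1\<close>. Lifting the
  coordinates of a singular simplex in a torus through the exponential function and applying
  \<open>\<theta>\<close> at the vertices turns it into a list of rational vectors, well defined up to translation; an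
  alternating form evaluated on the edges of this list is a rational cochain. These cochains are cocycles,
  they are natural for homomorphisms of tori, and the Eilenberg-Zilber map turns them into shuffle
  products of forms. Hence the chains on which all forms vanish are an operadic ideal \<open>N\<close> containing the
  boundaries.

  The forms restrict to a basis of the cohomology of a torus, so every cycle in \<open>N\<close> is a boundary and
  every chain is a cycle modulo \<open>N\<close>. Sending a chain to the homology class of a cycle congruent to it
  modulo \<open>N\<close> is therefore a quasi-isomorphism of operads from the singular chains to their homology.

  The homology of a torus is found by induction on its rank, from the covering that replaces its last
  factor by the complex line: the chains of the torus are the cokernel of the deck transformation minus
  the identity, and this transformation is chain homotopic to the identity by the Eilenberg-Zilber product
  with a segment.
\<close>

section \<open>Shuffle products\<close>

text \<open>The cochains imitate the logarithmic forms dlog z_j. These are closed and are pulled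
  back linearly by homomorphisms of tori, but their periods are multiples of 2 pi i; the
  normalisation of \<theta> makes the periods rational, so formality is reached over the rationals
  with no descent from complex coefficients. \<theta> is a mere Q-linear functional and need not be
  continuous. This is harmless: continuity is used for the lifting, while \<theta> is applied only
  to the values of the lift at vertices. The kernel is cut out by all alternating forms and not by a
  chosen basis, because then the ideal property is immediate: with the edges in one factor of a
  composition fixed, a form becomes a form in the edges of the other. Forms are evaluated on edges
  without dividing by p!, so the shuffle product carries a binomial coefficient and a product of p
  loops a factorial; both are invertible over the rationals. Vertices are kept in lists so that
  faces, shuffles and edges all become recursions on the first vertex. The signs are then settled by
  induction, and subsets with their inversions enter only to match the given formula for the
  Eilenberg-Zilber map.\<close>

definition alternate :: "nat \<Rightarrow> 'm::ab_group_add \<Rightarrow> 'm" where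
  "alternate n x = (if even n then x else - x)"

lemma alternate_simps [simp]:
  "alternate 0 x = x" "alternate (Suc n) x = - alternate n x" "alternate n 0 = 0"
  by (auto simp: alternate_def)

lemma alternate_add: "alternate n (x + y) = alternate n x + alternate n y"
  and alternate_diff: "alternate n (x - y) = alternate n x - alternate n y"
  and alternate_minus: "alternate n (- x) = - alternate n x"
  and alternate_alternate: "alternate m (alternate n x) = alternate (m + n) x"
  by (auto simp: alternate_def)

lemma alternate_self: "alternate n (alternate n x) = x"
  by (auto simp: alternate_def)

lemma alternate_rat: "alternate n (x :: rat) = (-1) ^ n * x"
  by (auto simp: alternate_def)

text \<open>
  The lists stand for the vertices of simplices, so dimension is length minus one, and the values on an
  empty list are junk.
\<close>

fun shuffle_sum :: "(('a \<times> 'b) list \<Rightarrow> 'm::ab_group_add) \<Rightarrow> 'a list \<Rightarrow> 'b list \<Rightarrow> 'm" where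
  "shuffle_sum F [] V = 0"
| "shuffle_sum F (x # U) [] = 0"
| "shuffle_sum F (x # U) (y # V) =
     shuffle_sum (\<lambda>l. F ((x, y) # l)) U (y # V)
     + alternate (length U) (shuffle_sum (\<lambda>l. F ((x, y) # l)) (x # U) V)
     + (if U = [] \<and> V = [] then F [(x, y)] else 0)"

fun face_sum :: "('a list \<Rightarrow> 'm::ab_group_add) \<Rightarrow> 'a list \<Rightarrow> 'm" where
  "face_sum F [] = 0"
| "face_sum F (x # U) = F U - face_sum (\<lambda>l. F (x # l)) U"

lemma shuffle_sum_Nil2 [simp]: "shuffle_sum F U [] = 0"
  by (cases U) auto

lemma shuffle_sum_Nil1 [simp]: "shuffle_sum F [] = (\<lambda>V. 0)"
  by auto

text \<open>The facts offered about \<open>l\<close> are the ones exploited later: the length fixes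
  signs and dimensions, the head determines the first edge of a path, and the entries stay inside
  the grid.\<close>

lemma shuffle_sum_cong:
  assumes "\<And>l. \<lbrakk>l \<noteq> []; Suc (length l) = length U + length V; hd l = (hd U, hd V);
      set l \<subseteq> set U \<times> set V; U \<noteq> []; V \<noteq> []\<rbrakk> \<Longrightarrow> F l = G l"
  shows "shuffle_sum F U V = shuffle_sum G U V"
  using assms
proof (induction F U V arbitrary: G rule: shuffle_sum.induct)
  case (3 F x U y V)
  have "shuffle_sum (\<lambda>l. F ((x, y) # l)) U (y # V) = shuffle_sum (\<lambda>l. G ((x, y) # l)) U (y # V)"
    by (rule "3.IH"(1), rule "3.prems") auto
  moreover have "shuffle_sum (\<lambda>l. F ((x, y) # l)) (x # U) V
      = shuffle_sum (\<lambda>l. G ((x, y) # l)) (x # U) V"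
    by (rule "3.IH"(2), rule "3.prems") auto
  moreover have "F [(x, y)] = G [(x, y)]" if "U = []" "V = []"
    using that by (intro "3.prems") auto
  ultimately show ?case by simp
qed auto

lemma shuffle_sum_zero [simp]: "shuffle_sum (\<lambda>l. 0 :: 'c :: ab_group_add) U V = 0"
proof -
  have "F = (\<lambda>l. 0) \<Longrightarrow> shuffle_sum F U V = 0" for F :: "('a \<times> 'b) list \<Rightarrow> 'c" and U V
    by (induction F U V rule: shuffle_sum.induct) auto
  then show ?thesis by blast
qed

lemma shuffle_sum_add:
  "shuffle_sum (\<lambda>l. F l + G l) U V = shuffle_sum F U V + shuffle_sum G U V"
proof (induction F U V arbitrary: G rule: shuffle_sum.induct)
  case (3 F x U y V)
  show ?case
    unfolding shuffle_sum.simps "3.IH" alternate_add by auto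
qed auto

lemma shuffle_sum_minus: "shuffle_sum (\<lambda>l. - F l) U V = - shuffle_sum F U V"
proof (induction F U V rule: shuffle_sum.induct)
  case (3 F x U y V)
  show ?case
    unfolding shuffle_sum.simps "3.IH" alternate_minus by auto
qed auto

lemma shuffle_sum_diff:
  "shuffle_sum (\<lambda>l. F l - G l) U V = shuffle_sum F U V - shuffle_sum G U V"
  using shuffle_sum_add [of F "\<lambda>l. - G l"] by (simp add: shuffle_sum_minus)

lemma shuffle_sum_alternate:
  "shuffle_sum (\<lambda>l. alternate n (F l)) U V = alternate n (shuffle_sum F U V)"
  by (simp add: alternate_def shuffle_sum_minus)

lemma shuffle_sum_map:
  "shuffle_sum F (map f U) (map g V) = shuffle_sum (\<lambda>l. F (map (map_prod f g) l)) U V"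
  by (induction "\<lambda>l. F (map (map_prod f g) l)" U V arbitrary: F rule: shuffle_sum.induct) auto

lemma hom_shuffle_sum:
  assumes "\<And>x y. h (x + y) = h x + h y" "h 0 = 0" 
  shows "h (shuffle_sum F U V) = shuffle_sum (\<lambda>l. h (F l)) U V"
proof -
  have "h (- x) = - h x" for x
    using assms(1)[of x "- x"] assms(2) by (simp add: eq_neg_iff_add_eq_0 add.commute)
  then have "h (alternate n x) = alternate n (h x)" for n x
    by (auto simp: alternate_def)
  then show ?thesis
    using assms by (induction F U V rule: shuffle_sum.induct) auto
qed

lemma face_sum_cong:
  assumes "\<And>l. Suc (length l) = length U \<Longrightarrow> set l \<subseteq> set U \<Longrightarrow> F l = G l"
  shows "face_sum F U = face_sum G U"
  using assms
proof (induction F U arbitrary: G rule: face_sum.induct)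
  case (2 F x U)
  have "face_sum (\<lambda>l. F (x # l)) U = face_sum (\<lambda>l. G (x # l)) U"
    by (rule "2.IH", rule "2.prems") auto
  moreover have "F U = G U"
    by (rule "2.prems") auto
  ultimately show ?case by simp
qed auto

lemma face_sum_zero [simp]: "face_sum (\<lambda>l. 0 :: 'b :: ab_group_add) U = 0"
proof -
  have "F = (\<lambda>l. 0) \<Longrightarrow> face_sum F U = 0" for F :: "'a list \<Rightarrow> 'b" and U
    by (induction F U rule: face_sum.induct) auto
  then show ?thesis by blast
qed

lemma face_sum_add: "face_sum (\<lambda>l. F l + G l) U = face_sum F U + face_sum G U"
proof (induction F U arbitrary: G rule: face_sum.induct)
  case (2 F x U)
  show ?case
    unfolding face_sum.simps "2.IH" by auto
qed auto

lemma face_sum_minus: "face_sum (\<lambda>l. - F l) U = - face_sum F U"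
proof (induction F U rule: face_sum.induct)
  case (2 F x U)
  show ?case
    unfolding face_sum.simps "2.IH" by auto
qed auto

lemma face_sum_alternate: "face_sum (\<lambda>l. alternate n (F l)) U = alternate n (face_sum F U)"
  by (simp add: alternate_def face_sum_minus)

lemma face_sum_if_Nil:
  "face_sum (\<lambda>l. if l = [] \<and> b then c else 0) U = (if length U = Suc 0 \<and> b then c else 0)"
  by (cases U) auto

lemma face_sum_map: "face_sum F (map f U) = face_sum (\<lambda>l. F (map f l)) U"
  by (induction U arbitrary: F) auto

text \<open>Expanding both sums at the first entry \<open>x\<close>, the two copies of
  \<open>face_sum F U\<close> cancel and the same double sum for \<open>F (x # l)\<close>
  remains.\<close>

lemma face_sum_face_sum: "face_sum (face_sum F) U = 0"
proof (induction U arbitrary: F)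
  case (Cons x U)
  then show ?case
    using face_sum_add [of F "\<lambda>l. - face_sum (\<lambda>l. F (x # l)) l" U]
    by (simp add: face_sum_minus)
qed auto

text \<open>Links the recursion with the usual alternating sum over deleted positions, which is the
  form of the singular boundary.\<close>

lemma face_sum_nth:
  "face_sum F U = (\<Sum>k<length U. alternate k (F (take k U @ drop (Suc k) U)))"
proof (induction U arbitrary: F)
  case (Cons x U)
  show ?case
    unfolding face_sum.simps Cons.IH
    by (simp add: sum.lessThan_Suc_shift sum_negf del: sum.lessThan_Suc)
qed auto

text \<open>
  The last summand is caused by \<^const>\<open>face_sum\<close> being the augmented boundary: it takes the value
  \<open>F []\<close> on a list with one element.
\<close>

lemma shuffle_sum_face_sum:
  "shuffle_sum (face_sum F) U V =
     face_sum (\<lambda>U. shuffle_sum F U V) U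
     + alternate (length U - 1) (face_sum (\<lambda>V. shuffle_sum F U V) V)
     + (if length U = 1 \<and> length V = 1 then F [] else 0)"
proof (induction "length U + length V" arbitrary: F U V)
  case 0
  then show ?case by simp
next
  case (Suc N)
  show ?case
  proof (cases "U = [] \<or> V = []")
    case True
    then show ?thesis by auto
  next
    case False
    then obtain x U' y V' where U: "U = x # U'" and V: "V = y # V'"
      by (meson list.exhaust)
    define G where "G = (\<lambda>l. F ((x, y) # l))"
    have IH1: "shuffle_sum (face_sum G) U' V = face_sum (\<lambda>U. shuffle_sum G U V) U'
       + alternate (length U' - 1) (face_sum (\<lambda>V. shuffle_sum G U' V) V)
       + (if length U' = 1 \<and> length V = 1 then G [] else 0)"
      by (rule Suc.hyps) (use Suc.hyps U V in auto)
    have IH2: "shuffle_sum (face_sum G) U V' = face_sum (\<lambda>U. shuffle_sum G U V') U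
       + alternate (length U - 1) (face_sum (\<lambda>V. shuffle_sum G U V) V')
       + (if length U = 1 \<and> length V' = 1 then G [] else 0)"
      by (rule Suc.hyps) (use Suc.hyps U V in auto)
    have fs: "(\<lambda>l. face_sum F ((x, y) # l)) = (\<lambda>l. F l - face_sum G l)"
      by (simp add: G_def)
    have L: "shuffle_sum (face_sum F) U V =
        shuffle_sum F U' V - shuffle_sum (face_sum G) U' V
        + alternate (length U') (shuffle_sum F U V' - shuffle_sum (face_sum G) U V')
        + (if U' = [] \<and> V' = [] then F [] else 0)"
      unfolding U V by (subst shuffle_sum.simps) (simp only: fs shuffle_sum_diff face_sum.simps diff_0_right G_def)
    have R1: "face_sum (\<lambda>U. shuffle_sum F U V) U = shuffle_sum F U' V
        - (face_sum (\<lambda>l. shuffle_sum G l V) U'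
          + alternate (length U' - 1) (face_sum (\<lambda>l. shuffle_sum G (x # l) V') U')
          + (if length U' = Suc 0 \<and> V' = [] then G [] else 0))"
    proof -
      have "face_sum (\<lambda>l. shuffle_sum F (x # l) V) U' =
          face_sum (\<lambda>l. shuffle_sum G l V + alternate (length U' - 1) (shuffle_sum G (x # l) V')
            + (if l = [] \<and> V' = [] then G [] else 0)) U'"
      proof (rule face_sum_cong)
        fix l assume "Suc (length l) = length U'" "set l \<subseteq> set U'"
        then have "length l = length U' - 1" by simp
        then show "shuffle_sum F (x # l) V = shuffle_sum G l V
            + alternate (length U' - 1) (shuffle_sum G (x # l) V')
            + (if l = [] \<and> V' = [] then G [] else 0)"
          by (simp add: V G_def)
      qed
      then show ?thesis
        by (simp add: U face_sum_add face_sum_alternate face_sum_if_Nil)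
    qed
    have R2: "face_sum (\<lambda>V. shuffle_sum F U V) V = shuffle_sum F U V'
        - (face_sum (\<lambda>l. shuffle_sum G U' (y # l)) V'
          + alternate (length U') (face_sum (\<lambda>l. shuffle_sum G U l) V')
          + (if length V' = Suc 0 \<and> U' = [] then G [] else 0))"
    proof -
      have "face_sum (\<lambda>l. shuffle_sum F U (y # l)) V' =
          face_sum (\<lambda>l. shuffle_sum G U' (y # l) + alternate (length U') (shuffle_sum G U l)
            + (if l = [] \<and> U' = [] then G [] else 0)) V'"
        by (rule face_sum_cong) (auto simp: U G_def)
      then show ?thesis
        by (simp add: V face_sum_add face_sum_alternate face_sum_if_Nil)
    qed
    \<comment> \<open>The term \<open>shuffle_sum G U' V'\<close>, common to \<open>fsX\<close> and
      \<open>fsY\<close>, collects the faces that run along the diagonal of the first square. Each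
      such face belongs to the two paths around that square, and the two occurrences cancel.\<close>
    have fsX: "face_sum (\<lambda>U. shuffle_sum G U V') U =
        shuffle_sum G U' V' - face_sum (\<lambda>l. shuffle_sum G (x # l) V') U'"
      by (simp add: U)
    have fsY: "face_sum (\<lambda>V. shuffle_sum G U' V) V =
        shuffle_sum G U' V' - face_sum (\<lambda>l. shuffle_sum G U' (y # l)) V'"
      by (simp add: V)
    have lX: "length U - 1 = length U'" "length U = Suc (length U')" "length V = Suc (length V')"
      by (simp_all add: U V)
    \<comment> \<open>The case \<open>U' = []\<close> is separate because of the truncated
      subtraction in \<open>length U' - 1\<close>; the diagonal terms then vanish on their
      own.\<close>
    show ?thesis
    proof (cases "length U'")
      case 0
      then show ?thesis
        unfolding L IH1 IH2 R1 R2 fsX fsY lX by (auto simp: alternate_add alternate_diff)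
    next
      case (Suc k)
      then show ?thesis
        unfolding L IH1 IH2 R1 R2 fsX fsY lX
        by (auto simp: alternate_add alternate_diff alternate_minus alternate_self algebra_simps)
    qed
  qed
qed

text \<open>Reflecting a lattice path in a p by q grid exchanges the squares on its two sides, so k
  inversions become pq - k and the sign changes by (-1)^(pq). In the recursion the summands for the
  two possible first steps trade places.\<close>

lemma shuffle_sum_swap:
  "shuffle_sum F U V =
     alternate ((length U - 1) * (length V - 1)) (shuffle_sum (\<lambda>l. F (map prod.swap l)) V U)"
proof (induction "length U + length V" arbitrary: F U V)
  case 0
  then show ?case by simp
next
  case (Suc N)
  show ?case
  proof (cases "U = [] \<or> V = []")
    case True
    then show ?thesis by auto
  next
    case False
    then obtain x U' y V' where U: "U = x # U'" and V: "V = y # V'"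
      by (meson list.exhaust)
    have IH1: "shuffle_sum (\<lambda>l. F ((x, y) # l)) U' V =
        alternate ((length U' - 1) * length V')
         (shuffle_sum (\<lambda>l. F ((x, y) # map prod.swap l)) V U')"
      by (subst Suc.hyps) (use Suc.hyps U V in auto)
    have IH2: "shuffle_sum (\<lambda>l. F ((x, y) # l)) U V' =
        alternate (length U' * (length V' - 1))
         (shuffle_sum (\<lambda>l. F ((x, y) # map prod.swap l)) V' U)"
      by (subst Suc.hyps) (use Suc.hyps U V in auto)
    show ?thesis
      unfolding U V by (subst (1 2) shuffle_sum.simps, unfold U [symmetric] V [symmetric] IH1 IH2)
        (cases U'; cases V'; auto simp: U V alternate_def)
  qed
qed

text \<open>Both sides are signed sums over lattice paths in a three-dimensional grid. They satisfy
  the same recursion on the direction of the first step, with signs 1, (-1)^p and (-1)^(p+q); these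
  are the facts \<open>L\<close> and \<open>R\<close>.\<close>

lemma shuffle_sum_assoc:
  "shuffle_sum (\<lambda>l. shuffle_sum F l W) U V =
     shuffle_sum (\<lambda>l. shuffle_sum (\<lambda>l'. F (map (\<lambda>(a, b, c). ((a, b), c)) l')) U l) V W"
proof (induction "length U + length V + length W" arbitrary: F U V W)
  case 0
  then show ?case by simp
next
  case (Suc N)
  let ?a = "\<lambda>(a, b, c). ((a, b), c)"
  show ?case
  proof (cases "U = [] \<or> V = [] \<or> W = []")
    case True
    then show ?thesis by auto
  next
    case False
    then obtain x U' y V' z W' where U: "U = x # U'" and V: "V = y # V'" and W: "W = z # W'"
      by (meson list.exhaust)
    define G where "G = (\<lambda>l. F (((x, y), z) # l))"
    let ?A = "\<lambda>U V W. shuffle_sum (\<lambda>l. shuffle_sum G l W) U V"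
    let ?B = "\<lambda>U V W. shuffle_sum (\<lambda>l. shuffle_sum (\<lambda>l'. G (map ?a l')) U l) V W"
    let ?e = "if U' = [] \<and> V' = [] \<and> W' = [] then G [] else 0"
    let ?p = "length U'" and ?q = "length V'"
    \<comment> \<open>All paths \<open>l\<close> of the outer sum have the same length, so the sign
      of a first step along \<open>W\<close> is constant and can be taken out.\<close>
    have 1: "shuffle_sum (\<lambda>l. shuffle_sum F ((x, y) # l) W) U'' V'' =
        ?A U'' V'' W + alternate (?p + ?q) (shuffle_sum (\<lambda>l. shuffle_sum G ((x, y) # l) W') U'' V'')"
      if "length U'' + length V'' = Suc (?p + ?q)" for U'' V''
    proof -
      have "shuffle_sum (\<lambda>l. shuffle_sum F ((x, y) # l) W) U'' V'' =
        shuffle_sum (\<lambda>l. shuffle_sum G l W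
          + alternate (?p + ?q) (shuffle_sum G ((x, y) # l) W')) U'' V''"
        by (rule shuffle_sum_cong) (use that in \<open>auto simp: W G_def\<close>)
      then show ?thesis
        by (simp add: shuffle_sum_add shuffle_sum_alternate)
    qed
    have "shuffle_sum (\<lambda>l. shuffle_sum F l W) U V =
        shuffle_sum (\<lambda>l. shuffle_sum F ((x, y) # l) W) U' V
        + alternate ?p (shuffle_sum (\<lambda>l. shuffle_sum F ((x, y) # l) W) U V')
        + (if U' = [] \<and> V' = [] then shuffle_sum F [(x, y)] W else 0)"
      unfolding U V by simp
    also have "\<dots> = ?A U' V W + alternate ?p (?A U V' W) + alternate (?p + ?q) (?A U V W') + ?e"
      by (subst (1 2) 1) (auto simp: U V W G_def alternate_add algebra_simps alternate_alternate)
    finally have L: "shuffle_sum (\<lambda>l. shuffle_sum F l W) U V =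
      ?A U' V W + alternate ?p (?A U V' W) + alternate (?p + ?q) (?A U V W') + ?e" .
    have 2: "shuffle_sum (\<lambda>l. shuffle_sum (\<lambda>l'. F (map ?a l')) U ((y, z) # l)) V'' W'' =
        shuffle_sum (\<lambda>l. shuffle_sum (\<lambda>l'. G (map ?a l')) U' ((y, z) # l)) V'' W''
        + alternate ?p (?B U V'' W'')" for V'' W''
    proof -
      have "shuffle_sum (\<lambda>l. shuffle_sum (\<lambda>l'. F (map ?a l')) U ((y, z) # l)) V'' W'' =
        shuffle_sum (\<lambda>l. shuffle_sum (\<lambda>l'. G (map ?a l')) U' ((y, z) # l)
          + alternate ?p (shuffle_sum (\<lambda>l'. G (map ?a l')) U l)) V'' W''"
        by (rule shuffle_sum_cong) (auto simp: U G_def)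
      then show ?thesis
        by (simp add: shuffle_sum_add shuffle_sum_alternate)
    qed
    have "shuffle_sum (\<lambda>l. shuffle_sum (\<lambda>l'. F (map ?a l')) U l) V W =
        shuffle_sum (\<lambda>l. shuffle_sum (\<lambda>l'. F (map ?a l')) U ((y, z) # l)) V' W
        + alternate ?q (shuffle_sum (\<lambda>l. shuffle_sum (\<lambda>l'. F (map ?a l')) U ((y, z) # l)) V W')
        + (if V' = [] \<and> W' = [] then shuffle_sum (\<lambda>l'. F (map ?a l')) U [(y, z)] else 0)"
      unfolding V W by simp
    also have "\<dots> = ?B U' V W + alternate ?p (?B U V' W) + alternate (?p + ?q) (?B U V W') + ?e"
      by (subst (1 2) 2) (auto simp: U V W G_def alternate_add algebra_simps alternate_alternate)
    finally have R: "shuffle_sum (\<lambda>l. shuffle_sum (\<lambda>l'. F (map ?a l')) U l) V W =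
      ?B U' V W + alternate ?p (?B U V' W) + alternate (?p + ?q) (?B U V W') + ?e" .
    have "?A U' V W = ?B U' V W" "?A U V' W = ?B U V' W" "?A U V W' = ?B U V W'"
      by (rule Suc.hyps; use Suc.hyps U V W in simp)+
    then show ?thesis
      unfolding L R by simp
  qed
qed

section \<open>Lattice paths encoded as subsets\<close>

definition inversions :: "nat \<Rightarrow> nat set \<Rightarrow> nat" where
  "inversions n A = card {(a, b). a \<in> A \<and> b \<in> {..<n} - A \<and> b < a}"

definition lattice_path :: "'a list \<Rightarrow> 'b list \<Rightarrow> nat \<Rightarrow> nat set \<Rightarrow> ('a \<times> 'b) list" where
  "lattice_path U V n A =
     map (\<lambda>k. (U ! card (A \<inter> {..<k}), V ! card ({..<k} - A))) [0..<Suc n]"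

lemma lessThan_Suc_image: "{..<Suc k} = insert 0 (Suc ` {..<k})"
  using lessThan_Suc_eq_insert_0 by blast

text \<open>The element 0 marks the first step of a path. As a member of the set it is below
  everything and creates no inversion; as a non-member it forms one inversion with each member,
  whence \<open>card B\<close>.\<close>

lemma
  assumes "B \<subseteq> {..<n}"
  shows inversions_insert_0: "inversions (Suc n) (insert 0 (Suc ` B)) = inversions n B"
    and inversions_Suc: "inversions (Suc n) (Suc ` B) = inversions n B + card B"
proof -
  define I where "I = {(a, b). a \<in> B \<and> b \<in> {..<n} - B \<and> b < a}"
  have fin: "finite B"
    using assms finite_subset by blast
  then have finI: "finite I"
    unfolding I_def by (auto intro: finite_subset[of _ "B \<times> {..<n}"])
  have invB: "inversions n B = card I"
    by (simp only: inversions_def I_def)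
  have inj: "inj_on (map_prod Suc Suc) I"
    by (auto simp: inj_on_def I_def)
  have "{(a, b). a \<in> insert 0 (Suc ` B) \<and> b \<in> {..<Suc n} - insert 0 (Suc ` B) \<and> b < a} =
      map_prod Suc Suc ` I"
    unfolding lessThan_Suc_image I_def by (force simp: image_iff)
  then show "inversions (Suc n) (insert 0 (Suc ` B)) = inversions n B"
    unfolding invB card_image[OF inj, symmetric] by (simp only: inversions_def)
  have "{(a, b). a \<in> Suc ` B \<and> b \<in> {..<Suc n} - Suc ` B \<and> b < a} =
      map_prod Suc Suc ` I \<union> (\<lambda>a. (Suc a, 0)) ` B"
    unfolding lessThan_Suc_image I_def by (force simp: image_iff)
  moreover have "card (map_prod Suc Suc ` I \<union> (\<lambda>a. (Suc a, 0)) ` B) = card I + card B"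
    by (subst card_Un_disjoint) (auto simp: card_image[OF inj] card_image[of "\<lambda>a. (Suc a, 0 :: nat)"] inj_on_def fin finI)
  ultimately show "inversions (Suc n) (Suc ` B) = inversions n B + card B"
    unfolding invB by (simp only: inversions_def)
qed

lemma lattice_path_insert_0:
  "lattice_path (x # U) V (Suc n) (insert 0 (Suc ` B)) = (x, V ! 0) # lattice_path U V n B"
proof -
  have 1: "insert 0 (Suc ` B) \<inter> {..<Suc k} = insert 0 (Suc ` (B \<inter> {..<k}))"
    and 2: "{..<Suc k} - insert 0 (Suc ` B) = Suc ` ({..<k} - B)" for k
    unfolding lessThan_Suc_image by auto
  show ?thesis
    unfolding lattice_path_def upt_conv_Cons[OF zero_less_Suc, of "Suc n"] map_Suc_upt[symmetric]
    by (simp add: 1 2 card_image del: upt_Suc)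
qed

lemma lattice_path_Suc:
  "lattice_path U (y # V) (Suc n) (Suc ` B) = (U ! 0, y) # lattice_path U V n B"
proof -
  have 1: "Suc ` B \<inter> {..<Suc k} = Suc ` (B \<inter> {..<k})"
    and 2: "{..<Suc k} - Suc ` B = insert 0 (Suc ` ({..<k} - B))" for k
    unfolding lessThan_Suc_image by auto
  show ?thesis
    unfolding lattice_path_def upt_conv_Cons[OF zero_less_Suc, of "Suc n"] map_Suc_upt[symmetric]
    by (simp add: 1 2 card_image del: upt_Suc)
qed

text \<open>The two pieces correspond to the direction of the first step of the path, as in the
  recursion of \<open>shuffle_sum\<close>.\<close>

lemma card_subsets_split:
  "{A. A \<subseteq> {..<Suc n} \<and> card A = p} =
     (\<lambda>B. insert 0 (Suc ` B)) ` {B. B \<subseteq> {..<n} \<and> Suc (card B) = p} \<union>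
     (`) Suc ` {B. B \<subseteq> {..<n} \<and> card B = p}" (is "?L = ?R1 \<union> ?R2")
proof
  show "?L \<subseteq> ?R1 \<union> ?R2"
  proof
    fix A assume A: "A \<in> ?L"
    define B where "B = {k. Suc k \<in> A}"
    have B: "B \<subseteq> {..<n}"
      using A by (auto simp: B_def)
    then have fin: "finite B"
      using finite_subset by blast
    show "A \<in> ?R1 \<union> ?R2"
    proof (cases "0 \<in> A")
      case True
      then have "A = insert 0 (Suc ` B)"
        unfolding B_def by (auto simp: image_iff) (metis not0_implies_Suc)
      then show ?thesis
        using A B fin by (auto simp: card_image)
    next
      case False
      then have "A = Suc ` B"
        unfolding B_def by (auto simp: image_iff) (metis not0_implies_Suc)
      then show ?thesis
        using A B by (auto simp: card_image)
    qed
  qed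
  show "?R1 \<union> ?R2 \<subseteq> ?L"
  proof (intro Un_least image_subsetI; unfold mem_Collect_eq; elim conjE; intro conjI)
    fix B assume B: "B \<subseteq> {..<n}"
    then show "insert 0 (Suc ` B) \<subseteq> {..<Suc n}" "Suc ` B \<subseteq> {..<Suc n}"
      by auto
    show "card (Suc ` B) = p" if "card B = p"
      using that by (simp add: card_image)
    show "card (insert 0 (Suc ` B)) = p" if "Suc (card B) = p"
      using that finite_subset[OF B] by (simp add: card_image)
  qed
qed

lemma alternate_sum: "(\<Sum>a\<in>A. alternate n (f a)) = alternate n (\<Sum>a\<in>A. f a)"
  by (simp add: alternate_def sum_negf)

text \<open>Splitting by membership of 0 reproduces the recursion of \<open>shuffle_sum\<close>: the
  p inversions gained when the first step goes in the second direction are its sign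
  \<open>alternate (length U)\<close>, the tail \<open>U\<close> there having p entries.\<close>

lemma sum_subsets_eq_shuffle_sum:
  assumes "length U = Suc p" "length V = Suc q"
  shows "(\<Sum>A | A \<subseteq> {..<p + q} \<and> card A = p.
      alternate (inversions (p + q) A) (F (lattice_path U V (p + q) A))) = shuffle_sum F U V"
  using assms
proof (induction "p + q" arbitrary: p q U V F)
  case 0
  then obtain x y where "U = [x]" "V = [y]" "p = 0" "q = 0"
    by (auto simp: length_Suc_conv)
  moreover have "(\<Sum>A | A \<subseteq> {..<0::nat} \<and> card A = 0. G A) = (\<Sum>A\<in>{{}}. G A)"
    for G :: "nat set \<Rightarrow> 'c"
    by (intro sum.cong) auto
  ultimately show ?case
    by (simp add: inversions_def lattice_path_def)
next
  case (Suc n)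
  obtain x U' y V' where U: "U = x # U'" and V: "V = y # V'"
    using Suc.prems by (auto simp: length_Suc_conv)
  let ?S = "\<lambda>n p. {B. B \<subseteq> {..<n} \<and> card B = p}"
  let ?S' = "{B. B \<subseteq> {..<n} \<and> Suc (card B) = p}"
  let ?f = "\<lambda>A. alternate (inversions (Suc n) A) (F (lattice_path U V (Suc n) A))"
  define G where "G = (\<lambda>l. F ((x, y) # l))"
  have fin: "finite (?S n p)" "finite ?S'"
    by (rule finite_subset[of _ "Pow {..<n}"]; auto)+
  have inj: "inj_on (\<lambda>B. insert 0 (Suc ` B)) ?S'" "inj_on ((`) Suc) (?S n p)"
    by (rule inj_on_inverseI[where g = "\<lambda>A. {k. Suc k \<in> A}"]; auto)+
  have "(\<Sum>A | A \<subseteq> {..<p + q} \<and> card A = p.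
      alternate (inversions (p + q) A) (F (lattice_path U V (p + q) A))) = sum ?f (?S (Suc n) p)"
    unfolding Suc.hyps(2) ..
  also have "\<dots> = sum ?f ((\<lambda>B. insert 0 (Suc ` B)) ` ?S') + sum ?f ((`) Suc ` ?S n p)"
  proof -
    have "0 \<in> A" if "A \<in> (\<lambda>B. insert 0 (Suc ` B)) ` ?S'" for A
      using that by blast
    moreover have "0 \<notin> A" if "A \<in> (`) Suc ` ?S n p" for A
      using that by blast
    ultimately have "(\<lambda>B. insert 0 (Suc ` B)) ` ?S' \<inter> (`) Suc ` ?S n p = {}"
      by blast
    then show ?thesis
      unfolding card_subsets_split using fin by (intro sum.union_disjoint finite_imageI)
  qed
  also have "sum ?f ((\<lambda>B. insert 0 (Suc ` B)) ` ?S') =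
      (\<Sum>B\<in>?S'. alternate (inversions n B) (G (lattice_path U' V n B)))"
    unfolding sum.reindex[OF inj(1)] o_def
    by (intro sum.cong refl, unfold mem_Collect_eq, elim conjE)
      (simp only: inversions_insert_0 lattice_path_insert_0 U V G_def nth_Cons_0)
  also have "\<dots> = shuffle_sum G U' V"
  proof (cases p)
    case 0
    then show ?thesis using Suc.prems U by auto
  next
    case (Suc p')
    then have n: "n = p' + q"
      using Suc.hyps(2) by simp
    have "(\<Sum>B | B \<subseteq> {..<n} \<and> card B = p'.
        alternate (inversions n B) (G (lattice_path U' V n B))) = shuffle_sum G U' V"
      unfolding n by (rule Suc.hyps(1)[OF n]) (use Suc.prems U \<open>p = Suc p'\<close> in simp_all)
    then show ?thesis
      unfolding \<open>p = Suc p'\<close> nat.inject .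
  qed
  also have "sum ?f ((`) Suc ` ?S n p) =
      (\<Sum>B\<in>?S n p. alternate p (alternate (inversions n B) (G (lattice_path U V' n B))))"
    unfolding sum.reindex[OF inj(2)] o_def
    by (intro sum.cong refl, unfold mem_Collect_eq, elim conjE)
      (simp only: inversions_Suc lattice_path_Suc U V G_def alternate_alternate add.commute[of p] nth_Cons_0)
  \<comment> \<open>For q = 0 no first step in the second direction exists: there are no p-element
    subsets of fewer than p positions, and \<open>V'\<close> is empty.\<close>
  also have "\<dots> = alternate p (shuffle_sum G U V')"
  proof (cases q)
    case 0
    then have "n < p" using Suc.hyps(2) by simp
    moreover have "card B \<le> n" if "B \<subseteq> {..<n}" for B
      using card_mono[OF _ that] by simp
    ultimately have "?S n p = {}"
      by (metis (mono_tags, lifting) empty_Collect_eq leD)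
    moreover have "V' = []"
      using Suc.prems V 0 by auto
    ultimately show ?thesis
      by (simp only: sum.empty shuffle_sum_Nil2 alternate_simps)
  next
    case (Suc q')
    then have n: "n = p + q'"
      using Suc.hyps(2) by simp
    have "(\<Sum>B\<in>?S n p. alternate (inversions n B) (G (lattice_path U V' n B))) = shuffle_sum G U V'"
      unfolding n by (rule Suc.hyps(1)[OF n]) (use Suc.prems V \<open>q = Suc q'\<close> in simp_all)
    then show ?thesis
      by (simp only: alternate_sum)
  qed
  also have "shuffle_sum G U' V + alternate p (shuffle_sum G U V') = shuffle_sum F U V"
  proof -
    have "length U' = p" "\<not> (U' = [] \<and> V' = [])"
      using Suc.hyps(2) Suc.prems by (auto simp: U V)
    then show ?thesis
      unfolding U V shuffle_sum.simps G_def by auto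
  qed
  finally show ?case .
qed

section \<open>Alternating forms\<close>

definition rat_linear_map :: "((nat \<Rightarrow> rat) \<Rightarrow> nat \<Rightarrow> rat) \<Rightarrow> bool" where
  "rat_linear_map f \<longleftrightarrow>
     (\<forall>u v. f (\<lambda>i. u i + v i) = (\<lambda>i. f u i + f v i)) \<and> (\<forall>r u. f (\<lambda>i. r * u i) = (\<lambda>i. r * f u i))"

text \<open>Only lists of length \<open>p\<close> are constrained; the value on other lists is
  arbitrary. Antisymmetry is demanded for neighbouring arguments, and longer moves are composed of
  such exchanges in \<open>alternating_form_move\<close>.\<close>

definition alternating_form :: "nat \<Rightarrow> ((nat \<Rightarrow> rat) list \<Rightarrow> rat) \<Rightarrow> bool" where
  "alternating_form p D \<longleftrightarrow>
     (\<forall>us vs u v. length us + length vs + 1 = p \<longrightarrow>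
        D (us @ (\<lambda>i. u i + v i) # vs) = D (us @ u # vs) + D (us @ v # vs)) \<and>
     (\<forall>us vs r u. length us + length vs + 1 = p \<longrightarrow>
        D (us @ (\<lambda>i. r * u i) # vs) = r * D (us @ u # vs)) \<and>
     (\<forall>us vs u v. length us + length vs + 2 = p \<longrightarrow>
        D (us @ u # v # vs) = - D (us @ v # u # vs))"

lemma alternating_formD:
  assumes "alternating_form p D"
  shows alternating_form_add: "length us + length vs + 1 = p \<Longrightarrow>
        D (us @ (\<lambda>i. u i + v i) # vs) = D (us @ u # vs) + D (us @ v # vs)"
    and alternating_form_scale: "length us + length vs + 1 = p \<Longrightarrow>
        D (us @ (\<lambda>i. r * u i) # vs) = r * D (us @ u # vs)"
    and alternating_form_swap: "length us + length vs + 2 = p \<Longrightarrow>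
        D (us @ u # v # vs) = - D (us @ v # u # vs)"
  using assms unfolding alternating_form_def by blast+

lemma alternating_form_Cons:
  assumes "alternating_form (Suc p) D"
  shows "alternating_form p (\<lambda>l. D (v # l))"
  unfolding alternating_form_def
proof (intro conjI allI impI, goal_cases)
  case (1 us vs u w)
  then show ?case using alternating_form_add[OF assms, of "v # us" "vs" u w]  by simp
next
  case (2 us vs r u)
  then show ?case using alternating_form_scale[OF assms, of "v # us" "vs" r u]  by simp
next
  case (3 us vs u w)
  then show ?case using alternating_form_swap[OF assms, of "v # us" "vs" u w]  by simp
qed

lemma alternating_form_append:
  assumes "alternating_form (p + q) D" "length ws = q"
  shows "alternating_form p (\<lambda>l. D (l @ ws))"
  unfolding alternating_form_def
proof (intro conjI allI impI, goal_cases)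
  case (1 us vs u w)
  then show ?case using alternating_form_add[OF assms(1), of "us" "vs @ ws" u w] assms(2) by simp
next
  case (2 us vs r u)
  then show ?case using alternating_form_scale[OF assms(1), of "us" "vs @ ws" r u] assms(2) by simp
next
  case (3 us vs u w)
  then show ?case using alternating_form_swap[OF assms(1), of "us" "vs @ ws" u w] assms(2) by simp
qed

lemma alternating_form_map:
  assumes D: "alternating_form p D" and f: "rat_linear_map f"
  shows "alternating_form p (\<lambda>l. D (map f l))"
  unfolding alternating_form_def
proof (intro conjI allI impI, goal_cases)
  case (1 us vs u w)
  then show ?case using alternating_form_add[OF D, of "map f us" "map f vs" "f u" "f w"] f[unfolded rat_linear_map_def] by simp
next
  case (2 us vs r u)
  then show ?case using alternating_form_scale[OF D, of "map f us" "map f vs" r "f u"] f[unfolded rat_linear_map_def] by simp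
next
  case (3 us vs u w)
  then show ?case using alternating_form_swap[OF D, of "map f us" "map f vs" "f u" "f w"] f[unfolded rat_linear_map_def] by simp
qed

lemma alternating_form_move:
  assumes "alternating_form p D" "length us + length vs + 1 = p"
  shows "D (v # us @ vs) = (-1) ^ length us * D (us @ v # vs)"
  using assms
proof (induction us arbitrary: p D)
  case (Cons u us)
  then obtain p' where p: "p = Suc p'" by (cases p) auto
  have "D (v # (u # us) @ vs) = - D (u # v # us @ vs)"
    using alternating_form_swap[OF Cons.prems(1), of "[]" "us @ vs" v u] Cons.prems(2) by simp
  also have "D (u # v # us @ vs) = (-1) ^ length us * D (u # us @ v # vs)"
    using Cons.IH[OF alternating_form_Cons[OF Cons.prems(1)[unfolded p]]] Cons.prems(2) p by simp
  finally show ?case by simp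
qed auto

text \<open>Differences do not see a common translation of the vertices, which removes the ambiguity
  of logarithms. The p + 1 vertices of a p-simplex yield the p arguments of a p-form.\<close>

fun edges :: "(nat \<Rightarrow> rat) list \<Rightarrow> (nat \<Rightarrow> rat) list" where
  "edges (u # v # l) = (\<lambda>i. v i - u i) # edges (v # l)"
| "edges _ = []"

lemma length_edges [simp]: "length (edges l) = length l - 1"
  by (induction l rule: edges.induct) auto

text \<open>The cocycle property. Deleting an interior vertex replaces two consecutive edges by
  their sum, so additivity makes the alternating sum telescope; the induction absorbs the first edge
  into the form.\<close>

lemma face_sum_edges:
  assumes "alternating_form p D" "length l = Suc (Suc p)"
  shows "face_sum (\<lambda>l. D (edges l)) l = 0"
  using assms
proof (induction p arbitrary: D l)
  case 0
  then obtain u v where "l = [u, v]"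
    by (auto simp: length_Suc_conv)
  then show ?case by simp
next
  case (Suc p)
  then obtain u v w l' where l: "l = u # v # w # l'"
    by (auto simp: length_Suc_conv)
  define D' where "D' = (\<lambda>l. D ((\<lambda>i. v i - u i) # l))"
  have "alternating_form p D'"
    unfolding D'_def by (rule alternating_form_Cons[OF Suc.prems(1)])
  \<comment> \<open>The identity for \<open>D'\<close> evaluates the sum of all faces that keep both
    \<open>u\<close> and \<open>v\<close>. What remains is additivity in the first argument for (w -
    u) = (w - v) + (v - u).\<close>
  from Suc.IH[OF this, of "v # w # l'"]
  have "face_sum (\<lambda>l. D' (edges (v # l))) (w # l') = D' (edges (w # l'))"
    using Suc.prems(2) l by simp
  then have eq: "face_sum (\<lambda>l. D (edges (u # v # l))) (w # l') = D' (edges (w # l'))"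
    by (simp add: D'_def)
  have "D ((\<lambda>i. w i - u i) # edges (w # l')) =
      D ((\<lambda>i. w i - v i) # edges (w # l')) + D ((\<lambda>i. v i - u i) # edges (w # l'))"
    using alternating_form_add[OF Suc.prems(1), of "[]" "edges (w # l')" "\<lambda>i. w i - v i" "\<lambda>i. v i - u i"]
      Suc.prems(2) l by simp
  with eq show ?case
    unfolding l face_sum.simps(2)[of _ u] face_sum.simps(2)[of _ v] by (simp add: D'_def)
qed

text \<open>Each step of a lattice path moves only one of the two vertices, so its edges are those
  of \<open>U\<close> and of \<open>V\<close> interleaved. Sorting the edges of \<open>U\<close> to
  the front costs exactly the sign of the shuffle; hence all paths contribute the same value, and
  the binomial coefficient counts them.\<close>

lemma shuffle_sum_edges:
  assumes "rat_linear_map f" "rat_linear_map g"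
    and "alternating_form (p + q) D" "length U = Suc p" "length V = Suc q"
  shows "shuffle_sum (\<lambda>l. D (edges (map (\<lambda>(u, v) i. f u i + g v i) l))) U V =
     of_nat (p + q choose p) * D (map f (edges U) @ map g (edges V))"
  using assms(3-5)
proof (induction "p + q" arbitrary: p q D U V)
  case 0
  then show ?case by (auto simp: length_Suc_conv)
next
  case (Suc n)
  obtain u U' v V' where U: "U = u # U'" and V: "V = v # V'"
    using Suc.prems by (auto simp: length_Suc_conv)
  let ?h = "\<lambda>(u, v) i. f u i + g v i"
  let ?F = "\<lambda>D l. D (edges (map ?h l)) :: rat"
  let ?R = "D (map f (edges U) @ map g (edges V))"
  have sub: "h (\<lambda>i. v i - u i) = (\<lambda>i. h v i - h u i)" if "rat_linear_map h" for h u v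
  proof -
    have "h (\<lambda>i. v i + (- 1) * u i) = (\<lambda>i. h v i + (- 1) * h u i)"
      using that unfolding rat_linear_map_def by metis
    then show ?thesis by simp
  qed
  have 1: "shuffle_sum (\<lambda>l. ?F D ((u, v) # l)) U' V = of_nat (n choose (p - 1)) * ?R" if p0: "p \<noteq> 0"
  proof -
    obtain u' U'' p' where U': "U' = u' # U''" and p: "p = Suc p'"
      using Suc.prems(2) U p0 by (cases p; cases U') auto
    define D' where "D' = (\<lambda>l. D ((\<lambda>i. f (\<lambda>i. u' i - u i) i) # l))"
    have D': "alternating_form (p' + q) D'"
      unfolding D'_def by (rule alternating_form_Cons) (use Suc.prems(1) p in simp)
    have "shuffle_sum (\<lambda>l. ?F D ((u, v) # l)) U' V = shuffle_sum (\<lambda>l. ?F D' l) U' V"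
    proof (rule shuffle_sum_cong)
      fix l assume "l \<noteq> []" "hd l = (hd U', hd V)"
      then obtain l' where l: "l = (u', v) # l'"
        by (cases l) (auto simp: U' V)
      show "?F D ((u, v) # l) = ?F D' l"
        by (simp add: l D'_def sub[OF assms(1)])
    qed
    also have "\<dots> = of_nat (p' + q choose p') * D' (map f (edges U') @ map g (edges V))"
      by (rule Suc.hyps(1)[OF _ D']) (use Suc.hyps(2) Suc.prems p U in auto)
    finally show ?thesis
      using Suc.hyps(2) p by (simp add: D'_def U U')
  qed
  have 2: "alternate p (shuffle_sum (\<lambda>l. ?F D ((u, v) # l)) U V') = of_nat (n choose p) * ?R" if q0: "q \<noteq> 0"
  proof -
    obtain v' V'' q' where V': "V' = v' # V''" and q: "q = Suc q'"
      using Suc.prems(3) V q0 by (cases q; cases V') auto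
    define D' where "D' = (\<lambda>l. D ((\<lambda>i. g (\<lambda>i. v' i - v i) i) # l))"
    have D': "alternating_form (p + q') D'"
      unfolding D'_def by (rule alternating_form_Cons) (use Suc.prems(1) q in simp)
    have "shuffle_sum (\<lambda>l. ?F D ((u, v) # l)) U V' = shuffle_sum (\<lambda>l. ?F D' l) U V'"
    proof (rule shuffle_sum_cong)
      fix l assume "l \<noteq> []" "hd l = (hd U, hd V')"
      then obtain l' where l: "l = (u, v') # l'"
        by (cases l) (auto simp: V' U)
      show "?F D ((u, v) # l) = ?F D' l"
        by (simp add: l D'_def sub[OF assms(2)])
    qed
    also have "\<dots> = of_nat (p + q' choose p) * D' (map f (edges U) @ map g (edges V'))"
      by (rule Suc.hyps(1)[OF _ D']) (use Suc.hyps(2) Suc.prems q V in auto)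
    \<comment> \<open>The edge of the first step comes first along the path, but in
      \<open>?R\<close> it follows the p edges of \<open>U\<close>. The sign of moving it there
      cancels \<open>alternate p\<close>, and Pascal's rule then adds up the two counts.\<close>
    also have "D' (map f (edges U) @ map g (edges V')) = (-1) ^ p * ?R"
      unfolding D'_def
      by (subst alternating_form_move[OF Suc.prems(1)]) (use Suc.prems q V V' in auto)
    finally show ?thesis
      using Suc.hyps(2) q by (simp add: alternate_rat flip: mult.assoc power_add)
  qed
  have "shuffle_sum (?F D) U V = shuffle_sum (\<lambda>l. ?F D ((u, v) # l)) U' V
      + alternate p (shuffle_sum (\<lambda>l. ?F D ((u, v) # l)) U V')"
    using Suc.hyps(2) Suc.prems by (auto simp: U V)
  also have "\<dots> = of_nat (p + q choose p) * ?R"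
  proof (cases p)
    case 0
    then show ?thesis
      using 2 Suc.hyps(2) Suc.prems U by auto
  next
    case (Suc p')
    show ?thesis
    proof (cases q)
      case 0
      then show ?thesis
        using 1 Suc.hyps(2) Suc.prems V Suc by auto
    next
      case (Suc q')
      have "(p + q choose p) = (n choose (p - 1)) + (n choose p)"
        unfolding Suc.hyps(2)[symmetric] by (simp add: \<open>p = Suc p'\<close>)
      then show ?thesis
        using 1 2 \<open>p = Suc p'\<close> Suc by (simp add: distrib_right)
    qed
  qed
  finally show ?case .
qed

section \<open>Minors as a dual basis of forms\<close>

definition unit_vec :: "nat \<Rightarrow> nat \<Rightarrow> rat" where
  "unit_vec i = (\<lambda>j. if j = i then 1 else 0)"

text \<open>The Leibniz expansion of the minor with columns \<open>J\<close>. For increasing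
  \<open>J\<close> these forms will be dual, up to p!, to the standard cycles of a torus.\<close>

definition minor_form :: "nat list \<Rightarrow> (nat \<Rightarrow> rat) list \<Rightarrow> rat" where
  "minor_form J vs = (\<Sum>\<pi> | \<pi> permutes {..<length J}.
      of_int (sign \<pi>) * (\<Prod>a<length J. (vs ! a) (J ! \<pi> a)))"

lemma alternating_minor_form: "alternating_form (length J) (minor_form J)"
proof -
  let ?p = "length J"
  \<comment> \<open>Isolates the factor of one argument. The placeholder \<open>undefined\<close> in
    its slot makes it visible that the remaining product does not depend on that argument.\<close>
  have split: "(\<Prod>a<?p. ((us @ w # vs) ! a) (c a)) =
      w (c (length us)) * (\<Prod>a\<in>{..<?p} - {length us}. ((us @ undefined # vs) ! a) (c a))"
    if "length us + length vs + 1 = ?p" for us vs w and c :: "nat \<Rightarrow> nat"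
  proof -
    have "(\<Prod>a<?p. ((us @ w # vs) ! a) (c a)) =
      w (c (length us)) * (\<Prod>a\<in>{..<?p} - {length us}. ((us @ w # vs) ! a) (c a))"
      by (subst prod.remove[of _ "length us"]) (use that in auto)
    also have "(\<Prod>a\<in>{..<?p} - {length us}. ((us @ w # vs) ! a) (c a)) =
        (\<Prod>a\<in>{..<?p} - {length us}. ((us @ undefined # vs) ! a) (c a))"
      by (intro prod.cong refl) (auto simp: nth_append nth_Cons split: nat.splits)
    finally show ?thesis .
  qed
  have "minor_form J (us @ u # v # vs) = - minor_form J (us @ v # u # vs)"
    if len: "length us + length vs + 2 = ?p" for us vs u v
  proof -
    \<comment> \<open>Exchanging two neighbouring arguments is compensated by composing the
      permutation with this transposition, which reverses its sign.\<close>
    define \<tau> where "\<tau> = Transposition.transpose (length us) (Suc (length us))"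
    have \<tau>: "\<tau> permutes {..<?p}"
      unfolding \<tau>_def by (rule permutes_swap_id) (use len in auto)
    have sgn: "sign (\<pi> \<circ> \<tau>) = - sign \<pi>" if "\<pi> permutes {..<?p}" for \<pi>
      using that \<tau> by (subst sign_compose)
        (auto simp: \<tau>_def sign_swap_id permutes_imp_permutation[of "{..<?p}"])
    have nth: "(us @ v # u # vs) ! \<tau> a = (us @ u # v # vs) ! a" for a
      by (auto simp: \<tau>_def Transposition.transpose_def nth_append nth_Cons split: nat.splits)
    have invol: "\<tau> (\<tau> a) = a" for a
      by (simp add: \<tau>_def)
    have "minor_form J (us @ v # u # vs) = (\<Sum>\<pi> | \<pi> permutes {..<?p}.
        of_int (sign (\<pi> \<circ> \<tau>)) * (\<Prod>a<?p. ((us @ v # u # vs) ! a) (J ! (\<pi> \<circ> \<tau>) a)))"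
      unfolding minor_form_def by (rule sum_permutations_compose_right[OF \<tau>])
    also have "\<dots> = (\<Sum>\<pi> | \<pi> permutes {..<?p}.
        - (of_int (sign \<pi>) * (\<Prod>a<?p. ((us @ u # v # vs) ! a) (J ! \<pi> a))))"
    proof (intro sum.cong refl, clarify)
      fix \<pi> assume \<pi>: "\<pi> permutes {..<?p}"
      have "(\<Prod>a<?p. ((us @ v # u # vs) ! a) (J ! (\<pi> \<circ> \<tau>) a)) =
          (\<Prod>a<?p. ((us @ v # u # vs) ! \<tau> a) (J ! (\<pi> \<circ> \<tau>) (\<tau> a)))"
        by (subst prod.permute[OF \<tau>]) (simp add: comp_def)
      also have "\<dots> = (\<Prod>a<?p. ((us @ u # v # vs) ! a) (J ! \<pi> a))"
        using invol by (simp add: nth)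
      finally show "of_int (sign (\<pi> \<circ> \<tau>)) * (\<Prod>a<?p. ((us @ v # u # vs) ! a) (J ! (\<pi> \<circ> \<tau>) a)) =
          - (of_int (sign \<pi>) * (\<Prod>a<?p. ((us @ u # v # vs) ! a) (J ! \<pi> a)))"
        by (simp add: sgn[OF \<pi>])
    qed
    finally show ?thesis
      by (simp add: minor_form_def sum_negf)
  qed
  moreover have "minor_form J (us @ (\<lambda>i. u i + v i) # vs) =
      minor_form J (us @ u # vs) + minor_form J (us @ v # vs)"
    if len: "length us + length vs + 1 = ?p" for us vs u v
    unfolding minor_form_def split[OF len] sum.distrib[symmetric]
    by (intro sum.cong refl) (simp add: algebra_simps)
  moreover have "minor_form J (us @ (\<lambda>i. r * u i) # vs) = r * minor_form J (us @ u # vs)"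
    if len: "length us + length vs + 1 = ?p" for us vs u r
    unfolding minor_form_def split[OF len] sum_distrib_left
    by (intro sum.cong refl) (simp add: mult_ac)
  ultimately show ?thesis
    unfolding alternating_form_def by blast
qed

text \<open>A summand is nonzero only if \<open>J\<close> permuted by \<pi> is \<open>I\<close>
  entry by entry. Then both lists have the same set of entries, so they agree because they are
  sorted, and distinctness forces \<pi> to be the identity.\<close>

lemma minor_form_unit_vec:
  assumes I: "sorted_wrt (<) I" and J: "sorted_wrt (<) J" and len: "length I = length J"
  shows "minor_form J (map unit_vec I) = (if I = J then 1 else 0)"
proof -
  let ?p = "length J"
  have "of_int (sign \<pi>) * (\<Prod>a<?p. ((map unit_vec I) ! a) (J ! \<pi> a)) =
      (if \<pi> = id then if I = J then 1 else 0 else (0::rat))" if \<pi>: "\<pi> permutes {..<?p}" for \<pi>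
  proof (cases "\<forall>a<?p. J ! \<pi> a = I ! a")
    case True
    have "set I \<subseteq> set J"
    proof
      fix x assume "x \<in> set I"
      then obtain a where "a < ?p" "x = I ! a"
        by (metis in_set_conv_nth len)
      moreover have "\<pi> a < ?p"
        using \<pi> \<open>a < ?p\<close> permutes_in_image by fastforce
      ultimately show "x \<in> set J"
        using True by (metis nth_mem)
    qed
    moreover have "card (set I) = card (set J)"
      using I J len by (simp add: distinct_card strict_sorted_iff)
    ultimately have "set I = set J"
      by (simp add: card_subset_eq)
    then have IJ: "I = J"
      using I J strict_sorted_equal by blast
    have dis: "distinct J"
      using J by (simp add: strict_sorted_iff)
    have "\<pi> a = a" for a
    proof (cases "a < ?p")
      case True
      then have "\<pi> a < ?p"
        using \<pi> permutes_in_image by fastforce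
      then show ?thesis
        using dis True \<open>\<forall>a<?p. J ! \<pi> a = I ! a\<close> IJ nth_eq_iff_index_eq by metis
    next
      case False
      then show ?thesis using \<pi> by (simp add: permutes_not_in)
    qed
    then have "\<pi> = id" by auto
    then show ?thesis
      using IJ by (simp add: unit_vec_def)
  next
    case False
    then obtain a where a: "a < ?p" "J ! \<pi> a \<noteq> I ! a" by blast
    then have "(\<Prod>a<?p. ((map unit_vec I) ! a) (J ! \<pi> a)) = 0"
      by (intro prod_zero) (use len in \<open>auto simp: unit_vec_def intro!: bexI[of _ a]\<close>)
    moreover have "\<not> (\<pi> = id \<and> I = J)"
      using a by auto
    ultimately show ?thesis by auto
  qed
  then have "minor_form J (map unit_vec I) =
      (\<Sum>\<pi> | \<pi> permutes {..<?p}. if \<pi> = id then if I = J then 1 else 0 else 0)"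
    unfolding minor_form_def by (intro sum.cong) auto
  also have "\<dots> = (if I = J then 1 else 0)"
    by (subst sum.delta) (auto simp: finite_permutations permutes_id)
  finally show ?thesis .
qed

text \<open>The nonzero number 2 pi i alone is linearly independent over the rationals; the
  functional extends the value 1 from it to all complex numbers regarded as a rational vector
  space.\<close>

lemma exists_rat_character:
  obtains \<theta> :: "complex \<Rightarrow> rat"
  where "\<And>x y. \<theta> (x + y) = \<theta> x + \<theta> y" "\<theta> (2 * of_real pi * \<i>) = 1"
proof -
  interpret vs: vector_space_pair "\<lambda>(q::rat) (z::complex). of_rat q * z" "(*) :: rat \<Rightarrow> rat \<Rightarrow> rat"
    by unfold_locales (auto simp: algebra_simps of_rat_add of_rat_mult)
  have "vs.vs1.independent {2 * of_real pi * \<i>}"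
    by simp
  from vs.linear_independent_extend[OF this, of "\<lambda>_. 1"]
  obtain g where g: "Vector_Spaces.linear (\<lambda>(q::rat) (z::complex). of_rat q * z) (*) g"
    "g (2 * of_real pi * \<i>) = (1::rat)"
    by auto
  show thesis
    by (rule that[of g]) (use g vs.linear_add in auto)
qed

section \<open>The Eilenberg-Zilber map\<close>

lemma lookup_rat_scale [simp]:
  "Poly_Mapping.lookup (rat_scale r c) k = r * Poly_Mapping.lookup c k"
  by (simp add: rat_scale_def Poly_Mapping.map.rep_eq when_def)

lemma rat_scale_simps [simp]:
  "rat_scale 1 c = c" "rat_scale 0 c = 0" "rat_scale r 0 = 0"
  "rat_scale r (rat_scale s c) = rat_scale (r * s) c"
  "rat_scale r (Poly_Mapping.single k s) = Poly_Mapping.single k (r * s)"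
  by (auto intro!: poly_mapping_eqI simp: lookup_single when_def)

lemma rat_scale_add: "rat_scale r (a + b) = rat_scale r a + rat_scale r b"
  and rat_scale_add_left: "rat_scale (r + s) a = rat_scale r a + rat_scale s a"
  and rat_scale_diff: "rat_scale r (a - b) = rat_scale r a - rat_scale r b"
  and rat_scale_minus: "rat_scale r (- a) = - rat_scale r a"
  and rat_scale_minus_left: "rat_scale (- r) a = - rat_scale r a"
  and rat_scale_uminus_one: "rat_scale (- 1) a = - a"
  by (auto intro!: poly_mapping_eqI simp: lookup_add lookup_minus algebra_simps)

lemma rat_scale_sum: "rat_scale r (\<Sum>i\<in>I. f i) = (\<Sum>i\<in>I. rat_scale r (f i))"
  by (induction I rule: infinite_finite_induct) (auto simp: rat_scale_add)

lemma alternate_eq_rat_scale: "alternate n a = rat_scale ((-1) ^ n) a"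
  by (simp add: alternate_def rat_scale_uminus_one)

lemma keys_rat_scale: "Poly_Mapping.keys (rat_scale r c) \<subseteq> Poly_Mapping.keys c"
  by (auto simp: in_keys_iff)

lemma rat_extend_superset:
  assumes "finite K" "Poly_Mapping.keys c \<subseteq> K"
  shows "rat_extend f c = (\<Sum>s\<in>K. rat_scale (Poly_Mapping.lookup c s) (f s))"
  unfolding rat_extend_def
  by (rule sum.mono_neutral_left) (use assms in \<open>auto simp: in_keys_iff\<close>)

lemma rat_extend_0 [simp]: "rat_extend f 0 = 0"
  by (simp add: rat_extend_def)

lemma rat_extend_single [simp]: "rat_extend f (Poly_Mapping.single s r) = rat_scale r (f s)"
  by (subst rat_extend_superset[of "{s}"]) auto

lemma rat_extend_add: "rat_extend f (a + b) = rat_extend f a + rat_extend f b"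
proof -
  let ?K = "Poly_Mapping.keys a \<union> Poly_Mapping.keys b"
  have "Poly_Mapping.keys (a + b) \<subseteq> ?K"
    by (rule keys_add)
  then show ?thesis
    by (simp add: rat_extend_superset[of ?K] lookup_add rat_scale_add_left sum.distrib)
qed

lemma rat_extend_scale: "rat_extend f (rat_scale r c) = rat_scale r (rat_extend f c)"
  using keys_rat_scale[of r c]
  by (simp add: rat_extend_superset[of "Poly_Mapping.keys c"] rat_scale_sum)

lemma rat_extend_minus: "rat_extend f (- c) = - rat_extend f c"
  using rat_extend_scale[of f "-1" c] by (simp add: rat_scale_uminus_one)

lemma rat_extend_diff: "rat_extend f (a - b) = rat_extend f a - rat_extend f b"
  using rat_extend_add[of f a "- b"] by (simp add: rat_extend_minus)

lemma rat_extend_sum: "rat_extend f (\<Sum>i\<in>I. g i) = (\<Sum>i\<in>I. rat_extend f (g i))"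
  by (induction I rule: infinite_finite_induct) (auto simp: rat_extend_add)

lemma rat_extend_alternate: "rat_extend f (alternate n c) = alternate n (rat_extend f c)"
  by (simp add: alternate_def rat_extend_minus)

lemma rat_extend_cong:
  "(\<And>s. s \<in> Poly_Mapping.keys c \<Longrightarrow> f s = g s) \<Longrightarrow> rat_extend f c = rat_extend g c"
  by (simp add: rat_extend_def)

lemma rat_extend_fun_add: "rat_extend (\<lambda>s. f s + g s) c = rat_extend f c + rat_extend g c"
  by (simp add: rat_extend_def rat_scale_add sum.distrib)

lemma rat_extend_fun_0 [simp]: "rat_extend (\<lambda>s. 0) c = 0"
  by (simp add: rat_extend_def)

lemma rat_extend_fun_scale: "rat_extend (\<lambda>s. rat_scale r (f s)) c = rat_scale r (rat_extend f c)"
  by (simp add: rat_extend_def rat_scale_sum mult.commute)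

lemma rat_extend_fun_alternate: "rat_extend (\<lambda>s. alternate n (f s)) c = alternate n (rat_extend f c)"
  by (simp add: alternate_eq_rat_scale rat_extend_fun_scale)

lemma hom_rat_extend:
  fixes c :: "'k \<Rightarrow>\<^sub>0 rat"
  assumes "\<And>a b. h (a + b) = h a + h b" "\<And>r a. h (rat_scale r a) = rat_scale r (h a)" "h 0 = 0"
  shows "h (rat_extend f c) = rat_extend (\<lambda>s. h (f s)) c"
proof -
  have "h (\<Sum>i\<in>I. g i) = (\<Sum>i\<in>I. h (g i))" for I :: "'k set" and g
    by (induction I rule: infinite_finite_induct) (auto simp: assms)
  then show ?thesis
    by (simp only: rat_extend_def assms)
qed

lemma rat_extend_rat_extend:
  "rat_extend g (rat_extend f c) = rat_extend (\<lambda>s. rat_extend g (f s)) c"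
  by (rule hom_rat_extend) (auto simp: rat_extend_add rat_extend_scale)

lemma rat_extend_shuffle_sum:
  "rat_extend g (shuffle_sum F U V) = shuffle_sum (\<lambda>l. rat_extend g (F l)) U V"
  by (rule hom_shuffle_sum) (auto simp: rat_extend_add)

lemma rat_extend_face_sum: "rat_extend g (face_sum F U) = face_sum (\<lambda>l. rat_extend g (F l)) U"
  by (induction F U rule: face_sum.induct) (auto simp: rat_extend_diff)

lemma rat_extend_id [simp]: "rat_extend (\<lambda>s. Poly_Mapping.single s 1) c = c"
proof (rule poly_mapping_eqI)
  fix k
  have "Poly_Mapping.lookup (rat_extend (\<lambda>s. Poly_Mapping.single s 1) c) k =
     (\<Sum>s\<in>Poly_Mapping.keys c. if s = k then Poly_Mapping.lookup c s else 0)"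
    by (auto simp: rat_extend_def lookup_sum lookup_single when_def intro!: sum.cong)
  also have "\<dots> = Poly_Mapping.lookup c k"
    by (simp add: in_keys_iff)
  finally show "Poly_Mapping.lookup (rat_extend (\<lambda>s. Poly_Mapping.single s 1) c) k =
    Poly_Mapping.lookup c k" .
qed

lemma rat_extend_swap:
  "rat_extend (\<lambda>s. rat_extend (\<lambda>t. h s t) c') c = rat_extend (\<lambda>t. rat_extend (\<lambda>s. h s t) c) c'"
  unfolding rat_extend_def rat_scale_sum
  by (subst sum.swap) (simp add: mult.commute)

lemma keys_rat_extend:
  assumes "\<And>s. s \<in> Poly_Mapping.keys c \<Longrightarrow> Poly_Mapping.keys (f s) \<subseteq> K"
  shows "Poly_Mapping.keys (rat_extend f c) \<subseteq> K"
  unfolding rat_extend_def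
  using assms keys_rat_scale keys_sum by fastforce

definition rat_eval :: "('k \<Rightarrow> rat) \<Rightarrow> ('k \<Rightarrow>\<^sub>0 rat) \<Rightarrow> rat" where
  "rat_eval F c = (\<Sum>s\<in>Poly_Mapping.keys c. Poly_Mapping.lookup c s * F s)"

lemma rat_eval_superset:
  assumes "finite K" "Poly_Mapping.keys c \<subseteq> K"
  shows "rat_eval F c = (\<Sum>s\<in>K. Poly_Mapping.lookup c s * F s)"
  unfolding rat_eval_def
  by (rule sum.mono_neutral_left) (use assms in \<open>auto simp: in_keys_iff\<close>)

lemma rat_eval_0 [simp]: "rat_eval F 0 = 0"
  by (simp add: rat_eval_def)

lemma rat_eval_single [simp]: "rat_eval F (Poly_Mapping.single s r) = r * F s"
  by (subst rat_eval_superset[of "{s}"]) auto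

lemma rat_eval_add: "rat_eval F (a + b) = rat_eval F a + rat_eval F b"
proof -
  let ?K = "Poly_Mapping.keys a \<union> Poly_Mapping.keys b"
  have "Poly_Mapping.keys (a + b) \<subseteq> ?K"
    by (rule keys_add)
  then show ?thesis
    by (simp add: rat_eval_superset[of ?K] lookup_add algebra_simps sum.distrib)
qed

lemma rat_eval_scale: "rat_eval F (rat_scale r c) = r * rat_eval F c"
  using keys_rat_scale[of r c]
  by (simp add: rat_eval_superset[of "Poly_Mapping.keys c"] sum_distrib_left mult.assoc)

lemma rat_eval_minus: "rat_eval F (- c) = - rat_eval F c"
  using rat_eval_scale[of F "-1" c] by (simp add: rat_scale_uminus_one)

lemma rat_eval_diff: "rat_eval F (a - b) = rat_eval F a - rat_eval F b"
  using rat_eval_add[of F a "- b"] by (simp add: rat_eval_minus)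

lemma rat_eval_sum: "rat_eval F (\<Sum>i\<in>I. g i) = (\<Sum>i\<in>I. rat_eval F (g i))"
  by (induction I rule: infinite_finite_induct) (auto simp: rat_eval_add)

lemma rat_eval_cong:
  "(\<And>s. s \<in> Poly_Mapping.keys c \<Longrightarrow> F s = G s) \<Longrightarrow> rat_eval F c = rat_eval G c"
  by (simp add: rat_eval_def)

lemma rat_eval_rat_extend: "rat_eval F (rat_extend f c) = rat_eval (\<lambda>s. rat_eval F (f s)) c"
  by (simp add: rat_extend_def rat_eval_sum rat_eval_scale) (simp add: rat_eval_def)

lemma rat_eval_fun_scale: "rat_eval (\<lambda>s. r * F s) c = r * rat_eval F c"
  by (simp add: rat_eval_def sum_distrib_left mult_ac)

lemma rat_eval_fun_0 [simp]: "rat_eval (\<lambda>s. 0) c = 0"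
  by (simp add: rat_eval_def)

lemma rat_eval_swap:
  "rat_eval (\<lambda>s. rat_eval (\<lambda>t. H s t) c') c = rat_eval (\<lambda>t. rat_eval (\<lambda>s. H s t) c) c'"
  unfolding rat_eval_def sum_distrib_left
  by (subst sum.swap) (simp add: mult_ac)

lemma rat_eval_shuffle_sum:
  "rat_eval G (shuffle_sum F U V) = shuffle_sum (\<lambda>l. rat_eval G (F l)) U V"
  by (rule hom_shuffle_sum) (auto simp: rat_eval_add)

lemma rat_eval_face_sum: "rat_eval G (face_sum F U) = face_sum (\<lambda>l. rat_eval G (F l)) U"
  by (induction F U rule: face_sum.induct) (auto simp: rat_eval_diff)

section \<open>Affine simplices given by lists of vertices\<close>

definition vertex_map :: "nat list \<Rightarrow> (nat \<Rightarrow> real) \<Rightarrow> nat \<Rightarrow> real" where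
  "vertex_map l = oriented_simplex (length l - 1) (\<lambda>k j. if j = l ! k then 1 else 0)"

text \<open>Lists that omit vertices give faces, lists that repeat them give degenerate simplices.
  Iterated faces thereby become lookups in lists, and the two projections of a lattice path are
  covered by the same \<open>vertex_map\<close>.\<close>

definition sub_simplex :: "((nat \<Rightarrow> real) \<Rightarrow> 'a) \<Rightarrow> nat list \<Rightarrow> (nat \<Rightarrow> real) \<Rightarrow> 'a" where
  "sub_simplex s l = (\<lambda>x\<in>standard_simplex (length l - 1). s (vertex_map l x))"

definition delete_nth :: "nat \<Rightarrow> 'a list \<Rightarrow> 'a list" where
  "delete_nth k l = take k l @ drop (Suc k) l"

lemma nth_delete_nth:
  "k < length l \<Longrightarrow> j < length l - 1 \<Longrightarrow> delete_nth k l ! j = (if j < k then l ! j else l ! Suc j)"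
  by (auto simp: delete_nth_def nth_append)

lemma length_delete_nth: "k < length l \<Longrightarrow> length (delete_nth k l) = length l - 1"
  by (auto simp: delete_nth_def)

lemma vertex_map_eq:
  "x \<in> standard_simplex (length l - 1) \<Longrightarrow>
    vertex_map l x = (\<lambda>i. \<Sum>j\<le>length l - 1. (if i = l ! j then x j else 0))"
  by (auto simp: vertex_map_def oriented_simplex_def intro!: sum.cong)

lemma vertex_map_in:
  assumes x: "x \<in> standard_simplex (length l - 1)" and l: "set l \<subseteq> {..p}" "l \<noteq> []"
  shows "vertex_map l x \<in> standard_simplex p"
proof -
  let ?n = "length l - 1"
  have lj: "l ! j \<le> p" if "j \<le> ?n" for j
    using l that nth_mem[of j l] by (cases l) (auto simp: less_Suc_eq_le)
  have x0: "x j \<ge> 0" for j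
    using x by (auto simp: standard_simplex_def)
  have x1: "(\<Sum>j\<le>?n. x j) = 1"
    using x by (auto simp: standard_simplex_def)
  have nonneg: "(\<Sum>j\<le>?n. (if i = l ! j then x j else 0)) \<ge> 0" for i
    by (intro sum_nonneg) (auto simp: x0)
  have le1: "(\<Sum>j\<le>?n. (if i = l ! j then x j else 0)) \<le> 1" for i
    unfolding x1[symmetric] by (intro sum_mono) (auto simp: x0)
  have "(\<Sum>i\<le>p. \<Sum>j\<le>?n. (if i = l ! j then x j else 0)) = (\<Sum>j\<le>?n. \<Sum>i\<le>p. (if i = l ! j then x j else 0))"
    by (rule sum.swap)
  also have "\<dots> = (\<Sum>j\<le>?n. x j)"
    by (intro sum.cong refl) (use lj in auto)
  finally have "(\<Sum>i\<le>p. \<Sum>j\<le>?n. (if i = l ! j then x j else 0)) = 1"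
    using x1 by simp
  moreover have "(\<Sum>j\<le>?n. (if i = l ! j then x j else 0)) = 0" if "i > p" for i
    using lj that by (intro sum.neutral) fastforce
  ultimately show ?thesis
    unfolding vertex_map_eq[OF x] using nonneg le1 by (simp add: standard_simplex_def)
qed

lemma vertex_map_vertex_map:
  assumes x: "x \<in> standard_simplex (length l' - 1)" and l': "set l' \<subseteq> {..<length l}" "l' \<noteq> []"
  shows "vertex_map l (vertex_map l' x) = vertex_map (map ((!) l) l') x"
proof -
  have l'j: "l' ! j < length l" if "j \<le> length l' - 1" for j
    using l' that nth_mem[of j l'] by (cases l') (auto simp: less_Suc_eq_le)
  have "set l' \<subseteq> {..length l - 1}"
    using l' by fastforce
  then have in_s: "vertex_map l' x \<in> standard_simplex (length l - 1)"
    using vertex_map_in[OF x] l' by blast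
  have "(\<Sum>k\<le>length l - 1. if i = l ! k then \<Sum>j\<le>length l' - 1. (if k = l' ! j then x j else 0) else 0) =
    (\<Sum>j\<le>length l' - 1. if i = map ((!) l) l' ! j then x j else 0)" for i
  proof -
    have "(\<Sum>k\<le>length l - 1. if i = l ! k then \<Sum>j\<le>length l' - 1. (if k = l' ! j then x j else 0) else 0) =
      (\<Sum>k\<le>length l - 1. \<Sum>j\<le>length l' - 1. if k = l' ! j then (if i = l ! k then x j else 0) else 0)"
      by (intro sum.cong) (auto intro!: sum.cong sum.neutral)
    also have "\<dots> = (\<Sum>j\<le>length l' - 1. \<Sum>k\<le>length l - 1. if k = l' ! j then (if i = l ! k then x j else 0) else 0)"
      by (rule sum.swap)
    also have "\<dots> = (\<Sum>j\<le>length l' - 1. if i = l ! (l' ! j) then x j else 0)"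
    proof (intro sum.cong refl)
      fix j assume "j \<in> {..length l' - 1}"
      then have "l' ! j \<le> length l - 1"
        using l'j[of j] by simp
      then show "(\<Sum>k\<le>length l - 1. if k = l' ! j then (if i = l ! k then x j else 0) else 0) =
          (if i = l ! (l' ! j) then x j else 0)"
        by (subst sum.delta) auto
    qed
    also have "\<dots> = (\<Sum>j\<le>length l' - 1. if i = map ((!) l) l' ! j then x j else 0)"
      using l' by (intro sum.cong refl, subst nth_map) (cases l', auto)
    finally show ?thesis .
  qed
  moreover have "x \<in> standard_simplex (length (map ((!) l) l') - 1)"
    using x by simp
  ultimately show ?thesis
    unfolding vertex_map_eq[OF in_s] by (simp only: vertex_map_eq x length_map)
qed

lemma vertex_map_upt:
  assumes "x \<in> standard_simplex p"
  shows "vertex_map [0..<Suc p] x = x"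
proof
  fix i
  have "(\<Sum>j\<le>p. if i = [0..<Suc p] ! j then x j else 0) = (\<Sum>j\<le>p. if i = j then x j else 0)"
    by (intro sum.cong refl) (simp del: upt_Suc)
  also have "\<dots> = x i"
    using assms by (auto simp: standard_simplex_def)
  finally show "vertex_map [0..<Suc p] x i = x i"
    using assms by (subst vertex_map_eq) (auto simp del: upt_Suc)
qed

lemma sub_simplex_sub_simplex:
  assumes "l' \<noteq> []" "set l' \<subseteq> {..<length l}"
  shows "sub_simplex (sub_simplex s l) l' = sub_simplex s (map ((!) l) l')"
proof
  fix x
  show "sub_simplex (sub_simplex s l) l' x = sub_simplex s (map ((!) l) l') x"
  proof (cases "x \<in> standard_simplex (length l' - 1)")
    case True
    moreover have "set l' \<subseteq> {..length l - 1}"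
      using assms by fastforce
    ultimately have "vertex_map l' x \<in> standard_simplex (length l - 1)"
      using vertex_map_in assms by blast
    then show ?thesis
      using True assms by (simp add: sub_simplex_def vertex_map_vertex_map)
  qed (simp add: sub_simplex_def)
qed

lemma continuous_map_vertex_map:
  assumes "set l \<subseteq> {..p}" "l \<noteq> []"
  shows "continuous_map (subtopology (powertop_real UNIV) (standard_simplex (length l - 1)))
    (subtopology (powertop_real UNIV) (standard_simplex p)) (vertex_map l)"
proof -
  have "(\<lambda>x i. \<Sum>j\<le>length l - 1. (if i = l ! j then 1 else 0) * x j) `
      standard_simplex (length l - 1) \<subseteq> standard_simplex p"
  proof (rule image_subsetI)
    fix x :: "nat \<Rightarrow> real" assume x: "x \<in> standard_simplex (length l - 1)"
    then show "(\<lambda>i. \<Sum>j\<le>length l - 1. (if i = l ! j then 1 else 0) * x j) \<in> standard_simplex p"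
      using vertex_map_in[OF x assms] by (simp add: vertex_map_def oriented_simplex_def)
  qed
  then have "simplicial_simplex (length l - 1) (standard_simplex p) (vertex_map l)"
    by (simp add: vertex_map_def simplicial_simplex_oriented_simplex)
  then show ?thesis
    using simplicial_imp_singular_simplex singular_simplex_def by blast
qed

lemma singular_simplex_sub_simplex:
  assumes "singular_simplex p T s" "set l \<subseteq> {..p}" "l \<noteq> []"
  shows "singular_simplex (length l - 1) T (sub_simplex s l)"
proof -
  have "continuous_map (subtopology (powertop_real UNIV) (standard_simplex (length l - 1))) T
      (s \<circ> vertex_map l)"
    using continuous_map_compose[OF continuous_map_vertex_map[OF assms(2,3)]] assms(1)
    by (auto simp: singular_simplex_def)
  then have "continuous_map (subtopology (powertop_real UNIV) (standard_simplex (length l - 1))) T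
      (sub_simplex s l)"
    by (rule continuous_map_eq) (auto simp: sub_simplex_def)
  then show ?thesis
    by (simp add: singular_simplex_def sub_simplex_def)
qed

lemma simplical_face_eq_vertex_map:
  assumes "k \<le> Suc p" "x \<in> standard_simplex p"
  shows "simplical_face k x = vertex_map (delete_nth k [0..<Suc (Suc p)]) x"
proof
  fix i
  let ?l = "delete_nth k [0..<Suc (Suc p)]"
  have len: "length ?l - 1 = p"
    using assms by (simp add: length_delete_nth del: upt_Suc)
  have nth: "?l ! j = (if j < k then j else Suc j)" if "j \<le> p" for j
    using assms that by (subst nth_delete_nth) (auto simp del: upt_Suc)
  have x0: "x j = 0" if "j > p" for j
    using assms(2) that by (simp add: standard_simplex_def)
  have "vertex_map ?l x i = (\<Sum>j\<le>p. if i = (if j < k then j else Suc j) then x j else 0)"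
    using assms(2) len by (subst vertex_map_eq) (simp_all add: nth del: upt_Suc)
  also have "\<dots> = simplical_face k x i"
  proof -
    consider "i < k" | "i = k" | "i > k" by linarith
    then show ?thesis
    proof cases
      case 1
      then have "(\<Sum>j\<le>p. if i = (if j < k then j else Suc j) then x j else 0) =
          (\<Sum>j\<le>p. if j = i then x j else 0)"
        by (intro sum.cong) auto
      then show ?thesis using 1 x0 by (auto simp: simplical_face_def)
    next
      case 2
      then have "(\<Sum>j\<le>p. if i = (if j < k then j else Suc j) then x j else 0) = 0"
        by (intro sum.neutral) auto
      then show ?thesis using 2 by (simp add: simplical_face_def)
    next
      case 3
      then have "(\<Sum>j\<le>p. if i = (if j < k then j else Suc j) then x j else 0) =
          (\<Sum>j\<le>p. if j = i - 1 then x j else 0)"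
        by (intro sum.cong) auto
      then show ?thesis using 3 x0 by (auto simp: simplical_face_def)
    qed
  qed
  finally show "simplical_face k x i = vertex_map ?l x i" ..
qed

text \<open>Translates the face operators of singular homology into vertex lists, so that boundaries
  become instances of \<open>face_sum\<close>.\<close>

lemma singular_face_eq_sub_simplex:
  assumes "k \<le> Suc p"
  shows "singular_face (Suc p) k s = sub_simplex s (delete_nth k [0..<Suc (Suc p)])"
proof -
  have "length (delete_nth k [0..<Suc (Suc p)]) - 1 = p"
    using assms by (simp add: length_delete_nth del: upt_Suc)
  then show ?thesis
    unfolding singular_face_def sub_simplex_def
    using simplical_face_eq_vertex_map[OF assms] by (auto simp: restrict_def simp del: upt_Suc)
qed

lemma face_sum_upt_Suc:
  "face_sum F [0..<Suc p] = (\<Sum>k\<le>p. alternate k (F (delete_nth k [0..<Suc p])))"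
  unfolding face_sum_nth delete_nth_def[symmetric] by (simp add: lessThan_Suc_atMost del: upt_Suc)

text \<open>Degree 0 is an exception because \<open>face_sum\<close> is augmented: on a single
  vertex it would return the value on the empty list instead of 0.\<close>

lemma rat_boundary_eq:
  "rat_boundary (int p) c = (if p = 0 then 0 else
     rat_extend (\<lambda>s. face_sum (\<lambda>l. Poly_Mapping.single (sub_simplex s l) 1) [0..<Suc p]) c)"
proof (cases p)
  case (Suc p')
  have "(\<Sum>k\<le>p. Poly_Mapping.single (singular_face p k s) ((- 1 :: rat) ^ k)) =
     face_sum (\<lambda>l. Poly_Mapping.single (sub_simplex s l) 1) [0..<Suc p]" for s :: "(nat \<Rightarrow> real) \<Rightarrow> 'a"
    unfolding face_sum_upt_Suc
    by (intro sum.cong refl)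
      (simp add: Suc singular_face_eq_sub_simplex alternate_eq_rat_scale del: upt_Suc)
  moreover have "p \<noteq> 0"
    by (simp add: Suc)
  ultimately show ?thesis
    by (simp add: rat_boundary_def del: upt_Suc sum.atMost_Suc)
qed (simp add: rat_boundary_def)

section \<open>Simplices of a product along lattice paths\<close>

definition pair_simplex ::
    "((nat \<Rightarrow> real) \<Rightarrow> 'a) \<Rightarrow> ((nat \<Rightarrow> real) \<Rightarrow> 'b) \<Rightarrow> (nat \<times> nat) list \<Rightarrow> (nat \<Rightarrow> real) \<Rightarrow> 'a \<times> 'b"
  where "pair_simplex s t l =
    (\<lambda>x\<in>standard_simplex (length l - 1). (s (vertex_map (map fst l) x), t (vertex_map (map snd l) x)))"

lemma sub_simplex_pair_simplex:
  assumes "l' \<noteq> []" "set l' \<subseteq> {..<length l}"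
  shows "sub_simplex (pair_simplex s t l) l' = pair_simplex s t (map ((!) l) l')"
proof
  fix x
  have [simp]: "map f (map ((!) l) l') = map ((!) (map f l)) l'" for f :: "nat \<times> nat \<Rightarrow> nat"
    using assms by auto
  show "sub_simplex (pair_simplex s t l) l' x = pair_simplex s t (map ((!) l) l') x"
  proof (cases "x \<in> standard_simplex (length l' - 1)")
    case True
    moreover have "set l' \<subseteq> {..length l - 1}"
      using assms by fastforce
    ultimately have "vertex_map l' x \<in> standard_simplex (length l - 1)"
      using vertex_map_in assms by blast
    then show ?thesis
      using True assms
      by (simp add: sub_simplex_def pair_simplex_def vertex_map_vertex_map del: map_map)
  qed (simp add: sub_simplex_def pair_simplex_def)
qed

lemma shuffle_simplex_eq:
  assumes A: "A \<subseteq> {..<p + q}" "card A = p"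
  shows "shuffle_simplex p q A s t = pair_simplex s t (lattice_path [0..<Suc p] [0..<Suc q] (p + q) A)"
proof -
  let ?l = "lattice_path [0..<Suc p] [0..<Suc q] (p + q) A"
  have fin: "finite A"
    using A finite_subset by blast
  \<comment> \<open>The bounds \<open>cA\<close> and \<open>cB\<close> keep the step counts inside
    the lists \<open>[0..<Suc p]\<close> and \<open>[0..<Suc q]\<close>, whose entry at such a count
    is the count itself.\<close>
  have cA: "card (A \<inter> {..<k}) \<le> p" for k
    using A fin by (metis card_mono Int_lower1)
  have cB: "card ({..<k} - A) \<le> q" if "k \<le> p + q" for k
  proof -
    have "card ({..<k} - A) \<le> card ({..<p + q} - A)"
      by (rule card_mono) (use that in auto)
    also have "\<dots> = q"
      using A fin by (simp add: card_Diff_subset)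
    finally show ?thesis .
  qed
  have len: "length ?l - 1 = p + q"
    by (simp add: lattice_path_def)
  have "vertex_map (map fst ?l) =
      oriented_simplex (p + q) (\<lambda>k j. if j = card (A \<inter> {..<k}) then 1 else 0)"
    unfolding vertex_map_def length_map len oriented_simplex_eq
    using cA by (auto simp: lattice_path_def fun_eq_iff less_Suc_eq_le simp del: upt_Suc)
  moreover have "vertex_map (map snd ?l) =
      oriented_simplex (p + q) (\<lambda>k j. if j = card ({..<k} - A) then 1 else 0)"
    unfolding vertex_map_def length_map len oriented_simplex_eq
    using cB by (auto simp: lattice_path_def fun_eq_iff less_Suc_eq_le simp del: upt_Suc)
  ultimately show ?thesis
    unfolding shuffle_simplex_def pair_simplex_def len by simp
qed

lemma eilenberg_zilber_eq:
  "eilenberg_zilber p q c c' = rat_extend (\<lambda>s. rat_extend (\<lambda>t.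
     shuffle_sum (\<lambda>l. Poly_Mapping.single (pair_simplex s t l) 1) [0..<Suc p] [0..<Suc q]) c') c"
proof -
  have "(\<Sum>A | A \<subseteq> {..<p + q} \<and> card A = p.
      Poly_Mapping.single (shuffle_simplex p q A s t) (shuffle_sign p q A)) =
    shuffle_sum (\<lambda>l. Poly_Mapping.single (pair_simplex s t l) 1) [0..<Suc p] [0..<Suc q]"
    for s :: "(nat \<Rightarrow> real) \<Rightarrow> 'a" and t :: "(nat \<Rightarrow> real) \<Rightarrow> 'b"
    by (subst sum_subsets_eq_shuffle_sum[where p = p and q = q, symmetric];
        (simp del: upt_Suc)?; intro sum.cong refl)
      (auto simp: shuffle_simplex_eq alternate_eq_rat_scale shuffle_sign_def inversions_def simp del: upt_Suc)
  then show ?thesis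
    by (simp add: eilenberg_zilber_def del: upt_Suc)
qed

definition ez_simplex ::
    "nat \<Rightarrow> nat \<Rightarrow> ((nat \<Rightarrow> real) \<Rightarrow> 'a) \<Rightarrow> ((nat \<Rightarrow> real) \<Rightarrow> 'b) \<Rightarrow> ('a \<times> 'b) rat_chain" where
  "ez_simplex p q s t =
     shuffle_sum (\<lambda>l. Poly_Mapping.single (pair_simplex s t l) 1) [0..<Suc p] [0..<Suc q]"

lemma eilenberg_zilber_def':
  "eilenberg_zilber p q c c' = rat_extend (\<lambda>s. rat_extend (ez_simplex p q s) c') c"
  unfolding eilenberg_zilber_eq ez_simplex_def ..

lemma eilenberg_zilber_0 [simp]: "eilenberg_zilber p q 0 c = 0" "eilenberg_zilber p q c 0 = 0"
  by (simp_all add: eilenberg_zilber_def')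

lemma eilenberg_zilber_add:
  "eilenberg_zilber p q (a + b) c = eilenberg_zilber p q a c + eilenberg_zilber p q b c"
  "eilenberg_zilber p q c (a' + b') = eilenberg_zilber p q c a' + eilenberg_zilber p q c b'"
  by (simp_all add: eilenberg_zilber_def' rat_extend_add rat_extend_fun_add)

lemma eilenberg_zilber_scale:
  "eilenberg_zilber p q (rat_scale r a) c = rat_scale r (eilenberg_zilber p q a c)"
  "eilenberg_zilber p q a (rat_scale r c) = rat_scale r (eilenberg_zilber p q a c)"
  by (simp_all add: eilenberg_zilber_def' rat_extend_scale rat_extend_fun_scale)

lemma eilenberg_zilber_diff:
  "eilenberg_zilber p q (a - b) c = eilenberg_zilber p q a c - eilenberg_zilber p q b c"
  "eilenberg_zilber p q c (a' - b') = eilenberg_zilber p q c a' - eilenberg_zilber p q c b'"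
  using eilenberg_zilber_add(1)[of p q "a - b" b c] eilenberg_zilber_add(2)[of p q c "a' - b'" b']
  by (simp_all add: algebra_simps)

lemma rat_boundary_0 [simp]: "rat_boundary d 0 = 0"
  by (simp add: rat_boundary_def)

lemma rat_boundary_add: "rat_boundary d (a + b) = rat_boundary d a + rat_boundary d b"
  by (simp add: rat_boundary_def rat_extend_add)

lemma rat_boundary_scale: "rat_boundary d (rat_scale r a) = rat_scale r (rat_boundary d a)"
  by (simp add: rat_boundary_def rat_extend_scale)

lemma rat_boundary_diff: "rat_boundary d (a - b) = rat_boundary d a - rat_boundary d b"
  by (simp add: rat_boundary_def rat_extend_diff)

lemma rat_boundary_rat_extend:
  "rat_boundary d (rat_extend f c) = rat_extend (\<lambda>s. rat_boundary d (f s)) c"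
  by (rule hom_rat_extend) (auto simp: rat_boundary_add rat_boundary_scale)

lemma rat_boundary_shuffle_sum:
  "rat_boundary d (shuffle_sum F U V) = shuffle_sum (\<lambda>l. rat_boundary d (F l)) U V"
  by (rule hom_shuffle_sum) (auto simp: rat_boundary_add)

lemma rat_boundary_face_sum: "rat_boundary d (face_sum F U) = face_sum (\<lambda>l. rat_boundary d (F l)) U"
  by (induction F U rule: face_sum.induct) (auto simp: rat_boundary_diff)

lemma rat_chain_map_0 [simp]: "rat_chain_map p f 0 = 0"
  by (simp add: rat_chain_map_def)

lemma rat_chain_map_single [simp]:
  "rat_chain_map p f (Poly_Mapping.single s r) = Poly_Mapping.single (simplex_map p f s) r"
  by (simp add: rat_chain_map_def)

lemma rat_chain_map_add: "rat_chain_map p f (a + b) = rat_chain_map p f a + rat_chain_map p f b"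
  by (simp add: rat_chain_map_def rat_extend_add)

lemma rat_chain_map_diff: "rat_chain_map p f (a - b) = rat_chain_map p f a - rat_chain_map p f b"
  by (simp add: rat_chain_map_def rat_extend_diff)

lemma rat_chain_map_scale: "rat_chain_map p f (rat_scale r a) = rat_scale r (rat_chain_map p f a)"
  by (simp add: rat_chain_map_def rat_extend_scale)

lemma rat_chain_map_alternate:
  "rat_chain_map p f (alternate n a) = alternate n (rat_chain_map p f a)"
  by (simp add: rat_chain_map_def rat_extend_alternate)

lemma rat_chain_map_sum: "rat_chain_map p f (\<Sum>i\<in>I. g i) = (\<Sum>i\<in>I. rat_chain_map p f (g i))"
  by (simp add: rat_chain_map_def rat_extend_sum)

lemma rat_chain_map_rat_extend:
  "rat_chain_map p f (rat_extend g c) = rat_extend (\<lambda>s. rat_chain_map p f (g s)) c"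
  by (simp add: rat_chain_map_def rat_extend_rat_extend)

lemma rat_chain_map_shuffle_sum:
  "rat_chain_map p f (shuffle_sum F U V) = shuffle_sum (\<lambda>l. rat_chain_map p f (F l)) U V"
  by (simp add: rat_chain_map_def rat_extend_shuffle_sum)

lemma rat_chain_map_rat_chain_map:
  "rat_chain_map p g (rat_chain_map p f c) = rat_chain_map p (g \<circ> f) c"
  unfolding rat_chain_map_def rat_extend_rat_extend by (simp add: simplex_map_compose)

lemma rat_eval_rat_chain_map:
  "rat_eval F (rat_chain_map p f c) = rat_eval (\<lambda>s. F (simplex_map p f s)) c"
  by (simp add: rat_chain_map_def rat_eval_rat_extend)

section \<open>Chains of a space in natural degree\<close>

definition rat_chains :: "nat \<Rightarrow> 'a topology \<Rightarrow> 'a rat_chain set" where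
  "rat_chains p T = {c. Poly_Mapping.keys c \<subseteq> singular_simplex_set p T}"

lemma rat_chains_0 [simp]: "0 \<in> rat_chains p T"
  by (simp add: rat_chains_def)

lemma rat_chains_add: "a \<in> rat_chains p T \<Longrightarrow> b \<in> rat_chains p T \<Longrightarrow> a + b \<in> rat_chains p T"
  using keys_add[of a b] by (auto simp: rat_chains_def)

lemma rat_chains_diff: "a \<in> rat_chains p T \<Longrightarrow> b \<in> rat_chains p T \<Longrightarrow> a - b \<in> rat_chains p T"
  using keys_diff[of a b] by (auto simp: rat_chains_def)

lemma rat_chains_minus: "a \<in> rat_chains p T \<Longrightarrow> - a \<in> rat_chains p T"
  by (auto simp: rat_chains_def)

lemma rat_chains_scale: "a \<in> rat_chains p T \<Longrightarrow> rat_scale r a \<in> rat_chains p T"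
  using keys_rat_scale[of r a] by (auto simp: rat_chains_def)

lemma rat_chains_alternate: "a \<in> rat_chains p T \<Longrightarrow> alternate n a \<in> rat_chains p T"
  by (simp add: alternate_eq_rat_scale rat_chains_scale)

lemma rat_chains_single [simp]:
  "Poly_Mapping.single s r \<in> rat_chains p T \<longleftrightarrow> r = 0 \<or> singular_simplex p T s"
  by (auto simp: rat_chains_def)

lemma rat_chains_rat_extend:
  assumes "\<And>s. s \<in> Poly_Mapping.keys c \<Longrightarrow> f s \<in> rat_chains p T"
  shows "rat_extend f c \<in> rat_chains p T"
  using keys_rat_extend[of c f "singular_simplex_set p T"] assms by (simp add: rat_chains_def)

lemma rat_chains_empty:
  assumes "topspace T = {}"
  shows "rat_chains p T = {0}"
proof -
  have "singular_simplex_set p T = {}"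
    using singular_simplex_empty[OF assms] by blast
  then show ?thesis
    by (simp only: rat_chains_def) auto
qed

lemma rat_chain_map_in:
  assumes "c \<in> rat_chains p T" "continuous_map T T' f"
  shows "rat_chain_map p f c \<in> rat_chains p T'"
  unfolding rat_chain_map_def
  by (rule rat_chains_rat_extend)
    (use assms in \<open>auto simp: rat_chains_def intro!: singular_simplex_simplex_map\<close>)

lemma rat_chain_map_cong:
  assumes "c \<in> rat_chains p T" "\<And>x. x \<in> topspace T \<Longrightarrow> f x = g x"
  shows "rat_chain_map p f c = rat_chain_map p g c"
  unfolding rat_chain_map_def
proof (rule rat_extend_cong)
  fix s assume "s \<in> Poly_Mapping.keys c"
  then have "singular_simplex p T s"
    using assms(1) by (auto simp: rat_chains_def)
  then show "Poly_Mapping.single (simplex_map p f s) 1 = Poly_Mapping.single (simplex_map p g s) (1::rat)"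
    using simplex_map_eq[of p T s f g] assms(2) by simp
qed

lemma rat_chain_map_id:
  assumes "c \<in> rat_chains p T" "\<And>x. x \<in> topspace T \<Longrightarrow> f x = x"
  shows "rat_chain_map p f c = c"
proof -
  have "rat_chain_map p f c = rat_extend (\<lambda>s. Poly_Mapping.single s 1) c"
    unfolding rat_chain_map_def
  proof (rule rat_extend_cong)
    fix s assume "s \<in> Poly_Mapping.keys c"
    then have "singular_simplex p T s"
      using assms(1) by (auto simp: rat_chains_def)
    then show "Poly_Mapping.single (simplex_map p f s) 1 = Poly_Mapping.single s (1::rat)"
      using simplex_map_id_gen[of p T s f] assms(2) by simp
  qed
  then show ?thesis by simp
qed

lemma shuffle_sum_in_rat_chains:
  assumes "\<And>l. \<lbrakk>l \<noteq> []; Suc (length l) = length U + length V; set l \<subseteq> set U \<times> set V\<rbrakk> \<Longrightarrow>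
    F l \<in> rat_chains p T"
  shows "shuffle_sum F U V \<in> rat_chains p T"
  using assms
proof (induction F U V rule: shuffle_sum.induct)
  case (3 F x U y V)
  have "shuffle_sum (\<lambda>l. F ((x, y) # l)) U (y # V) \<in> rat_chains p T"
    by (rule "3.IH"(1), rule "3.prems") auto
  moreover have "shuffle_sum (\<lambda>l. F ((x, y) # l)) (x # U) V \<in> rat_chains p T"
    by (rule "3.IH"(2), rule "3.prems") auto
  moreover have "F [(x, y)] \<in> rat_chains p T" if "U = []" "V = []"
    using that by (intro "3.prems") auto
  ultimately show ?case
    by (auto intro!: rat_chains_add rat_chains_alternate)
qed auto

lemma face_sum_in_rat_chains:
  assumes "\<And>l. \<lbrakk>Suc (length l) = length U; set l \<subseteq> set U\<rbrakk> \<Longrightarrow> F l \<in> rat_chains p T"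
  shows "face_sum F U \<in> rat_chains p T"
  using assms
proof (induction F U rule: face_sum.induct)
  case (2 F x U)
  have "face_sum (\<lambda>l. F (x # l)) U \<in> rat_chains p T"
    by (rule "2.IH", rule "2.prems") auto
  moreover have "F U \<in> rat_chains p T"
    by (rule "2.prems") auto
  ultimately show ?case
    by (auto intro!: rat_chains_diff)
qed auto

lemma rat_boundary_in:
  assumes "c \<in> rat_chains (Suc p) T"
  shows "rat_boundary (int (Suc p)) c \<in> rat_chains p T"
  unfolding rat_boundary_eq
proof (simp del: upt_Suc, rule rat_chains_rat_extend, rule face_sum_in_rat_chains)
  fix s l assume "s \<in> Poly_Mapping.keys c"
    and l: "Suc (length l) = length [0..<Suc (Suc p)]" "set l \<subseteq> set [0..<Suc (Suc p)]"
  then have "singular_simplex (Suc p) T s"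
    using assms by (auto simp: rat_chains_def)
  moreover have "set l \<subseteq> {..Suc p}" "l \<noteq> []"
    using l by auto
  ultimately have "singular_simplex (length l - 1) T (sub_simplex s l)"
    by (rule singular_simplex_sub_simplex)
  then show "Poly_Mapping.single (sub_simplex s l) 1 \<in> rat_chains p T"
    using l by simp
qed

text \<open>Faces of positions in \<open>l\<close> are renamed to faces of \<open>l\<close> itself.
  This turns an iterated boundary into an iterated \<open>face_sum\<close>, which vanishes.\<close>

lemma rat_boundary_single_sub_simplex:
  assumes "length l = Suc (Suc p)"
  shows "rat_boundary (int (Suc p)) (Poly_Mapping.single (sub_simplex s l) r) =
     face_sum (\<lambda>l. Poly_Mapping.single (sub_simplex s l) r) l"
proof -
  have l: "l = map ((!) l) [0..<Suc (Suc p)]"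
    using assms map_nth[of l] by simp
  have "face_sum (\<lambda>l. Poly_Mapping.single (sub_simplex s l) r) l =
      face_sum (\<lambda>l'. Poly_Mapping.single (sub_simplex s (map ((!) l) l')) r) [0..<Suc (Suc p)]"
    using face_sum_map[of "\<lambda>l. Poly_Mapping.single (sub_simplex s l) r" "(!) l" "[0..<Suc (Suc p)]"]
    unfolding l[symmetric] .
  also have "\<dots> = face_sum (\<lambda>l'. Poly_Mapping.single (sub_simplex (sub_simplex s l) l') r) [0..<Suc (Suc p)]"
    by (rule face_sum_cong, subst sub_simplex_sub_simplex) (use assms in auto)
  also have "\<dots> = rat_boundary (int (Suc p)) (Poly_Mapping.single (sub_simplex s l) r)"
  proof -
    have "rat_scale r (face_sum F U) = face_sum (\<lambda>l. rat_scale r (F l)) U"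
      for F :: "nat list \<Rightarrow> 'a rat_chain" and U
      by (induction F U rule: face_sum.induct) (auto simp: rat_scale_diff)
    then show ?thesis
      by (simp add: rat_boundary_eq del: upt_Suc of_nat_Suc)
  qed
  finally show ?thesis ..
qed

lemma rat_boundary_rat_boundary: "rat_boundary (int p) (rat_boundary (int (Suc p)) c) = 0"
proof (cases p)
  case 0
  then show ?thesis by (simp add: rat_boundary_def)
next
  case (Suc p')
  have "rat_boundary (int (Suc p')) (face_sum (\<lambda>l. Poly_Mapping.single (sub_simplex s l) 1) [0..<Suc (Suc p)])
      = 0" for s :: "(nat \<Rightarrow> real) \<Rightarrow> 'a"
  proof -
    have "rat_boundary (int (Suc p')) (face_sum (\<lambda>l. Poly_Mapping.single (sub_simplex s l) 1) [0..<Suc (Suc p)])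
      = face_sum (face_sum (\<lambda>l. Poly_Mapping.single (sub_simplex s l) 1)) [0..<Suc (Suc p)]"
      unfolding rat_boundary_face_sum
      by (rule face_sum_cong) (subst rat_boundary_single_sub_simplex; simp add: Suc)
    then show ?thesis
      by (simp only: face_sum_face_sum)
  qed
  then have "rat_extend (\<lambda>s. rat_boundary (int (Suc p'))
      (face_sum (\<lambda>l. Poly_Mapping.single (sub_simplex s l) 1) [0..<Suc (Suc p)])) c = 0"
    by (simp only: rat_extend_fun_0)
  moreover have "rat_boundary (int (Suc p)) c = rat_extend (\<lambda>s. face_sum
      (\<lambda>l. Poly_Mapping.single (sub_simplex s l) 1) [0..<Suc (Suc p)]) c"
    unfolding rat_boundary_eq by (simp only: nat.distinct if_False)
  ultimately show ?thesis
    using Suc by (simp only: rat_boundary_rat_extend)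
qed

section \<open>Leibniz rule, naturality, symmetry, associativity and units\<close>

lemma simplex_map_vertex_map:
  "\<lbrakk>set l \<subseteq> {..p}; l \<noteq> []; x \<in> standard_simplex (length l - 1)\<rbrakk> \<Longrightarrow>
    simplex_map p f s (vertex_map l x) = f (s (vertex_map l x))"
  using vertex_map_in[of x l p] by (simp add: simplex_map_def)

lemma sub_simplex_vertex_map:
  assumes "x \<in> standard_simplex (length l' - 1)" "set l' \<subseteq> {..<length l}" "l' \<noteq> []"
  shows "sub_simplex s l (vertex_map l' x) = s (vertex_map (map ((!) l) l') x)"
proof -
  have "set l' \<subseteq> {..length l - 1}"
    using assms by fastforce
  then have "vertex_map l' x \<in> standard_simplex (length l - 1)"
    using vertex_map_in assms by blast
  then show ?thesis
    using assms by (simp add: sub_simplex_def vertex_map_vertex_map)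
qed

lemma pair_simplex_vertex_map:
  assumes "x \<in> standard_simplex (length l' - 1)" "set l' \<subseteq> {..<length l}" "l' \<noteq> []"
  shows "pair_simplex s t l (vertex_map l' x) =
    (s (vertex_map (map fst (map ((!) l) l')) x), t (vertex_map (map snd (map ((!) l) l')) x))"
proof -
  have [simp]: "map f (map ((!) l) l') = map ((!) (map f l)) l'" for f :: "nat \<times> nat \<Rightarrow> nat"
    using assms by auto
  have "set l' \<subseteq> {..length l - 1}"
    using assms by fastforce
  then have "vertex_map l' x \<in> standard_simplex (length l - 1)"
    using vertex_map_in assms by blast
  then show ?thesis
    using assms by (simp add: pair_simplex_def vertex_map_vertex_map del: map_map)
qed

lemma pair_simplex_sub_left:
  assumes "l' \<noteq> []" "fst ` set l' \<subseteq> {..<length l}"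
  shows "pair_simplex (sub_simplex s l) t l' = pair_simplex s t (map (map_prod ((!) l) id) l')"
proof
  fix x
  show "pair_simplex (sub_simplex s l) t l' x = pair_simplex s t (map (map_prod ((!) l) id) l') x"
    using sub_simplex_vertex_map[of x "map fst l'" l s] assms
    by (auto simp: pair_simplex_def restrict_def comp_def)
qed

lemma pair_simplex_sub_right:
  assumes "l' \<noteq> []" "snd ` set l' \<subseteq> {..<length l}"
  shows "pair_simplex s (sub_simplex t l) l' = pair_simplex s t (map (map_prod id ((!) l)) l')"
proof
  fix x
  show "pair_simplex s (sub_simplex t l) l' x = pair_simplex s t (map (map_prod id ((!) l)) l') x"
    using sub_simplex_vertex_map[of x "map snd l'" l t] assms
    by (auto simp: pair_simplex_def restrict_def comp_def)
qed

text \<open>The product of a face with \<open>t\<close> is again a shuffle sum over vertices of the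
  original \<open>s\<close>, now taken from a shorter list. In this form it matches the terms of
  \<open>shuffle_sum_face_sum\<close>.\<close>

lemma ez_simplex_sub_left:
  assumes "length l = Suc p"
  shows "ez_simplex p q (sub_simplex s l) t =
    shuffle_sum (\<lambda>l. Poly_Mapping.single (pair_simplex s t l) 1) l [0..<Suc q]"
proof -
  have l: "l = map ((!) l) [0..<Suc p]"
    using assms map_nth[of l] by simp
  have "shuffle_sum (\<lambda>l. Poly_Mapping.single (pair_simplex s t l) (1::rat)) l [0..<Suc q] =
    shuffle_sum (\<lambda>l'. Poly_Mapping.single (pair_simplex s t (map (map_prod ((!) l) id) l')) 1)
      [0..<Suc p] [0..<Suc q]"
    using shuffle_sum_map[of "\<lambda>l. Poly_Mapping.single (pair_simplex s t l) (1::rat)" "(!) l" "[0..<Suc p]" id "[0..<Suc q]"]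
    unfolding l[symmetric] list.map_id .
  also have "\<dots> = ez_simplex p q (sub_simplex s l) t"
    unfolding ez_simplex_def
    by (rule shuffle_sum_cong, subst pair_simplex_sub_left) (use assms in \<open>auto simp del: upt_Suc\<close>)
  finally show ?thesis ..
qed

lemma ez_simplex_sub_right:
  assumes "length l = Suc q"
  shows "ez_simplex p q s (sub_simplex t l) =
    shuffle_sum (\<lambda>l. Poly_Mapping.single (pair_simplex s t l) 1) [0..<Suc p] l"
proof -
  have l: "l = map ((!) l) [0..<Suc q]"
    using assms map_nth[of l] by simp
  have "shuffle_sum (\<lambda>l. Poly_Mapping.single (pair_simplex s t l) (1::rat)) [0..<Suc p] l =
    shuffle_sum (\<lambda>l'. Poly_Mapping.single (pair_simplex s t (map (map_prod id ((!) l)) l')) 1)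
      [0..<Suc p] [0..<Suc q]"
    using shuffle_sum_map[of "\<lambda>l. Poly_Mapping.single (pair_simplex s t l) (1::rat)" id "[0..<Suc p]" "(!) l" "[0..<Suc q]"]
    unfolding l[symmetric] list.map_id .
  also have "\<dots> = ez_simplex p q s (sub_simplex t l)"
    unfolding ez_simplex_def
    by (rule shuffle_sum_cong, subst pair_simplex_sub_right) (use assms in \<open>auto simp del: upt_Suc\<close>)
  finally show ?thesis ..
qed

lemma rat_boundary_single_pair_simplex:
  assumes "length l = Suc (Suc p)"
  shows "rat_boundary (int (Suc p)) (Poly_Mapping.single (pair_simplex s t l) 1) =
     face_sum (\<lambda>l. Poly_Mapping.single (pair_simplex s t l) 1) l"
proof -
  have l: "l = map ((!) l) [0..<Suc (Suc p)]"
    using assms map_nth[of l] by simp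
  have "face_sum (\<lambda>l. Poly_Mapping.single (pair_simplex s t l) (1::rat)) l =
      face_sum (\<lambda>l'. Poly_Mapping.single (pair_simplex s t (map ((!) l) l')) 1) [0..<Suc (Suc p)]"
    using face_sum_map[of "\<lambda>l. Poly_Mapping.single (pair_simplex s t l) (1::rat)" "(!) l" "[0..<Suc (Suc p)]"]
    unfolding l[symmetric] .
  also have "\<dots> = face_sum (\<lambda>l'. Poly_Mapping.single (sub_simplex (pair_simplex s t l) l') 1) [0..<Suc (Suc p)]"
    by (rule face_sum_cong, subst sub_simplex_pair_simplex) (use assms in auto)
  also have "\<dots> = rat_boundary (int (Suc p)) (Poly_Mapping.single (pair_simplex s t l) 1)"
    by (simp add: rat_boundary_eq del: upt_Suc of_nat_Suc)
  finally show ?thesis ..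
qed

text \<open>The Leibniz rule is \<open>shuffle_sum_face_sum\<close> applied to simplices along
  lattice paths. The truncated degrees \<open>p - 1\<close> and \<open>q - 1\<close> do no harm, as
  the boundary in degree 0 is zero.\<close>

lemma rat_boundary_eilenberg_zilber:
  "rat_boundary (int (p + q)) (eilenberg_zilber p q c c') =
     eilenberg_zilber (p - 1) q (rat_boundary (int p) c) c'
     + alternate p (eilenberg_zilber p (q - 1) c (rat_boundary (int q) c'))"
proof (cases "p + q")
  case 0
  then show ?thesis by (simp add: rat_boundary_def)
next
  case (Suc n)
  define F where "F = (\<lambda>(s :: (nat \<Rightarrow> real) \<Rightarrow> 'a) (t :: (nat \<Rightarrow> real) \<Rightarrow> 'b) l.
    Poly_Mapping.single (pair_simplex s t l) (1::rat))"
  let ?P = "[0..<Suc p]" and ?Q = "[0..<Suc q]"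
  have 1: "rat_boundary (int (p + q)) (ez_simplex p q s t) =
      face_sum (\<lambda>l. shuffle_sum (F s t) l ?Q) ?P + alternate p (face_sum (\<lambda>l. shuffle_sum (F s t) ?P l) ?Q)"
    for s t
  proof -
    have "rat_boundary (int (p + q)) (ez_simplex p q s t) = shuffle_sum (face_sum (F s t)) ?P ?Q"
      unfolding ez_simplex_def rat_boundary_shuffle_sum F_def Suc
      by (rule shuffle_sum_cong, rule rat_boundary_single_pair_simplex) (use Suc in simp)
    \<comment> \<open>The augmentation term of \<open>shuffle_sum_face_sum\<close> occurs only for p
      = q = 0, which is excluded in this case.\<close>
    also have "\<dots> = face_sum (\<lambda>l. shuffle_sum (F s t) l ?Q) ?P
        + alternate p (face_sum (\<lambda>l. shuffle_sum (F s t) ?P l) ?Q)"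
      unfolding shuffle_sum_face_sum using Suc by (auto simp del: upt_Suc)
    finally show ?thesis .
  qed
  have 2: "eilenberg_zilber (p - 1) q (rat_boundary (int p) c) c' =
      rat_extend (\<lambda>s. rat_extend (\<lambda>t. face_sum (\<lambda>l. shuffle_sum (F s t) l ?Q) ?P) c') c"
  proof (cases p)
    case 0
    then show ?thesis by (simp add: rat_boundary_def)
  next
    case (Suc p')
    have "rat_extend (\<lambda>s'. rat_extend (ez_simplex (p - 1) q s') c')
        (face_sum (\<lambda>l. Poly_Mapping.single (sub_simplex s l) 1) ?P) =
      rat_extend (\<lambda>t. face_sum (\<lambda>l. shuffle_sum (F s t) l ?Q) ?P) c'" for s
    proof -
      have "rat_extend (\<lambda>s'. rat_extend (ez_simplex (p - 1) q s') c')
          (face_sum (\<lambda>l. Poly_Mapping.single (sub_simplex s l) 1) ?P) =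
        rat_extend (\<lambda>t. face_sum (\<lambda>l. ez_simplex (p - 1) q (sub_simplex s l) t) ?P) c'"
        unfolding rat_extend_swap[of _ c'] rat_extend_face_sum by (simp del: upt_Suc)
      also have "\<dots> = rat_extend (\<lambda>t. face_sum (\<lambda>l. shuffle_sum (F s t) l ?Q) ?P) c'"
        unfolding F_def
        by (rule rat_extend_cong, rule face_sum_cong, rule ez_simplex_sub_left) (simp add: Suc)
      finally show ?thesis .
    qed
    then show ?thesis
      unfolding eilenberg_zilber_def' rat_boundary_eq rat_extend_rat_extend
      using Suc by (simp add: rat_extend_rat_extend del: upt_Suc)
  qed
  have 3: "eilenberg_zilber p (q - 1) c (rat_boundary (int q) c') =
      rat_extend (\<lambda>s. rat_extend (\<lambda>t. face_sum (\<lambda>l. shuffle_sum (F s t) ?P l) ?Q) c') c"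
  proof (cases q)
    case 0
    then show ?thesis by (simp add: rat_boundary_def)
  next
    case (Suc q')
    have "rat_extend (ez_simplex p (q - 1) s)
        (face_sum (\<lambda>l. Poly_Mapping.single (sub_simplex t l) 1) ?Q) =
      face_sum (\<lambda>l. shuffle_sum (F s t) ?P l) ?Q" for s t
    proof -
      have "rat_extend (ez_simplex p (q - 1) s)
          (face_sum (\<lambda>l. Poly_Mapping.single (sub_simplex t l) 1) ?Q) =
        face_sum (\<lambda>l. ez_simplex p (q - 1) s (sub_simplex t l)) ?Q"
        unfolding rat_extend_face_sum by (simp del: upt_Suc)
      also have "\<dots> = face_sum (\<lambda>l. shuffle_sum (F s t) ?P l) ?Q"
        unfolding F_def
        by (rule face_sum_cong, rule ez_simplex_sub_right) (simp add: Suc)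
      finally show ?thesis .
    qed
    then show ?thesis
      unfolding eilenberg_zilber_def' rat_boundary_eq
      using Suc by (simp add: rat_extend_rat_extend del: upt_Suc)
  qed
  show ?thesis
    unfolding 2 3 unfolding eilenberg_zilber_def' rat_boundary_rat_extend 1
    by (simp only: rat_extend_fun_add rat_extend_fun_alternate)
qed

lemma simplex_map_pair_simplex:
  assumes "l \<noteq> []" "set l \<subseteq> {..p} \<times> {..q}"
  shows "simplex_map (length l - 1) (map_prod f g) (pair_simplex s t l) =
    pair_simplex (simplex_map p f s) (simplex_map q g t) l"
proof
  fix x
  have "set (map fst l) \<subseteq> {..p}" "set (map snd l) \<subseteq> {..q}"
    using assms by auto
  then show "simplex_map (length l - 1) (map_prod f g) (pair_simplex s t l) x =
    pair_simplex (simplex_map p f s) (simplex_map q g t) l x"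
    using simplex_map_vertex_map[of "map fst l" p x f s] simplex_map_vertex_map[of "map snd l" q x g t] assms(1)
    by (auto simp: simplex_map_def[of "length l - Suc 0"] pair_simplex_def)
qed

lemma rat_chain_map_eilenberg_zilber:
  "rat_chain_map (p + q) (map_prod f g) (eilenberg_zilber p q c c') =
    eilenberg_zilber p q (rat_chain_map p f c) (rat_chain_map q g c')"
proof -
  have "rat_chain_map (p + q) (map_prod f g) (ez_simplex p q s t) =
    ez_simplex p q (simplex_map p f s) (simplex_map q g t)" for s t
    unfolding ez_simplex_def rat_chain_map_shuffle_sum rat_chain_map_single
  proof (rule shuffle_sum_cong)
    fix l assume "l \<noteq> []" "Suc (length l) = length [0..<Suc p] + length [0..<Suc q]"
      "set l \<subseteq> set [0..<Suc p] \<times> set [0..<Suc q]"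
    then have "l \<noteq> []" "set l \<subseteq> {..p} \<times> {..q}" "p + q = length l - 1"
      by auto
    then show "Poly_Mapping.single (simplex_map (p + q) (map_prod f g) (pair_simplex s t l)) 1 =
      Poly_Mapping.single (pair_simplex (simplex_map p f s) (simplex_map q g t) l) (1::rat)"
      using simplex_map_pair_simplex by metis
  qed
  then show ?thesis
    unfolding eilenberg_zilber_def' rat_chain_map_rat_extend
    by (simp add: rat_chain_map_def rat_extend_rat_extend)
qed

lemma rat_chain_map_swap_eilenberg_zilber:
  fixes c :: "'a rat_chain" and c' :: "'b rat_chain"
  shows "rat_chain_map (p + q) prod.swap (eilenberg_zilber p q c c') =
    alternate (p * q) (eilenberg_zilber q p c' c)"
proof -
  have eq: "rat_chain_map (p + q) prod.swap (ez_simplex p q s t) = alternate (p * q) (ez_simplex q p t s)"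
    for s :: "(nat \<Rightarrow> real) \<Rightarrow> 'a" and t :: "(nat \<Rightarrow> real) \<Rightarrow> 'b"
  proof -
    have "rat_chain_map (p + q) prod.swap (ez_simplex p q s t) = alternate (p * q)
        (shuffle_sum (\<lambda>l. Poly_Mapping.single (simplex_map (p + q) prod.swap (pair_simplex s t (map prod.swap l))) 1)
        [0..<Suc q] [0..<Suc p])"
      unfolding ez_simplex_def rat_chain_map_shuffle_sum rat_chain_map_single
      by (subst shuffle_sum_swap) (simp del: upt_Suc)
    also have "shuffle_sum (\<lambda>l. Poly_Mapping.single (simplex_map (p + q) prod.swap (pair_simplex s t (map prod.swap l))) 1)
        [0..<Suc q] [0..<Suc p] = ez_simplex q p t s"
      unfolding ez_simplex_def
    proof (rule shuffle_sum_cong)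
      fix l :: "(nat \<times> nat) list"
      assume "Suc (length l) = length [0..<Suc q] + length [0..<Suc p]"
      then have len: "p + q = length l - 1"
        by simp
      show "Poly_Mapping.single (simplex_map (p + q) prod.swap (pair_simplex s t (map prod.swap l))) 1 =
        Poly_Mapping.single (pair_simplex t s l) (1::rat)"
        unfolding len simplex_map_def pair_simplex_def by (simp add: comp_def restrict_def cong: if_cong)
    qed
    finally show ?thesis .
  qed
  show ?thesis
    unfolding eilenberg_zilber_def' rat_chain_map_rat_extend eq rat_extend_fun_alternate
    by (subst rat_extend_swap) (rule refl)
qed

text \<open>Each side is one of the two iterated sums of \<open>shuffle_sum_assoc\<close>; the
  mapped function only rearranges the brackets of triples.\<close>

lemma eilenberg_zilber_assoc:
  "rat_chain_map (p + q + r) (\<lambda>((x, y), z). (x, y, z)) (eilenberg_zilber (p + q) r (eilenberg_zilber p q a b) c) =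
    eilenberg_zilber p (q + r) a (eilenberg_zilber q r b c)"
proof -
  let ?P = "[0..<Suc p]" and ?Q = "[0..<Suc q]" and ?R = "[0..<Suc r]"
  let ?a = "\<lambda>((x, y), z). (x, y, z)" and ?a' = "\<lambda>(x, y, z). ((x, y), z)"
  have "rat_chain_map (p + q + r) ?a (rat_extend (\<lambda>w. ez_simplex (p + q) r w u) (ez_simplex p q s t)) =
    rat_extend (ez_simplex p (q + r) s) (ez_simplex q r t u)"
    for s :: "(nat \<Rightarrow> real) \<Rightarrow> 'a" and t :: "(nat \<Rightarrow> real) \<Rightarrow> 'b" and u :: "(nat \<Rightarrow> real) \<Rightarrow> 'c"
  proof -
    \<comment> \<open>The simplex of the triple product along a path in the three-dimensional grid.
      \<open>L\<close> and \<open>R\<close> reduce both bracketings to it.\<close>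
    define H where "H = (\<lambda>l. \<lambda>x\<in>standard_simplex (length l - 1).
      (s (vertex_map (map (fst \<circ> fst) l) x), t (vertex_map (map (snd \<circ> fst) l) x), u (vertex_map (map snd l) x)))"
    define F where "F = (\<lambda>l. Poly_Mapping.single (H l) (1::rat))"
    have L: "rat_chain_map (p + q + r) ?a (ez_simplex (p + q) r (pair_simplex s t l) u) = shuffle_sum F l ?R"
      if len: "length l = Suc (p + q)" for l
    proof -
      have l: "l = map ((!) l) [0..<Suc (p + q)]"
        using len map_nth[of l] by simp
      have "shuffle_sum F l ?R = shuffle_sum (\<lambda>l'. F (map (map_prod ((!) l) id) l')) [0..<Suc (p + q)] ?R"
        using shuffle_sum_map[of F "(!) l" "[0..<Suc (p + q)]" id ?R]
        unfolding l[symmetric] list.map_id .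
      also have "\<dots> = rat_chain_map (p + q + r) ?a (ez_simplex (p + q) r (pair_simplex s t l) u)"
        unfolding ez_simplex_def rat_chain_map_shuffle_sum rat_chain_map_single F_def
      proof (rule shuffle_sum_cong, rule arg_cong2[of _ _ _ _ Poly_Mapping.single], rule ext)
        fix l' x assume "l' \<noteq> []" "Suc (length l') = length [0..<Suc (p + q)] + length ?R"
          "set l' \<subseteq> set [0..<Suc (p + q)] \<times> set ?R"
        then have *: "l' \<noteq> []" "set (map fst l') \<subseteq> {..<length l}" "length l' - 1 = p + q + r"
          using len by auto
        then show "H (map (map_prod ((!) l) id) l') x =
            simplex_map (p + q + r) ?a (pair_simplex (pair_simplex s t l) u l') x"
          using pair_simplex_vertex_map[of x "map fst l'" l s t]
          by (cases "x \<in> standard_simplex (p + q + r)")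
            (auto simp: H_def simplex_map_def pair_simplex_def[of _ u] comp_def)
      qed simp
      finally show ?thesis ..
    qed
    have R: "ez_simplex p (q + r) s (pair_simplex t u l) = shuffle_sum (\<lambda>l'. F (map ?a' l')) ?P l"
      if len: "length l = Suc (q + r)" for l
    proof -
      have l: "l = map ((!) l) [0..<Suc (q + r)]"
        using len map_nth[of l] by simp
      have "shuffle_sum (\<lambda>l'. F (map ?a' l')) ?P l =
          shuffle_sum (\<lambda>l'. F (map ?a' (map (map_prod id ((!) l)) l'))) ?P [0..<Suc (q + r)]"
        using shuffle_sum_map[of "\<lambda>l'. F (map ?a' l')" id ?P "(!) l" "[0..<Suc (q + r)]"]
        unfolding l[symmetric] list.map_id .
      also have "\<dots> = ez_simplex p (q + r) s (pair_simplex t u l)"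
        unfolding ez_simplex_def F_def
      proof (rule shuffle_sum_cong, rule arg_cong2[of _ _ _ _ Poly_Mapping.single], rule ext)
        fix l' x assume "l' \<noteq> []" "Suc (length l') = length ?P + length [0..<Suc (q + r)]"
          "set l' \<subseteq> set ?P \<times> set [0..<Suc (q + r)]"
        then have *: "l' \<noteq> []" "set (map snd l') \<subseteq> {..<length l}"
          using len by auto
        then show "H (map ?a' (map (map_prod id ((!) l)) l')) x = pair_simplex s (pair_simplex t u l) l' x"
          using pair_simplex_vertex_map[of x "map snd l'" l t u]
          by (cases "x \<in> standard_simplex (length l' - 1)")
            (auto simp: H_def pair_simplex_def[of s] comp_def case_prod_beta)
      qed simp
      finally show ?thesis ..
    qed
    have "rat_chain_map (p + q + r) ?a (rat_extend (\<lambda>w. ez_simplex (p + q) r w u) (ez_simplex p q s t)) =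
        shuffle_sum (\<lambda>l. rat_chain_map (p + q + r) ?a (ez_simplex (p + q) r (pair_simplex s t l) u)) ?P ?Q"
      unfolding ez_simplex_def[of p q] rat_extend_shuffle_sum rat_chain_map_shuffle_sum
      by (simp del: upt_Suc)
    also have "\<dots> = shuffle_sum (\<lambda>l. shuffle_sum F l ?R) ?P ?Q"
      by (rule shuffle_sum_cong, rule L) simp
    also have "\<dots> = shuffle_sum (\<lambda>l. shuffle_sum (\<lambda>l'. F (map ?a' l')) ?P l) ?Q ?R"
      by (rule shuffle_sum_assoc)
    also have "\<dots> = shuffle_sum (\<lambda>l. ez_simplex p (q + r) s (pair_simplex t u l)) ?Q ?R"
      by (rule shuffle_sum_cong, rule R[symmetric]) simp
    also have "\<dots> = rat_extend (ez_simplex p (q + r) s) (ez_simplex q r t u)"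
      unfolding ez_simplex_def[of q r] rat_extend_shuffle_sum
      by (simp del: upt_Suc)
    finally show ?thesis .
  qed
  then show ?thesis
    unfolding eilenberg_zilber_def' rat_extend_rat_extend
    unfolding rat_extend_swap[of _ c "ez_simplex p q _ _"] rat_chain_map_rat_extend
    by (simp only:)
qed

lemma shuffle_sum_single_left: "V \<noteq> [] \<Longrightarrow> shuffle_sum F [x] V = F (map (Pair x) V)"
  by (induction V arbitrary: F) auto

lemma shuffle_sum_single_right: "U \<noteq> [] \<Longrightarrow> shuffle_sum F U [y] = F (map (\<lambda>x. (x, y)) U)"
  by (induction U arbitrary: F) auto

abbreviation point_chain :: "'a \<Rightarrow> 'a rat_chain" where
  "point_chain u \<equiv> Poly_Mapping.single (\<lambda>x\<in>standard_simplex 0. u) 1"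

text \<open>A grid with a single column has only one lattice path, of sign 1, so the product with a
  point is the inclusion of a slice.\<close>

lemma eilenberg_zilber_point_left:
  "eilenberg_zilber 0 q (point_chain u) c = rat_chain_map q (Pair u) c"
proof -
  have "ez_simplex 0 q (\<lambda>x\<in>standard_simplex 0. u) t = Poly_Mapping.single (simplex_map q (Pair u) t) 1"
    for t :: "(nat \<Rightarrow> real) \<Rightarrow> 'b"
  proof -
    have "pair_simplex (\<lambda>x\<in>standard_simplex 0. u) t (map (Pair 0) [0..<Suc q]) = simplex_map q (Pair u) t"
    proof
      fix x
      have "vertex_map (map (\<lambda>_. 0) [0..<Suc q]) x \<in> standard_simplex 0" if "x \<in> standard_simplex q"
        using that by (intro vertex_map_in) (auto simp del: upt_Suc)
      then show "pair_simplex (\<lambda>x\<in>standard_simplex 0. u) t (map (Pair 0) [0..<Suc q]) x =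
          simplex_map q (Pair u) t x"
        by (auto simp: pair_simplex_def simplex_map_def vertex_map_upt comp_def simp del: upt_Suc replicate_Suc)
    qed
    moreover have "[0..<Suc 0] = [0]"
      by simp
    ultimately show ?thesis
      unfolding ez_simplex_def by (simp add: shuffle_sum_single_left del: upt.upt_Suc)
  qed
  then have "ez_simplex 0 q (\<lambda>x\<in>standard_simplex 0. u) =
      (\<lambda>t :: (nat \<Rightarrow> real) \<Rightarrow> 'b. Poly_Mapping.single (simplex_map q (Pair u) t) 1)"
    by blast
  then show ?thesis
    by (simp add: eilenberg_zilber_def' rat_chain_map_def)
qed

lemma eilenberg_zilber_point_right:
  "eilenberg_zilber p 0 c (point_chain u) = rat_chain_map p (\<lambda>x. (x, u)) c"
proof -
  have "ez_simplex p 0 s (\<lambda>x\<in>standard_simplex 0. u) = Poly_Mapping.single (simplex_map p (\<lambda>x. (x, u)) s) 1"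
    for s :: "(nat \<Rightarrow> real) \<Rightarrow> 'a"
  proof -
    have "pair_simplex s (\<lambda>x\<in>standard_simplex 0. u) (map (\<lambda>k. (k, 0)) [0..<Suc p]) =
        simplex_map p (\<lambda>x. (x, u)) s"
    proof
      fix x
      have "vertex_map (map (\<lambda>_. 0) [0..<Suc p]) x \<in> standard_simplex 0" if "x \<in> standard_simplex p"
        using that by (intro vertex_map_in) (auto simp del: upt_Suc)
      then show "pair_simplex s (\<lambda>x\<in>standard_simplex 0. u) (map (\<lambda>k. (k, 0)) [0..<Suc p]) x =
          simplex_map p (\<lambda>x. (x, u)) s x"
        by (auto simp: pair_simplex_def simplex_map_def vertex_map_upt comp_def simp del: upt_Suc replicate_Suc)
    qed
    moreover have "[0..<Suc 0] = [0]"
      by simp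
    ultimately show ?thesis
      unfolding ez_simplex_def by (simp add: shuffle_sum_single_right del: upt.upt_Suc)
  qed
  then show ?thesis
    by (simp add: eilenberg_zilber_def' rat_chain_map_def)
qed

lemma singular_simplex_pair_simplex:
  assumes "singular_simplex p T s" "singular_simplex q T' t" "l \<noteq> []" "set l \<subseteq> {..p} \<times> {..q}"
  shows "singular_simplex (length l - 1) (prod_topology T T') (pair_simplex s t l)"
proof -
  have sub: "set (map fst l) \<subseteq> {..p}" "set (map snd l) \<subseteq> {..q}"
    using assms(4) by auto
  have 1: "singular_simplex (length l - 1) T (sub_simplex s (map fst l))"
    using singular_simplex_sub_simplex[OF assms(1) sub(1)] assms(3) by simp
  have 2: "singular_simplex (length l - 1) T' (sub_simplex t (map snd l))"
    using singular_simplex_sub_simplex[OF assms(2) sub(2)] assms(3) by simp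
  have "continuous_map (subtopology (powertop_real UNIV) (standard_simplex (length l - 1))) (prod_topology T T')
      (\<lambda>x. (sub_simplex s (map fst l) x, sub_simplex t (map snd l) x))"
    using 1 2 by (auto simp: singular_simplex_def continuous_map_paired)
  then have "continuous_map (subtopology (powertop_real UNIV) (standard_simplex (length l - 1))) (prod_topology T T')
      (pair_simplex s t l)"
    by (rule continuous_map_eq) (auto simp: pair_simplex_def sub_simplex_def)
  then show ?thesis
    by (simp add: singular_simplex_def pair_simplex_def)
qed

lemma eilenberg_zilber_in:
  assumes "c \<in> rat_chains p T" "c' \<in> rat_chains q T'"
  shows "eilenberg_zilber p q c c' \<in> rat_chains (p + q) (prod_topology T T')"
  unfolding eilenberg_zilber_def'
proof (intro rat_chains_rat_extend, unfold ez_simplex_def, rule shuffle_sum_in_rat_chains)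
  fix s t l
  assume "s \<in> Poly_Mapping.keys c" "t \<in> Poly_Mapping.keys c'"
    and l: "l \<noteq> []" "Suc (length l) = length [0..<Suc p] + length [0..<Suc q]"
      "set l \<subseteq> set [0..<Suc p] \<times> set [0..<Suc q]"
  then have st: "singular_simplex p T s" "singular_simplex q T' t"
    using assms by (auto simp: rat_chains_def)
  have "set l \<subseteq> {..p} \<times> {..q}"
    using l(3) by auto
  then have "singular_simplex (length l - 1) (prod_topology T T') (pair_simplex s t l)"
    using singular_simplex_pair_simplex[OF st l(1)] by simp
  moreover have "length l - 1 = p + q"
    using l by simp
  ultimately show "Poly_Mapping.single (pair_simplex s t l) 1 \<in> rat_chains (p + q) (prod_topology T T')"
    by simp
qed

lemma rat_boundary_rat_chain_map:
  "rat_boundary (int p) (rat_chain_map p f c) = rat_chain_map (p - 1) f (rat_boundary (int p) c)"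
proof (cases p)
  case 0
  then show ?thesis by (simp add: rat_boundary_def)
next
  case (Suc p')
  have "face_sum (\<lambda>l. Poly_Mapping.single (sub_simplex (simplex_map p f s) l) 1) [0..<Suc p] =
    rat_chain_map p' f (face_sum (\<lambda>l. Poly_Mapping.single (sub_simplex s l) 1) [0..<Suc p])" for s
  proof -
    have "sub_simplex (simplex_map p f s) l = simplex_map p' f (sub_simplex s l)"
      if "Suc (length l) = length [0..<Suc p]" "set l \<subseteq> set [0..<Suc p]" for l
    proof
      fix x
      have "set l \<subseteq> {..p}" "l \<noteq> []" "length l - 1 = p'"
        using that Suc by auto
      then show "sub_simplex (simplex_map p f s) l x = simplex_map p' f (sub_simplex s l) x"
        using simplex_map_vertex_map[of l p x f s]
        by (auto simp: sub_simplex_def simplex_map_def[of p'])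
    qed
    then show ?thesis
      unfolding rat_chain_map_def rat_extend_face_sum
      by (intro face_sum_cong) simp
  qed
  then show ?thesis
    using Suc by (simp add: rat_boundary_eq rat_chain_map_rat_extend del: upt_Suc of_nat_Suc)
      (simp add: rat_chain_map_def rat_extend_rat_extend del: upt_Suc)
qed

section \<open>The operad of singular chains\<close>

lemma eilenberg_zilber_alternate:
  "eilenberg_zilber p q (alternate n a) c = alternate n (eilenberg_zilber p q a c)"
  "eilenberg_zilber p q a (alternate n c) = alternate n (eilenberg_zilber p q a c)"
  by (simp_all add: alternate_eq_rat_scale eilenberg_zilber_scale)

lemma eilenberg_zilber_map_left:
  assumes "c' \<in> rat_chains q T'"
  shows "eilenberg_zilber p q (rat_chain_map p f c) c' =
    rat_chain_map (p + q) (map_prod f id) (eilenberg_zilber p q c c')"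
  unfolding rat_chain_map_eilenberg_zilber using rat_chain_map_id[OF assms, of id] by simp

lemma eilenberg_zilber_map_right:
  assumes "c \<in> rat_chains p T"
  shows "eilenberg_zilber p q c (rat_chain_map q f c') =
    rat_chain_map (p + q) (map_prod id f) (eilenberg_zilber p q c c')"
  unfolding rat_chain_map_eilenberg_zilber using rat_chain_map_id[OF assms, of id] by simp

text \<open>Reassociate, exchange the last two factors with their Koszul sign, and reassociate back.
  This supplies the sign in the parallel composition axiom.\<close>

lemma eilenberg_zilber_exchange:
  assumes a: "a \<in> rat_chains p A" and b: "b \<in> rat_chains q B" and c: "c \<in> rat_chains r C"
  shows "eilenberg_zilber (p + q) r (eilenberg_zilber p q a b) c =
    alternate (q * r) (rat_chain_map (p + q + r) (\<lambda>((x, z), y). ((x, y), z))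
      (eilenberg_zilber (p + r) q (eilenberg_zilber p r a c) b))" (is "?W = _")
proof -
  let ?W' = "eilenberg_zilber (p + r) q (eilenberg_zilber p r a c) b"
  let ?a' = "\<lambda>(x, y, z). ((x, y), z)"
  have W: "?W \<in> rat_chains (p + q + r) (prod_topology (prod_topology A B) C)"
    by (intro eilenberg_zilber_in assms)
  have "?W = rat_chain_map (p + q + r) ?a' (rat_chain_map (p + q + r) (\<lambda>((x, y), z). (x, y, z)) ?W)"
    unfolding rat_chain_map_rat_chain_map
    by (rule rat_chain_map_id[OF W, symmetric]) auto
  also have "rat_chain_map (p + q + r) (\<lambda>((x, y), z). (x, y, z)) ?W = eilenberg_zilber p (q + r) a (eilenberg_zilber q r b c)"
    by (rule eilenberg_zilber_assoc)
  also have "eilenberg_zilber q r b c =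
      alternate (q * r) (rat_chain_map (q + r) prod.swap (eilenberg_zilber r q c b))"
    using rat_chain_map_swap_eilenberg_zilber[of r q c b] by (simp add: alternate_self mult.commute add.commute)
  also have "eilenberg_zilber p (q + r) a \<dots> = alternate (q * r)
      (rat_chain_map (p + q + r) (map_prod id prod.swap) (eilenberg_zilber p (q + r) a (eilenberg_zilber r q c b)))"
    unfolding eilenberg_zilber_alternate eilenberg_zilber_map_right[OF a] add.assoc ..
  also have "eilenberg_zilber p (q + r) a (eilenberg_zilber r q c b) = rat_chain_map (p + q + r) (\<lambda>((x, y), z). (x, y, z)) ?W'"
    using eilenberg_zilber_assoc[of p r q a c b] by (simp add: ac_simps)
  finally show ?thesis
    unfolding rat_chain_map_alternate rat_chain_map_rat_chain_map
    by (simp add: comp_def case_prod_unfold map_prod_def)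
qed

section \<open>From topological operads to operads of chains\<close>

locale top_ns_operad =
  fixes T :: "'a top_operad"
  assumes tcomp_continuous: "\<lbrakk>1 \<le> i; i \<le> n\<rbrakk> \<Longrightarrow>
      continuous_map (prod_topology (tspace T n) (tspace T m)) (tspace T (n + m - 1))
        (\<lambda>(x, y). tcomp T n m i x y)"
    and tunit_in: "tunit T \<in> topspace (tspace T 1)"
    and tunit_left: "x \<in> topspace (tspace T n) \<Longrightarrow> tcomp T 1 n 1 (tunit T) x = x"
    and tunit_right: "\<lbrakk>1 \<le> i; i \<le> n; x \<in> topspace (tspace T n)\<rbrakk> \<Longrightarrow> tcomp T n 1 i x (tunit T) = x"
    and tcomp_sequential: "\<lbrakk>1 \<le> i; i \<le> n; 1 \<le> j; j \<le> m; x \<in> topspace (tspace T n);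
        y \<in> topspace (tspace T m); z \<in> topspace (tspace T l)\<rbrakk> \<Longrightarrow>
      tcomp T (n + m - 1) l (i + j - 1) (tcomp T n m i x y) z =
        tcomp T n (m + l - 1) i x (tcomp T m l j y z)"
    and tcomp_parallel: "\<lbrakk>1 \<le> i; i < k; k \<le> n; x \<in> topspace (tspace T n);
        y \<in> topspace (tspace T m); z \<in> topspace (tspace T l)\<rbrakk> \<Longrightarrow>
      tcomp T (n + m - 1) l (k + m - 1) (tcomp T n m i x y) z =
        tcomp T (n + l - 1) m i (tcomp T n l k x z) y"

lemma rat_singular_chains_simps [simp]:
  "carrier (rat_singular_chains d U) = (if d < 0 then {0} else rat_chains (nat d) U)"
  "zero (rat_singular_chains d U) = 0"
  "add (rat_singular_chains d U) = (+)"
  "module.smult (rat_singular_chains d U) = rat_scale"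
  by (auto simp: rat_singular_chains_def rat_chains_def)

lemma singular_operad_simps [simp]:
  "obj (singular_operad T) n d = rat_singular_chains d (tspace T n)"
  "bdry (singular_operad T) n d = rat_boundary d"
  "pcomp (singular_operad T) n m i d e c c' =
     rat_chain_map (nat (d + e)) (\<lambda>(x, y). tcomp T n m i x y) (eilenberg_zilber (nat d) (nat e) c c')"
  "opunit (singular_operad T) = point_chain (tunit T)"
  by (simp_all add: singular_operad_def)

lemma module_rat_singular_chains: "Module.module rat_ring (rat_singular_chains d U)"
proof (rule Module.moduleI)
  show "cring rat_ring"
    by (rule cring_from_type_algebra)
  show "abelian_group (rat_singular_chains d U)"
  proof (rule abelian_groupI)
    fix x assume x: "x \<in> carrier (rat_singular_chains d U)"
    show "\<exists>y\<in>carrier (rat_singular_chains d U).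
        y \<oplus>\<^bsub>rat_singular_chains d U\<^esub> x = \<zero>\<^bsub>rat_singular_chains d U\<^esub>"
      using x by (intro bexI[of _ "- x"]) (auto simp: rat_chains_minus)
  qed (auto simp: algebra_simps rat_chains_add)
qed (auto simp: ring_of_type_algebra_def rat_chains_scale rat_scale_add rat_scale_add_left)

lemma rat_chains_tcomp:
  assumes "top_ns_operad T" "1 \<le> i" "i \<le> n"
    and "c \<in> rat_chains p (tspace T n)" "c' \<in> rat_chains q (tspace T m)"
  shows "rat_chain_map (p + q) (\<lambda>(x, y). tcomp T n m i x y) (eilenberg_zilber p q c c')
    \<in> rat_chains (p + q) (tspace T (n + m - 1))"
  by (rule rat_chain_map_in[OF eilenberg_zilber_in[OF assms(4,5)] top_ns_operad.tcomp_continuous[OF assms(1-3)]])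

text \<open>Each axiom combines a property of the Eilenberg-Zilber map (Leibniz rule, unit,
  associativity or exchange) with naturality and the corresponding axiom of \<open>T\<close> on
  points.\<close>

theorem dg_ns_operad_singular_operad:
  assumes "top_ns_operad T"
  shows "dg_ns_operad (singular_operad T)"
proof -
  interpret top_ns_operad T by fact
  let ?P = "singular_operad T"
  let ?t = "\<lambda>n m i (x, y). tcomp T n m i x y"
  \<comment> \<open>Chains in negative degree are zero, so every axiom splits into trivial cases and
    one case with natural degrees.\<close>
  have carrierE: "x = 0 \<or> (\<exists>p. d = int p \<and> x \<in> rat_chains p (tspace T n))"
    if "x \<in> carrier (obj ?P n d)" for x n d
    using that by (cases "d < 0") (auto intro: exI[of _ "nat d"])
  have comp_closed: "pcomp ?P n m i d e x y \<in> carrier (obj ?P (n + m - 1) (d + e))"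
    if "1 \<le> i" "i \<le> n" "x \<in> carrier (obj ?P n d)" "y \<in> carrier (obj ?P m e)" for n m i d e x y
    using carrierE[OF that(3)] carrierE[OF that(4)]
  proof (elim disjE exE conjE)
    fix p q assume "d = int p" "x \<in> rat_chains p (tspace T n)" "e = int q" "y \<in> rat_chains q (tspace T m)"
    then show ?thesis
      using rat_chains_tcomp[OF assms that(1,2)] by (simp add: nat_add_distrib)
  qed auto
  show ?thesis
  proof (rule dg_ns_operad.intro)
    fix n d
    show "Module.module rat_ring (obj ?P n d)"
      by (simp add: module_rat_singular_chains)
    have "rat_boundary d x \<in> carrier (obj ?P n (d - 1))" if "x \<in> carrier (obj ?P n d)" for x
    proof (cases "d \<le> 0")
      case True
      then show ?thesis by (simp add: rat_boundary_def)
    next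
      case False
      then obtain p where "d = int (Suc p)"
        by (metis int_nat_eq not_le_imp_less zero_less_imp_eq_int not0_implies_Suc of_nat_0 less_irrefl)
      then show ?thesis
        using that rat_boundary_in[of x p] by (simp add: nat_add_distrib del: of_nat_Suc) (simp add: nat_add_distrib)
    qed
    then show "rat_linear (obj ?P n d) (obj ?P n (d - 1)) (bdry ?P n d)"
      unfolding rat_linear_def by (auto simp: rat_boundary_add rat_boundary_scale simp del: rat_singular_chains_simps(1))
  next
    fix x n d assume "x \<in> carrier (obj ?P n d)"
    show "bdry ?P n (d - 1) (bdry ?P n d x) = \<zero>\<^bsub>obj ?P n (d - 2)\<^esub>"
    proof (cases "d \<le> 0")
      case True
      then show ?thesis by (simp add: rat_boundary_def)
    next
      case False
      then have "d = int (Suc (nat (d - 1)))" "d - 1 = int (nat (d - 1))"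
        by auto
      then show ?thesis
        using rat_boundary_rat_boundary[of "nat (d - 1)" x] by simp
    qed
  next
    fix i n m :: nat and e d y assume i: "1 \<le> i" "i \<le> n" and y: "y \<in> carrier (obj ?P m e)"
    show "rat_linear (obj ?P n d) (obj ?P (n + m - 1) (d + e)) (\<lambda>x. pcomp ?P n m i d e x y)"
      unfolding rat_linear_def using comp_closed[OF i _ y]
      by (auto simp: eilenberg_zilber_add eilenberg_zilber_scale rat_chain_map_add rat_chain_map_scale
          simp del: rat_singular_chains_simps(1))
  next
    fix i n m :: nat and e d x assume i: "1 \<le> i" "i \<le> n" and x: "x \<in> carrier (obj ?P n d)"
    show "rat_linear (obj ?P m e) (obj ?P (n + m - 1) (d + e)) (pcomp ?P n m i d e x)"
      unfolding rat_linear_def using comp_closed[OF i x]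
      by (auto simp: eilenberg_zilber_add eilenberg_zilber_scale rat_chain_map_add rat_chain_map_scale
          simp del: rat_singular_chains_simps(1))
  next
    fix i n m d e x y
    assume i: "1 \<le> i" "i \<le> n" and x: "x \<in> carrier (obj ?P n d)" and y: "y \<in> carrier (obj ?P m e)"
    show "bdry ?P (n + m - 1) (d + e) (pcomp ?P n m i d e x y) =
        pcomp ?P n m i (d - 1) e (bdry ?P n d x) y
        \<oplus>\<^bsub>obj ?P (n + m - 1) (d + e - 1)\<^esub>
        koszul_sign d \<odot>\<^bsub>obj ?P (n + m - 1) (d + e - 1)\<^esub> pcomp ?P n m i d (e - 1) x (bdry ?P m e y)"
      using carrierE[OF x] carrierE[OF y]
    proof (elim disjE exE conjE)
      fix p q assume d: "d = int p" and e: "e = int q"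
      \<comment> \<open>In degree 0 the integer degree -1 and the truncated \<open>p - 1\<close>
        disagree after \<open>nat\<close>, but the boundary is zero there. The next fact is the same
        for \<open>y\<close>.\<close>
      have "rat_boundary (int p) x = 0 \<or> nat (int p - 1 + int q) = p + q - 1 \<and> nat (int p - 1) = p - 1"
        by (cases p) (auto simp: rat_boundary_def)
      moreover have "rat_boundary (int q) y = 0 \<or> nat (int p + (int q - 1)) = p + q - 1 \<and> nat (int q - 1) = q - 1"
        by (cases q) (auto simp: rat_boundary_def)
      moreover have "koszul_sign (int p) = (-1) ^ p"
        by (simp add: koszul_sign_def)
      ultimately show ?thesis
        unfolding d e singular_operad_simps rat_singular_chains_simps of_nat_add[symmetric] nat_int
          rat_boundary_rat_chain_map rat_boundary_eilenberg_zilber rat_chain_map_add rat_chain_map_alternate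
        by (auto simp: alternate_eq_rat_scale)
    qed auto
  next
    show "opunit ?P \<in> carrier (obj ?P 1 0)"
      using tunit_in by (simp add: singular_simplex_def)
    show "bdry ?P 1 0 (opunit ?P) = \<zero>\<^bsub>obj ?P 1 (- 1)\<^esub>"
      by (simp add: rat_boundary_def)
  next
    fix x n d assume x: "x \<in> carrier (obj ?P n d)"
    show "pcomp ?P 1 n 1 0 d (opunit ?P) x = x"
      using carrierE[OF x]
    proof (elim disjE exE conjE)
      fix p assume "d = int p" and x: "x \<in> rat_chains p (tspace T n)"
      then show ?thesis
        using rat_chain_map_id[OF x, of "?t 1 n 1 \<circ> Pair (tunit T)"]
        by (simp add: eilenberg_zilber_point_left rat_chain_map_rat_chain_map tunit_left[simplified])
    qed auto
  next
    fix i n x d assume i: "1 \<le> i" "i \<le> n" and x: "x \<in> carrier (obj ?P n d)"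
    show "pcomp ?P n 1 i d 0 x (opunit ?P) = x"
      using carrierE[OF x]
    proof (elim disjE exE conjE)
      fix p assume "d = int p" and x: "x \<in> rat_chains p (tspace T n)"
      then show ?thesis
        using rat_chain_map_id[OF x, of "?t n 1 i \<circ> (\<lambda>x. (x, tunit T))"] i
        by (simp add: eilenberg_zilber_point_right rat_chain_map_rat_chain_map tunit_right[simplified])
    qed auto
  next
    fix i n j m x d y e z l f
    assume ij: "1 \<le> i" "i \<le> n" "1 \<le> j" "j \<le> m" and x: "x \<in> carrier (obj ?P n d)"
      and y: "y \<in> carrier (obj ?P m e)" and z: "z \<in> carrier (obj ?P l f)"
    show "pcomp ?P (n + m - 1) l (i + j - 1) (d + e) f (pcomp ?P n m i d e x y) z =
        pcomp ?P n (m + l - 1) i d (e + f) x (pcomp ?P m l j e f y z)"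
      using carrierE[OF x] carrierE[OF y] carrierE[OF z]
    proof (elim disjE exE conjE)
      fix p q r assume d: "d = int p" "e = int q" "f = int r" and x: "x \<in> rat_chains p (tspace T n)"
        and y: "y \<in> rat_chains q (tspace T m)" and z: "z \<in> rat_chains r (tspace T l)"
      have W: "eilenberg_zilber (p + q) r (eilenberg_zilber p q x y) z
          \<in> rat_chains (p + q + r) (prod_topology (prod_topology (tspace T n) (tspace T m)) (tspace T l))"
        by (intro eilenberg_zilber_in x y z)
      show ?thesis
        unfolding d singular_operad_simps of_nat_add[symmetric] nat_int
          eilenberg_zilber_map_left[OF z] eilenberg_zilber_map_right[OF x]
          eilenberg_zilber_assoc[symmetric] rat_chain_map_rat_chain_map add.assoc[symmetric]
        by (rule rat_chain_map_cong[OF W]) (use ij tcomp_sequential in auto)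
    qed auto
  next
    fix i k n x d y m e z l f
    assume ik: "1 \<le> i" "i < k" "k \<le> n" and x: "x \<in> carrier (obj ?P n d)"
      and y: "y \<in> carrier (obj ?P m e)" and z: "z \<in> carrier (obj ?P l f)"
    show "pcomp ?P (n + m - 1) l (k + m - 1) (d + e) f (pcomp ?P n m i d e x y) z =
        koszul_sign (e * f) \<odot>\<^bsub>obj ?P (n + m + l - 2) (d + e + f)\<^esub>
        pcomp ?P (n + l - 1) m i (d + f) e (pcomp ?P n l k d f x z) y"
      using carrierE[OF x] carrierE[OF y] carrierE[OF z]
    proof (elim disjE exE conjE)
      fix p q r assume d: "d = int p" "e = int q" "f = int r" and x: "x \<in> rat_chains p (tspace T n)"
        and y: "y \<in> rat_chains q (tspace T m)" and z: "z \<in> rat_chains r (tspace T l)"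
      have W: "eilenberg_zilber (p + r) q (eilenberg_zilber p r x z) y
          \<in> rat_chains (p + r + q) (prod_topology (prod_topology (tspace T n) (tspace T l)) (tspace T m))"
        by (intro eilenberg_zilber_in x y z)
      have sgn: "koszul_sign (int q * int r) = (-1) ^ (q * r)"
        by (simp add: koszul_sign_def)
      have pqr: "p + r + q = p + q + r"
        by simp
      show ?thesis
        unfolding d singular_operad_simps rat_singular_chains_simps of_nat_add[symmetric] nat_int
          eilenberg_zilber_map_left[OF z] eilenberg_zilber_map_left[OF y]
          eilenberg_zilber_exchange[OF x y z] rat_chain_map_scale rat_chain_map_rat_chain_map
          sgn alternate_eq_rat_scale pqr
        by (rule arg_cong[of _ _ "rat_scale _"], rule rat_chain_map_cong[OF W[unfolded pqr]])
          (use ik tcomp_parallel in auto)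
    qed auto
  qed
qed

section \<open>The homology operad\<close>

lemma rat_ring_simps [simp]:
  "carrier rat_ring = UNIV" "x \<otimes>\<^bsub>rat_ring\<^esub> y = x * y" "x \<oplus>\<^bsub>rat_ring\<^esub> y = x + y"
  "\<one>\<^bsub>rat_ring\<^esub> = 1" "\<zero>\<^bsub>rat_ring\<^esub> = 0"
  by (simp_all add: ring_of_type_algebra_def)

lemma rat_linearD:
  assumes "rat_linear M N f"
  shows "x \<in> carrier M \<Longrightarrow> f x \<in> carrier N"
    and "x \<in> carrier M \<Longrightarrow> y \<in> carrier M \<Longrightarrow> f (x \<oplus>\<^bsub>M\<^esub> y) = f x \<oplus>\<^bsub>N\<^esub> f y"
    and "x \<in> carrier M \<Longrightarrow> f (r \<odot>\<^bsub>M\<^esub> x) = r \<odot>\<^bsub>N\<^esub> f x"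
  using assms unfolding rat_linear_def by blast+

lemma rat_linear_zero:
  assumes "rat_linear M N f" "Module.module rat_ring M" "Module.module rat_ring N"
  shows "f \<zero>\<^bsub>M\<^esub> = \<zero>\<^bsub>N\<^esub>"
proof -
  interpret M: Module.module rat_ring M by fact
  interpret N: Module.module rat_ring N by fact
  have "f \<zero>\<^bsub>M\<^esub> = f ((0::rat) \<odot>\<^bsub>M\<^esub> \<zero>\<^bsub>M\<^esub>)"
    using M.smult_l_null[of "\<zero>\<^bsub>M\<^esub>"] by simp
  also have "\<dots> = (0::rat) \<odot>\<^bsub>N\<^esub> f \<zero>\<^bsub>M\<^esub>"
    by (rule rat_linearD(3)[OF assms(1) M.zero_closed])
  also have "\<dots> = \<zero>\<^bsub>N\<^esub>"
    using N.smult_l_null[of "f \<zero>\<^bsub>M\<^esub>"] rat_linearD[OF assms(1)] by simp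
  finally show ?thesis .
qed

context dg_ns_operad
begin

sublocale ob: Module.module rat_ring "obj P n d" for n d
  by (rule obj_module)

lemma smult_closed [simp]: "x \<in> carrier (obj P n d) \<Longrightarrow> r \<odot>\<^bsub>obj P n d\<^esub> x \<in> carrier (obj P n d)"
  using ob.smult_closed by simp

lemmas bdry_closed [simp] = rat_linearD(1)[OF bdry_linear]
lemmas bdry_add = rat_linearD(2)[OF bdry_linear]
lemmas bdry_smult = rat_linearD(3)[OF bdry_linear]
lemmas bdry_zero [simp] = rat_linear_zero[OF bdry_linear obj_module obj_module]
lemmas pcomp_closed = rat_linearD(1)[OF pcomp_linear_right]
lemmas pcomp_add_right = rat_linearD(2)[OF pcomp_linear_right]
lemmas pcomp_smult_right = rat_linearD(3)[OF pcomp_linear_right]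
lemmas pcomp_zero_right = rat_linear_zero[OF pcomp_linear_right obj_module obj_module]
lemmas pcomp_add_left = rat_linearD(2)[OF pcomp_linear_left]
lemmas pcomp_smult_left = rat_linearD(3)[OF pcomp_linear_left]
lemmas pcomp_zero_left = rat_linear_zero[OF pcomp_linear_left obj_module obj_module]

lemma cyclesI:
  "\<lbrakk>x \<in> carrier (obj P n d); bdry P n d x = \<zero>\<^bsub>obj P n (d - 1)\<^esub>\<rbrakk> \<Longrightarrow> x \<in> cycles P n d"
  by (simp add: cycles_def)

lemma cycles_carrier: "x \<in> cycles P n d \<Longrightarrow> x \<in> carrier (obj P n d)"
  and cycles_bdry: "x \<in> cycles P n d \<Longrightarrow> bdry P n d x = \<zero>\<^bsub>obj P n (d - 1)\<^esub>"
  by (simp_all add: cycles_def)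

declare cycles_carrier [simp] cycles_bdry [simp]

lemma cycles_zero [simp]: "\<zero>\<^bsub>obj P n d\<^esub> \<in> cycles P n d"
  by (rule cyclesI) simp_all

lemma cycles_add [simp]:
  "\<lbrakk>x \<in> cycles P n d; y \<in> cycles P n d\<rbrakk> \<Longrightarrow> x \<oplus>\<^bsub>obj P n d\<^esub> y \<in> cycles P n d"
  by (rule cyclesI) (simp_all add: bdry_add)

lemma cycles_smult [simp]: "x \<in> cycles P n d \<Longrightarrow> r \<odot>\<^bsub>obj P n d\<^esub> x \<in> cycles P n d"
  using ob.smult_r_null by (intro cyclesI) (simp_all add: bdry_smult)

lemma boundaries_carrier: "x \<in> boundaries P n d \<Longrightarrow> x \<in> carrier (obj P n d)"
  unfolding boundaries_def using bdry_closed[of _ n "d + 1"] by fastforce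

lemma boundaries_cycles: "x \<in> boundaries P n d \<Longrightarrow> x \<in> cycles P n d"
  unfolding boundaries_def
  using bdry_closed[of _ n "d + 1"] bdry_bdry[of _ n "d + 1"] by (force intro: cyclesI)

lemma boundaries_smult [simp]: "x \<in> boundaries P n d \<Longrightarrow> r \<odot>\<^bsub>obj P n d\<^esub> x \<in> boundaries P n d"
proof -
  assume "x \<in> boundaries P n d"
  then obtain a where a: "a \<in> carrier (obj P n (d + 1))" "x = bdry P n (d + 1) a"
    unfolding boundaries_def by blast
  show ?thesis
    unfolding boundaries_def
  proof (rule image_eqI)
    show "r \<odot>\<^bsub>obj P n d\<^esub> x = bdry P n (d + 1) (r \<odot>\<^bsub>obj P n (d + 1)\<^esub> a)"
      using bdry_smult[OF a(1), of r] unfolding a(2) by simp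
    show "r \<odot>\<^bsub>obj P n (d + 1)\<^esub> a \<in> carrier (obj P n (d + 1))"
      using a(1) by (rule smult_closed)
  qed
qed

lemma boundaries_add [simp]:
  "\<lbrakk>x \<in> boundaries P n d; y \<in> boundaries P n d\<rbrakk> \<Longrightarrow> x \<oplus>\<^bsub>obj P n d\<^esub> y \<in> boundaries P n d"
proof -
  assume "x \<in> boundaries P n d" "y \<in> boundaries P n d"
  then obtain a b where a: "a \<in> carrier (obj P n (d + 1))" "x = bdry P n (d + 1) a"
    and b: "b \<in> carrier (obj P n (d + 1))" "y = bdry P n (d + 1) b"
    unfolding boundaries_def by blast
  show ?thesis
    unfolding boundaries_def
  proof (rule image_eqI)
    show "x \<oplus>\<^bsub>obj P n d\<^esub> y = bdry P n (d + 1) (a \<oplus>\<^bsub>obj P n (d + 1)\<^esub> b)"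
      using bdry_add[OF a(1) b(1)] unfolding a(2) b(2) by simp
    show "a \<oplus>\<^bsub>obj P n (d + 1)\<^esub> b \<in> carrier (obj P n (d + 1))"
      using a(1) b(1) by (rule ob.a_closed)
  qed
qed

lemma boundaries_zero [simp]: "\<zero>\<^bsub>obj P n d\<^esub> \<in> boundaries P n d"
  unfolding boundaries_def using bdry_zero[of n "d + 1"] ob.zero_closed
  by (metis add_diff_cancel_right' image_eqI)

declare boundaries_carrier [simp] boundaries_cycles [simp]

lemma minus_eq_smult:
  assumes "x \<in> carrier (obj P n d)"
  shows "\<ominus>\<^bsub>obj P n d\<^esub> x = (- 1 :: rat) \<odot>\<^bsub>obj P n d\<^esub> x"
proof -
  have "(- 1 :: rat) \<odot>\<^bsub>obj P n d\<^esub> x \<oplus>\<^bsub>obj P n d\<^esub> x =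
      ((- 1) + 1 :: rat) \<odot>\<^bsub>obj P n d\<^esub> x"
    using ob.smult_l_distr[of "- 1" 1 x n d] ob.smult_one[of x n d] assms by simp
  also have "\<dots> = \<zero>\<^bsub>obj P n d\<^esub>"
    using ob.smult_l_null[OF assms] by simp
  finally show ?thesis
    using assms by (simp add: ob.minus_equality)
qed

lemma boundaries_subgroup: "additive_subgroup (boundaries P n d) (obj P n d)"
proof (rule additive_subgroupI, rule subgroup.intro)
  show "boundaries P n d \<subseteq> carrier (add_monoid (obj P n d))"
    by auto
  fix x y
  show "\<lbrakk>x \<in> boundaries P n d; y \<in> boundaries P n d\<rbrakk> \<Longrightarrow>
      x \<otimes>\<^bsub>add_monoid (obj P n d)\<^esub> y \<in> boundaries P n d"
    by simp
  show "\<one>\<^bsub>add_monoid (obj P n d)\<^esub> \<in> boundaries P n d"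
    by simp
  show "x \<in> boundaries P n d \<Longrightarrow> inv\<^bsub>add_monoid (obj P n d)\<^esub> x \<in> boundaries P n d"
    using minus_eq_smult[of x n d] by (simp add: a_inv_def)
qed

sublocale bd: abelian_subgroup "boundaries P n d" "obj P n d" for n d
  by (rule abelian_subgroupI3[OF boundaries_subgroup ob.abelian_group_axioms])

lemma homology_class_iff:
  "x' \<in> homology_class P n d x \<longleftrightarrow> (\<exists>b\<in>boundaries P n d. x' = b \<oplus>\<^bsub>obj P n d\<^esub> x)"
  unfolding homology_class_def a_r_coset_def' by blast

lemma homology_class_self: "x \<in> carrier (obj P n d) \<Longrightarrow> x \<in> homology_class P n d x"
  unfolding homology_class_def by (rule bd.a_rcos_self)

lemma homology_class_add_boundary:
  assumes "b \<in> boundaries P n d" "x \<in> carrier (obj P n d)"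
  shows "homology_class P n d (b \<oplus>\<^bsub>obj P n d\<^esub> x) = homology_class P n d x"
proof -
  have "b \<oplus>\<^bsub>obj P n d\<^esub> x \<in> boundaries P n d +>\<^bsub>obj P n d\<^esub> x"
    using homology_class_iff assms unfolding homology_class_def by blast
  then show ?thesis
    unfolding homology_class_def using ob.a_repr_independence[OF _ assms(2) bd.a_subgroup] by simp
qed

lemma homology_class_boundary: "b \<in> boundaries P n d \<Longrightarrow> homology_class P n d b = boundaries P n d"
  unfolding homology_class_def
  by (rule ob.a_coset_join2[OF _ bd.a_subgroup]) simp_all

lemma homology_class_zero: "homology_class P n d \<zero>\<^bsub>obj P n d\<^esub> = boundaries P n d"
  by (simp add: homology_class_boundary)

lemma homology_class_cycle:
  assumes "x \<in> cycles P n d" "x' \<in> homology_class P n d x"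
  shows "x' \<in> cycles P n d" "homology_class P n d x' = homology_class P n d x"
  using assms homology_class_add_boundary by (auto simp: homology_class_iff)

text \<open>The operations on homology are unions over representatives; this collapses such a union
  once the family is known to be constant on the coset.\<close>

lemma UN_homology_class:
  assumes "x \<in> carrier (obj P n d)"
    and "\<And>b. b \<in> boundaries P n d \<Longrightarrow> F (b \<oplus>\<^bsub>obj P n d\<^esub> x) = F x"
  shows "(\<Union>x'\<in>homology_class P n d x. F x') = F x"
proof (rule UN_constant_eq[OF homology_class_self[OF assms(1)]], rule ballI)
  fix x' assume "x' \<in> homology_class P n d x"
  then obtain b where "b \<in> boundaries P n d" "x' = b \<oplus>\<^bsub>obj P n d\<^esub> x"
    unfolding homology_class_iff by blast
  then show "F x' = F x"
    using assms(2) by simp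
qed

lemma cycle_pcomp:
  assumes "1 \<le> i" "i \<le> n" "x \<in> cycles P n d" "y \<in> cycles P m e"
  shows "pcomp P n m i d e x y \<in> cycles P (n + m - 1) (d + e)"
proof -
  have "bdry P (n + m - 1) (d + e) (pcomp P n m i d e x y) =
      pcomp P n m i (d - 1) e \<zero>\<^bsub>obj P n (d - 1)\<^esub> y \<oplus>\<^bsub>obj P (n + m - 1) (d + e - 1)\<^esub>
      koszul_sign d \<odot>\<^bsub>obj P (n + m - 1) (d + e - 1)\<^esub> pcomp P n m i d (e - 1) x \<zero>\<^bsub>obj P m (e - 1)\<^esub>"
    using bdry_pcomp[of i n x d y m e] assms by simp
  also have "pcomp P n m i (d - 1) e \<zero>\<^bsub>obj P n (d - 1)\<^esub> y = \<zero>\<^bsub>obj P (n + m - 1) (d - 1 + e)\<^esub>"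
    using pcomp_zero_left[of i n y m e "d - 1"] assms by simp
  also have "d - 1 + e = d + e - 1"
    by simp
  also have "pcomp P n m i d (e - 1) x \<zero>\<^bsub>obj P m (e - 1)\<^esub> = \<zero>\<^bsub>obj P (n + m - 1) (d + (e - 1))\<^esub>"
    using pcomp_zero_right[of i n x d m "e - 1"] assms by simp
  also have "d + (e - 1) = d + e - 1"
    by simp
  finally show ?thesis
    using assms pcomp_closed[of i n x d y m e] ob.smult_r_null by (intro cyclesI) simp_all
qed

text \<open>With \<open>x\<close> the boundary of \<open>a\<close>, the composite is the boundary of
  \<open>a\<close> composed with \<open>y\<close>; the second Leibniz term vanishes because
  \<open>y\<close> is a cycle.\<close>

lemma boundary_pcomp_left:
  assumes "1 \<le> i" "i \<le> n" "x \<in> boundaries P n d" "y \<in> cycles P m e"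
  shows "pcomp P n m i d e x y \<in> boundaries P (n + m - 1) (d + e)"
proof -
  obtain a where a: "a \<in> carrier (obj P n (d + 1))" "x = bdry P n (d + 1) a"
    using assms unfolding boundaries_def by blast
  let ?N = "obj P (n + m - 1) (d + e)"
  have deg: "d + 1 + e = d + e + 1" "d + 1 + (e - 1) = d + e"
    by simp_all
  have "pcomp P n m i (d + 1) (e - 1) a \<zero>\<^bsub>obj P m (e - 1)\<^esub> = \<zero>\<^bsub>?N\<^esub>"
    using pcomp_zero_right[of i n a "d + 1" m "e - 1"] assms a unfolding deg by simp
  then have "bdry P (n + m - 1) (d + e + 1) (pcomp P n m i (d + 1) e a y) = pcomp P n m i d e x y"
    using bdry_pcomp[of i n a "d + 1" y m e] assms a pcomp_closed[of i n x d y m e] ob.smult_r_null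
    unfolding deg by simp
  then show ?thesis
    using pcomp_closed[of i n a "d + 1" y m e] a assms
    unfolding boundaries_def deg by (metis cycles_carrier imageI)
qed

lemma boundary_pcomp_right:
  assumes "1 \<le> i" "i \<le> n" "x \<in> cycles P n d" "y \<in> boundaries P m e"
  shows "pcomp P n m i d e x y \<in> boundaries P (n + m - 1) (d + e)"
proof -
  obtain a where a: "a \<in> carrier (obj P m (e + 1))" "y = bdry P m (e + 1) a"
    using assms unfolding boundaries_def by blast
  let ?N = "obj P (n + m - 1) (d + e)"
  have deg: "d + (e + 1) = d + e + 1" "d - 1 + (e + 1) = d + e"
    by simp_all
  have cl: "pcomp P n m i d e x y \<in> carrier ?N"
    using assms pcomp_closed[of i n x d y m e] by simp
  have "pcomp P n m i (d - 1) (e + 1) \<zero>\<^bsub>obj P n (d - 1)\<^esub> a = \<zero>\<^bsub>?N\<^esub>"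
    using pcomp_zero_left[of i n a m "e + 1" "d - 1"] assms a unfolding deg by simp
  then have "bdry P (n + m - 1) (d + e + 1) (pcomp P n m i d (e + 1) x a) =
      koszul_sign d \<odot>\<^bsub>?N\<^esub> pcomp P n m i d e x y"
    using bdry_pcomp[of i n x d a m "e + 1"] assms a cl
    unfolding deg by simp
  then have "koszul_sign d \<odot>\<^bsub>?N\<^esub> pcomp P n m i d e x y \<in> boundaries P (n + m - 1) (d + e)"
    using pcomp_closed[of i n x d a m "e + 1"] a assms
    unfolding boundaries_def deg by (metis cycles_carrier imageI)
  \<comment> \<open>The Leibniz rule only gives the composite up to a sign; multiplying once more by
    that sign, whose square is 1, removes it.\<close>
  then have "koszul_sign d \<odot>\<^bsub>?N\<^esub> (koszul_sign d \<odot>\<^bsub>?N\<^esub> pcomp P n m i d e x y)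
      \<in> boundaries P (n + m - 1) (d + e)"
    by (rule boundaries_smult)
  moreover have "koszul_sign d \<odot>\<^bsub>?N\<^esub> (koszul_sign d \<odot>\<^bsub>?N\<^esub> pcomp P n m i d e x y) =
      pcomp P n m i d e x y"
  proof -
    have "koszul_sign d * koszul_sign d = 1"
      by (simp add: koszul_sign_def)
    then show ?thesis
      using ob.smult_assoc1[OF _ _ cl, of "koszul_sign d" "koszul_sign d"] ob.smult_one[OF cl] by simp
  qed
  ultimately show ?thesis by simp
qed

abbreviation H where "H \<equiv> homology_operad P"

lemma homology_carrier: "carrier (obj H n d) = homology_class P n d ` cycles P n d"
  by (simp add: homology_operad_def)

lemma homology_zero: "\<zero>\<^bsub>obj H n d\<^esub> = boundaries P n d"
  by (simp add: homology_operad_def)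

lemma homology_bdry: "bdry H n d U = boundaries P n (d - 1)"
  by (simp add: homology_operad_def)

lemma homology_opunit: "opunit H = homology_class P 1 0 (opunit P)"
  by (simp add: homology_operad_def)

lemma homology_add:
  "\<lbrakk>x \<in> cycles P n d; y \<in> cycles P n d\<rbrakk> \<Longrightarrow>
    homology_class P n d x \<oplus>\<^bsub>obj H n d\<^esub> homology_class P n d y =
    homology_class P n d (x \<oplus>\<^bsub>obj P n d\<^esub> y)"
  by (simp add: homology_operad_def homology_class_def bd.a_rcos_sum)

lemma homology_smult:
  assumes "x \<in> cycles P n d"
  shows "r \<odot>\<^bsub>obj H n d\<^esub> homology_class P n d x = homology_class P n d (r \<odot>\<^bsub>obj P n d\<^esub> x)"
proof -
  have "(\<Union>x'\<in>homology_class P n d x. homology_class P n d (r \<odot>\<^bsub>obj P n d\<^esub> x')) =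
      homology_class P n d (r \<odot>\<^bsub>obj P n d\<^esub> x)"
    using assms ob.smult_r_distr by (intro UN_homology_class) (auto simp: homology_class_add_boundary)
  then show ?thesis
    by (simp add: homology_operad_def)
qed

text \<open>Independence of representatives is checked one argument at a time: first in
  \<open>y\<close> for every cycle \<open>x'\<close> in the class of \<open>x\<close>, then in
  \<open>x\<close>.\<close>

lemma homology_pcomp:
  assumes "1 \<le> i" "i \<le> n" and x: "x \<in> cycles P n d" and y: "y \<in> cycles P m e"
  shows "pcomp H n m i d e (homology_class P n d x) (homology_class P m e y) =
    homology_class P (n + m - 1) (d + e) (pcomp P n m i d e x y)"
proof -
  let ?F = "\<lambda>x y. homology_class P (n + m - 1) (d + e) (pcomp P n m i d e x y)"
  have "(\<Union>y'\<in>homology_class P m e y. ?F x' y') = ?F x' y" if x': "x' \<in> cycles P n d" for x'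
  proof (rule UN_homology_class)
    fix b assume b: "b \<in> boundaries P m e"
    have "pcomp P n m i d e x' (b \<oplus>\<^bsub>obj P m e\<^esub> y) =
        pcomp P n m i d e x' b \<oplus>\<^bsub>obj P (n + m - 1) (d + e)\<^esub> pcomp P n m i d e x' y"
      using pcomp_add_right[of i n x' d b m e y] assms x' b by simp
    then show "?F x' (b \<oplus>\<^bsub>obj P m e\<^esub> y) = ?F x' y"
      using boundary_pcomp_right[of i n x' d b m e] pcomp_closed[of i n x' d y m e] assms x' b
      by (simp add: homology_class_add_boundary)
  qed (use y in simp)
  then have "(\<Union>x'\<in>homology_class P n d x. \<Union>y'\<in>homology_class P m e y. ?F x' y') =
      (\<Union>x'\<in>homology_class P n d x. ?F x' y)"
    using homology_class_cycle(1)[OF x] by simp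
  also have "\<dots> = ?F x y"
  proof (rule UN_homology_class)
    fix b assume b: "b \<in> boundaries P n d"
    have "pcomp P n m i d e (b \<oplus>\<^bsub>obj P n d\<^esub> x) y =
        pcomp P n m i d e b y \<oplus>\<^bsub>obj P (n + m - 1) (d + e)\<^esub> pcomp P n m i d e x y"
      using pcomp_add_left[of i n y m e b d x] assms b by simp
    then show "?F (b \<oplus>\<^bsub>obj P n d\<^esub> x) y = ?F x y"
      using boundary_pcomp_left[of i n b d y m e] pcomp_closed[of i n x d y m e] assms b
      by (simp add: homology_class_add_boundary)
  qed (use x in simp)
  finally show ?thesis
    by (simp add: homology_operad_def)
qed

lemma homology_carrierE:
  assumes "U \<in> carrier (obj H n d)"
  obtains x where "x \<in> cycles P n d" "U = homology_class P n d x"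
  using assms by (auto simp: homology_carrier)

lemma homology_carrierI: "x \<in> cycles P n d \<Longrightarrow> homology_class P n d x \<in> carrier (obj H n d)"
  by (auto simp: homology_carrier)

lemma opunit_cycle: "opunit P \<in> cycles P 1 0"
  using opunit_closed bdry_opunit by (intro cyclesI) simp_all

lemma homology_module: "Module.module rat_ring (obj H n d)"
proof (rule Module.moduleI)
  show "cring rat_ring"
    by (rule cring_from_type_algebra)
  have zero: "\<zero>\<^bsub>obj H n d\<^esub> = homology_class P n d \<zero>\<^bsub>obj P n d\<^esub>"
    by (simp add: homology_zero homology_class_zero)
  show "abelian_group (obj H n d)"
  proof (rule abelian_groupI)
    show "\<zero>\<^bsub>obj H n d\<^esub> \<in> carrier (obj H n d)"
      unfolding zero by (rule homology_carrierI) simp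
  next
    fix U assume "U \<in> carrier (obj H n d)"
    then obtain x where x: "x \<in> cycles P n d" "U = homology_class P n d x"
      by (rule homology_carrierE)
    show "\<zero>\<^bsub>obj H n d\<^esub> \<oplus>\<^bsub>obj H n d\<^esub> U = U"
      using x by (simp add: zero homology_add)
    have "\<ominus>\<^bsub>obj P n d\<^esub> x \<in> cycles P n d"
      using x by (simp add: minus_eq_smult)
    then show "\<exists>V\<in>carrier (obj H n d). V \<oplus>\<^bsub>obj H n d\<^esub> U = \<zero>\<^bsub>obj H n d\<^esub>"
      using x by (intro bexI[of _ "homology_class P n d (\<ominus>\<^bsub>obj P n d\<^esub> x)"])
        (auto simp: zero homology_add homology_carrierI ob.l_neg)
  qed (auto elim!: homology_carrierE simp: homology_add homology_carrierI ob.a_ac)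
qed (auto elim!: homology_carrierE simp: homology_add homology_smult homology_carrierI
      ob.smult_l_distr[simplified] ob.smult_r_distr[simplified] ob.smult_assoc1[simplified]
      ob.smult_one[simplified])

text \<open>All axioms are read off cycle representatives. The differential is zero, so in the
  Leibniz rule every term is the zero class.\<close>

lemma dg_ns_operad_homology: "dg_ns_operad H"
proof (rule dg_ns_operad.intro)
  fix n d
  show "Module.module rat_ring (obj H n d)"
    by (rule homology_module)
  show "rat_linear (obj H n d) (obj H n (d - 1)) (bdry H n d)"
  proof -
    have "homology_class P n (d - 1) \<zero>\<^bsub>obj P n (d - 1)\<^esub> \<in> carrier (obj H n (d - 1))"
      by (rule homology_carrierI) simp
    moreover have "boundaries P n (d - 1) = boundaries P n (d - 1) \<oplus>\<^bsub>obj H n (d - 1)\<^esub> boundaries P n (d - 1)"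
      using homology_add[of "\<zero>\<^bsub>obj P n (d - 1)\<^esub>" n "d - 1" "\<zero>\<^bsub>obj P n (d - 1)\<^esub>"]
      by (simp add: homology_class_zero)
    moreover have "boundaries P n (d - 1) = r \<odot>\<^bsub>obj H n (d - 1)\<^esub> boundaries P n (d - 1)" for r
      using homology_smult[of "\<zero>\<^bsub>obj P n (d - 1)\<^esub>" n "d - 1" r] ob.smult_r_null[simplified]
      by (simp add: homology_class_zero)
    ultimately show ?thesis
      unfolding rat_linear_def by (auto simp: homology_bdry homology_class_zero)
  qed
next
  fix x n d
  show "bdry H n (d - 1) (bdry H n d x) = \<zero>\<^bsub>obj H n (d - 2)\<^esub>"
    by (simp add: homology_bdry homology_zero)
next
  fix i n m :: nat and e d y
  assume i: "1 \<le> i" "i \<le> n" and "y \<in> carrier (obj H m e)"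
  then obtain y' where "y' \<in> cycles P m e" "y = homology_class P m e y'"
    by (auto elim: homology_carrierE)
  then show "rat_linear (obj H n d) (obj H (n + m - 1) (d + e)) (\<lambda>x. pcomp H n m i d e x y)"
    unfolding rat_linear_def using i cycle_pcomp[of i n _ d y' m e] pcomp_add_left[of i n y' m e _ d]
      pcomp_smult_left[of i n y' m e _ d]
    by (auto elim!: homology_carrierE simp: homology_pcomp homology_add homology_smult homology_carrierI)
next
  fix i n m :: nat and e d x
  assume i: "1 \<le> i" "i \<le> n" and "x \<in> carrier (obj H n d)"
  then obtain x' where "x' \<in> cycles P n d" "x = homology_class P n d x'"
    by (auto elim: homology_carrierE)
  then show "rat_linear (obj H m e) (obj H (n + m - 1) (d + e)) (pcomp H n m i d e x)"
    unfolding rat_linear_def using i cycle_pcomp[of i n x' d _ m e] pcomp_add_right[of i n x' d _ m e]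
      pcomp_smult_right[of i n x' d _ m e]
    by (auto elim!: homology_carrierE simp: homology_pcomp homology_add homology_smult homology_carrierI)
next
  fix i n m :: nat and e d x y
  assume i: "1 \<le> i" "i \<le> n" and "x \<in> carrier (obj H n d)" "y \<in> carrier (obj H m e)"
  then obtain x' y' where x: "x' \<in> cycles P n d" "x = homology_class P n d x'"
    and y: "y' \<in> cycles P m e" "y = homology_class P m e y'"
    by (auto elim!: homology_carrierE)
  let ?N = "obj H (n + m - 1) (d + e - 1)" and ?Z = "boundaries P (n + m - 1) (d + e - 1)"
  have 1: "pcomp H n m i (d - 1) e (boundaries P n (d - 1)) y = ?Z"
    using homology_pcomp[of i n "\<zero>\<^bsub>obj P n (d - 1)\<^esub>" "d - 1" y' m e]
      pcomp_zero_left[of i n y' m e "d - 1"] i y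
    by (simp add: homology_class_zero algebra_simps)
  have 2: "pcomp H n m i d (e - 1) x (boundaries P m (e - 1)) = ?Z"
    using homology_pcomp[of i n x' d "\<zero>\<^bsub>obj P m (e - 1)\<^esub>" m "e - 1"]
      pcomp_zero_right[of i n x' d m "e - 1"] i x
    by (simp add: homology_class_zero algebra_simps)
  interpret hm: Module.module rat_ring ?N
    by (rule homology_module)
  show "bdry H (n + m - 1) (d + e) (pcomp H n m i d e x y) =
      pcomp H n m i (d - 1) e (bdry H n d x) y
      \<oplus>\<^bsub>?N\<^esub> koszul_sign d \<odot>\<^bsub>?N\<^esub> pcomp H n m i d (e - 1) x (bdry H m e y)"
    unfolding homology_bdry 1 2 unfolding homology_zero[symmetric] using hm.smult_r_null hm.r_zero[OF hm.zero_closed] by simp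
next
  show "opunit H \<in> carrier (obj H 1 0)"
    unfolding homology_opunit by (rule homology_carrierI[OF opunit_cycle])
  show "bdry H 1 0 (opunit H) = \<zero>\<^bsub>obj H 1 (- 1)\<^esub>"
    by (simp add: homology_bdry homology_zero)
next
  fix x n d assume "x \<in> carrier (obj H n d)"
  then obtain x' where "x' \<in> cycles P n d" "x = homology_class P n d x'"
    by (rule homology_carrierE)
  then show "pcomp H 1 n 1 0 d (opunit H) x = x"
    using homology_pcomp[of 1 1 "opunit P" 0 x' n d] opunit_cycle
    by (simp add: homology_opunit opunit_left[simplified])
next
  fix i n x d assume i: "1 \<le> i" "i \<le> n" and "x \<in> carrier (obj H n d)"
  then obtain x' where "x' \<in> cycles P n d" "x = homology_class P n d x'"
    by (auto elim: homology_carrierE)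
  then show "pcomp H n 1 i d 0 x (opunit H) = x"
    using homology_pcomp[of i n x' d "opunit P" 1 0] opunit_cycle i
    by (simp add: homology_opunit opunit_right[simplified])
next
  fix i n j m l :: nat and d e f x y z
  assume ij: "1 \<le> i" "i \<le> n" "1 \<le> j" "j \<le> m"
    and "x \<in> carrier (obj H n d)" "y \<in> carrier (obj H m e)" "z \<in> carrier (obj H l f)"
  then obtain x' y' z' where x: "x' \<in> cycles P n d" "x = homology_class P n d x'"
    and y: "y' \<in> cycles P m e" "y = homology_class P m e y'"
    and z: "z' \<in> cycles P l f" "z = homology_class P l f z'"
    by (auto elim!: homology_carrierE)
  have c1: "pcomp P n m i d e x' y' \<in> cycles P (n + m - 1) (d + e)"
    using cycle_pcomp ij x y by blast
  have c2: "pcomp P m l j e f y' z' \<in> cycles P (m + l - 1) (e + f)"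
    using cycle_pcomp ij y z by blast
  have "1 \<le> i + j - 1" "i + j - 1 \<le> n + m - 1" "n + m - 1 + l - 1 = n + (m + l - 1) - 1"
    using ij by auto
  then show "pcomp H (n + m - 1) l (i + j - 1) (d + e) f (pcomp H n m i d e x y) z =
      pcomp H n (m + l - 1) i d (e + f) x (pcomp H m l j e f y z)"
    using pcomp_sequential[of i n j m x' d y' e z' l f] ij x y z
      homology_pcomp[of i n x' d y' m e] homology_pcomp[of j m y' e z' l f]
      homology_pcomp[OF _ _ c1 z(1), of "i + j - 1"] homology_pcomp[OF ij(1,2) x(1) c2]
    by (simp add: add.assoc)
next
  fix i k n m l :: nat and d e f x y z
  assume ik: "1 \<le> i" "i < k" "k \<le> n"
    and "x \<in> carrier (obj H n d)" "y \<in> carrier (obj H m e)" "z \<in> carrier (obj H l f)"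
  then obtain x' y' z' where x: "x' \<in> cycles P n d" "x = homology_class P n d x'"
    and y: "y' \<in> cycles P m e" "y = homology_class P m e y'"
    and z: "z' \<in> cycles P l f" "z = homology_class P l f z'"
    by (auto elim!: homology_carrierE)
  have i: "1 \<le> k" "i \<le> n" "1 \<le> k + m - 1" "k + m - 1 \<le> n + m - 1" "i \<le> n + l - 1"
    and ar: "n + m - 1 + l - 1 = n + m + l - 2" "n + l - 1 + m - 1 = n + m + l - 2"
    and deg: "d + f + e = d + e + f"
    using ik by auto
  have c1: "pcomp P n m i d e x' y' \<in> cycles P (n + m - 1) (d + e)"
    using cycle_pcomp ik i x y by blast
  have c2: "pcomp P n l k d f x' z' \<in> cycles P (n + l - 1) (d + f)"
    using cycle_pcomp ik i x z by blast
  have c3: "pcomp P (n + l - 1) m i (d + f) e (pcomp P n l k d f x' z') y' \<in> cycles P (n + m + l - 2) (d + e + f)"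
    using cycle_pcomp[OF ik(1) i(5) c2 y(1)] unfolding ar deg .
  show "pcomp H (n + m - 1) l (k + m - 1) (d + e) f (pcomp H n m i d e x y) z =
      koszul_sign (e * f) \<odot>\<^bsub>obj H (n + m + l - 2) (d + e + f)\<^esub>
      pcomp H (n + l - 1) m i (d + f) e (pcomp H n l k d f x z) y"
    unfolding x(2) y(2) z(2) homology_pcomp[OF ik(1) i(2) x(1) y(1)] homology_pcomp[OF i(1) ik(3) x(1) z(1)]
      homology_pcomp[OF i(3,4) c1 z(1)] homology_pcomp[OF ik(1) i(5) c2 y(1)] ar deg homology_smult[OF c3]
    using pcomp_parallel[of i k n x' d y' m e z' l f] ik x y z by simp
qed

end

section \<open>A criterion for formality\<close>

text \<open>The quotient of \<open>P\<close> by the ideal \<open>N\<close> has zero differential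
  because \<open>N\<close> contains the boundaries. By the last two premises each class modulo
  \<open>N\<close> contains a cycle, unique up to boundaries, so this quotient is the homology. The
  map is sent directly to \<open>homology_operad P\<close>, which already lives on the required
  type.\<close>

lemma formal_operadI:
  fixes P :: "'a dg_operad" and N :: "nat \<Rightarrow> int \<Rightarrow> 'a set"
  assumes P: "dg_ns_operad P"
    and N: "\<And>n d. additive_subgroup (N n d) (obj P n d)"
    and N_smult: "\<And>n d r x. x \<in> N n d \<Longrightarrow> r \<odot>\<^bsub>obj P n d\<^esub> x \<in> N n d"
    and N_boundaries: "\<And>n d. boundaries P n d \<subseteq> N n d"
    and N_left: "\<And>n m i d e x y. \<lbrakk>1 \<le> i; i \<le> n; x \<in> N n d; y \<in> carrier (obj P m e)\<rbrakk> \<Longrightarrow>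
      pcomp P n m i d e x y \<in> N (n + m - 1) (d + e)"
    and N_right: "\<And>n m i d e x y. \<lbrakk>1 \<le> i; i \<le> n; x \<in> carrier (obj P n d); y \<in> N m e\<rbrakk> \<Longrightarrow>
      pcomp P n m i d e x y \<in> N (n + m - 1) (d + e)"
    and N_cycles: "\<And>n d. cycles P n d \<inter> N n d \<subseteq> boundaries P n d"
    and decompose: "\<And>n d x. x \<in> carrier (obj P n d) \<Longrightarrow>
      \<exists>u\<in>N n d. \<exists>z\<in>cycles P n d. x = u \<oplus>\<^bsub>obj P n d\<^esub> z"
  shows "formal_operad P"
proof -
  interpret dg_ns_operad P by fact
  interpret N: additive_subgroup "N n d" "obj P n d" for n d
    by (rule N)
  have N_carrier: "u \<in> carrier (obj P n d)" if "u \<in> N n d" for u n d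
    using that N.a_subset by blast
  \<comment> \<open>The cycle congruent to \<open>x\<close> is chosen arbitrarily. Two such cycles
    differ by a cycle in \<open>N\<close>, that is by a boundary, so the class does not depend on
    the choice.\<close>
  define f where "f n d x = homology_class P n d
    (SOME z. z \<in> cycles P n d \<and> (\<exists>u\<in>N n d. x = u \<oplus>\<^bsub>obj P n d\<^esub> z))" for n d x
  have f: "f n d (u \<oplus>\<^bsub>obj P n d\<^esub> z) = homology_class P n d z"
    if z: "z \<in> cycles P n d" and u: "u \<in> N n d" for n d u z
  proof -
    let ?Q = "\<lambda>z'. z' \<in> cycles P n d \<and> (\<exists>u'\<in>N n d. u \<oplus>\<^bsub>obj P n d\<^esub> z = u' \<oplus>\<^bsub>obj P n d\<^esub> z')"
    define z' where "z' = (SOME z'. ?Q z')"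
    have "?Q z'"
      unfolding z'_def by (rule someI[of ?Q z]) (use z u in auto)
    then obtain u' where z': "z' \<in> cycles P n d" and u': "u' \<in> N n d"
      and eq: "u \<oplus>\<^bsub>obj P n d\<^esub> z = u' \<oplus>\<^bsub>obj P n d\<^esub> z'"
      by blast
    define b where "b = z' \<oplus>\<^bsub>obj P n d\<^esub> \<ominus>\<^bsub>obj P n d\<^esub> z"
    have carr: "u \<in> carrier (obj P n d)" "u' \<in> carrier (obj P n d)" "z \<in> carrier (obj P n d)" "z' \<in> carrier (obj P n d)"
      using z z' u u' N_carrier by auto
    have "b \<in> cycles P n d"
      using z z' by (simp add: b_def minus_eq_smult)
    moreover have "b = \<ominus>\<^bsub>obj P n d\<^esub> u' \<oplus>\<^bsub>obj P n d\<^esub> u"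
    proof -
      have "z' = \<ominus>\<^bsub>obj P n d\<^esub> u' \<oplus>\<^bsub>obj P n d\<^esub> (u' \<oplus>\<^bsub>obj P n d\<^esub> z')"
        using carr by (simp add: ob.r_neg1)
      also have "\<dots> = (\<ominus>\<^bsub>obj P n d\<^esub> u' \<oplus>\<^bsub>obj P n d\<^esub> u) \<oplus>\<^bsub>obj P n d\<^esub> z"
        using carr by (simp add: eq[symmetric] ob.a_assoc)
      finally have "b = (\<ominus>\<^bsub>obj P n d\<^esub> u' \<oplus>\<^bsub>obj P n d\<^esub> u) \<oplus>\<^bsub>obj P n d\<^esub> z \<oplus>\<^bsub>obj P n d\<^esub> \<ominus>\<^bsub>obj P n d\<^esub> z"
        by (simp add: b_def)
      then show ?thesis
        using carr by (simp add: ob.a_assoc ob.r_neg)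
    qed
    then have "b \<in> N n d"
      using u u' by simp
    ultimately have "b \<in> boundaries P n d"
      using N_cycles by blast
    then have "homology_class P n d (b \<oplus>\<^bsub>obj P n d\<^esub> z) = homology_class P n d z"
      using carr by (intro homology_class_add_boundary)
    moreover have "b \<oplus>\<^bsub>obj P n d\<^esub> z = z'"
      using carr by (simp add: b_def ob.a_assoc ob.l_neg)
    ultimately show ?thesis
      by (simp add: f_def z'_def)
  qed
  have f_cycle: "f n d z = homology_class P n d z" if "z \<in> cycles P n d" for n d z
    using f[OF that N.zero_closed] that by simp
  have linear: "rat_linear (obj P n d) (obj H n d) (f n d)" for n d
    unfolding rat_linear_def
  proof (intro conjI funcsetI ballI allI)
    fix x assume "x \<in> carrier (obj P n d)"
    then obtain u z where x: "u \<in> N n d" "z \<in> cycles P n d" "x = u \<oplus>\<^bsub>obj P n d\<^esub> z"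
      using decompose by blast
    then show "f n d x \<in> carrier (obj H n d)"
      by (simp add: f homology_carrierI)
    fix r
    have "r \<odot>\<^bsub>obj P n d\<^esub> x = r \<odot>\<^bsub>obj P n d\<^esub> u \<oplus>\<^bsub>obj P n d\<^esub> r \<odot>\<^bsub>obj P n d\<^esub> z"
      using x N_carrier by (simp add: ob.smult_r_distr[simplified])
    then show "f n d (r \<odot>\<^bsub>obj P n d\<^esub> x) = r \<odot>\<^bsub>obj H n d\<^esub> f n d x"
      using x N_smult by (simp add: f homology_smult)
  next
    fix x y assume "x \<in> carrier (obj P n d)" "y \<in> carrier (obj P n d)"
    then obtain u z v w where x: "u \<in> N n d" "z \<in> cycles P n d" "x = u \<oplus>\<^bsub>obj P n d\<^esub> z"
      and y: "v \<in> N n d" "w \<in> cycles P n d" "y = v \<oplus>\<^bsub>obj P n d\<^esub> w"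
      using decompose by meson
    have "x \<oplus>\<^bsub>obj P n d\<^esub> y = (u \<oplus>\<^bsub>obj P n d\<^esub> v) \<oplus>\<^bsub>obj P n d\<^esub> (z \<oplus>\<^bsub>obj P n d\<^esub> w)"
      using x y N_carrier by (simp add: ob.a_ac)
    then show "f n d (x \<oplus>\<^bsub>obj P n d\<^esub> y) = f n d x \<oplus>\<^bsub>obj H n d\<^esub> f n d y"
      using x y by (simp add: f homology_add)
  qed
  have "op_morphism P H f"
    unfolding op_morphism_def
  proof (intro conjI allI ballI)
    fix n d x assume "x \<in> carrier (obj P n d)"
    then have "bdry P n d x \<in> boundaries P n (d - 1)"
      unfolding boundaries_def by simp
    then have "bdry P n d x \<in> N n (d - 1)" "bdry P n d x \<in> carrier (obj P n (d - 1))"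
      using N_boundaries by auto
    then have "f n (d - 1) (bdry P n d x) = homology_class P n (d - 1) \<zero>\<^bsub>obj P n (d - 1)\<^esub>"
      using f[of "\<zero>\<^bsub>obj P n (d - 1)\<^esub>" n "d - 1" "bdry P n d x"] by simp
    then show "f n (d - 1) (bdry P n d x) = bdry H n d (f n d x)"
      by (simp add: homology_bdry homology_class_zero)
  next
    fix n m d e i x y
    assume i: "i \<in> {1..n}" and xc: "x \<in> carrier (obj P n d)" and yc: "y \<in> carrier (obj P m e)"
    then obtain u z v w where x: "u \<in> N n d" "z \<in> cycles P n d" "x = u \<oplus>\<^bsub>obj P n d\<^esub> z"
      and y: "v \<in> N m e" "w \<in> cycles P m e" "y = v \<oplus>\<^bsub>obj P m e\<^esub> w"
      using decompose by meson
    let ?c = "pcomp P n m i d e" and ?M = "obj P (n + m - 1) (d + e)"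
    have i': "1 \<le> i" "i \<le> n"
      using i by auto
    note closed = pcomp_closed[OF i', of _ d _ m e]
    have "?c x y = ?c u y \<oplus>\<^bsub>?M\<^esub> ?c z y"
      unfolding x(3) using pcomp_add_left[OF i' yc, of u d z] x N_carrier by simp
    also have "?c z y = ?c z v \<oplus>\<^bsub>?M\<^esub> ?c z w"
      unfolding y(3) using pcomp_add_right[OF i', of z d v m e w] x y N_carrier by simp
    \<comment> \<open>Of the three summands, the first two have a factor in \<open>N\<close> and lie
      in the ideal; only the composite of the cycle parts survives.\<close>
    finally have "?c x y = (?c u y \<oplus>\<^bsub>?M\<^esub> ?c z v) \<oplus>\<^bsub>?M\<^esub> ?c z w"
      using x y yc N_carrier closed by (simp add: ob.a_assoc)
    moreover have "?c u y \<oplus>\<^bsub>?M\<^esub> ?c z v \<in> N (n + m - 1) (d + e)"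
      using N_left[OF i' x(1) yc] N_right[OF i' _ y(1), of z d] x by simp
    ultimately have "f (n + m - 1) (d + e) (?c x y) = homology_class P (n + m - 1) (d + e) (?c z w)"
      using f cycle_pcomp[OF i' x(2) y(2)] by simp
    then show "f (n + m - 1) (d + e) (?c x y) = pcomp H n m i d e (f n d x) (f m e y)"
      using x y by (simp add: f homology_pcomp[OF i'])
  qed (use linear f_cycle[OF opunit_cycle] homology_opunit in simp_all)
  \<comment> \<open>The homology of \<open>H\<close> consists of singletons, since its boundaries
    are only the zero class. On a class \<open>U\<close> all representatives are sent to
    \<open>U\<close>, so the induced map is \<open>U\<close> to \<open>{U}\<close>.\<close>
  moreover have "bij_betw (induced_map H f n d) (carrier (obj H n d)) (carrier (obj (homology_operad H) n d))" for n d
  proof -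
    interpret HH: dg_ns_operad H
      by (rule dg_ns_operad_homology)
    have "carrier (obj H n (d + 1)) \<noteq> {}"
      using HH.ob.zero_closed by blast
    moreover have "boundaries H n d = (\<lambda>U. boundaries P n (d + 1 - 1)) ` carrier (obj H n (d + 1))"
      unfolding boundaries_def[of H] homology_bdry ..
    ultimately have bd: "boundaries H n d = {\<zero>\<^bsub>obj H n d\<^esub>}"
      by (simp add: homology_zero image_constant_conv)
    have cl: "homology_class H n d U = {U}" if "U \<in> carrier (obj H n d)" for U
      using HH.ob.l_zero[OF that] unfolding homology_class_def[of H] a_r_coset_def' bd by simp
    have "cycles H n d = carrier (obj H n d)"
      unfolding cycles_def[of H] homology_bdry homology_zero by simp
    then have carr: "carrier (obj (homology_operad H) n d) = (\<lambda>U. {U}) ` carrier (obj H n d)"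
      using cl by (simp add: HH.homology_carrier)
    have "induced_map H f n d U = {U}" if U: "U \<in> carrier (obj H n d)" for U
    proof -
      obtain z where z: "z \<in> cycles P n d" "U = homology_class P n d z"
        using U by (rule homology_carrierE)
      have "f n d x = U" if "x \<in> U" for x
        using homology_class_cycle[OF z(1)] that z f_cycle by simp
      moreover have "U \<noteq> {}"
        using homology_class_self[of z n d] z by auto
      ultimately show ?thesis
        unfolding induced_map_def using cl[OF U] by simp
    qed
    then show ?thesis
      unfolding carr by (auto simp: bij_betw_def inj_on_def)
  qed
  ultimately have "quasi_iso P H"
    unfolding quasi_iso_def using P dg_ns_operad_homology by blast
  \<comment> \<open>The homology itself serves as the first operad of the zig-zag, and the remaining
    part is trivial by reflexivity.\<close>
  then show ?thesis
    unfolding formal_operad_def by (intro exI[of _ H]) (simp add: equivclp_def)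
qed

section \<open>Logarithmic forms on singular simplices\<close>

text \<open>Passes from the product topology used for singular simplices to the type class topology,
  in which compactness, connectedness and continuity on sets are expressed.\<close>

lemma powertop_real_euclidean: "powertop_real UNIV = (euclidean :: (nat \<Rightarrow> real) topology)"
  by (simp add: euclidean_product_topology)

lemma compact_standard_simplex: "compact (standard_simplex p)"
  using compactin_standard_simplex[of p] by (simp add: powertop_real_euclidean)

lemma connected_standard_simplex: "connected (standard_simplex p)"
  using connectedin_standard_simplex[of p] by (simp add: powertop_real_euclidean)

lemma continuous_map_simplex_iff:
  fixes S :: "(nat \<Rightarrow> real) set"
  shows "continuous_map (subtopology (powertop_real UNIV) S) (top_of_set A) f \<longleftrightarrow>
     continuous_on S f \<and> f ` S \<subseteq> A"
  by (simp only: powertop_real_euclidean continuous_map_in_subtopology continuous_map_iff_continuous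
      topspace_euclidean_subtopology image_subset_iff_funcset)

text \<open>
  Subdividing the segment from a vertex to a point finely enough, the successive quotients of the
  values of \<open>u\<close> lie in the right half plane, and their principal logarithms add up.
\<close>

lemma continuous_log_on_simplex:
  fixes u :: "(nat \<Rightarrow> real) \<Rightarrow> complex"
  assumes u: "continuous_on (standard_simplex p) u" and u0: "\<And>x. x \<in> standard_simplex p \<Longrightarrow> u x \<noteq> 0"
  obtains g where "continuous_on (standard_simplex p) g"
    and "\<And>x. x \<in> standard_simplex p \<Longrightarrow> u x = exp (g x)"
proof -
  let ?S = "standard_simplex p"
  define x0 :: "nat \<Rightarrow> real" where "x0 = (\<lambda>j. if j = 0 then 1 else 0)"
  have x0: "x0 \<in> ?S"
    by (simp add: x0_def)
  define K where "K = ?S \<times> {0..1::real}"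
  have K: "compact K"
    unfolding K_def by (intro compact_Times compact_standard_simplex compact_Icc)
  define c where "c = (\<lambda>(x, t) i. (1 - t) * x0 i + t * x i :: real)"
  have c: "c ` K \<subseteq> ?S"
    unfolding c_def K_def using convex_standard_simplex[OF x0] by auto
  have "continuous_on K c"
    unfolding c_def case_prod_unfold
    by (intro continuous_on_coordinatewise_then_product continuous_intros
        continuous_on_compose2[OF continuous_on_product_coordinates continuous_on_fst]) auto
  then have h: "continuous_on K (\<lambda>z. u (c z))"
    by (rule continuous_on_compose2[OF u]) (rule c)
  have h0: "u (c z) \<noteq> 0" if "z \<in> K" for z
    using that c u0 by blast
  have "(x0, 0) \<in> K"
    using x0 by (simp add: K_def)
  \<comment> \<open>The minimum modulus along all segments, positive by compactness, serves as the
    tolerance in uniform continuity: successive values then differ by less than their modulus, so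
    the quotients have distance less than 1 from 1.\<close>
  then obtain z0 where z0: "z0 \<in> K" "\<And>z. z \<in> K \<Longrightarrow> norm (u (c z0)) \<le> norm (u (c z))"
    using continuous_attains_inf[OF K _ continuous_on_norm[OF h]] by blast
  have "norm (u (c z0)) > 0"
    using h0[OF z0(1)] by simp
  then obtain \<delta> where \<delta>: "\<delta> > 0"
    "\<And>z z'. \<lbrakk>z \<in> K; z' \<in> K; dist z' z < \<delta>\<rbrakk> \<Longrightarrow> dist (u (c z')) (u (c z)) < norm (u (c z0))"
    using compact_uniformly_continuous[OF h K] unfolding uniformly_continuous_on_def by meson
  obtain N :: nat where N: "N > 0" "1 / real N < \<delta>"
    using \<delta>(1) by (metis nat_approx_posE of_nat_0_less_iff zero_less_Suc inverse_eq_divide)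
  define F where "F k x = u (c (x, real k / real N))" for k x
  have inK: "(x, real k / real N) \<in> K" if "x \<in> ?S" "k \<le> N" for x k
    using that N(1) by (simp add: K_def divide_le_eq_1)
  have F0: "F k x \<noteq> 0" if "x \<in> ?S" "k \<le> N" for x k
    unfolding F_def by (rule h0[OF inK[OF that]])
  have contF: "continuous_on ?S (F k)" if "k \<le> N" for k
  proof -
    have "continuous_on ?S (\<lambda>x. (x, real k / real N))"
      by (intro continuous_intros)
    then show ?thesis
      unfolding F_def by (rule continuous_on_compose2[OF h]) (use inK that in auto)
  qed
  have ratio: "F (Suc k) x / F k x \<notin> \<real>\<^sub>\<le>\<^sub>0" if "x \<in> ?S" "k < N" for x k
  proof -
    have "dist (x, real (Suc k) / real N) (x, real k / real N) = 1 / real N"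
      using N(1) by (simp add: dist_Pair_Pair dist_real_def diff_divide_distrib[symmetric])
    then have "dist (x, real (Suc k) / real N) (x, real k / real N) < \<delta>"
      using N(2) by simp
    then have "dist (F (Suc k) x) (F k x) < norm (u (c z0))"
      unfolding F_def by (intro \<delta>(2) inK) (use that in auto)
    also have "\<dots> \<le> norm (F k x)"
      unfolding F_def using z0(2) inK that by simp
    finally have "norm (F (Suc k) x - F k x) < norm (F k x)"
      by (simp add: dist_norm)
    moreover have "F (Suc k) x / F k x - 1 = (F (Suc k) x - F k x) / F k x"
      using F0[of x k] that by (simp add: field_simps)
    ultimately have "norm (F (Suc k) x / F k x - 1) < 1"
      using F0[of x k] that by (simp add: norm_divide)
    then have "\<bar>Re (F (Suc k) x / F k x - 1)\<bar> < 1"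
      using abs_Re_le_cmod le_less_trans by blast
    then show ?thesis
      by (auto simp: complex_nonpos_Reals_iff)
  qed
  define g where "g x = Ln (u x0) + (\<Sum>k<N. Ln (F (Suc k) x / F k x))" for x
  have "continuous_on ?S g"
    unfolding g_def using ratio F0
    by (intro continuous_intros continuous_on_Ln contF) auto
  moreover have "u x = exp (g x)" if x: "x \<in> ?S" for x
  proof -
    have "exp (g x) = u x0 * (\<Prod>k<N. F (Suc k) x / F k x)"
      unfolding g_def exp_add exp_sum[OF finite_lessThan]
      using F0[OF x] u0[OF x0] by (intro arg_cong2[of _ _ _ _ "(*)"] prod.cong) auto
    also have "(\<Prod>k<n. F (Suc k) x / F k x) = F n x / F 0 x" if "n \<le> N" for n
      using that F0[OF x] by (induction n) auto
    then have "(\<Prod>k<N. F (Suc k) x / F k x) = F N x / F 0 x"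
      by simp
    also have "F N x = u x"
      unfolding F_def c_def using N(1) by simp
    also have "F 0 x = u x0"
      unfolding F_def c_def by simp
    finally show ?thesis
      using u0[OF x0] by simp
  qed
  ultimately show thesis
    by (rule that)
qed

section \<open>Rational potentials on the vertices of a simplex\<close>

definition rat_char :: "complex \<Rightarrow> rat" where
  "rat_char = (SOME \<theta>. (\<forall>x y. \<theta> (x + y) = \<theta> x + \<theta> y) \<and> \<theta> (2 * of_real pi * \<i>) = 1)"

lemma rat_char_add: "rat_char (x + y) = rat_char x + rat_char y"
  and rat_char_period: "rat_char (2 * of_real pi * \<i>) = 1"
proof -
  have "\<exists>\<theta> :: complex \<Rightarrow> rat. (\<forall>x y. \<theta> (x + y) = \<theta> x + \<theta> y) \<and> \<theta> (2 * of_real pi * \<i>) = 1"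
    using exists_rat_character by metis
  from someI_ex[OF this] show "rat_char (x + y) = rat_char x + rat_char y"
    "rat_char (2 * of_real pi * \<i>) = 1"
    unfolding rat_char_def by blast+
qed

lemma rat_char_0 [simp]: "rat_char 0 = 0"
  using rat_char_add[of 0 0] by simp

lemma rat_char_diff: "rat_char (x - y) = rat_char x - rat_char y"
  using rat_char_add[of "x - y" y] by simp

definition simplex_log :: "nat \<Rightarrow> ((nat \<Rightarrow> real) \<Rightarrow> complex) \<Rightarrow> (nat \<Rightarrow> real) \<Rightarrow> complex" where
  "simplex_log p u = (SOME g. continuous_on (standard_simplex p) g \<and> (\<forall>x\<in>standard_simplex p. u x = exp (g x)))"

definition vertex :: "nat \<Rightarrow> nat \<Rightarrow> real" where
  "vertex i = (\<lambda>j. if j = i then 1 else 0)"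

lemma vertex_in [simp]: "vertex i \<in> standard_simplex p \<longleftrightarrow> i \<le> p"
  by (simp add: vertex_def)

lemma vertex_map_vertex:
  assumes "b < length l"
  shows "vertex_map l (vertex b) = vertex (l ! b)"
proof -
  have b: "vertex b \<in> standard_simplex (length l - 1)" "b \<le> length l - 1"
    using assms by simp_all
  have "(\<Sum>j\<le>length l - 1. if i = l ! j then vertex b j else 0) = vertex (l ! b) i" for i
  proof -
    have "(\<Sum>j\<le>length l - 1. if i = l ! j then vertex b j else 0) =
        (\<Sum>j\<le>length l - 1. if j = b then vertex (l ! b) i else 0)"
      by (intro sum.cong refl) (simp add: vertex_def)
    also have "\<dots> = vertex (l ! b) i"
      using b(2) by (subst sum.delta) simp_all
    finally show ?thesis .
  qed
  then show ?thesis
    unfolding vertex_map_eq[OF b(1)] by blast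
qed

text \<open>Two continuous logarithms differ by a continuous function with values in the multiples
  of 2 pi i. Distinct values are at distance at least 1, so it is constant on a connected
  set.\<close>

lemma log_difference:
  assumes "connected S" "continuous_on S g" "continuous_on S h"
    and "\<And>x. x \<in> S \<Longrightarrow> exp (g x) = exp (h x :: complex)" and "x \<in> S" "y \<in> S"
  shows "g x - g y = h x - h y"
proof -
  have "(\<lambda>x. g x - h x) constant_on S"
  proof (rule continuous_discrete_range_constant[OF assms(1)])
    show "continuous_on S (\<lambda>x. g x - h x)"
      by (intro continuous_intros assms)
    fix x assume x: "x \<in> S"
    have "1 \<le> norm (g y - h y - (g x - h x))" if "y \<in> S" "g y - h y \<noteq> g x - h x" for y
    proof -
      have "exp (g y - h y - (g x - h x)) = 1"
        using assms(4)[OF x] assms(4)[OF that(1)] by (simp add: exp_diff)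
      then obtain n :: int where n: "g y - h y - (g x - h x) = of_int (2 * n) * of_real pi * \<i>"
        using exp_eq[of "g y - h y - (g x - h x)" 0] by auto
      then have "n \<noteq> 0"
        using that by auto
      then have "1 \<le> \<bar>real_of_int n\<bar>"
        by linarith
      moreover have "norm (g y - h y - (g x - h x)) = 2 * pi * \<bar>real_of_int n\<bar>"
        unfolding n by (simp add: norm_mult)
      moreover have "1 \<le> 2 * pi"
        using pi_gt3 by simp
      ultimately show ?thesis
        using mult_mono[of 1 "2 * pi" 1 "\<bar>real_of_int n\<bar>"] by simp
    qed
    then show "\<exists>e>0. \<forall>y. y \<in> S \<and> g y - h y \<noteq> g x - h x \<longrightarrow> e \<le> norm (g y - h y - (g x - h x))"
      by (intro exI[of _ 1]) auto
  qed
  then have "g x - h x = g y - h y"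
    using assms(5,6) unfolding constant_on_def by metis
  then show ?thesis
    by (simp add: algebra_simps)
qed

definition log_vertex :: "nat \<Rightarrow> ((nat \<Rightarrow> real) \<Rightarrow> complex) \<Rightarrow> nat \<Rightarrow> rat" where
  "log_vertex p u b = rat_char (simplex_log p u (vertex b))"

text \<open>Frees later arguments from the arbitrary choice in \<open>simplex_log\<close>: any
  convenient continuous logarithm, such as a restriction or a sum of others, computes the same
  differences.\<close>

lemma log_vertex_diff:
  assumes "continuous_on (standard_simplex p) g" "\<And>x. x \<in> standard_simplex p \<Longrightarrow> u x = exp (g x)"
    and "a \<le> p" "b \<le> p"
  shows "log_vertex p u b - log_vertex p u a = rat_char (g (vertex b)) - rat_char (g (vertex a))"
proof -
  let ?h = "simplex_log p u"
  have "\<exists>g. continuous_on (standard_simplex p) g \<and> (\<forall>x\<in>standard_simplex p. u x = exp (g x))"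
    using assms(1,2) by blast
  from someI_ex[OF this] have h: "continuous_on (standard_simplex p) ?h"
    "\<And>x. x \<in> standard_simplex p \<Longrightarrow> u x = exp (?h x)"
    unfolding simplex_log_def by blast+
  have "?h (vertex b) - ?h (vertex a) = g (vertex b) - g (vertex a)"
    by (rule log_difference[OF connected_standard_simplex h(1) assms(1)])
      (use h(2) assms in auto)
  then show ?thesis
    unfolding log_vertex_def rat_char_diff[symmetric] by simp
qed

definition torus_coords :: "'a topology \<Rightarrow> nat \<Rightarrow> (nat \<Rightarrow> 'a \<Rightarrow> complex) \<Rightarrow> bool" where
  "torus_coords T k c \<longleftrightarrow> (\<forall>j<k. continuous_map T Cstar (c j))"

text \<open>The rational vector attached to vertex \<open>b\<close>. The choice of logarithms
  translates all vertices of a simplex by a common vector, which \<open>edges\<close> does not see.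
  Coordinates from \<open>k\<close> on are 0, so that vectors of all ranks share one type.\<close>

definition potential :: "nat \<Rightarrow> (nat \<Rightarrow> 'a \<Rightarrow> complex) \<Rightarrow> nat \<Rightarrow> ((nat \<Rightarrow> real) \<Rightarrow> 'a) \<Rightarrow> nat \<Rightarrow> nat \<Rightarrow> rat" where
  "potential k c p s b = (\<lambda>j. if j < k then log_vertex p (\<lambda>x. c j (s x)) b else 0)"

lemma torus_coords_log:
  assumes "torus_coords T k c" "singular_simplex p T s" "j < k"
  obtains g where "continuous_on (standard_simplex p) g"
    and "\<And>x. x \<in> standard_simplex p \<Longrightarrow> c j (s x) = exp (g x)"
proof -
  have "continuous_map (subtopology (powertop_real UNIV) (standard_simplex p)) Cstar (c j \<circ> s)"
    using assms unfolding torus_coords_def singular_simplex_def by (blast intro: continuous_map_compose)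
  then have "continuous_on (standard_simplex p) (c j \<circ> s)" "(c j \<circ> s) ` standard_simplex p \<subseteq> - {0}"
    by (simp_all only: continuous_map_simplex_iff)
  then have "continuous_on (standard_simplex p) (\<lambda>x. c j (s x))"
    "\<And>x. x \<in> standard_simplex p \<Longrightarrow> c j (s x) \<noteq> 0"
    by (auto simp: comp_def)
  from continuous_log_on_simplex[OF this] that show thesis
    by blast
qed

lemma continuous_on_vertex_map:
  assumes "set l \<subseteq> {..p}" "l \<noteq> []"
  shows "continuous_on (standard_simplex (length l - 1)) (vertex_map l)"
    and "vertex_map l ` standard_simplex (length l - 1) \<subseteq> standard_simplex p"
  using continuous_map_vertex_map[OF assms] by (simp_all only: powertop_real_euclidean continuous_map_in_subtopology
      continuous_map_iff_continuous topspace_euclidean_subtopology image_subset_iff_funcset)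

lemma edges_conv_nth:
  "edges l = map (\<lambda>i j. (l ! Suc i) j - (l ! i) j) [0..<length l - 1]"
proof (induction l rule: edges.induct)
  case (1 u v l)
  then show ?case
    by (simp add: upt_conv_Cons map_Suc_upt[symmetric] comp_def del: upt_Suc)
qed auto

lemma edges_cong:
  assumes "length l = length l'"
    and "\<And>i j. Suc i < length l \<Longrightarrow> (l ! Suc i) j - (l ! i) j = (l' ! Suc i) j - (l' ! i) j"
  shows "edges l = edges l'"
  unfolding edges_conv_nth using assms by (auto simp: fun_eq_iff)

text \<open>A logarithm along \<open>s\<close>, composed with \<open>vertex_map l\<close>, is a
  logarithm along the subsimplex, so both sides are differences of the same function at the same
  vertices.\<close>

lemma edges_potential_sub_simplex:
  assumes c: "torus_coords T k c" and s: "singular_simplex p T s"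
    and l: "set l \<subseteq> {..p}" "length l = Suc n"
  shows "edges (map (potential k c n (sub_simplex s l)) [0..<Suc n]) = edges (map (potential k c p s) l)"
proof (rule edges_cong)
  show "length (map (potential k c n (sub_simplex s l)) [0..<Suc n]) = length (map (potential k c p s) l)"
    using l by simp
  fix i j assume i: "Suc i < length (map (potential k c n (sub_simplex s l)) [0..<Suc n])"
  have lp: "l ! b \<le> p" if "b \<le> n" for b
    using l that by (metis atMost_iff le_imp_less_Suc nth_mem subsetD)
  have "potential k c n (sub_simplex s l) (Suc i) j - potential k c n (sub_simplex s l) i j =
      potential k c p s (l ! Suc i) j - potential k c p s (l ! i) j"
  proof (cases "j < k")
    case True
    obtain g where g: "continuous_on (standard_simplex p) g"
      "\<And>x. x \<in> standard_simplex p \<Longrightarrow> c j (s x) = exp (g x)"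
      using torus_coords_log[OF c s True] by blast
    have vm: "continuous_on (standard_simplex n) (vertex_map l)" "vertex_map l ` standard_simplex n \<subseteq> standard_simplex p"
      using continuous_on_vertex_map[OF l(1)] l(2) by fastforce+
    have "log_vertex n (\<lambda>x. c j (sub_simplex s l x)) (Suc i) - log_vertex n (\<lambda>x. c j (sub_simplex s l x)) i =
        rat_char (g (vertex_map l (vertex (Suc i)))) - rat_char (g (vertex_map l (vertex i)))"
    proof (rule log_vertex_diff)
      show "continuous_on (standard_simplex n) (\<lambda>x. g (vertex_map l x))"
        by (rule continuous_on_compose2[OF g(1) vm])
      show "c j (sub_simplex s l x) = exp (g (vertex_map l x))" if "x \<in> standard_simplex n" for x
        using that g(2) vm(2) l(2) by (auto simp: sub_simplex_def)
    qed (use i in auto)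
    also have "\<dots> = rat_char (g (vertex (l ! Suc i))) - rat_char (g (vertex (l ! i)))"
      using i l by (simp add: vertex_map_vertex)
    also have "\<dots> = log_vertex p (\<lambda>x. c j (s x)) (l ! Suc i) - log_vertex p (\<lambda>x. c j (s x)) (l ! i)"
      by (rule log_vertex_diff[symmetric, OF g]) (use i lp in auto)
    finally show ?thesis
      using True by (simp add: potential_def)
  qed (simp add: potential_def)
  then show "(map (potential k c n (sub_simplex s l)) [0..<Suc n] ! Suc i) j
      - (map (potential k c n (sub_simplex s l)) [0..<Suc n] ! i) j =
      (map (potential k c p s) l ! Suc i) j - (map (potential k c p s) l ! i) j"
    using i l by (simp del: upt_Suc)
qed

section \<open>Monomial maps between tori\<close>

definition monomial :: "nat option \<Rightarrow> (nat \<Rightarrow> 'a \<Rightarrow> complex) \<Rightarrow> 'a \<Rightarrow> complex" where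
  "monomial A c x = (case A of None \<Rightarrow> 1 | Some a \<Rightarrow> c a x)"

definition monomial_linear :: "nat \<Rightarrow> (nat \<Rightarrow> nat option) \<Rightarrow> (nat \<Rightarrow> rat) \<Rightarrow> nat \<Rightarrow> rat" where
  "monomial_linear k A v = (\<lambda>j. if j < k then case A j of None \<Rightarrow> 0 | Some a \<Rightarrow> v a else 0)"

lemma rat_linear_monomial_linear [simp]: "rat_linear_map (monomial_linear k A)"
  unfolding rat_linear_map_def monomial_linear_def by (auto simp: fun_eq_iff split: option.splits)

text \<open>The homomorphisms needed here multiply at most one coordinate of each argument, so
  \<open>A\<close> and \<open>B\<close> merely name these coordinates and \<open>None\<close> stands
  for the factor 1. On logarithms such a map is the sum of the two linear maps
  \<open>monomial_linear\<close>.\<close>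

definition monomial_map :: "'a topology \<Rightarrow> nat \<Rightarrow> (nat \<Rightarrow> 'a \<Rightarrow> complex) \<Rightarrow> (nat \<Rightarrow> nat option) \<Rightarrow>
    'b topology \<Rightarrow> nat \<Rightarrow> (nat \<Rightarrow> 'b \<Rightarrow> complex) \<Rightarrow> (nat \<Rightarrow> nat option) \<Rightarrow>
    nat \<Rightarrow> (nat \<Rightarrow> 'c \<Rightarrow> complex) \<Rightarrow> ('a \<times> 'b \<Rightarrow> 'c) \<Rightarrow> bool" where
  "monomial_map T k c A T' k' c' B k'' c'' f \<longleftrightarrow>
     (\<forall>j<k''. (\<forall>a. A j = Some a \<longrightarrow> a < k) \<and> (\<forall>b. B j = Some b \<longrightarrow> b < k') \<and>
       (\<forall>x\<in>topspace T. \<forall>y\<in>topspace T'. c'' j (f (x, y)) = monomial (A j) c x * monomial (B j) c' y))"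

lemma singular_simplex_topspace: "singular_simplex p T s \<Longrightarrow> x \<in> standard_simplex p \<Longrightarrow> s x \<in> topspace T"
  unfolding singular_simplex_def continuous_map_def by auto

lemma monomial_log:
  assumes "torus_coords T k c" "singular_simplex p T s" "\<forall>a. A j = Some a \<longrightarrow> a < k" "j < k'"
  obtains g where "continuous_on (standard_simplex p) g"
    and "\<And>x. x \<in> standard_simplex p \<Longrightarrow> monomial (A j) c (s x) = exp (g x)"
    and "\<And>a b. \<lbrakk>a \<le> p; b \<le> p\<rbrakk> \<Longrightarrow>
      monomial_linear k' A (potential k c p s b) j - monomial_linear k' A (potential k c p s a) j =
      rat_char (g (vertex b)) - rat_char (g (vertex a))"
proof (cases "A j")
  case None
  show thesis
    by (rule that[of "\<lambda>x. 0"]) (use None in \<open>auto simp: monomial_def monomial_linear_def\<close>)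
next
  case (Some a)
  then have a: "a < k"
    using assms(3) by blast
  obtain g where g: "continuous_on (standard_simplex p) g"
    "\<And>x. x \<in> standard_simplex p \<Longrightarrow> c a (s x) = exp (g x)"
    using torus_coords_log[OF assms(1,2) a] by blast
  show thesis
  proof (rule that[OF g(1)])
    show "monomial (A j) c (s x) = exp (g x)" if "x \<in> standard_simplex p" for x
      using g(2)[OF that] Some by (simp add: monomial_def)
    show "monomial_linear k' A (potential k c p s b') j - monomial_linear k' A (potential k c p s a') j =
      rat_char (g (vertex b')) - rat_char (g (vertex a'))" if "a' \<le> p" "b' \<le> p" for a' b'
      using log_vertex_diff[OF g that] Some a assms(4) by (simp add: monomial_linear_def potential_def)
  qed
qed

text \<open>The logarithm of a product is the sum of the logarithms. So up to translation the
  vertices of a composite simplex are sums of linear images of the vertices of its factors, which is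
  the shape required by \<open>shuffle_sum_edges\<close>.\<close>

lemma edges_potential_pair_simplex:
  assumes c: "torus_coords T k c" and s: "singular_simplex p T s"
    and c': "torus_coords T' k' c'" and t: "singular_simplex q T' t"
    and f: "monomial_map T k c A T' k' c' B k'' c'' f"
    and l: "set l \<subseteq> {..p} \<times> {..q}" "length l = Suc n"
  shows "edges (map (potential k'' c'' n (simplex_map n f (pair_simplex s t l))) [0..<Suc n]) =
    edges (map (\<lambda>(u, v) i. monomial_linear k'' A u i + monomial_linear k'' B v i)
      (map (map_prod (potential k c p s) (potential k' c' q t)) l))" (is "edges ?L = edges ?R")
proof (rule edges_cong)
  show "length ?L = length ?R"
    using l by simp
  fix i j assume "Suc i < length ?L"
  then have i: "Suc i \<le> n" by simp
  have lp: "fst (l ! b) \<le> p" "snd (l ! b) \<le> q" if "b \<le> n" for b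
  proof -
    have "l ! b \<in> {..p} \<times> {..q}"
      using l that by (metis le_imp_less_Suc nth_mem subsetD)
    then show "fst (l ! b) \<le> p" "snd (l ! b) \<le> q"
      by (simp_all add: mem_Times_iff)
  qed
  let ?s = "simplex_map n f (pair_simplex s t l)"
  let ?F = "\<lambda>b. monomial_linear k'' A (potential k c p s (fst (l ! b))) j"
  let ?G = "\<lambda>b. monomial_linear k'' B (potential k' c' q t (snd (l ! b))) j"
  have "potential k'' c'' n ?s (Suc i) j - potential k'' c'' n ?s i j = ?F (Suc i) + ?G (Suc i) - (?F i + ?G i)"
  proof (cases "j < k''")
    case True
    have Aj: "\<forall>a. A j = Some a \<longrightarrow> a < k" and Bj: "\<forall>b. B j = Some b \<longrightarrow> b < k'"
      and fj: "\<And>x y. \<lbrakk>x \<in> topspace T; y \<in> topspace T'\<rbrakk> \<Longrightarrow>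
        c'' j (f (x, y)) = monomial (A j) c x * monomial (B j) c' y"
      using f True unfolding monomial_map_def by auto
    obtain g where g: "continuous_on (standard_simplex p) g"
      "\<And>x. x \<in> standard_simplex p \<Longrightarrow> monomial (A j) c (s x) = exp (g x)"
      "\<And>a b. \<lbrakk>a \<le> p; b \<le> p\<rbrakk> \<Longrightarrow>
        monomial_linear k'' A (potential k c p s b) j - monomial_linear k'' A (potential k c p s a) j =
        rat_char (g (vertex b)) - rat_char (g (vertex a))"
      using monomial_log[where A = A and j = j, OF c s Aj True] by blast
    obtain h where h: "continuous_on (standard_simplex q) h"
      "\<And>x. x \<in> standard_simplex q \<Longrightarrow> monomial (B j) c' (t x) = exp (h x)"
      "\<And>a b. \<lbrakk>a \<le> q; b \<le> q\<rbrakk> \<Longrightarrow>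
        monomial_linear k'' B (potential k' c' q t b) j - monomial_linear k'' B (potential k' c' q t a) j =
        rat_char (h (vertex b)) - rat_char (h (vertex a))"
      using monomial_log[where A = B and j = j, OF c' t Bj True] by blast
    let ?l1 = "map fst l" and ?l2 = "map snd l"
    have sub: "set ?l1 \<subseteq> {..p}" "?l1 \<noteq> []" "set ?l2 \<subseteq> {..q}" "?l2 \<noteq> []"
      using l by auto
    have vm: "continuous_on (standard_simplex n) (vertex_map ?l1)" "vertex_map ?l1 ` standard_simplex n \<subseteq> standard_simplex p"
      "continuous_on (standard_simplex n) (vertex_map ?l2)" "vertex_map ?l2 ` standard_simplex n \<subseteq> standard_simplex q"
      using continuous_on_vertex_map[OF sub(1,2)] continuous_on_vertex_map[OF sub(3,4)] l(2) by simp_all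
    let ?gh = "\<lambda>x. g (vertex_map ?l1 x) + h (vertex_map ?l2 x)"
    have "log_vertex n (\<lambda>x. c'' j (?s x)) (Suc i) - log_vertex n (\<lambda>x. c'' j (?s x)) i =
        rat_char (?gh (vertex (Suc i))) - rat_char (?gh (vertex i))"
    proof (rule log_vertex_diff)
      show "continuous_on (standard_simplex n) ?gh"
        by (intro continuous_on_add continuous_on_compose2[OF g(1) vm(1,2)] continuous_on_compose2[OF h(1) vm(3,4)])
      show "c'' j (?s x) = exp (?gh x)" if x: "x \<in> standard_simplex n" for x
      proof -
        have "vertex_map ?l1 x \<in> standard_simplex p" "vertex_map ?l2 x \<in> standard_simplex q"
          using x vm by auto
        then show ?thesis
          using x l(2) fj g(2) h(2) s t
          by (simp add: simplex_map_def pair_simplex_def singular_simplex_topspace exp_add)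
      qed
    qed (use i in auto)
    moreover have "rat_char (?gh (vertex b)) = rat_char (g (vertex (fst (l ! b)))) + rat_char (h (vertex (snd (l ! b))))"
      if "b \<le> n" for b
      using that l by (simp add: vertex_map_vertex rat_char_add)
    ultimately have "log_vertex n (\<lambda>x. c'' j (?s x)) (Suc i) - log_vertex n (\<lambda>x. c'' j (?s x)) i =
       (rat_char (g (vertex (fst (l ! Suc i)))) - rat_char (g (vertex (fst (l ! i)))))
       + (rat_char (h (vertex (snd (l ! Suc i)))) - rat_char (h (vertex (snd (l ! i)))))"
      using i by simp
    also have "\<dots> = (?F (Suc i) - ?F i) + (?G (Suc i) - ?G i)"
      using i lp by (simp add: g(3) h(3))
    finally show ?thesis
      using True by (simp add: potential_def)
  qed (simp add: potential_def monomial_linear_def)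
  then show "(?L ! Suc i) j - (?L ! i) j = (?R ! Suc i) j - (?R ! i) j"
    using i l by (simp add: case_prod_unfold del: upt_Suc)
qed

definition simplex_edges :: "nat \<Rightarrow> (nat \<Rightarrow> 'a \<Rightarrow> complex) \<Rightarrow> nat \<Rightarrow> ((nat \<Rightarrow> real) \<Rightarrow> 'a) \<Rightarrow> (nat \<Rightarrow> rat) list" where
  "simplex_edges k c p s = edges (map (potential k c p s) [0..<Suc p])"

definition form_eval ::
    "nat \<Rightarrow> (nat \<Rightarrow> 'a \<Rightarrow> complex) \<Rightarrow> nat \<Rightarrow> ((nat \<Rightarrow> rat) list \<Rightarrow> rat) \<Rightarrow> 'a rat_chain \<Rightarrow> rat" where
  "form_eval k c p D = rat_eval (\<lambda>s. D (simplex_edges k c p s))"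

lemma length_simplex_edges [simp]: "length (simplex_edges k c p s) = p"
  by (simp add: simplex_edges_def)

text \<open>Forms are cocycles: subsimplices have the edges of the corresponding vertex lists, and
  there \<open>face_sum_edges\<close> applies.\<close>

lemma form_eval_boundary:
  assumes c: "torus_coords T k c" and a: "a \<in> rat_chains (Suc p) T" and D: "alternating_form p D"
  shows "form_eval k c p D (rat_boundary (int (Suc p)) a) = 0"
proof -
  have "form_eval k c p D (face_sum (\<lambda>l. Poly_Mapping.single (sub_simplex s l) 1) [0..<Suc (Suc p)]) = 0"
    if s: "singular_simplex (Suc p) T s" for s
  proof -
    have "form_eval k c p D (face_sum (\<lambda>l. Poly_Mapping.single (sub_simplex s l) 1) [0..<Suc (Suc p)]) =
      face_sum (\<lambda>l. D (simplex_edges k c p (sub_simplex s l))) [0..<Suc (Suc p)]"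
      unfolding form_eval_def rat_eval_face_sum by (simp del: upt_Suc)
    also have "\<dots> = face_sum (\<lambda>l. D (edges (map (potential k c (Suc p) s) l))) [0..<Suc (Suc p)]"
      unfolding simplex_edges_def
      by (rule face_sum_cong, subst edges_potential_sub_simplex[OF c s]) auto
    also have "\<dots> = face_sum (\<lambda>l. D (edges l)) (map (potential k c (Suc p) s) [0..<Suc (Suc p)])"
      by (rule face_sum_map[symmetric])
    also have "\<dots> = 0"
      by (rule face_sum_edges[OF D]) simp
    finally show ?thesis .
  qed
  then have "rat_eval (\<lambda>s. form_eval k c p D
      (face_sum (\<lambda>l. Poly_Mapping.single (sub_simplex s l) 1) [0..<Suc (Suc p)])) a = rat_eval (\<lambda>s. 0) a"
    by (intro rat_eval_cong) (use a in \<open>auto simp: rat_chains_def simp del: upt_Suc\<close>)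
  then show ?thesis
    unfolding rat_boundary_eq form_eval_def by (simp add: rat_eval_rat_extend del: upt_Suc)
qed

text \<open>The pairing of a form with a composite depends only on the edges of the two factors
  separately. This gives both the ideal property of the kernel and the periods of products of
  loops.\<close>

lemma form_eval_eilenberg_zilber:
  assumes c: "torus_coords T k c" and a: "a \<in> rat_chains p T"
    and c': "torus_coords T' k' c'" and b: "b \<in> rat_chains q T'"
    and f: "monomial_map T k c A T' k' c' B k'' c'' f" and D: "alternating_form (p + q) D"
  shows "form_eval k'' c'' (p + q) D (rat_chain_map (p + q) f (eilenberg_zilber p q a b)) =
    of_nat (p + q choose p) * rat_eval (\<lambda>s. rat_eval (\<lambda>t.
      D (map (monomial_linear k'' A) (simplex_edges k c p s) @ map (monomial_linear k'' B) (simplex_edges k' c' q t))) b) a"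
proof -
  have "form_eval k'' c'' (p + q) D (rat_chain_map (p + q) f (ez_simplex p q s t)) =
    of_nat (p + q choose p) *
      D (map (monomial_linear k'' A) (simplex_edges k c p s) @ map (monomial_linear k'' B) (simplex_edges k' c' q t))"
    if s: "singular_simplex p T s" and t: "singular_simplex q T' t" for s t
  proof -
    let ?h = "\<lambda>(u, v) i. monomial_linear k'' A u i + monomial_linear k'' B v i"
    have "form_eval k'' c'' (p + q) D (rat_chain_map (p + q) f (ez_simplex p q s t)) =
      shuffle_sum (\<lambda>l. D (simplex_edges k'' c'' (p + q) (simplex_map (p + q) f (pair_simplex s t l))))
        [0..<Suc p] [0..<Suc q]"
      unfolding ez_simplex_def form_eval_def rat_chain_map_shuffle_sum rat_eval_shuffle_sum by (simp del: upt_Suc)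
    also have "\<dots> = shuffle_sum (\<lambda>l. D (edges (map ?h (map (map_prod (potential k c p s) (potential k' c' q t)) l))))
        [0..<Suc p] [0..<Suc q]"
      unfolding simplex_edges_def
      by (rule shuffle_sum_cong, subst edges_potential_pair_simplex[OF c s c' t f]) auto
    also have "\<dots> = shuffle_sum (\<lambda>l. D (edges (map ?h l)))
        (map (potential k c p s) [0..<Suc p]) (map (potential k' c' q t) [0..<Suc q])"
      by (rule shuffle_sum_map[symmetric])
    also have "\<dots> = of_nat (p + q choose p) *
      D (map (monomial_linear k'' A) (simplex_edges k c p s) @ map (monomial_linear k'' B) (simplex_edges k' c' q t))"
      unfolding simplex_edges_def by (rule shuffle_sum_edges[OF _ _ D]) simp_all
    finally show ?thesis .
  qed
  then have "rat_eval (\<lambda>s. rat_eval (\<lambda>t. form_eval k'' c'' (p + q) D (rat_chain_map (p + q) f (ez_simplex p q s t))) b) a =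
    rat_eval (\<lambda>s. rat_eval (\<lambda>t. of_nat (p + q choose p) *
      D (map (monomial_linear k'' A) (simplex_edges k c p s) @ map (monomial_linear k'' B) (simplex_edges k' c' q t))) b) a"
    using a b by (intro rat_eval_cong) (auto simp: rat_chains_def)
  then show ?thesis
    unfolding eilenberg_zilber_def' rat_chain_map_rat_extend form_eval_def rat_eval_rat_extend rat_eval_fun_scale .
qed

section \<open>Homology of tori\<close>

lemma continuous_map_complex_intros:
  fixes f g :: "'a \<Rightarrow> complex"
  assumes "continuous_map T euclidean f"
  shows "continuous_map T euclidean g \<Longrightarrow> continuous_map T euclidean (\<lambda>x. f x * g x)"
    and "continuous_map T euclidean g \<Longrightarrow> continuous_map T euclidean (\<lambda>x. f x + g x)"
    and "continuous_map T euclidean (\<lambda>x. exp (f x))"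
  using assms by (simp_all add: continuous_map_atin tendsto_mult tendsto_add tendsto_exp)

lemma continuous_map_Cstar_iff:
  "continuous_map T Cstar f \<longleftrightarrow> continuous_map T euclidean f \<and> (\<forall>x\<in>topspace T. f x \<noteq> 0)"
  by (auto simp: continuous_map_in_subtopology)

definition torus :: "nat \<Rightarrow> (nat \<Rightarrow> complex) topology" where
  "torus k = product_topology (\<lambda>_. Cstar) {..<k}"

text \<open>The infinite cyclic covering of \<open>torus (Suc k)\<close> through
  \<open>cover_proj\<close>: the last factor is unrolled by exp. Scaling that factor to 0 contracts
  it onto \<open>torus k\<close>, and translation of it by 2 pi i generates the deck group.\<close>

definition torus_cover :: "nat \<Rightarrow> (nat \<Rightarrow> complex) topology" where
  "torus_cover k = product_topology (\<lambda>i. if i < k then Cstar else euclidean) {..<Suc k}"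

lemma topspace_torus: "z \<in> topspace (torus k) \<longleftrightarrow> z \<in> extensional {..<k} \<and> (\<forall>i<k. z i \<noteq> 0)"
  by (auto simp: torus_def PiE_def)

lemma topspace_torus_cover:
  "z \<in> topspace (torus_cover k) \<longleftrightarrow> z \<in> extensional {..<Suc k} \<and> (\<forall>i<k. z i \<noteq> 0)"
  by (auto simp: torus_cover_def PiE_def Pi_def)

lemma continuous_map_torus_coord: "j < k \<Longrightarrow> continuous_map (torus k) Cstar (\<lambda>z. z j)"
  unfolding torus_def by (rule continuous_map_product_projection) simp

lemma continuous_map_cover_coord: "j < k \<Longrightarrow> continuous_map (torus_cover k) Cstar (\<lambda>z. z j)"
  using continuous_map_product_projection[of j "{..<Suc k}" "\<lambda>i. if i < k then Cstar else euclidean"]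
  unfolding torus_cover_def by simp

lemma continuous_map_cover_last: "continuous_map (torus_cover k) euclidean (\<lambda>z. z k)"
  using continuous_map_product_projection[of k "{..<Suc k}" "\<lambda>i. if i < k then Cstar else euclidean"]
  unfolding torus_cover_def by simp

lemma continuous_map_into_torus:
  "\<lbrakk>\<And>x. x \<in> topspace T \<Longrightarrow> f x \<in> extensional {..<k}; \<And>j. j < k \<Longrightarrow> continuous_map T Cstar (\<lambda>x. f x j)\<rbrakk> \<Longrightarrow>
    continuous_map T (torus k) f"
  unfolding torus_def continuous_map_componentwise by auto

lemma continuous_map_into_torus_cover:
  "\<lbrakk>\<And>x. x \<in> topspace T \<Longrightarrow> f x \<in> extensional {..<Suc k}; \<And>j. j < k \<Longrightarrow> continuous_map T Cstar (\<lambda>x. f x j);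
     continuous_map T euclidean (\<lambda>x. f x k)\<rbrakk> \<Longrightarrow>
    continuous_map T (torus_cover k) f"
  unfolding torus_cover_def continuous_map_componentwise by (auto simp: less_Suc_eq)

definition torus_act :: "nat \<Rightarrow> nat \<Rightarrow> (nat \<Rightarrow> complex) \<times> complex \<Rightarrow> nat \<Rightarrow> complex" where
  "torus_act k i = (\<lambda>(z, w). \<lambda>j\<in>{..<k}. if j = i then z j * w else z j)"

definition cover_add :: "nat \<Rightarrow> (nat \<Rightarrow> complex) \<times> complex \<Rightarrow> nat \<Rightarrow> complex" where
  "cover_add k = (\<lambda>(z, w). \<lambda>j\<in>{..<Suc k}. if j = k then z j + w else z j)"

definition cover_scale :: "nat \<Rightarrow> (nat \<Rightarrow> complex) \<times> complex \<Rightarrow> nat \<Rightarrow> complex" where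
  "cover_scale k = (\<lambda>(z, w). \<lambda>j\<in>{..<Suc k}. if j = k then z j * w else z j)"

definition cover_proj :: "nat \<Rightarrow> (nat \<Rightarrow> complex) \<Rightarrow> nat \<Rightarrow> complex" where
  "cover_proj k z = (\<lambda>j\<in>{..<Suc k}. if j = k then exp (z j) else z j)"

definition cover_incl :: "nat \<Rightarrow> (nat \<Rightarrow> complex) \<Rightarrow> nat \<Rightarrow> complex" where
  "cover_incl k z = (\<lambda>j\<in>{..<Suc k}. if j = k then 0 else z j)"

lemma continuous_torus_act:
  "continuous_map (prod_topology (torus k) Cstar) (torus k) (torus_act k i)"
proof (rule continuous_map_into_torus)
  let ?P = "prod_topology (torus k) Cstar"
  fix j assume j: "j < k"
  have 1: "continuous_map ?P Cstar (\<lambda>x. fst x j)"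
    using continuous_map_compose[OF continuous_map_fst continuous_map_torus_coord[OF j]] by (simp add: comp_def)
  have 2: "continuous_map ?P Cstar snd"
    by (rule continuous_map_snd)
  have "continuous_map ?P Cstar (\<lambda>x. fst x j * snd x)"
    using 1 2 continuous_map_complex_intros(1) unfolding continuous_map_Cstar_iff by auto
  then show "continuous_map ?P Cstar (\<lambda>x. torus_act k i x j)"
    using 1 j by (cases "j = i") (simp_all add: torus_act_def case_prod_unfold)
qed (auto simp: torus_act_def)

lemma continuous_cover_add:
  "continuous_map (prod_topology (torus_cover k) euclidean) (torus_cover k) (cover_add k)"
  and continuous_cover_scale:
  "continuous_map (prod_topology (torus_cover k) euclidean) (torus_cover k) (cover_scale k)"
proof -
  let ?P = "prod_topology (torus_cover k) (euclidean :: complex topology)"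
  have 1: "continuous_map ?P Cstar (\<lambda>x. fst x j)" if "j < k" for j
    using continuous_map_compose[OF continuous_map_fst continuous_map_cover_coord[OF that]] by (simp add: comp_def)
  have 2: "continuous_map ?P euclidean (\<lambda>x. fst x k)"
    using continuous_map_compose[OF continuous_map_fst continuous_map_cover_last] by (simp add: comp_def)
  have 3: "continuous_map ?P euclidean snd"
    by (rule continuous_map_snd)
  show "continuous_map ?P (torus_cover k) (cover_add k)"
    by (rule continuous_map_into_torus_cover)
      (use 1 2 3 continuous_map_complex_intros(2)[OF 2 3] in \<open>simp_all add: cover_add_def case_prod_unfold\<close>)
  show "continuous_map ?P (torus_cover k) (cover_scale k)"
    by (rule continuous_map_into_torus_cover)
      (use 1 2 3 continuous_map_complex_intros(1)[OF 2 3] in \<open>simp_all add: cover_scale_def case_prod_unfold\<close>)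
qed

lemma continuous_cover_proj: "continuous_map (torus_cover k) (torus (Suc k)) (cover_proj k)"
proof (rule continuous_map_into_torus)
  fix j assume "j < Suc k"
  then consider "j < k" | "j = k" by linarith
  then show "continuous_map (torus_cover k) Cstar (\<lambda>z. cover_proj k z j)"
  proof cases
    case 1
    then show ?thesis
      using continuous_map_cover_coord[OF 1] by (simp add: cover_proj_def)
  next
    case 2
    then show ?thesis
      using continuous_map_complex_intros(3)[OF continuous_map_cover_last]
      by (simp add: cover_proj_def continuous_map_Cstar_iff)
  qed
qed (auto simp: cover_proj_def)

lemma continuous_cover_incl: "continuous_map (torus k) (torus_cover k) (cover_incl k)"
  by (rule continuous_map_into_torus_cover) (auto simp: cover_incl_def continuous_map_torus_coord)

lemma continuous_cover_forget: "continuous_map (torus_cover k) (torus k) (\<lambda>z. restrict z {..<k})"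
  by (rule continuous_map_into_torus) (auto simp: continuous_map_cover_coord)

lemma continuous_map_pair_const: "a \<in> topspace T' \<Longrightarrow> continuous_map T (prod_topology T T') (\<lambda>z. (z, a))"
  by (simp add: continuous_map_paired)

section \<open>Cycles, prisms and products with loops\<close>

definition rat_cycles :: "nat \<Rightarrow> 'a topology \<Rightarrow> 'a rat_chain set" where
  "rat_cycles p T = {c \<in> rat_chains p T. rat_boundary (int p) c = 0}"

lemma rat_cyclesD: "c \<in> rat_cycles p T \<Longrightarrow> c \<in> rat_chains p T" "c \<in> rat_cycles p T \<Longrightarrow> rat_boundary (int p) c = 0"
  by (simp_all add: rat_cycles_def)

lemma rat_cycles_map: "c \<in> rat_cycles p T \<Longrightarrow> continuous_map T T' f \<Longrightarrow> rat_chain_map p f c \<in> rat_cycles p T'"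
  by (auto simp: rat_cycles_def rat_boundary_rat_chain_map intro: rat_chain_map_in)

lemma rat_cycles_add: "c \<in> rat_cycles p T \<Longrightarrow> c' \<in> rat_cycles p T \<Longrightarrow> c + c' \<in> rat_cycles p T"
  and rat_cycles_scale: "c \<in> rat_cycles p T \<Longrightarrow> rat_scale r c \<in> rat_cycles p T"
  and rat_cycles_0: "0 \<in> rat_cycles p T"
  by (simp_all add: rat_cycles_def rat_chains_add rat_boundary_add rat_chains_scale rat_boundary_scale)

lemma rat_cycles_sum: "(\<And>i. i \<in> I \<Longrightarrow> f i \<in> rat_cycles p T) \<Longrightarrow> (\<Sum>i\<in>I. f i) \<in> rat_cycles p T"
  by (induction I rule: infinite_finite_induct) (auto intro: rat_cycles_add rat_cycles_0)

definition ray :: "complex \<Rightarrow> (nat \<Rightarrow> real) \<Rightarrow> complex" where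
  "ray a = (\<lambda>x\<in>standard_simplex 1. of_real (x 1) * a)"

lemma singular_simplex_ray: "singular_simplex 1 euclidean (ray a)"
proof -
  have "continuous_on (standard_simplex 1) (\<lambda>x. of_real (x 1) * a)"
    by (intro continuous_intros continuous_on_subset[OF continuous_on_product_coordinates subset_UNIV])
  then have "continuous_map (subtopology (powertop_real UNIV) (standard_simplex 1)) euclidean (\<lambda>x. of_real (x 1) * a)"
    by (simp only: powertop_real_euclidean continuous_map_iff_continuous)
  then have "continuous_map (subtopology (powertop_real UNIV) (standard_simplex 1)) euclidean (ray a)"
    by (rule continuous_map_eq) (auto simp: ray_def)
  then show ?thesis
    by (simp add: singular_simplex_def ray_def)
qed

lemma rat_boundary_ray:
  "rat_boundary (int 1) (Poly_Mapping.single (ray a) 1) = point_chain a - point_chain 0"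
proof -
  have face: "simplical_face k x \<in> standard_simplex 1" if "k \<le> 1" "x \<in> standard_simplex 0" for k and x :: "nat \<Rightarrow> real"
    using simplical_face_in_standard_simplex[of 1 k x] that by simp
  have x0: "x 0 = 1" if "x \<in> standard_simplex 0" for x :: "nat \<Rightarrow> real"
    using that by (simp add: standard_simplex_def)
  have "singular_face 1 0 (ray a) = (\<lambda>x\<in>standard_simplex 0. a)"
    using face[of 0] x0 by (auto simp: singular_face_def ray_def simplical_face_def fun_eq_iff)
  moreover have "singular_face 1 1 (ray a) = (\<lambda>x\<in>standard_simplex 0. 0)"
    using face[of 1] x0 by (auto simp: singular_face_def ray_def simplical_face_def fun_eq_iff)
  moreover have "rat_boundary (int 1) (Poly_Mapping.single (ray a) 1) =
      Poly_Mapping.single (singular_face 1 0 (ray a)) 1 - Poly_Mapping.single (singular_face 1 1 (ray a)) 1"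
    by (simp add: rat_boundary_def single_uminus)
  ultimately show ?thesis
    by simp
qed

text \<open>The prism operator of the homotopy that moves the second argument of \<open>h\<close>
  along the segment from 0 to \<open>a\<close>.\<close>

definition homotopy_chain :: "nat \<Rightarrow> ('a \<times> complex \<Rightarrow> 'b) \<Rightarrow> complex \<Rightarrow> 'a rat_chain \<Rightarrow> 'b rat_chain" where
  "homotopy_chain p h a c = rat_chain_map (p + 1) h (eilenberg_zilber p 1 c (Poly_Mapping.single (ray a) 1))"

lemma homotopy_chain_in:
  assumes "c \<in> rat_chains p T" "continuous_map (prod_topology T euclidean) T' h"
  shows "homotopy_chain p h a c \<in> rat_chains (Suc p) T'"
proof -
  have "eilenberg_zilber p 1 c (Poly_Mapping.single (ray a) 1) \<in> rat_chains (p + 1) (prod_topology T euclidean)"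
    using assms(1) singular_simplex_ray by (intro eilenberg_zilber_in) simp_all
  from rat_chain_map_in[OF this assms(2)] show ?thesis
    by (simp add: homotopy_chain_def)
qed

text \<open>In the Leibniz rule only the boundary of the segment remains, since \<open>c\<close> is
  a cycle; passing it over \<open>c\<close> produces the sign.\<close>

lemma rat_boundary_homotopy_chain:
  assumes "c \<in> rat_cycles p T"
  shows "rat_boundary (int (Suc p)) (homotopy_chain p h a c) =
    alternate p (rat_chain_map p (\<lambda>z. h (z, a)) c - rat_chain_map p (\<lambda>z. h (z, 0)) c)"
proof -
  have "rat_boundary (int (p + 1)) (homotopy_chain p h a c) =
    rat_chain_map p h (alternate p (eilenberg_zilber p 0 c (point_chain a - point_chain 0)))"
    unfolding homotopy_chain_def rat_boundary_rat_chain_map rat_boundary_eilenberg_zilber rat_boundary_ray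
    using rat_cyclesD(2)[OF assms] by simp
  also have "\<dots> = alternate p (rat_chain_map p (\<lambda>z. h (z, a)) c - rat_chain_map p (\<lambda>z. h (z, 0)) c)"
    unfolding rat_chain_map_alternate eilenberg_zilber_diff eilenberg_zilber_point_right
      rat_chain_map_diff rat_chain_map_rat_chain_map by (simp add: comp_def)
  finally show ?thesis by simp
qed

text \<open>The image under exp of the segment from 0 to 2 pi i: the circle traversed once.\<close>

definition loop :: "(nat \<Rightarrow> real) \<Rightarrow> complex" where
  "loop = simplex_map 1 exp (ray (2 * of_real pi * \<i>))"

lemma loop_cycle: "Poly_Mapping.single loop 1 \<in> rat_cycles 1 Cstar"
proof -
  have "continuous_map euclidean Cstar exp"
    using continuous_map_complex_intros(3)[of euclidean "\<lambda>x. x"] by (simp add: continuous_map_Cstar_iff)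
  then have "singular_simplex 1 Cstar loop"
    unfolding loop_def by (rule singular_simplex_simplex_map[OF singular_simplex_ray])
  moreover have "rat_boundary (int 1) (Poly_Mapping.single loop 1) =
      rat_chain_map 0 exp (rat_boundary (int 1) (Poly_Mapping.single (ray (2 * of_real pi * \<i>)) 1))"
    using rat_boundary_rat_chain_map[of 1 exp "Poly_Mapping.single (ray (2 * of_real pi * \<i>)) 1"]
    by (simp add: loop_def)
  moreover have "simplex_map 0 exp (\<lambda>x\<in>standard_simplex 0. 2 * of_real pi * \<i>) =
      simplex_map 0 exp (\<lambda>x\<in>standard_simplex 0. 0)"
    by (auto simp: simplex_map_def fun_eq_iff)
  ultimately show ?thesis
    unfolding rat_boundary_ray by (simp add: rat_cycles_def rat_chain_map_diff)
qed

text \<open>The Pontryagin product with the loop in coordinate \<open>i\<close>. Only this one-loop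
  product is needed, as larger cycles are built one loop at a time.\<close>

definition torus_mult :: "nat \<Rightarrow> nat \<Rightarrow> nat \<Rightarrow> (nat \<Rightarrow> complex) rat_chain \<Rightarrow> (nat \<Rightarrow> complex) rat_chain" where
  "torus_mult k i p c = rat_chain_map (p + 1) (torus_act k i) (eilenberg_zilber p 1 c (Poly_Mapping.single loop 1))"

lemma torus_mult_in: "c \<in> rat_chains p (torus k) \<Longrightarrow> torus_mult k i p c \<in> rat_chains (Suc p) (torus k)"
proof -
  assume "c \<in> rat_chains p (torus k)"
  then have "eilenberg_zilber p 1 c (Poly_Mapping.single loop 1) \<in> rat_chains (p + 1) (prod_topology (torus k) Cstar)"
    by (intro eilenberg_zilber_in rat_cyclesD(1)[OF loop_cycle])
  from rat_chain_map_in[OF this continuous_torus_act] show ?thesis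
    by (simp add: torus_mult_def)
qed

lemma rat_boundary_torus_mult:
  "rat_boundary (int (Suc p)) (torus_mult k i p c) = (if p = 0 then 0 else torus_mult k i (p - 1) (rat_boundary (int p) c))"
proof -
  have "rat_boundary (int (p + 1)) (torus_mult k i p c) =
      rat_chain_map p (torus_act k i) (eilenberg_zilber (p - 1) 1 (rat_boundary (int p) c) (Poly_Mapping.single loop 1))"
    unfolding torus_mult_def rat_boundary_rat_chain_map rat_boundary_eilenberg_zilber rat_cyclesD(2)[OF loop_cycle]
    by simp
  also have "\<dots> = (if p = 0 then 0 else torus_mult k i (p - 1) (rat_boundary (int p) c))"
    by (cases p) (simp_all add: torus_mult_def rat_boundary_def)
  finally show ?thesis by simp
qed

lemma torus_mult_cycle: "c \<in> rat_cycles p (torus k) \<Longrightarrow> torus_mult k i p c \<in> rat_cycles (Suc p) (torus k)"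
  unfolding rat_cycles_def mem_Collect_eq rat_boundary_torus_mult
  by (auto simp: torus_mult_in) (simp add: torus_mult_def)

lemma torus_mult_add: "torus_mult k i p (c + c') = torus_mult k i p c + torus_mult k i p c'"
  and torus_mult_scale: "torus_mult k i p (rat_scale r c) = rat_scale r (torus_mult k i p c)"
  and torus_mult_0: "torus_mult k i p 0 = 0"
  by (simp_all add: torus_mult_def eilenberg_zilber_add rat_chain_map_add eilenberg_zilber_scale rat_chain_map_scale)

lemma torus_mult_sum: "torus_mult k i p (\<Sum>a\<in>A. f a) = (\<Sum>a\<in>A. torus_mult k i p (f a))"
  by (induction A rule: infinite_finite_induct) (auto simp: torus_mult_add torus_mult_0)

text \<open>The Pontryagin product of the coordinate loops in \<open>I\<close>, starting from the
  unit point. The head of the list is multiplied last, which is why a \<open>rev\<close> appears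
  when forms are evaluated.\<close>

primrec torus_cycle :: "nat \<Rightarrow> nat list \<Rightarrow> (nat \<Rightarrow> complex) rat_chain" where
  "torus_cycle k [] = point_chain (\<lambda>j\<in>{..<k}. 1)"
| "torus_cycle k (i # I) = torus_mult k i (length I) (torus_cycle k I)"

lemma torus_cycle_cycle: "torus_cycle k I \<in> rat_cycles (length I) (torus k)"
proof (induction I)
  case Nil
  have "(\<lambda>j\<in>{..<k}. 1) \<in> topspace (torus k)"
    by (simp add: topspace_torus)
  then show ?case
    by (simp add: rat_cycles_def singular_simplex_def rat_boundary_def)
qed (simp add: torus_mult_cycle)

lemma torus_mult_incl:
  assumes "c \<in> rat_chains p (torus k)" "i < k"
  shows "rat_chain_map (Suc p) (cover_proj k \<circ> cover_incl k) (torus_mult k i p c) =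
    torus_mult (Suc k) i p (rat_chain_map p (cover_proj k \<circ> cover_incl k) c)"
proof -
  let ?f = "cover_proj k \<circ> cover_incl k"
  have W: "eilenberg_zilber p 1 c (Poly_Mapping.single loop 1) \<in> rat_chains (p + 1) (prod_topology (torus k) Cstar)"
    by (intro eilenberg_zilber_in assms rat_cyclesD(1)[OF loop_cycle])
  have "rat_chain_map (p + 1) ?f (torus_mult k i p c) =
      rat_chain_map (p + 1) (?f \<circ> torus_act k i) (eilenberg_zilber p 1 c (Poly_Mapping.single loop 1))"
    unfolding torus_mult_def rat_chain_map_rat_chain_map ..
  also have "\<dots> = rat_chain_map (p + 1) (torus_act (Suc k) i \<circ> map_prod ?f id)
      (eilenberg_zilber p 1 c (Poly_Mapping.single loop 1))"
    by (rule rat_chain_map_cong[OF W])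
      (use assms(2) in \<open>auto simp: cover_proj_def cover_incl_def torus_act_def fun_eq_iff\<close>)
  also have "\<dots> = torus_mult (Suc k) i p (rat_chain_map p ?f c)"
    unfolding torus_mult_def eilenberg_zilber_map_left[OF rat_cyclesD(1)[OF loop_cycle]]
      rat_chain_map_rat_chain_map ..
  finally show ?thesis by simp
qed

lemma torus_cycle_incl:
  "set I \<subseteq> {..<k} \<Longrightarrow>
    rat_chain_map (length I) (cover_proj k \<circ> cover_incl k) (torus_cycle k I) = torus_cycle (Suc k) I"
proof (induction I)
  case Nil
  have "simplex_map 0 (cover_proj k \<circ> cover_incl k) (\<lambda>x\<in>standard_simplex 0. \<lambda>j\<in>{..<k}. 1) =
      (\<lambda>x\<in>standard_simplex 0. \<lambda>j\<in>{..<Suc k}. 1)"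
    by (auto simp: simplex_map_def cover_proj_def cover_incl_def fun_eq_iff)
  then show ?case
    by (simp only: torus_cycle.simps rat_chain_map_single list.size)
next
  case (Cons i I)
  then show ?case
    using torus_mult_incl[OF rat_cyclesD(1)[OF torus_cycle_cycle[of k I]], of i] by (simp add: comp_def)
qed

section \<open>The covering and its deck transformations\<close>

abbreviation deck :: "nat \<Rightarrow> int \<Rightarrow> (nat \<Rightarrow> complex) \<Rightarrow> nat \<Rightarrow> complex" where
  "deck k n \<equiv> \<lambda>z. cover_add k (z, of_int n * (2 * of_real pi * \<i>))"

lemma continuous_deck: "continuous_map (torus_cover k) (torus_cover k) (deck k n)"
  using continuous_map_compose[OF continuous_map_pair_const continuous_cover_add] by (simp add: comp_def)

lemma lift_simplex:
  assumes "singular_simplex p (torus (Suc k)) \<sigma>"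
  shows "\<exists>s. singular_simplex p (torus_cover k) s \<and> simplex_map p (cover_proj k) s = \<sigma>"
proof -
  let ?D = "subtopology (powertop_real UNIV) (standard_simplex p)"
  have "torus_coords (torus (Suc k)) (Suc k) (\<lambda>j z. z j)"
    by (simp add: torus_coords_def continuous_map_torus_coord)
  then obtain g where g: "continuous_on (standard_simplex p) g"
    "\<And>x. x \<in> standard_simplex p \<Longrightarrow> \<sigma> x k = exp (g x)"
    using torus_coords_log[OF _ assms, of "Suc k" "\<lambda>j z. z j" k] by blast
  define s where "s = (\<lambda>x\<in>standard_simplex p. \<lambda>j\<in>{..<Suc k}. if j = k then g x else \<sigma> x j)"
  have "continuous_map ?D (torus_cover k) s"
  proof (rule continuous_map_into_torus_cover)
    fix j assume j: "j < k"
    have "continuous_map ?D Cstar ((\<lambda>z. z j) \<circ> \<sigma>)"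
      using assms continuous_map_torus_coord[of j "Suc k"] j
      unfolding singular_simplex_def by (intro continuous_map_compose[of _ "torus (Suc k)"]) auto
    then show "continuous_map ?D Cstar (\<lambda>x. s x j)"
      by (rule continuous_map_eq) (use j in \<open>auto simp: s_def\<close>)
  next
    have "continuous_map ?D euclidean g"
      using g(1) by (simp only: powertop_real_euclidean continuous_map_iff_continuous)
    then show "continuous_map ?D euclidean (\<lambda>x. s x k)"
      by (rule continuous_map_eq) (auto simp: s_def)
  qed (auto simp: s_def)
  then have "singular_simplex p (torus_cover k) s"
    by (simp add: singular_simplex_def s_def)
  moreover have "simplex_map p (cover_proj k) s = \<sigma>"
  proof
    fix x
    show "simplex_map p (cover_proj k) s x = \<sigma> x"
    proof (cases "x \<in> standard_simplex p")
      case True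
      then have "\<sigma> x \<in> extensional {..<Suc k}"
        using singular_simplex_topspace[OF assms True] by (simp add: topspace_torus)
      then show ?thesis
        using True g(2) by (auto simp: simplex_map_def s_def cover_proj_def extensional_def fun_eq_iff)
    next
      case False
      then show ?thesis
        using assms by (auto simp: simplex_map_def singular_simplex_def extensional_def)
    qed
  qed
  ultimately show ?thesis by blast
qed

text \<open>Two lifts differ only in the last coordinate, where both are continuous logarithms of
  the same function; by \<open>log_difference\<close> the difference at vertex 0, a multiple of 2 pi
  i, is the difference everywhere.\<close>

lemma lift_unique:
  assumes s: "singular_simplex p (torus_cover k) s" and t: "singular_simplex p (torus_cover k) t"
    and eq: "simplex_map p (cover_proj k) s = simplex_map p (cover_proj k) t"
  shows "\<exists>n. s = simplex_map p (deck k n) t"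
proof -
  have eqx: "cover_proj k (s x) = cover_proj k (t x)" if "x \<in> standard_simplex p" for x
    using fun_cong[OF eq, of x] that by (simp add: simplex_map_def)
  have expk: "exp (s x k) = exp (t x k)" if "x \<in> standard_simplex p" for x
    using fun_cong[OF eqx[OF that], of k] by (simp add: cover_proj_def)
  have other: "s x j = t x j" if "x \<in> standard_simplex p" "j < k" for x j
    using fun_cong[OF eqx[OF that(1)], of j] that by (simp add: cover_proj_def)
  have cont: "continuous_on (standard_simplex p) (\<lambda>x. s' x k)" if "singular_simplex p (torus_cover k) s'" for s'
  proof -
    have "continuous_map (subtopology (powertop_real UNIV) (standard_simplex p)) euclidean ((\<lambda>z. z k) \<circ> s')"
      using that continuous_map_cover_last unfolding singular_simplex_def by (blast intro: continuous_map_compose)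
    then show ?thesis
      by (simp only: powertop_real_euclidean continuous_map_iff_continuous comp_def)
  qed
  obtain n :: int where n: "s (vertex 0) k = t (vertex 0) k + of_int (2 * n) * of_real pi * \<i>"
    using exp_eq[of "s (vertex 0) k" "t (vertex 0) k"] expk[of "vertex 0"] by auto
  have sk: "s x k = t x k + of_int n * (2 * of_real pi * \<i>)" if "x \<in> standard_simplex p" for x
  proof -
    have "s x k - s (vertex 0) k = t x k - t (vertex 0) k"
      by (rule log_difference[OF connected_standard_simplex cont[OF s] cont[OF t] expk]) (use that in auto)
    then show ?thesis
      using n by (simp add: algebra_simps)
  qed
  have "s = simplex_map p (deck k n) t"
  proof
    fix x
    show "s x = simplex_map p (deck k n) t x"
    proof (cases "x \<in> standard_simplex p")
      case True
      then have "s x \<in> extensional {..<Suc k}"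
        using singular_simplex_topspace[OF s True] by (simp add: topspace_torus_cover)
      then show ?thesis
        using True sk other by (auto simp: simplex_map_def cover_add_def extensional_def fun_eq_iff less_Suc_eq)
    next
      case False
      then show ?thesis
        using s by (auto simp: simplex_map_def singular_simplex_def extensional_def)
    qed
  qed
  then show ?thesis ..
qed

lemma deck_deck: "deck k m (deck k n z) = deck k (m + n) z"
  by (auto simp: cover_add_def fun_eq_iff algebra_simps)

lemma simplex_map_deck_deck: "simplex_map p (deck k m) (simplex_map p (deck k n) s) = simplex_map p (deck k (m + n)) s"
  by (auto simp: simplex_map_def deck_deck fun_eq_iff)

lemma deck_0:
  assumes "singular_simplex p (torus_cover k) s"
  shows "simplex_map p (deck k 0) s = s"
  by (rule simplex_map_id_gen[OF assms]) (auto simp: cover_add_def topspace_torus_cover extensional_def fun_eq_iff)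

text \<open>With T the deck transformation, T^n - 1 is divisible by T - 1 for every integer n; the
  witness grows or shrinks by one translate in each step of the induction.\<close>

lemma deck_power_difference:
  assumes s: "singular_simplex p (torus_cover k) s"
  shows "\<exists>u\<in>rat_chains p (torus_cover k).
    Poly_Mapping.single (simplex_map p (deck k n) s) 1 - Poly_Mapping.single s 1 = rat_chain_map p (deck k 1) u - u"
proof (induction n rule: int_induct[where k = 0])
  case base
  then show ?case
    by (intro bexI[of _ 0]) (simp_all add: deck_0[OF s, simplified])
next
  case (step1 n)
  then obtain u where u: "u \<in> rat_chains p (torus_cover k)"
    "Poly_Mapping.single (simplex_map p (deck k n) s) 1 - Poly_Mapping.single s 1 = rat_chain_map p (deck k 1) u - u"
    by blast
  let ?v = "Poly_Mapping.single (simplex_map p (deck k n) s) (1 :: rat)"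
  have v: "?v \<in> rat_chains p (torus_cover k)"
    using singular_simplex_simplex_map[OF s continuous_deck] by simp
  have "rat_chain_map p (deck k 1) ?v = Poly_Mapping.single (simplex_map p (deck k (n + 1)) s) 1"
    using simplex_map_deck_deck[of p k 1 n s] by (simp add: add.commute)
  then have "Poly_Mapping.single (simplex_map p (deck k (n + 1)) s) 1 - Poly_Mapping.single s 1 =
      rat_chain_map p (deck k 1) (u + ?v) - (u + ?v)"
    using u(2) unfolding rat_chain_map_add by (simp add: algebra_simps)
  then show ?case
    using rat_chains_add[OF u(1) v] by blast
next
  case (step2 n)
  then obtain u where u: "u \<in> rat_chains p (torus_cover k)"
    "Poly_Mapping.single (simplex_map p (deck k n) s) 1 - Poly_Mapping.single s 1 = rat_chain_map p (deck k 1) u - u"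
    by blast
  let ?v = "Poly_Mapping.single (simplex_map p (deck k (n - 1)) s) (1 :: rat)"
  have v: "?v \<in> rat_chains p (torus_cover k)"
    using singular_simplex_simplex_map[OF s continuous_deck] by (simp del: of_int_diff)
  have "rat_chain_map p (deck k 1) ?v = Poly_Mapping.single (simplex_map p (deck k n) s) 1"
    using simplex_map_deck_deck[of p k 1 "n - 1" s] by simp
  then have "Poly_Mapping.single (simplex_map p (deck k (n - 1)) s) 1 - Poly_Mapping.single s 1 =
      rat_chain_map p (deck k 1) (u - ?v) - (u - ?v)"
    using u(2) unfolding rat_chain_map_diff by (simp add: algebra_simps)
  then show ?case
    using rat_chains_diff[OF u(1) v] by blast
qed

text \<open>
  Exactness of \<open>0 \<rightarrow> C\<^sub>*(torus_cover k) \<rightarrow> C\<^sub>*(torus_cover k) \<rightarrow> C\<^sub>*(torus (Suc k)) \<rightarrow> 0\<close>, whose first map is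
  \<open>deck k 1 - id\<close>.
\<close>

lemma lift_chain:
  assumes "c \<in> rat_chains p (torus (Suc k))"
  shows "\<exists>w\<in>rat_chains p (torus_cover k). rat_chain_map p (cover_proj k) w = c"
proof -
  have "\<forall>\<sigma>\<in>Poly_Mapping.keys c. \<exists>s. singular_simplex p (torus_cover k) s \<and> simplex_map p (cover_proj k) s = \<sigma>"
    using assms lift_simplex by (auto simp: rat_chains_def)
  then obtain L where L: "\<And>\<sigma>. \<sigma> \<in> Poly_Mapping.keys c \<Longrightarrow> singular_simplex p (torus_cover k) (L \<sigma>)"
    "\<And>\<sigma>. \<sigma> \<in> Poly_Mapping.keys c \<Longrightarrow> simplex_map p (cover_proj k) (L \<sigma>) = \<sigma>"
    by metis
  let ?w = "rat_extend (\<lambda>\<sigma>. Poly_Mapping.single (L \<sigma>) 1) c"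
  have "rat_chain_map p (cover_proj k) ?w = rat_extend (\<lambda>\<sigma>. Poly_Mapping.single \<sigma> 1) c"
    unfolding rat_chain_map_rat_extend by (rule rat_extend_cong) (simp add: L)
  moreover have "?w \<in> rat_chains p (torus_cover k)"
    by (rule rat_chains_rat_extend) (simp add: L)
  ultimately show ?thesis by auto
qed

text \<open>Modulo the image of the deck transformation minus the identity, each simplex equals the
  chosen lift \<open>L\<close> of its projection. After this replacement the chain depends only on
  its projection, which is 0.\<close>

lemma deck_exact:
  assumes c: "c \<in> rat_chains p (torus_cover k)" and c0: "rat_chain_map p (cover_proj k) c = 0"
  shows "\<exists>u\<in>rat_chains p (torus_cover k). c = rat_chain_map p (deck k 1) u - u"
proof -
  define L where "L \<sigma> = (SOME s. singular_simplex p (torus_cover k) s \<and> simplex_map p (cover_proj k) s = \<sigma>)" for \<sigma>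
  have L: "singular_simplex p (torus_cover k) (L \<sigma>)" "simplex_map p (cover_proj k) (L \<sigma>) = \<sigma>"
    if "singular_simplex p (torus (Suc k)) \<sigma>" for \<sigma>
    using someI_ex[OF lift_simplex[OF that]] unfolding L_def by blast+
  have "\<exists>u. u \<in> rat_chains p (torus_cover k) \<and>
      Poly_Mapping.single s 1 - Poly_Mapping.single (L (simplex_map p (cover_proj k) s)) 1 =
      rat_chain_map p (deck k 1) u - u"
    if s: "singular_simplex p (torus_cover k) s" for s
  proof -
    have \<sigma>: "singular_simplex p (torus (Suc k)) (simplex_map p (cover_proj k) s)"
      by (rule singular_simplex_simplex_map[OF s continuous_cover_proj])
    obtain n where "s = simplex_map p (deck k n) (L (simplex_map p (cover_proj k) s))"
      using lift_unique[OF s L(1)[OF \<sigma>]] L(2)[OF \<sigma>] by auto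
    then show ?thesis
      using deck_power_difference[OF L(1)[OF \<sigma>], of n] by auto
  qed
  then obtain U where U: "\<And>s. singular_simplex p (torus_cover k) s \<Longrightarrow> U s \<in> rat_chains p (torus_cover k)"
    "\<And>s. singular_simplex p (torus_cover k) s \<Longrightarrow>
      Poly_Mapping.single s 1 - Poly_Mapping.single (L (simplex_map p (cover_proj k) s)) 1 =
      rat_chain_map p (deck k 1) (U s) - U s"
    by metis
  have keys: "singular_simplex p (torus_cover k) s" if "s \<in> Poly_Mapping.keys c" for s
    using that c by (auto simp: rat_chains_def)
  have "rat_extend (\<lambda>s. Poly_Mapping.single (L (simplex_map p (cover_proj k) s)) 1) c =
      rat_extend (\<lambda>\<sigma>. Poly_Mapping.single (L \<sigma>) 1) (rat_chain_map p (cover_proj k) c)"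
    unfolding rat_chain_map_def rat_extend_rat_extend by simp
  then have L0: "rat_extend (\<lambda>s. Poly_Mapping.single (L (simplex_map p (cover_proj k) s)) 1) c = 0"
    by (simp add: c0)
  have "c = rat_extend (\<lambda>s. Poly_Mapping.single s 1) c"
    by simp
  also have "\<dots> = rat_extend (\<lambda>s. (rat_chain_map p (deck k 1) (U s) + rat_scale (-1) (U s))
      + Poly_Mapping.single (L (simplex_map p (cover_proj k) s)) 1) c"
  proof (rule rat_extend_cong)
    fix s assume "s \<in> Poly_Mapping.keys c"
    from U(2)[OF keys[OF this]]
    show "Poly_Mapping.single s 1 = (rat_chain_map p (deck k 1) (U s) + rat_scale (-1) (U s))
      + Poly_Mapping.single (L (simplex_map p (cover_proj k) s)) 1"
      by (simp add: rat_scale_uminus_one algebra_simps)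
  qed
  also have "\<dots> = rat_chain_map p (deck k 1) (rat_extend U c) - rat_extend U c"
    unfolding rat_extend_fun_add L0 rat_extend_fun_scale rat_chain_map_rat_extend
    by (simp add: rat_scale_uminus_one)
  finally show ?thesis
    using rat_chains_rat_extend[of c U p "torus_cover k"] U(1)[OF keys] by blast
qed

text \<open>The support of an invariant chain is stable under the deck transformation. But it is
  finite, and each translation raises the imaginary part of the last coordinate at vertex 0 by 2 pi,
  so a highest simplex gives a contradiction.\<close>

lemma deck_injective:
  assumes u: "u \<in> rat_chains p (torus_cover k)" and eq: "rat_chain_map p (deck k 1) u = u"
  shows "u = 0"
proof (rule ccontr)
  assume "u \<noteq> 0"
  then have "Poly_Mapping.keys u \<noteq> {}" "finite (Poly_Mapping.keys u)"
    by simp_all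
  let ?h = "\<lambda>s :: (nat \<Rightarrow> real) \<Rightarrow> nat \<Rightarrow> complex. Im (s (vertex 0) k)"
  obtain s where s: "s \<in> Poly_Mapping.keys u" "\<And>t. t \<in> Poly_Mapping.keys u \<Longrightarrow> ?h t \<le> ?h s"
    using finite_imp_Sup_less[of "?h ` Poly_Mapping.keys u"]
      Max_in[of "?h ` Poly_Mapping.keys u"] Max_ge[of "?h ` Poly_Mapping.keys u"]
      \<open>Poly_Mapping.keys u \<noteq> {}\<close> \<open>finite (Poly_Mapping.keys u)\<close> by fastforce
  let ?t = "simplex_map p (deck k 1)"
  have keys: "singular_simplex p (torus_cover k) t" if "t \<in> Poly_Mapping.keys u" for t
    using that u by (auto simp: rat_chains_def)
  have inj: "t = t'" if "t \<in> Poly_Mapping.keys u" "t' \<in> Poly_Mapping.keys u" "?t t = ?t t'" for t t'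
  proof -
    have "simplex_map p (deck k (-1)) (?t t) = simplex_map p (deck k (-1)) (?t t')"
      using that(3) by simp
    then show ?thesis
      unfolding simplex_map_deck_deck using deck_0[OF keys[OF that(1)]] deck_0[OF keys[OF that(2)]] by simp
  qed
  have "Poly_Mapping.lookup u (?t s) = Poly_Mapping.lookup (rat_chain_map p (deck k 1) u) (?t s)"
    by (simp only: eq)
  also have "\<dots> = (\<Sum>t\<in>Poly_Mapping.keys u. if ?t t = ?t s then Poly_Mapping.lookup u t else 0)"
    unfolding rat_chain_map_def rat_extend_def
    by (auto simp: lookup_sum lookup_single when_def intro!: sum.cong)
  also have "\<dots> = (\<Sum>t\<in>Poly_Mapping.keys u. if t = s then Poly_Mapping.lookup u s else 0)"
    by (intro sum.cong refl) (use inj s(1) in auto)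
  also have "\<dots> = Poly_Mapping.lookup u s"
    using s(1) by simp
  finally have "?t s \<in> Poly_Mapping.keys u"
    using s(1) by (simp add: in_keys_iff)
  then have "?h (?t s) \<le> ?h s"
    by (rule s(2))
  moreover have "?h (?t s) = ?h s + 2 * pi"
    by (simp add: simplex_map_def cover_add_def)
  ultimately show False
    using pi_gt_zero by linarith
qed

text \<open>Decreasing lists are used because the induction on the rank multiplies by the loop of
  the new, largest coordinate, and \<open>torus_cycle\<close> multiplies at the head.\<close>

definition cycle_basis :: "nat \<Rightarrow> nat \<Rightarrow> nat list set" where
  "cycle_basis k p = {I. sorted_wrt (>) I \<and> set I \<subseteq> {..<k} \<and> length I = p}"

lemma finite_cycle_basis [simp]: "finite (cycle_basis k p)"
  by (rule finite_subset[OF _ finite_lists_length_eq[of "{..<k}" p]]) (auto simp: cycle_basis_def)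

text \<open>The chains homologous to rational combinations of the standard cycles.\<close>

definition torus_span :: "nat \<Rightarrow> nat \<Rightarrow> (nat \<Rightarrow> complex) rat_chain set" where
  "torus_span k p = {c. \<exists>r. \<exists>y\<in>rat_chains (Suc p) (torus k).
     c = (\<Sum>I\<in>cycle_basis k p. rat_scale (r I) (torus_cycle k I)) + rat_boundary (int (Suc p)) y}"

lemma torus_span_add:
  assumes "a \<in> torus_span k p" "b \<in> torus_span k p"
  shows "a + b \<in> torus_span k p"
proof -
  obtain r y s x where "y \<in> rat_chains (Suc p) (torus k)" "x \<in> rat_chains (Suc p) (torus k)"
    "a = (\<Sum>I\<in>cycle_basis k p. rat_scale (r I) (torus_cycle k I)) + rat_boundary (int (Suc p)) y"
    "b = (\<Sum>I\<in>cycle_basis k p. rat_scale (s I) (torus_cycle k I)) + rat_boundary (int (Suc p)) x"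
    using assms unfolding torus_span_def by blast
  then have "y + x \<in> rat_chains (Suc p) (torus k)"
    "a + b = (\<Sum>I\<in>cycle_basis k p. rat_scale (r I + s I) (torus_cycle k I)) + rat_boundary (int (Suc p)) (y + x)"
    by (simp_all only: rat_chains_add rat_scale_add_left sum.distrib rat_boundary_add ac_simps)
  then show ?thesis
    unfolding torus_span_def mem_Collect_eq by (intro exI[of _ "\<lambda>I. r I + s I"] bexI)
qed

lemma torus_span_scale:
  assumes "a \<in> torus_span k p"
  shows "rat_scale s a \<in> torus_span k p"
proof -
  obtain r y where "y \<in> rat_chains (Suc p) (torus k)"
    "a = (\<Sum>I\<in>cycle_basis k p. rat_scale (r I) (torus_cycle k I)) + rat_boundary (int (Suc p)) y"
    using assms unfolding torus_span_def by blast
  then have "rat_scale s y \<in> rat_chains (Suc p) (torus k)"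
    "rat_scale s a = (\<Sum>I\<in>cycle_basis k p. rat_scale (s * r I) (torus_cycle k I)) + rat_boundary (int (Suc p)) (rat_scale s y)"
    by (simp_all only: rat_chains_scale rat_scale_add rat_scale_sum rat_boundary_scale rat_scale_simps)
  then show ?thesis
    unfolding torus_span_def mem_Collect_eq by (intro exI[of _ "\<lambda>I. s * r I"] bexI)
qed

lemma torus_span_boundary: "y \<in> rat_chains (Suc p) (torus k) \<Longrightarrow> rat_boundary (int (Suc p)) y \<in> torus_span k p"
  unfolding torus_span_def by (auto intro!: exI[of _ "\<lambda>_. 0"] bexI[of _ y])

lemma torus_span_0: "0 \<in> torus_span k p"
  using torus_span_boundary[of 0 p k] by simp

lemma torus_span_alternate: "a \<in> torus_span k p \<Longrightarrow> alternate n a \<in> torus_span k p"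
  by (simp add: alternate_eq_rat_scale torus_span_scale)

lemma torus_span_cycle:
  assumes "J \<in> cycle_basis k p"
  shows "torus_cycle k J \<in> torus_span k p"
proof -
  have "(\<Sum>I\<in>cycle_basis k p. rat_scale (if I = J then 1 else 0) (torus_cycle k I)) =
      (\<Sum>I\<in>cycle_basis k p. if I = J then torus_cycle k J else 0)"
    by (intro sum.cong) auto
  also have "\<dots> = torus_cycle k J"
    using assms by simp
  finally show ?thesis
    unfolding torus_span_def by (auto intro!: exI[of _ "\<lambda>I. if I = J then 1 else 0"] bexI[of _ 0])
qed

lemma torus_span_sum: "(\<And>i. i \<in> A \<Longrightarrow> f i \<in> torus_span k p) \<Longrightarrow> (\<Sum>i\<in>A. f i) \<in> torus_span k p"
  by (induction A rule: infinite_finite_induct) (auto intro: torus_span_add torus_span_0)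

text \<open>The torus of rank 0 is a point with one singular simplex in each degree. Its boundary
  maps are alternately zero and the identity, which leaves homology only in degree 0.\<close>

lemma torus_0_cycles:
  assumes c: "c \<in> rat_cycles p (torus 0)"
  shows "c \<in> torus_span 0 p"
proof -
  define pt :: "nat \<Rightarrow> (nat \<Rightarrow> real) \<Rightarrow> nat \<Rightarrow> complex" where "pt p = (\<lambda>x\<in>standard_simplex p. \<lambda>_. undefined)" for p
  have undef: "(\<lambda>_. undefined) \<in> topspace (torus 0)"
    by (simp add: topspace_torus)
  then have sing: "singular_simplex p (torus 0) (pt p)" for p
    by (simp add: singular_simplex_def pt_def)
  have "s = pt p" if "singular_simplex p (torus 0) s" for s
  proof
    fix x
    show "s x = pt p x"
    proof (cases "x \<in> standard_simplex p")
      case True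
      then show ?thesis
        using singular_simplex_topspace[OF that True] by (auto simp: topspace_torus pt_def)
    next
      case False
      then show ?thesis
        using that by (auto simp: singular_simplex_def extensional_def pt_def)
    qed
  qed
  then have keys: "Poly_Mapping.keys c \<subseteq> {pt p}"
    using rat_cyclesD(1)[OF c] by (auto simp: rat_chains_def)
  define r where "r = Poly_Mapping.lookup c (pt p)"
  have cr: "c = Poly_Mapping.single (pt p) r"
  proof (rule poly_mapping_eqI)
    fix s
    show "Poly_Mapping.lookup c s = Poly_Mapping.lookup (Poly_Mapping.single (pt p) r) s"
      using keys by (cases "s = pt p") (auto simp: r_def lookup_single in_keys_iff)
  qed
  \<comment> \<open>All q + 2 faces of the only simplex agree, so their alternating sum is one face
    or zero according to the parity of q + 1.\<close>
  have bd: "rat_boundary (int (Suc q)) (Poly_Mapping.single (pt (Suc q)) r) =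
      Poly_Mapping.single (pt q) (if even (Suc q) then r else 0)" for q
  proof -
    have face: "singular_face (Suc q) k (pt (Suc q)) = pt q" if "k \<le> Suc q" for k
      using simplical_face_in_standard_simplex[of "Suc q" k] that
      by (auto simp: singular_face_def pt_def fun_eq_iff)
    have alt: "(\<Sum>k\<le>n. Poly_Mapping.single (pt q) ((-1) ^ k)) = Poly_Mapping.single (pt q) (if even n then 1 else (0::rat))" for n
      by (induction n) (auto simp: single_add[symmetric])
    have "rat_boundary (int (Suc q)) (Poly_Mapping.single (pt (Suc q)) r) =
        rat_scale r (\<Sum>k\<le>Suc q. Poly_Mapping.single (singular_face (Suc q) k (pt (Suc q))) ((-1) ^ k))"
      by (simp only: rat_boundary_def rat_extend_single nat_int) simp
    also have "(\<Sum>k\<le>Suc q. Poly_Mapping.single (singular_face (Suc q) k (pt (Suc q))) ((-1) ^ k)) =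
        (\<Sum>k\<le>Suc q. Poly_Mapping.single (pt q) ((-1 :: rat) ^ k))"
      by (intro sum.cong refl) (simp add: face)
    also have "rat_scale r \<dots> = Poly_Mapping.single (pt q) (if even (Suc q) then r else 0)"
      unfolding alt by simp
    finally show ?thesis .
  qed
  consider "p = 0" | "odd p" | "even p" "p \<noteq> 0" by blast
  then show ?thesis
  proof cases
    case 1
    have "[] \<in> cycle_basis 0 p"
      using 1 by (simp add: cycle_basis_def)
    moreover have "c = rat_scale r (torus_cycle 0 [])"
      using cr 1 by (simp add: pt_def restrict_def)
    ultimately show ?thesis
      using torus_span_scale[OF torus_span_cycle] by metis
  next
    case 2
    then have "c = rat_boundary (int (Suc p)) (Poly_Mapping.single (pt (Suc p)) r)"
      unfolding bd cr by simp
    then show ?thesis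
      using torus_span_boundary[of "Poly_Mapping.single (pt (Suc p)) r" p 0] sing by simp
  next
    case 3
    then obtain q where q: "p = Suc q"
      using not0_implies_Suc by blast
    have "Poly_Mapping.single (pt q) r = 0"
      using bd[of q] rat_cyclesD(2)[OF c] 3 unfolding cr q by simp
    then have "c = 0"
      using cr by (metis lookup_single_eq lookup_zero single_zero)
    then show ?thesis
      by (simp add: torus_span_0)
  qed
qed

text \<open>The covering contracts onto \<open>torus k\<close>, so a cycle of it is homologous to
  one pushed in from \<open>torus k\<close>. The combination uses only indices below
  \<open>k\<close>, as the main induction requires before it prepends \<open>k\<close>.\<close>

lemma torus_cover_cycles:
  assumes IH: "\<And>c. c \<in> rat_cycles p (torus k) \<Longrightarrow> c \<in> torus_span k p"
    and w: "w \<in> rat_cycles p (torus_cover k)"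
  shows "\<exists>r. \<exists>y\<in>rat_chains (Suc p) (torus (Suc k)). rat_chain_map p (cover_proj k) w =
    (\<Sum>I\<in>cycle_basis k p. rat_scale (r I) (torus_cycle (Suc k) I)) + rat_boundary (int (Suc p)) y"
proof -
  let ?proj = "cover_proj k" and ?incl = "cover_incl k" and ?forget = "\<lambda>z. restrict z {..<k}"
  note wc = rat_cyclesD(1)[OF w]
  \<comment> \<open>The prism of the contraction; the factor \<open>alternate p\<close> cancels the
    sign of its boundary.\<close>
  define b where "b = alternate p (homotopy_chain p (cover_scale k) 1 w)"
  have b: "b \<in> rat_chains (Suc p) (torus_cover k)"
    unfolding b_def by (intro rat_chains_alternate homotopy_chain_in[OF wc continuous_cover_scale])
  have "rat_chain_map p (\<lambda>z. cover_scale k (z, 1)) w = w"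
    by (rule rat_chain_map_id[OF wc])
      (auto simp: cover_scale_def topspace_torus_cover extensional_def fun_eq_iff)
  moreover have "rat_chain_map p (\<lambda>z. cover_scale k (z, 0)) w = rat_chain_map p ?incl (rat_chain_map p ?forget w)"
    unfolding rat_chain_map_rat_chain_map
    by (rule rat_chain_map_cong[OF wc]) (auto simp: cover_scale_def cover_incl_def fun_eq_iff)
  ultimately have "rat_boundary (int (Suc p)) b = w - rat_chain_map p ?incl (rat_chain_map p ?forget w)"
    unfolding b_def alternate_eq_rat_scale rat_boundary_scale rat_boundary_homotopy_chain[OF w]
    by (simp flip: power_add)
  then have w_eq: "w = rat_chain_map p ?incl (rat_chain_map p ?forget w) + rat_boundary (int (Suc p)) b"
    by simp
  have "rat_chain_map p ?forget w \<in> torus_span k p"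
    by (rule IH[OF rat_cycles_map[OF w continuous_cover_forget]])
  then obtain r y where y: "y \<in> rat_chains (Suc p) (torus k)"
    "rat_chain_map p ?forget w =
      (\<Sum>I\<in>cycle_basis k p. rat_scale (r I) (torus_cycle k I)) + rat_boundary (int (Suc p)) y"
    unfolding torus_span_def by blast
  have cont: "continuous_map (torus k) (torus (Suc k)) (?proj \<circ> ?incl)"
    by (rule continuous_map_compose[OF continuous_cover_incl continuous_cover_proj])
  have bdm: "rat_boundary (int (Suc p)) (rat_chain_map (Suc p) f a) = rat_chain_map p f (rat_boundary (int (Suc p)) a)"
    for f and a :: "(nat \<Rightarrow> complex) rat_chain"
    by (simp add: rat_boundary_rat_chain_map del: of_nat_Suc)
  define y' where "y' = rat_chain_map (Suc p) (?proj \<circ> ?incl) y + rat_chain_map (Suc p) ?proj b"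
  have y': "y' \<in> rat_chains (Suc p) (torus (Suc k))"
    unfolding y'_def by (intro rat_chains_add rat_chain_map_in[OF y(1) cont] rat_chain_map_in[OF b continuous_cover_proj])
  have "rat_chain_map p ?proj w =
      rat_chain_map p (?proj \<circ> ?incl) (rat_chain_map p ?forget w) + rat_chain_map p ?proj (rat_boundary (int (Suc p)) b)"
    by (subst w_eq) (simp only: rat_chain_map_add rat_chain_map_rat_chain_map[of p ?proj ?incl])
  also have "\<dots> = (\<Sum>I\<in>cycle_basis k p. rat_scale (r I) (rat_chain_map p (?proj \<circ> ?incl) (torus_cycle k I)))
      + rat_boundary (int (Suc p)) y'"
    unfolding y(2) y'_def rat_chain_map_add rat_chain_map_sum rat_chain_map_scale rat_boundary_add bdm by simp
  also have "(\<Sum>I\<in>cycle_basis k p. rat_scale (r I) (rat_chain_map p (?proj \<circ> ?incl) (torus_cycle k I))) =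
      (\<Sum>I\<in>cycle_basis k p. rat_scale (r I) (torus_cycle (Suc k) I))"
    by (intro sum.cong refl) (auto simp: cycle_basis_def simp flip: torus_cycle_incl)
  finally show ?thesis
    using y' by blast
qed

text \<open>Under exp, translating the last coordinate along a segment becomes multiplying it along
  the loop. Thus the prism that joins the identity to the deck transformation projects to the
  product with the new loop.\<close>

lemma cover_proj_homotopy_chain:
  assumes u: "u \<in> rat_chains p (torus_cover k)"
  shows "rat_chain_map (Suc p) (cover_proj k) (homotopy_chain p (cover_add k) (2 * of_real pi * \<i>) u) =
    torus_mult (Suc k) k p (rat_chain_map p (cover_proj k) u)"
proof -
  let ?ray = "Poly_Mapping.single (ray (2 * of_real pi * \<i>)) (1::rat)"
  have W: "eilenberg_zilber p 1 u ?ray \<in> rat_chains (p + 1) (prod_topology (torus_cover k) euclidean)"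
    using singular_simplex_ray by (intro eilenberg_zilber_in u) simp
  have "rat_chain_map (p + 1) (cover_proj k) (homotopy_chain p (cover_add k) (2 * of_real pi * \<i>) u) =
    rat_chain_map (p + 1) (cover_proj k \<circ> cover_add k) (eilenberg_zilber p 1 u ?ray)"
    unfolding homotopy_chain_def rat_chain_map_rat_chain_map ..
  also have "\<dots> = rat_chain_map (p + 1) (torus_act (Suc k) k \<circ> map_prod (cover_proj k) exp) (eilenberg_zilber p 1 u ?ray)"
    by (rule rat_chain_map_cong[OF W])
      (auto simp: cover_proj_def cover_add_def torus_act_def fun_eq_iff exp_add)
  also have "\<dots> = torus_mult (Suc k) k p (rat_chain_map p (cover_proj k) u)"
    unfolding torus_mult_def rat_chain_map_rat_chain_map[symmetric] rat_chain_map_eilenberg_zilber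
    by (simp add: loop_def)
  finally show ?thesis by simp
qed

text \<open>The long exact sequence of the covering, carried out on chains. A lift \<open>w\<close>
  of \<open>c\<close> fails to be a cycle by the deck difference of a cycle \<open>u\<close>;
  subtracting the prism over \<open>u\<close> corrects this. The corrected part comes from
  \<open>torus k\<close>, and the prism projects, up to sign, to \<open>u\<close> times the new
  loop.\<close>

lemma rat_cycles_torus_span: "c \<in> rat_cycles p (torus k) \<Longrightarrow> c \<in> torus_span k p"
proof (induction k arbitrary: p c)
  case 0
  then show ?case by (rule torus_0_cycles)
next
  case (Suc k)
  let ?proj = "cover_proj k" and ?deck = "deck k 1"
  obtain w where w: "w \<in> rat_chains p (torus_cover k)" "rat_chain_map p ?proj w = c"
    using lift_chain[OF rat_cyclesD(1)[OF Suc.prems]] by blast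
  have basis: "cycle_basis k q \<subseteq> cycle_basis (Suc k) q" for q
    by (auto simp: cycle_basis_def)
  have cover: "rat_chain_map q ?proj w' \<in> torus_span (Suc k) q" if w': "w' \<in> rat_cycles q (torus_cover k)" for q w'
  proof -
    obtain r y where y: "y \<in> rat_chains (Suc q) (torus (Suc k))" "rat_chain_map q ?proj w' =
      (\<Sum>I\<in>cycle_basis k q. rat_scale (r I) (torus_cycle (Suc k) I)) + rat_boundary (int (Suc q)) y"
      using torus_cover_cycles[OF Suc.IH w'] by blast
    show ?thesis
      unfolding y(2) using basis
      by (intro torus_span_add torus_span_sum torus_span_scale torus_span_cycle torus_span_boundary y(1)) auto
  qed
  show ?case
  proof (cases p)
    case 0
    then have "w \<in> rat_cycles p (torus_cover k)"
      using w by (simp add: rat_cycles_def rat_boundary_def)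
    then show ?thesis
      using cover w by blast
  next
    case (Suc q)
    have "rat_chain_map q ?proj (rat_boundary (int p) w) = rat_boundary (int p) (rat_chain_map p ?proj w)"
      using Suc by (simp add: rat_boundary_rat_chain_map del: of_nat_Suc)
    also have "\<dots> = 0"
      using w(2) rat_cyclesD(2)[OF Suc.prems] by simp
    finally obtain u where u: "u \<in> rat_chains q (torus_cover k)"
      and du: "rat_boundary (int p) w = rat_chain_map q ?deck u - u"
      using deck_exact[of "rat_boundary (int p) w" q k] rat_boundary_in[of w q "torus_cover k"] w(1) Suc by auto
    \<comment> \<open>The deck difference of the boundary of \<open>u\<close> is a double boundary,
      hence 0, and the deck difference is injective.\<close>
    have "rat_boundary (int q) u = 0"
    proof (cases q)
      case 0
      then show ?thesis by (simp add: rat_boundary_def)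
    next
      case (Suc q')
      have "rat_chain_map q' ?deck (rat_boundary (int q) u) - rat_boundary (int q) u =
          rat_boundary (int q) (rat_boundary (int p) w)"
        unfolding du rat_boundary_diff rat_boundary_rat_chain_map using Suc by simp
      also have "\<dots> = 0"
        unfolding \<open>p = Suc q\<close> by (rule rat_boundary_rat_boundary)
      finally show ?thesis
        using deck_injective[of "rat_boundary (int q) u" q' k] rat_boundary_in[of u q' "torus_cover k"] u Suc by simp
    qed
    then have uc: "u \<in> rat_cycles q (torus_cover k)"
      using u by (simp add: rat_cycles_def)
    \<comment> \<open>The prism from the identity to the deck transformation, with the sign that
      makes its boundary equal to that of \<open>w\<close>.\<close>
    define b where "b = alternate q (homotopy_chain q (cover_add k) (2 * of_real pi * \<i>) u)"
    have b: "b \<in> rat_chains p (torus_cover k)"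
      unfolding b_def Suc by (intro rat_chains_alternate homotopy_chain_in[OF u continuous_cover_add])
    have "rat_chain_map q (\<lambda>z. cover_add k (z, 0)) u = u"
      by (rule rat_chain_map_id[OF u])
        (auto simp: cover_add_def topspace_torus_cover extensional_def fun_eq_iff)
    then have db: "rat_boundary (int p) b = rat_chain_map q ?deck u - u"
      unfolding b_def alternate_eq_rat_scale rat_boundary_scale Suc rat_boundary_homotopy_chain[OF uc]
      by (simp flip: power_add)
    have "w - b \<in> rat_cycles p (torus_cover k)"
      using w(1) b du db by (simp add: rat_cycles_def rat_chains_diff rat_boundary_diff)
    then have 1: "rat_chain_map p ?proj (w - b) \<in> torus_span (Suc k) p"
      by (rule cover)
    obtain r y where y: "y \<in> rat_chains (Suc q) (torus (Suc k))" "rat_chain_map q ?proj u =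
      (\<Sum>I\<in>cycle_basis k q. rat_scale (r I) (torus_cycle (Suc k) I)) + rat_boundary (int (Suc q)) y"
      using torus_cover_cycles[OF Suc.IH uc] by blast
    have "torus_mult (Suc k) k q (torus_cycle (Suc k) I) \<in> torus_span (Suc k) p" if I: "I \<in> cycle_basis k q" for I
    proof -
      have "k # I \<in> cycle_basis (Suc k) p"
        using I Suc by (auto simp: cycle_basis_def)
      from torus_span_cycle[OF this] show ?thesis
        using I by (simp add: cycle_basis_def)
    qed
    moreover have "torus_mult (Suc k) k q (rat_boundary (int (Suc q)) y) \<in> torus_span (Suc k) p"
    proof -
      have "torus_mult (Suc k) k (Suc q) y \<in> rat_chains (Suc p) (torus (Suc k))"
        using torus_mult_in[OF y(1)] Suc by simp
      from torus_span_boundary[OF this] show ?thesis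
        using rat_boundary_torus_mult[of "Suc q" "Suc k" k y] Suc by (simp del: of_nat_Suc)
    qed
    ultimately have "torus_mult (Suc k) k q (rat_chain_map q ?proj u) \<in> torus_span (Suc k) p"
      unfolding y(2) torus_mult_add torus_mult_sum torus_mult_scale
      by (intro torus_span_add torus_span_sum torus_span_scale)
    then have 2: "rat_chain_map p ?proj b \<in> torus_span (Suc k) p"
      unfolding b_def rat_chain_map_alternate Suc cover_proj_homotopy_chain[OF u]
      by (rule torus_span_alternate)
    have "c = rat_chain_map p ?proj (w - b) + rat_chain_map p ?proj b"
      using w(2) by (simp add: rat_chain_map_diff)
    then show ?thesis
      using torus_span_add[OF 1 2] by simp
  qed
qed

section \<open>Pairing of forms with cycles of tori\<close>

abbreviation coords :: "nat \<Rightarrow> (nat \<Rightarrow> complex) \<Rightarrow> complex" where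
  "coords \<equiv> \<lambda>j z. z j"

lemma torus_coords_torus: "torus_coords (torus k) k coords"
  by (simp add: torus_coords_def continuous_map_torus_coord)

lemma simplex_edges_support:
  assumes "v \<in> set (simplex_edges k c p s)" "k \<le> j"
  shows "v j = 0"
  using assms unfolding simplex_edges_def edges_conv_nth
  by (auto simp: potential_def simp del: upt_Suc)

lemma map_monomial_linear_Some:
  "map (monomial_linear k Some) (simplex_edges k c p s) = simplex_edges k c p s"
proof (rule map_idI)
  fix v assume "v \<in> set (simplex_edges k c p s)"
  then have "v j = 0" if "k \<le> j" for j
    using simplex_edges_support that by blast
  then show "monomial_linear k Some v = v"
    by (auto simp: monomial_linear_def fun_eq_iff)
qed

text \<open>Along the loop the logarithm grows by 2 pi i, which \<open>rat_char\<close> normalises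
  to 1.\<close>

lemma simplex_edges_loop:
  "simplex_edges 1 (\<lambda>_ w. w) 1 loop = [unit_vec 0]"
proof -
  let ?g = "\<lambda>x :: nat \<Rightarrow> real. of_real (x 1) * (2 * of_real pi * \<i>)"
  have "log_vertex 1 (\<lambda>x. loop x) 1 - log_vertex 1 (\<lambda>x. loop x) 0 = rat_char (?g (vertex 1)) - rat_char (?g (vertex 0))"
  proof (rule log_vertex_diff)
    show "continuous_on (standard_simplex 1) ?g"
      by (intro continuous_intros continuous_on_subset[OF continuous_on_product_coordinates subset_UNIV])
  qed (auto simp: loop_def simplex_map_def ray_def)
  also have "\<dots> = 1"
    by (simp add: vertex_def rat_char_period)
  finally show ?thesis
    by (auto simp: simplex_edges_def potential_def unit_vec_def fun_eq_iff numeral_2_eq_2)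
qed

lemma form_eval_add: "form_eval k c p D (a + b) = form_eval k c p D a + form_eval k c p D b"
  and form_eval_scale: "form_eval k c p D (rat_scale r a) = r * form_eval k c p D a"
  and form_eval_diff: "form_eval k c p D (a - b) = form_eval k c p D a - form_eval k c p D b"
  and form_eval_sum: "form_eval k c p D (\<Sum>i\<in>I. f i) = (\<Sum>i\<in>I. form_eval k c p D (f i))"
  by (simp_all add: form_eval_def rat_eval_add rat_eval_scale rat_eval_diff rat_eval_sum)

text \<open>The loop is the second factor and has the single edge \<open>unit_vec i\<close>, which
  is appended to the edges of \<open>a\<close>; the coefficient is the binomial p + 1 over
  p.\<close>

lemma form_eval_torus_mult:
  assumes a: "a \<in> rat_chains p (torus k)" and i: "i < k" and D: "alternating_form (Suc p) D"
  shows "form_eval k coords (Suc p) D (torus_mult k i p a) =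
    of_nat (Suc p) * form_eval k coords p (\<lambda>l. D (l @ [unit_vec i])) a"
proof -
  let ?B = "\<lambda>j. if j = i then Some 0 else None" and ?c' = "\<lambda>_ w :: complex. w"
  have "torus_coords Cstar 1 ?c'"
    by (simp add: torus_coords_def)
  moreover have "monomial_map (torus k) k coords Some Cstar 1 ?c' ?B k coords (torus_act k i)"
    unfolding monomial_map_def by (auto simp: monomial_def torus_act_def)
  ultimately have "form_eval k coords (p + 1) D (torus_mult k i p a) =
    of_nat (p + 1 choose p) * rat_eval (\<lambda>s. rat_eval (\<lambda>t.
      D (map (monomial_linear k Some) (simplex_edges k coords p s) @ map (monomial_linear k ?B) (simplex_edges 1 ?c' 1 t)))
      (Poly_Mapping.single loop 1)) a"
    unfolding torus_mult_def using D
    by (intro form_eval_eilenberg_zilber[OF torus_coords_torus a _ rat_cyclesD(1)[OF loop_cycle]]) simp_all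
  moreover have "monomial_linear k ?B (unit_vec 0) = unit_vec i"
    using i by (auto simp: monomial_linear_def unit_vec_def fun_eq_iff)
  ultimately show ?thesis
    by (simp add: map_monomial_linear_Some simplex_edges_loop[simplified] form_eval_def)
qed

text \<open>The factors p + 1 of successive products multiply to the factorial. Later factors sit
  nearer to the head of \<open>I\<close>, while their edges are appended at the end, whence the
  reversal.\<close>

lemma form_eval_torus_cycle:
  "\<lbrakk>set I \<subseteq> {..<k}; alternating_form (length I) D\<rbrakk> \<Longrightarrow>
    form_eval k coords (length I) D (torus_cycle k I) = fact (length I) * D (map unit_vec (rev I))"
proof (induction I arbitrary: D)
  case Nil
  then show ?case
    by (simp add: form_eval_def simplex_edges_def)
next
  case (Cons i I)
  have "alternating_form (length I) (\<lambda>l. D (l @ [unit_vec i]))"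
    using alternating_form_append[of "length I" 1 D "[unit_vec i]"] Cons.prems by simp
  then show ?case
    using Cons form_eval_torus_mult[OF rat_cyclesD(1)[OF torus_cycle_cycle[of k I]], of i D]
    by (simp add: mult.assoc)
qed

lemma alternating_form_expand:
  assumes D: "alternating_form (Suc (length us)) D"
  shows "D (us @ [\<lambda>j. \<Sum>i<m. v i * unit_vec i j]) = (\<Sum>i<m. v i * D (us @ [unit_vec i]))"
proof (induction m)
  case 0
  \<comment> \<open>The empty sum is the zero vector, that is 0 times an arbitrary vector, so
    homogeneity gives the value 0.\<close>
  show ?case
    using alternating_form_scale[OF D, of us "[]" 0 undefined] by simp
next
  case (Suc m)
  have "D (us @ [\<lambda>j. (\<Sum>i<m. v i * unit_vec i j) + v m * unit_vec m j]) =
      D (us @ [\<lambda>j. \<Sum>i<m. v i * unit_vec i j]) + D (us @ [\<lambda>j. v m * unit_vec m j])"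
    using alternating_form_add[OF D, of us "[]"] by simp
  then show ?case
    using Suc alternating_form_scale[OF D, of us "[]" "v m" "unit_vec m"] by simp
qed

text \<open>Although a simplex is not closed, its form values are those of a cycle: a product of
  rational combinations of coordinate loops with the prescribed edge vectors.\<close>

lemma exists_cycle_with_edges:
  assumes "\<And>v j. v \<in> set us \<Longrightarrow> k \<le> j \<Longrightarrow> v j = 0"
  shows "\<exists>z\<in>rat_cycles (length us) (torus k). \<forall>D. alternating_form (length us) D \<longrightarrow>
    form_eval k coords (length us) D z = D us"
  using assms
proof (induction us rule: rev_induct)
  case Nil
  show ?case
    using torus_cycle_cycle[of k "[]"] form_eval_torus_cycle[of "[]" k] by auto
next
  case (snoc v us)
  then obtain z where z: "z \<in> rat_cycles (length us) (torus k)"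
    "\<And>D. alternating_form (length us) D \<Longrightarrow> form_eval k coords (length us) D z = D us"
    by auto
  let ?p = "length us"
  \<comment> \<open>The combination of loops in direction \<open>v\<close>; the division cancels the
    factor p + 1 of \<open>form_eval_torus_mult\<close>.\<close>
  define z' where "z' = rat_scale (1 / of_nat (Suc ?p)) (\<Sum>i<k. rat_scale (v i) (torus_mult k i ?p z))"
  have "z' \<in> rat_cycles (Suc ?p) (torus k)"
    unfolding z'_def by (intro rat_cycles_scale rat_cycles_sum torus_mult_cycle z(1))
  moreover have "form_eval k coords (Suc ?p) D z' = D (us @ [v])" if D: "alternating_form (Suc ?p) D" for D
  proof -
    have app: "alternating_form ?p (\<lambda>l. D (l @ [w]))" for w
      using alternating_form_append[of ?p 1 D "[w]"] D by simp
    have "v = (\<lambda>j. \<Sum>i<k. v i * unit_vec i j)"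
    proof
      fix j
      have "(\<Sum>i<k. v i * unit_vec i j) = (\<Sum>i<k. if i = j then v j else 0)"
        by (intro sum.cong) (auto simp: unit_vec_def)
      also have "\<dots> = v j"
        using snoc.prems[of v j] by (auto simp: not_less)
      finally show "v j = (\<Sum>i<k. v i * unit_vec i j)" ..
    qed
    then have "D (us @ [v]) = (\<Sum>i<k. v i * D (us @ [unit_vec i]))"
      using alternating_form_expand[OF D, where m = k and v = v] by simp
    moreover have "form_eval k coords (Suc ?p) D z' =
        1 / of_nat (Suc ?p) * (\<Sum>i<k. v i * (of_nat (Suc ?p) * D (us @ [unit_vec i])))"
      unfolding z'_def form_eval_scale form_eval_sum
      using form_eval_torus_mult[OF rat_cyclesD(1)[OF z(1)] _ D] z(2)[OF app]
      by (intro arg_cong2[of _ _ _ _ "(*)"] sum.cong) auto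
    ultimately show ?thesis
      by (simp add: sum_distrib_left del: of_nat_Suc)
  qed
  ultimately show ?case by auto
qed

text \<open>A cycle is a combination of standard cycles plus a boundary. The minor with columns
  \<open>rev J\<close> picks out p! times the coefficient at \<open>J\<close>, so vanishing of all
  forms kills every coefficient.\<close>

theorem torus_cycle_boundary:
  assumes c: "c \<in> rat_cycles p (torus k)"
    and forms: "\<And>D. alternating_form p D \<Longrightarrow> form_eval k coords p D c = 0"
  shows "\<exists>y\<in>rat_chains (Suc p) (torus k). c = rat_boundary (int (Suc p)) y"
proof -
  obtain r y where y: "y \<in> rat_chains (Suc p) (torus k)"
    "c = (\<Sum>I\<in>cycle_basis k p. rat_scale (r I) (torus_cycle k I)) + rat_boundary (int (Suc p)) y"
    using rat_cycles_torus_span[OF c] unfolding torus_span_def by blast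
  have "r J = 0" if J: "J \<in> cycle_basis k p" for J
  proof -
    let ?D = "minor_form (rev J)"
    have Jp: "length J = p" and sJ: "sorted_wrt (<) (rev J)"
      using J by (auto simp: cycle_basis_def sorted_wrt_rev)
    have D: "alternating_form p ?D"
      using alternating_minor_form[of "rev J"] Jp by simp
    have "form_eval k coords p ?D (torus_cycle k I) = (if I = J then fact p else 0)" if "I \<in> cycle_basis k p" for I
    proof -
      have I: "length I = p" "sorted_wrt (<) (rev I)" "set I \<subseteq> {..<k}"
        using that by (auto simp: cycle_basis_def sorted_wrt_rev)
      then show ?thesis
        using form_eval_torus_cycle[of I k ?D] D minor_form_unit_vec[OF I(2) sJ] Jp by auto
    qed
    then have "form_eval k coords p ?D c = (\<Sum>I\<in>cycle_basis k p. if I = J then r J * fact p else 0)"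
      unfolding y(2) form_eval_add form_eval_sum form_eval_scale
        form_eval_boundary[OF torus_coords_torus y(1) D] add_0_right
      by (intro sum.cong) auto
    also have "\<dots> = r J * fact p"
      using J by simp
    finally show ?thesis
      using forms[OF D] by simp
  qed
  then show ?thesis
    using y by auto
qed

text \<open>Each simplex is replaced by a cycle with the same form values, extended linearly to
  chains.\<close>

theorem torus_chain_cycle:
  assumes c: "c \<in> rat_chains p (torus k)"
  shows "\<exists>z\<in>rat_cycles p (torus k). \<forall>D. alternating_form p D \<longrightarrow> form_eval k coords p D z = form_eval k coords p D c"
proof -
  let ?Q = "\<lambda>s z. z \<in> rat_cycles p (torus k) \<and> (\<forall>D. alternating_form p D \<longrightarrow>
      form_eval k coords p D z = D (simplex_edges k coords p s))"
  define Z where "Z s = (SOME z. ?Q s z)" for s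
  have ex: "\<exists>z. ?Q s z" for s
  proof -
    have "v j = 0" if "v \<in> set (simplex_edges k coords p s)" "k \<le> j" for v j
      using simplex_edges_support[OF that] .
    then show ?thesis
      using exists_cycle_with_edges[of "simplex_edges k coords p s" k] unfolding length_simplex_edges by blast
  qed
  have Z: "Z s \<in> rat_cycles p (torus k)"
    "alternating_form p D \<Longrightarrow> form_eval k coords p D (Z s) = D (simplex_edges k coords p s)" for s D
    using someI_ex[OF ex[of s]] unfolding Z_def by blast+
  have "rat_extend Z c \<in> rat_cycles p (torus k)"
    unfolding rat_extend_def by (intro rat_cycles_sum rat_cycles_scale Z)
  moreover have "form_eval k coords p D (rat_extend Z c) = form_eval k coords p D c"
    if "alternating_form p D" for D
    using Z(2)[OF that] unfolding form_eval_def rat_eval_rat_extend by simp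
  ultimately show ?thesis by blast
qed

section \<open>Operads in tori\<close>

lemma alternating_form_prepend:
  assumes "alternating_form (p + q) D" "length ws = p"
  shows "alternating_form q (\<lambda>l. D (ws @ l))"
  using assms
proof (induction ws arbitrary: p D)
  case (Cons w ws)
  then obtain p' where p: "p = Suc p'" "length ws = p'"
    by auto
  have "alternating_form (p' + q) (\<lambda>l. D (w # l))"
    using alternating_form_Cons[of "p' + q" D w] Cons.prems p by simp
  from Cons.IH[OF this p(2)] show ?case by simp
qed simp

lemma log_vertex_cong:
  assumes "\<And>x. x \<in> standard_simplex p \<Longrightarrow> u x = v x"
  shows "log_vertex p u = log_vertex p v"
proof -
  have "simplex_log p u = simplex_log p v"
    unfolding simplex_log_def using assms by (intro arg_cong[of _ _ Eps] ext) auto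
  then show ?thesis
    by (simp add: log_vertex_def fun_eq_iff)
qed

text \<open>Evaluating after a map is evaluating with pulled back coordinates. Hence the forms on an
  operad component can be computed on the torus to which it is homeomorphic.\<close>

lemma form_eval_rat_chain_map:
  "form_eval k c p D (rat_chain_map p f a) = form_eval k (\<lambda>j x. c j (f x)) p D a"
proof -
  have "simplex_edges k c p (simplex_map p f s) = simplex_edges k (\<lambda>j x. c j (f x)) p s" for s
  proof -
    have "log_vertex p (\<lambda>x. c j (simplex_map p f s x)) = log_vertex p (\<lambda>x. c j (f (s x)))" for j
      by (rule log_vertex_cong) (simp add: simplex_map_def)
    then have "potential k c p (simplex_map p f s) = potential k (\<lambda>j x. c j (f x)) p s"
      by (simp add: potential_def fun_eq_iff)
    then show ?thesis
      by (simp only: simplex_edges_def)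
  qed
  then show ?thesis
    by (simp add: form_eval_def rat_eval_rat_chain_map)
qed

lemma form_eval_0 [simp]: "form_eval k c p D 0 = 0"
  by (simp add: form_eval_def)

text \<open>Both operads fit this description: arity 0 is empty, the other arities are tori through
  the coordinates \<open>h n\<close>, and in these coordinates compositions are monomial, hence
  homomorphisms.\<close>

locale torus_operad = top_ns_operad T for T :: "'a top_operad" +
  fixes rank :: "nat \<Rightarrow> nat" and h :: "nat \<Rightarrow> 'a \<Rightarrow> nat \<Rightarrow> complex" and h' :: "nat \<Rightarrow> (nat \<Rightarrow> complex) \<Rightarrow> 'a"
  assumes tspace_0: "topspace (tspace T 0) = {}"
    and torus_homeomorphism: "1 \<le> n \<Longrightarrow> homeomorphic_maps (tspace T n) (torus (rank n)) (h n) (h' n)"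
    and tcomp_monomial: "\<lbrakk>1 \<le> i; i \<le> n; 1 \<le> m\<rbrakk> \<Longrightarrow> \<exists>A B. monomial_map
      (tspace T n) (rank n) (\<lambda>j x. h n x j) A (tspace T m) (rank m) (\<lambda>j x. h m x j) B
      (rank (n + m - 1)) (\<lambda>j x. h (n + m - 1) x j) (\<lambda>(x, y). tcomp T n m i x y)"
begin

abbreviation S where "S \<equiv> singular_operad T"

definition eval_form :: "nat \<Rightarrow> nat \<Rightarrow> ((nat \<Rightarrow> rat) list \<Rightarrow> rat) \<Rightarrow> 'a rat_chain \<Rightarrow> rat" where
  "eval_form n = form_eval (rank n) (\<lambda>j x. h n x j)"

text \<open>The ideal to which \<open>formal_operadI\<close> is applied. In negative degree the
  carrier is already zero, so the truncation by \<open>nat\<close> is harmless.\<close>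

definition form_kernel :: "nat \<Rightarrow> int \<Rightarrow> 'a rat_chain set" where
  "form_kernel n d = {c \<in> carrier (obj S n d). \<forall>D. alternating_form (nat d) D \<longrightarrow> eval_form n (nat d) D c = 0}"

lemma torus_maps:
  assumes "1 \<le> n"
  shows "continuous_map (tspace T n) (torus (rank n)) (h n)" "continuous_map (torus (rank n)) (tspace T n) (h' n)"
    and "\<And>x. x \<in> topspace (tspace T n) \<Longrightarrow> h' n (h n x) = x"
    and "\<And>z. z \<in> topspace (torus (rank n)) \<Longrightarrow> h n (h' n z) = z"
  using torus_homeomorphism[OF assms] by (auto simp: homeomorphic_maps_def)

lemma torus_coords_h:
  assumes "1 \<le> n"
  shows "torus_coords (tspace T n) (rank n) (\<lambda>j x. h n x j)"
  unfolding torus_coords_def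
  using continuous_map_compose[OF torus_maps(1)[OF assms] continuous_map_torus_coord] by (simp add: comp_def)

lemma eval_form_map:
  "eval_form n p D c = form_eval (rank n) coords p D (rat_chain_map p (h n) c)"
  unfolding eval_form_def form_eval_rat_chain_map ..

lemma carrierE:
  assumes "c \<in> carrier (obj S n d)"
  obtains "c = 0" | p where "1 \<le> n" "d = int p" "c \<in> rat_chains p (tspace T n)"
proof (cases "c = 0")
  case False
  then have d: "d \<ge> 0" "c \<in> rat_chains (nat d) (tspace T n)"
    using assms by (auto split: if_splits)
  then have "n \<noteq> 0"
    using rat_chains_empty[OF tspace_0] False by (metis singletonD)
  then show thesis
    using that(2)[of "nat d"] d by simp
qed (use that in simp)

lemma form_kernel_0: "0 \<in> form_kernel n d"
  by (simp add: form_kernel_def eval_form_def)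

text \<open>With one simplex held fixed, the form in the formula of
  \<open>form_eval_eilenberg_zilber\<close> becomes an alternating form in the edges of the other
  factor, on which the vanishing hypothesis applies.\<close>

lemma eval_form_tcomp:
  assumes i: "1 \<le> i" "i \<le> n" and m: "1 \<le> m" and D: "alternating_form (p + q) D"
    and x: "x \<in> rat_chains p (tspace T n)" and y: "y \<in> rat_chains q (tspace T m)"
    and zero: "(\<forall>D. alternating_form p D \<longrightarrow> eval_form n p D x = 0) \<or> (\<forall>D. alternating_form q D \<longrightarrow> eval_form m q D y = 0)"
  shows "eval_form (n + m - 1) (p + q) D
    (rat_chain_map (p + q) (\<lambda>(x, y). tcomp T n m i x y) (eilenberg_zilber p q x y)) = 0"
proof -
  have n: "1 \<le> n"
    using i by simp
  obtain A B where AB: "monomial_map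
      (tspace T n) (rank n) (\<lambda>j x. h n x j) A (tspace T m) (rank m) (\<lambda>j x. h m x j) B
      (rank (n + m - 1)) (\<lambda>j x. h (n + m - 1) x j) (\<lambda>(x, y). tcomp T n m i x y)"
    using tcomp_monomial[OF i m] by blast
  let ?f = "monomial_linear (rank (n + m - 1)) A" and ?g = "monomial_linear (rank (n + m - 1)) B"
  let ?es = "simplex_edges (rank n) (\<lambda>j x. h n x j) p" and ?et = "simplex_edges (rank m) (\<lambda>j x. h m x j) q"
  define R where "R = rat_eval (\<lambda>s. rat_eval (\<lambda>t. D (map ?f (?es s) @ map ?g (?et t))) y) x"
  have "R = 0"
    using zero
  proof
    assume x0: "\<forall>D. alternating_form p D \<longrightarrow> eval_form n p D x = 0"
    have "alternating_form p (\<lambda>l. D (map ?f l @ map ?g (?et t)))" for t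
      using alternating_form_map[OF alternating_form_append[OF D], of "map ?g (?et t)" ?f] by simp
    \<comment> \<open>Here the inner variable is the fixed one, so the order of the two evaluations
      has to be exchanged by \<open>rat_eval_swap\<close>.\<close>
    then have "rat_eval (\<lambda>s. D (map ?f (?es s) @ map ?g (?et t))) x = 0" for t
      using x0 unfolding eval_form_def form_eval_def by blast
    then show ?thesis
      unfolding R_def rat_eval_swap[of _ y x] by simp
  next
    assume y0: "\<forall>D. alternating_form q D \<longrightarrow> eval_form m q D y = 0"
    have "alternating_form q (\<lambda>l. D (map ?f (?es s) @ map ?g l))" for s
      using alternating_form_map[OF alternating_form_prepend[OF D], of "map ?f (?es s)" ?g] by simp
    then have "rat_eval (\<lambda>t. D (map ?f (?es s) @ map ?g (?et t))) y = 0" for s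
      using y0 unfolding eval_form_def form_eval_def by blast
    then show ?thesis
      unfolding R_def by simp
  qed
  then show ?thesis
    unfolding eval_form_def R_def
    by (subst form_eval_eilenberg_zilber[OF torus_coords_h[OF n] x torus_coords_h[OF m] y AB D]) simp
qed

theorem formal_singular_operad: "formal_operad S"
proof (rule formal_operadI[where N = form_kernel])
  show S: "dg_ns_operad S"
    by (rule dg_ns_operad_singular_operad) unfold_locales
  interpret dg_ns_operad S
    by fact
  have smult: "r \<odot>\<^bsub>obj S n d\<^esub> x \<in> form_kernel n d" if "x \<in> form_kernel n d" for r n d x
    using that by (auto simp: form_kernel_def eval_form_def form_eval_scale rat_chains_scale)
  then show "\<And>n d r x. x \<in> form_kernel n d \<Longrightarrow> r \<odot>\<^bsub>obj S n d\<^esub> x \<in> form_kernel n d" .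
  show "additive_subgroup (form_kernel n d) (obj S n d)" for n d
  proof (rule additive_subgroupI, rule subgroup.intro)
    show "form_kernel n d \<subseteq> carrier (add_monoid (obj S n d))"
      by (auto simp: form_kernel_def)
    show "x \<otimes>\<^bsub>add_monoid (obj S n d)\<^esub> y \<in> form_kernel n d" if "x \<in> form_kernel n d" "y \<in> form_kernel n d" for x y
      using that by (auto simp: form_kernel_def eval_form_def form_eval_add rat_chains_add)
    show "\<one>\<^bsub>add_monoid (obj S n d)\<^esub> \<in> form_kernel n d"
      by (simp add: form_kernel_0)
    show "inv\<^bsub>add_monoid (obj S n d)\<^esub> x \<in> form_kernel n d" if x: "x \<in> form_kernel n d" for x
    proof -
      have "x \<in> carrier (obj S n d)"
        using x by (simp add: form_kernel_def)
      from minus_eq_smult[OF this] smult[OF x, of "- 1"] show ?thesis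
        by (simp only: a_inv_def)
    qed
  qed
  show "boundaries S n d \<subseteq> form_kernel n d" for n d
  proof
    fix b assume b: "b \<in> boundaries S n d"
    then obtain a where a: "a \<in> carrier (obj S n (d + 1))" "b = rat_boundary (d + 1) a"
      by (auto simp: boundaries_def)
    from a(1) show "b \<in> form_kernel n d"
    proof (cases rule: carrierE)
      case 1
      then show ?thesis
        using a form_kernel_0 by simp
    next
      case (2 p)
      show ?thesis
      proof (cases p)
        case 0
        then show ?thesis
          using a 2 form_kernel_0 by (simp add: rat_boundary_def)
      next
        case (Suc q)
        then have d: "d = int q"
          using 2 by simp
        have "eval_form n q D b = 0" if "alternating_form q D" for D
          using form_eval_boundary[OF torus_coords_h[OF 2(1)] 2(3)[unfolded Suc] that] a(2) 2(2) Suc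
          by (simp add: eval_form_def)
        then show ?thesis
          using boundaries_carrier[OF b] unfolding form_kernel_def d nat_int by blast
      qed
    qed
  qed
  show "pcomp S n m i d e x y \<in> form_kernel (n + m - 1) (d + e)"
    if i: "1 \<le> i" "i \<le> n" and x: "x \<in> form_kernel n d" and y: "y \<in> carrier (obj S m e)" for n m i d e x y
  proof -
    have xc: "x \<in> carrier (obj S n d)"
      using x by (simp add: form_kernel_def)
    from xc show ?thesis
    proof (cases rule: carrierE)
      case 1
      then show ?thesis using form_kernel_0 by simp
    next
      case x': (2 p)
      from y show ?thesis
      proof (cases rule: carrierE)
        case 1
        then show ?thesis using form_kernel_0 by simp
      next
        case y': (2 q)
        have "eval_form (n + m - 1) (p + q) D (pcomp S n m i d e x y) = 0" if D: "alternating_form (p + q) D" for D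
          using eval_form_tcomp[OF i y'(1) D x'(3) y'(3)] x unfolding x'(2) y'(2) form_kernel_def
          by (simp flip: of_nat_add)
        then show ?thesis
          using pcomp_closed[OF i xc y] unfolding form_kernel_def x'(2) y'(2) of_nat_add[symmetric] nat_int by blast
      qed
    qed
  qed
  show "pcomp S n m i d e x y \<in> form_kernel (n + m - 1) (d + e)"
    if i: "1 \<le> i" "i \<le> n" and x: "x \<in> carrier (obj S n d)" and y: "y \<in> form_kernel m e" for n m i d e x y
  proof -
    have yc: "y \<in> carrier (obj S m e)"
      using y by (simp add: form_kernel_def)
    from yc show ?thesis
    proof (cases rule: carrierE)
      case 1
      then show ?thesis using form_kernel_0 by simp
    next
      case y': (2 q)
      from x show ?thesis
      proof (cases rule: carrierE)
        case 1
        then show ?thesis using form_kernel_0 by simp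
      next
        case x': (2 p)
        have "eval_form (n + m - 1) (p + q) D (pcomp S n m i d e x y) = 0" if D: "alternating_form (p + q) D" for D
          using eval_form_tcomp[OF i y'(1) D x'(3) y'(3)] y unfolding x'(2) y'(2) form_kernel_def
          by (simp flip: of_nat_add)
        then show ?thesis
          using pcomp_closed[OF i x yc] unfolding form_kernel_def x'(2) y'(2) of_nat_add[symmetric] nat_int by blast
      qed
    qed
  qed
  \<comment> \<open>The two remaining conditions are theorems about tori; \<open>left_inv\<close>
    and \<open>right_inv\<close> carry chains along the coordinate homeomorphism and back.\<close>
  have left_inv: "rat_chain_map p (h' n) (rat_chain_map p (h n) x) = x"
    if "1 \<le> n" "x \<in> rat_chains p (tspace T n)" for n p x
    unfolding rat_chain_map_rat_chain_map by (rule rat_chain_map_id[OF that(2)]) (simp add: torus_maps[OF that(1)])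
  have right_inv: "rat_chain_map p (h n) (rat_chain_map p (h' n) z) = z"
    if "1 \<le> n" "z \<in> rat_chains p (torus (rank n))" for n p z
    unfolding rat_chain_map_rat_chain_map by (rule rat_chain_map_id[OF that(2)]) (simp add: torus_maps[OF that(1)])
  show "cycles S n d \<inter> form_kernel n d \<subseteq> boundaries S n d" for n d
  proof
    fix x assume x: "x \<in> cycles S n d \<inter> form_kernel n d"
    then have "x \<in> carrier (obj S n d)"
      by (simp add: form_kernel_def)
    then show "x \<in> boundaries S n d"
    proof (cases rule: carrierE)
      case 1
      then show ?thesis
        using boundaries_zero[of n d] by simp
    next
      case (2 p)
      have "rat_boundary (int p) x = 0"
        using x 2 by (simp add: cycles_def)
      then have "x \<in> rat_cycles p (tspace T n)"
        using 2 by (simp add: rat_cycles_def)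
      then have "rat_chain_map p (h n) x \<in> rat_cycles p (torus (rank n))"
        by (rule rat_cycles_map) (rule torus_maps(1)[OF 2(1)])
      moreover have "form_eval (rank n) coords p D (rat_chain_map p (h n) x) = 0" if "alternating_form p D" for D
        using x that 2 by (simp add: form_kernel_def eval_form_map)
      ultimately obtain y where y: "y \<in> rat_chains (Suc p) (torus (rank n))"
        "rat_chain_map p (h n) x = rat_boundary (int (Suc p)) y"
        using torus_cycle_boundary by blast
      have "x = rat_boundary (int (Suc p)) (rat_chain_map (Suc p) (h' n) y)"
        using left_inv[OF 2(1,3)] unfolding y(2) by (simp add: rat_boundary_rat_chain_map del: of_nat_Suc)
      moreover have "rat_chain_map (Suc p) (h' n) y \<in> rat_chains (Suc p) (tspace T n)"
        by (rule rat_chain_map_in[OF y(1) torus_maps(2)[OF 2(1)]])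
      moreover have d: "d + 1 = int (Suc p)"
        using 2 by simp
      ultimately show ?thesis
        unfolding boundaries_def singular_operad_simps rat_singular_chains_simps d by (auto simp del: of_nat_Suc)
    qed
  qed
  show "\<exists>u\<in>form_kernel n d. \<exists>z\<in>cycles S n d. x = u \<oplus>\<^bsub>obj S n d\<^esub> z" if x: "x \<in> carrier (obj S n d)" for n d x
    using x
  proof (cases rule: carrierE)
    case 1
    then show ?thesis
      using form_kernel_0[of n d] cycles_zero[of n d] by (intro bexI[of _ 0]) auto
  next
    case (2 p)
    have "rat_chain_map p (h n) x \<in> rat_chains p (torus (rank n))"
      by (rule rat_chain_map_in[OF 2(3) torus_maps(1)[OF 2(1)]])
    then obtain z' where z': "z' \<in> rat_cycles p (torus (rank n))"
      "\<And>D. alternating_form p D \<Longrightarrow> form_eval (rank n) coords p D z' = form_eval (rank n) coords p D (rat_chain_map p (h n) x)"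
      using torus_chain_cycle by blast
    define z where "z = rat_chain_map p (h' n) z'"
    have zc: "z \<in> rat_cycles p (tspace T n)"
      unfolding z_def by (rule rat_cycles_map[OF z'(1) torus_maps(2)[OF 2(1)]])
    have "eval_form n p D (x - z) = 0" if "alternating_form p D" for D
      using z'(2)[OF that] right_inv[OF 2(1) rat_cyclesD(1)[OF z'(1)]]
      unfolding eval_form_map rat_chain_map_diff form_eval_diff z_def by simp
    then have "x - z \<in> form_kernel n d"
      using 2 rat_cyclesD(1)[OF zc] by (simp add: form_kernel_def rat_chains_diff)
    moreover have "z \<in> cycles S n d"
      using 2 zc by (simp add: cycles_def rat_cycles_def)
    moreover have "x = (x - z) \<oplus>\<^bsub>obj S n d\<^esub> z"
      by simp
    ultimately show ?thesis by blast
  qed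
qed

end

section \<open>The two operads\<close>

lemma AsS1_comp_left: "\<lbrakk>1 \<le> k; k < i; k < n + m - 1\<rbrakk> \<Longrightarrow> AsS1_comp n m i z w k = z k"
  and AsS1_comp_mid: "\<lbrakk>1 \<le> k; i \<le> k; k < i + m - 1; k < n + m - 1; j = k + 1 - i\<rbrakk> \<Longrightarrow> AsS1_comp n m i z w k = w j"
  and AsS1_comp_right: "\<lbrakk>1 \<le> k; i \<le> k; i + m - 1 \<le> k; k < n + m - 1; j = k + 1 - m\<rbrakk> \<Longrightarrow> AsS1_comp n m i z w k = z j"
  and AsS1_comp_outside: "k \<notin> {1..<n + m - 1} \<Longrightarrow> AsS1_comp n m i z w k = undefined"
  by (auto simp: AsS1_comp_def)

text \<open>The coordinates of the double composite fall into five consecutive blocks, coming from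
  \<open>x\<close>, \<open>y\<close>, \<open>z\<close>, \<open>y\<close>, \<open>x\<close>. The
  bounds reflect that a point of arity m has only m - 1 coordinates.\<close>

lemma AsS1_comp_sequential:
  assumes "1 \<le> i" "i \<le> n" "1 \<le> j" "j \<le> m" "1 \<le> l"
  shows "AsS1_comp (n + m - 1) l (i + j - 1) (AsS1_comp n m i x y) z =
    AsS1_comp n (m + l - 1) i x (AsS1_comp m l j y z)"
proof
  fix k
  show "AsS1_comp (n + m - 1) l (i + j - 1) (AsS1_comp n m i x y) z k =
    AsS1_comp n (m + l - 1) i x (AsS1_comp m l j y z) k"
  proof (cases "k \<in> {1..<n + m - 1 + l - 1}")
    case True
    consider "k < i" | "i \<le> k" "k < i + j - 1" | "i + j - 1 \<le> k" "k < i + j + l - 2"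
      | "i + j + l - 2 \<le> k" "k < i + m + l - 2" | "i + m + l - 2 \<le> k"
      by linarith
    then show ?thesis
    proof cases
      case 1
      have "AsS1_comp (n + m - 1) l (i + j - 1) (AsS1_comp n m i x y) z k = AsS1_comp n m i x y k"
        by (rule AsS1_comp_left) (use 1 True assms in auto)
      moreover have "AsS1_comp n m i x y k = x k"
        by (rule AsS1_comp_left) (use 1 True assms in auto)
      moreover have "AsS1_comp n (m + l - 1) i x (AsS1_comp m l j y z) k = x k"
        by (rule AsS1_comp_left) (use 1 True assms in auto)
      ultimately show ?thesis
        by (simp only:)
    next
      case 2
      have "AsS1_comp (n + m - 1) l (i + j - 1) (AsS1_comp n m i x y) z k = AsS1_comp n m i x y k"
        by (rule AsS1_comp_left) (use 2 True assms in auto)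
      moreover have "AsS1_comp n m i x y k = y (k + 1 - i)"
        by (rule AsS1_comp_mid) (use 2 True assms in auto)
      moreover have "AsS1_comp n (m + l - 1) i x (AsS1_comp m l j y z) k = AsS1_comp m l j y z (k + 1 - i)"
        by (rule AsS1_comp_mid) (use 2 True assms in auto)
      moreover have "AsS1_comp m l j y z (k + 1 - i) = y (k + 1 - i)"
        by (rule AsS1_comp_left) (use 2 True assms in auto)
      ultimately show ?thesis
        by (simp only:)
    next
      case 3
      have "AsS1_comp (n + m - 1) l (i + j - 1) (AsS1_comp n m i x y) z k = z (k + 2 - i - j)"
        by (rule AsS1_comp_mid) (use 3 True assms in auto)
      moreover have "AsS1_comp n (m + l - 1) i x (AsS1_comp m l j y z) k = AsS1_comp m l j y z (k + 1 - i)"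
        by (rule AsS1_comp_mid) (use 3 True assms in auto)
      moreover have "AsS1_comp m l j y z (k + 1 - i) = z (k + 2 - i - j)"
        by (rule AsS1_comp_mid) (use 3 True assms in auto)
      ultimately show ?thesis
        by (simp only:)
    next
      case 4
      have "AsS1_comp (n + m - 1) l (i + j - 1) (AsS1_comp n m i x y) z k = AsS1_comp n m i x y (k + 1 - l)"
        by (rule AsS1_comp_right) (use 4 True assms in auto)
      moreover have "AsS1_comp n m i x y (k + 1 - l) = y (k + 2 - i - l)"
        by (rule AsS1_comp_mid) (use 4 True assms in auto)
      moreover have "AsS1_comp n (m + l - 1) i x (AsS1_comp m l j y z) k = AsS1_comp m l j y z (k + 1 - i)"
        by (rule AsS1_comp_mid) (use 4 True assms in auto)
      moreover have "AsS1_comp m l j y z (k + 1 - i) = y (k + 2 - i - l)"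
        by (rule AsS1_comp_right) (use 4 True assms in auto)
      ultimately show ?thesis
        by (simp only:)
    next
      case 5
      have "AsS1_comp (n + m - 1) l (i + j - 1) (AsS1_comp n m i x y) z k = AsS1_comp n m i x y (k + 1 - l)"
        by (rule AsS1_comp_right) (use 5 True assms in auto)
      moreover have "AsS1_comp n m i x y (k + 1 - l) = x (k + 2 - m - l)"
        by (rule AsS1_comp_right) (use 5 True assms in auto)
      moreover have "AsS1_comp n (m + l - 1) i x (AsS1_comp m l j y z) k = x (k + 2 - m - l)"
        by (rule AsS1_comp_right) (use 5 True assms in auto)
      ultimately show ?thesis
        by (simp only:)
    qed
  next
    case False
    then have "k \<notin> {1..<n + (m + l - 1) - 1}"
      using assms by auto
    with False show ?thesis
      by (simp only: AsS1_comp_outside not_False_eq_True)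
  qed
qed

text \<open>The blocks are now \<open>x\<close>, \<open>y\<close>, \<open>x\<close>,
  \<open>z\<close>, \<open>x\<close>, where the later insertion is shifted by the m - 1 coordinates
  of the earlier one.\<close>

lemma AsS1_comp_parallel:
  assumes "1 \<le> i" "i < k" "k \<le> n" "1 \<le> m" "1 \<le> l"
  shows "AsS1_comp (n + m - 1) l (k + m - 1) (AsS1_comp n m i x y) z =
    AsS1_comp (n + l - 1) m i (AsS1_comp n l k x z) y"
proof
  fix a
  show "AsS1_comp (n + m - 1) l (k + m - 1) (AsS1_comp n m i x y) z a =
    AsS1_comp (n + l - 1) m i (AsS1_comp n l k x z) y a"
  proof (cases "a \<in> {1..<n + m - 1 + l - 1}")
    case True
    consider "a < i" | "i \<le> a" "a < i + m - 1" | "i + m - 1 \<le> a" "a < k + m - 1"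
      | "k + m - 1 \<le> a" "a < k + m + l - 2" | "k + m + l - 2 \<le> a"
      by linarith
    then show ?thesis
    proof cases
      case 1
      have "AsS1_comp (n + m - 1) l (k + m - 1) (AsS1_comp n m i x y) z a = AsS1_comp n m i x y a"
        by (rule AsS1_comp_left) (use 1 True assms in auto)
      moreover have "AsS1_comp n m i x y a = x a"
        by (rule AsS1_comp_left) (use 1 True assms in auto)
      moreover have "AsS1_comp (n + l - 1) m i (AsS1_comp n l k x z) y a = AsS1_comp n l k x z a"
        by (rule AsS1_comp_left) (use 1 True assms in auto)
      moreover have "AsS1_comp n l k x z a = x a"
        by (rule AsS1_comp_left) (use 1 True assms in auto)
      ultimately show ?thesis
        by (simp only:)
    next
      case 2
      have "AsS1_comp (n + m - 1) l (k + m - 1) (AsS1_comp n m i x y) z a = AsS1_comp n m i x y a"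
        by (rule AsS1_comp_left) (use 2 True assms in auto)
      moreover have "AsS1_comp n m i x y a = y (a + 1 - i)"
        by (rule AsS1_comp_mid) (use 2 True assms in auto)
      moreover have "AsS1_comp (n + l - 1) m i (AsS1_comp n l k x z) y a = y (a + 1 - i)"
        by (rule AsS1_comp_mid) (use 2 True assms in auto)
      ultimately show ?thesis
        by (simp only:)
    next
      case 3
      have "AsS1_comp (n + m - 1) l (k + m - 1) (AsS1_comp n m i x y) z a = AsS1_comp n m i x y a"
        by (rule AsS1_comp_left) (use 3 True assms in auto)
      moreover have "AsS1_comp n m i x y a = x (a + 1 - m)"
        by (rule AsS1_comp_right) (use 3 True assms in auto)
      moreover have "AsS1_comp (n + l - 1) m i (AsS1_comp n l k x z) y a = AsS1_comp n l k x z (a + 1 - m)"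
        by (rule AsS1_comp_right) (use 3 True assms in auto)
      moreover have "AsS1_comp n l k x z (a + 1 - m) = x (a + 1 - m)"
        by (rule AsS1_comp_left) (use 3 True assms in auto)
      ultimately show ?thesis
        by (simp only:)
    next
      case 4
      have "AsS1_comp (n + m - 1) l (k + m - 1) (AsS1_comp n m i x y) z a = z (a + 2 - k - m)"
        by (rule AsS1_comp_mid) (use 4 True assms in auto)
      moreover have "AsS1_comp (n + l - 1) m i (AsS1_comp n l k x z) y a = AsS1_comp n l k x z (a + 1 - m)"
        by (rule AsS1_comp_right) (use 4 True assms in auto)
      moreover have "AsS1_comp n l k x z (a + 1 - m) = z (a + 2 - k - m)"
        by (rule AsS1_comp_mid) (use 4 True assms in auto)
      ultimately show ?thesis
        by (simp only:)
    next
      case 5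
      have "AsS1_comp (n + m - 1) l (k + m - 1) (AsS1_comp n m i x y) z a = AsS1_comp n m i x y (a + 1 - l)"
        by (rule AsS1_comp_right) (use 5 True assms in auto)
      moreover have "AsS1_comp n m i x y (a + 1 - l) = x (a + 2 - m - l)"
        by (rule AsS1_comp_right) (use 5 True assms in auto)
      moreover have "AsS1_comp (n + l - 1) m i (AsS1_comp n l k x z) y a = AsS1_comp n l k x z (a + 1 - m)"
        by (rule AsS1_comp_right) (use 5 True assms in auto)
      moreover have "AsS1_comp n l k x z (a + 1 - m) = x (a + 2 - m - l)"
        by (rule AsS1_comp_right) (use 5 True assms in auto)
      ultimately show ?thesis
        by (simp only:)
    qed
  next
    case False
    then have "a \<notin> {1..<n + l - 1 + m - 1}"
      using assms by auto
    with False show ?thesis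
      by (simp only: AsS1_comp_outside not_False_eq_True)
  qed
qed

lemma AsS1_comp_unit_left:
  "x \<in> extensional {1..<n} \<Longrightarrow> AsS1_comp 1 n 1 u x = x"
  by (auto simp: AsS1_comp_def extensional_def fun_eq_iff)

lemma AsS1_comp_unit_right:
  "x \<in> extensional {1..<n} \<Longrightarrow> AsS1_comp n 1 i x u = x"
  by (auto simp: AsS1_comp_def extensional_def fun_eq_iff)

lemma topspace_AsS1_space:
  "z \<in> topspace (AsS1_space n) \<longleftrightarrow> n \<noteq> 0 \<and> z \<in> extensional {1..<n} \<and> (\<forall>k\<in>{1..<n}. z k \<noteq> 0)"
  by (auto simp: AsS1_space_def PiE_def)

lemma continuous_map_into_AsS1_space:
  "\<lbrakk>1 \<le> n; \<And>x. x \<in> topspace T \<Longrightarrow> f x \<in> extensional {1..<n}; \<And>k. k \<in> {1..<n} \<Longrightarrow> continuous_map T Cstar (\<lambda>x. f x k)\<rbrakk> \<Longrightarrow>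
    continuous_map T (AsS1_space n) f"
  unfolding AsS1_space_def by (auto simp: continuous_map_componentwise)

lemma continuous_map_AsS1_coord: "k \<in> {1..<n} \<Longrightarrow> continuous_map (AsS1_space n) Cstar (\<lambda>z. z k)"
  unfolding AsS1_space_def by (auto intro!: continuous_map_product_projection)

lemma continuous_map_of_component:
  assumes "continuous_map T T' f" "continuous_map T' Cstar (\<lambda>z. z k)"
  shows "continuous_map T Cstar (\<lambda>x. f x k)"
  using continuous_map_compose[OF assms] by (simp add: comp_def)

lemma continuous_map_Cstar_mult:
  "\<lbrakk>continuous_map T Cstar f; continuous_map T Cstar g\<rbrakk> \<Longrightarrow> continuous_map T Cstar (\<lambda>x. f x * g x)"
  unfolding continuous_map_Cstar_iff by (auto intro: continuous_map_complex_intros)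

text \<open>The second argument is assumed continuous coordinate by coordinate, the form in which
  the rotated point of the semidirect product is available.\<close>

lemma continuous_AsS1_comp:
  assumes i: "1 \<le> i" "i \<le> n" and m: "1 \<le> m"
    and f: "continuous_map T (AsS1_space n) f" and g: "\<And>k. k \<in> {1..<m} \<Longrightarrow> continuous_map T Cstar (\<lambda>x. g x k)"
  shows "continuous_map T (AsS1_space (n + m - 1)) (\<lambda>x. AsS1_comp n m i (f x) (g x))"
proof (rule continuous_map_into_AsS1_space)
  have f': "continuous_map T Cstar (\<lambda>x. f x k)" if "k \<in> {1..<n}" for k
    by (rule continuous_map_of_component[OF f continuous_map_AsS1_coord[OF that]])
  fix k assume k: "k \<in> {1..<n + m - 1}"
  consider "k < i" | "i \<le> k" "k < i + m - 1" | "i + m - 1 \<le> k" "i \<le> k"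
    using m by linarith
  then show "continuous_map T Cstar (\<lambda>x. AsS1_comp n m i (f x) (g x) k)"
  proof cases
    case 1
    then show ?thesis
      using k i f'[of k] by (auto simp: AsS1_comp_def)
  next
    case 2
    then have "k + 1 - i \<in> {1..<m}"
      by auto
    from g[OF this] show ?thesis
      using 2 k i by (simp add: AsS1_comp_def)
  next
    case 3
    then have "k + 1 - m \<in> {1..<n}"
      using k i m by auto
    from f'[OF this] show ?thesis
      using 3 k i by (simp add: AsS1_comp_def)
  qed
qed (use i m in \<open>auto simp: AsS1_comp_def\<close>)

lemma top_ns_operad_AsS1: "top_ns_operad AsS1"
proof
  fix i n m :: nat assume i: "1 \<le> i" "i \<le> n"
  show "continuous_map (prod_topology (tspace AsS1 n) (tspace AsS1 m)) (tspace AsS1 (n + m - 1))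
      (\<lambda>(x, y). tcomp AsS1 n m i x y)"
  proof (cases "m = 0")
    case True
    then show ?thesis
      by (simp add: AsS1_def AsS1_space_def continuous_map_on_empty)
  next
    case False
    then show ?thesis
      unfolding AsS1_def top_operad.simps case_prod_unfold
      by (intro continuous_AsS1_comp i continuous_map_fst continuous_map_of_component[OF continuous_map_snd]
          continuous_map_AsS1_coord) auto
  qed
next
  fix i n j m l :: nat and x y z
  assume "1 \<le> i" "i \<le> n" "1 \<le> j" "j \<le> m" "x \<in> topspace (tspace AsS1 n)"
    "y \<in> topspace (tspace AsS1 m)" "z \<in> topspace (tspace AsS1 l)"
  then show "tcomp AsS1 (n + m - 1) l (i + j - 1) (tcomp AsS1 n m i x y) z =
      tcomp AsS1 n (m + l - 1) i x (tcomp AsS1 m l j y z)"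
    using AsS1_comp_sequential[of i n j m l x y z] by (simp add: AsS1_def topspace_AsS1_space)
next
  fix i k n m l :: nat and x y z
  assume "1 \<le> i" "i < k" "k \<le> n" "x \<in> topspace (tspace AsS1 n)"
    "y \<in> topspace (tspace AsS1 m)" "z \<in> topspace (tspace AsS1 l)"
  then show "tcomp AsS1 (n + m - 1) l (k + m - 1) (tcomp AsS1 n m i x y) z =
      tcomp AsS1 (n + l - 1) m i (tcomp AsS1 n l k x z) y"
    using AsS1_comp_parallel[of i k n m l x y z] by (simp add: AsS1_def topspace_AsS1_space)
qed (simp_all add: AsS1_def topspace_AsS1_space AsS1_comp_unit_left[simplified] AsS1_comp_unit_right[simplified])

definition AsS1_coords :: "nat \<Rightarrow> (nat \<Rightarrow> complex) \<Rightarrow> nat \<Rightarrow> complex" where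
  "AsS1_coords n z = (\<lambda>j\<in>{..<n - 1}. z (j + 1))"

definition AsS1_of_coords :: "nat \<Rightarrow> (nat \<Rightarrow> complex) \<Rightarrow> nat \<Rightarrow> complex" where
  "AsS1_of_coords n w = (\<lambda>k\<in>{1..<n}. w (k - 1))"

lemma torus_operad_AsS1: "torus_operad AsS1 (\<lambda>n. n - 1) AsS1_coords AsS1_of_coords"
proof (rule torus_operad.intro[OF top_ns_operad_AsS1], rule torus_operad_axioms.intro)
  show "topspace (tspace AsS1 0) = {}"
    by (simp add: AsS1_def AsS1_space_def)
next
  fix n :: nat assume n: "1 \<le> n"
  have "continuous_map (AsS1_space n) (torus (n - 1)) (AsS1_coords n)"
    by (rule continuous_map_into_torus) (auto simp: AsS1_coords_def continuous_map_AsS1_coord)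
  moreover have "continuous_map (torus (n - 1)) (AsS1_space n) (AsS1_of_coords n)"
    by (rule continuous_map_into_AsS1_space[OF n]) (auto simp: AsS1_of_coords_def continuous_map_torus_coord)
  moreover have "AsS1_of_coords n (AsS1_coords n z) = z" if "z \<in> topspace (AsS1_space n)" for z
    using that by (auto simp: AsS1_coords_def AsS1_of_coords_def topspace_AsS1_space extensional_def fun_eq_iff)
  moreover have "AsS1_coords n (AsS1_of_coords n w) = w" if "w \<in> topspace (torus (n - 1))" for w
    using that by (auto simp: AsS1_coords_def AsS1_of_coords_def topspace_torus extensional_def fun_eq_iff)
  ultimately show "homeomorphic_maps (tspace AsS1 n) (torus (n - 1)) (AsS1_coords n) (AsS1_of_coords n)"
    by (simp add: homeomorphic_maps_def AsS1_def)
next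
  fix i n m :: nat assume i: "1 \<le> i" "i \<le> n" and m: "1 \<le> m"
  \<comment> \<open>Torus coordinates start at 0, so \<open>j\<close> stands for the operadic
    coordinate j + 1. Every coordinate of the composite is copied from exactly one argument, hence
    exactly one of \<open>?A\<close> and \<open>?B\<close> is not \<open>None\<close>.\<close>
  let ?A = "\<lambda>j. if j + 1 < i then Some j else if j + 1 < i + m - 1 then None else Some (j + 1 - m)"
  let ?B = "\<lambda>j. if j + 1 < i then None else if j + 1 < i + m - 1 then Some (j + 1 - i) else None"
  have "monomial_map (tspace AsS1 n) (n - 1) (\<lambda>j x. AsS1_coords n x j) ?A
      (tspace AsS1 m) (m - 1) (\<lambda>j x. AsS1_coords m x j) ?B
      (n + m - 1 - 1) (\<lambda>j x. AsS1_coords (n + m - 1) x j) (\<lambda>(x, y). tcomp AsS1 n m i x y)"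
    unfolding monomial_map_def
  proof (intro allI impI conjI ballI)
    fix j assume j: "j < n + m - 1 - 1"
    show "a < n - 1" if "?A j = Some a" for a
      using that i m j by (auto split: if_splits)
    show "b < m - 1" if "?B j = Some b" for b
      using that i m j by (auto split: if_splits)
    fix x y
    consider "j + 1 < i" | "i \<le> j + 1" "j + 1 < i + m - 1" | "i \<le> j + 1" "i + m - 1 \<le> j + 1"
      using m by linarith
    then show "AsS1_coords (n + m - 1) (case (x, y) of (x, y) \<Rightarrow> tcomp AsS1 n m i x y) j =
        monomial (?A j) (\<lambda>j x. AsS1_coords n x j) x * monomial (?B j) (\<lambda>j x. AsS1_coords m x j) y"
    proof cases
      case 1
      then show ?thesis
        using i m j by (simp add: AsS1_coords_def AsS1_def AsS1_comp_def monomial_def)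
    next
      case 2
      then have "Suc (Suc j) - i = Suc (Suc j - i)" "Suc j - i < m - 1" "Suc j < n + m - Suc 0"
        using j by auto
      then show ?thesis
        using 2 i m j by (simp add: AsS1_coords_def AsS1_def AsS1_comp_def monomial_def)
    next
      case 3
      then have "Suc (Suc j) - m = Suc (Suc j - m)" "Suc j - m < n - 1" "Suc j < n + m - Suc 0"
        using i j m by auto
      then show ?thesis
        using 3 i m j by (simp add: AsS1_coords_def AsS1_def AsS1_comp_def monomial_def)
    qed
  qed
  then show "\<exists>A B. monomial_map (tspace AsS1 n) (n - 1) (\<lambda>j x. AsS1_coords n x j) A
      (tspace AsS1 m) (m - 1) (\<lambda>j x. AsS1_coords m x j) B
      (n + m - 1 - 1) (\<lambda>j x. AsS1_coords (n + m - 1) x j) (\<lambda>(x, y). tcomp AsS1 n m i x y)"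
    by blast
qed

section \<open>The semidirect product\<close>

definition frame_comp :: "nat \<Rightarrow> nat \<Rightarrow> nat \<Rightarrow> (nat \<Rightarrow> complex) \<Rightarrow> (nat \<Rightarrow> complex) \<Rightarrow> nat \<Rightarrow> complex" where
  "frame_comp n m i g h = (\<lambda>k\<in>{1..n + m - 1}.
     if k < i then g k else if k < i + m then g i * h (k + 1 - i) else g (k + 1 - m))"

lemma AsS1_semidirect_simps:
  "tspace AsS1_semidirect n = prod_topology (AsS1_space n) (product_topology (\<lambda>_. Cstar) {1..n})"
  "tcomp AsS1_semidirect n m i (p, g) (q, h) = (AsS1_comp n m i p (AsS1_action m (g i) q), frame_comp n m i g h)"
  "tunit AsS1_semidirect = (\<lambda>_. undefined, \<lambda>k\<in>{1}. 1)"
  by (simp_all add: AsS1_semidirect_def frame_comp_def)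

text \<open>Compatibility of the action with composition, on which associativity of the semidirect
  product rests.\<close>

lemma AsS1_action_comp:
  assumes "1 \<le> i" "i \<le> n" "1 \<le> m"
  shows "AsS1_action (n + m - 1) a (AsS1_comp n m i z w) = AsS1_comp n m i (AsS1_action n a z) (AsS1_action m a w)"
  using assms by (auto simp: AsS1_action_def AsS1_comp_def fun_eq_iff)

lemma AsS1_action_action: "AsS1_action n a (AsS1_action n b z) = AsS1_action n (a * b) z"
  by (auto simp: AsS1_action_def fun_eq_iff)

lemma AsS1_action_1: "z \<in> extensional {1..<n} \<Longrightarrow> AsS1_action n 1 z = z"
  by (auto simp: AsS1_action_def extensional_def fun_eq_iff)

lemma frame_comp_left: "\<lbrakk>1 \<le> k; k < i; k \<le> n + m - 1\<rbrakk> \<Longrightarrow> frame_comp n m i g h k = g k"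
  and frame_comp_mid: "\<lbrakk>1 \<le> k; i \<le> k; k < i + m; k \<le> n + m - 1; j = k + 1 - i\<rbrakk> \<Longrightarrow> frame_comp n m i g h k = g i * h j"
  and frame_comp_right: "\<lbrakk>1 \<le> k; i \<le> k; i + m \<le> k; k \<le> n + m - 1; j = k + 1 - m\<rbrakk> \<Longrightarrow> frame_comp n m i g h k = g j"
  and frame_comp_outside: "k \<notin> {1..n + m - 1} \<Longrightarrow> frame_comp n m i g h k = undefined"
  by (auto simp: frame_comp_def)

text \<open>The same five blocks as for \<open>AsS1_comp\<close>, each frame group being one
  position longer. In the innermost block the frames of all three factors are multiplied.\<close>

lemma frame_comp_sequential:
  assumes "1 \<le> i" "i \<le> n" "1 \<le> j" "j \<le> m" "1 \<le> l"
  shows "frame_comp (n + m - 1) l (i + j - 1) (frame_comp n m i g h) f =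
    frame_comp n (m + l - 1) i g (frame_comp m l j h f)"
proof
  fix k
  show "frame_comp (n + m - 1) l (i + j - 1) (frame_comp n m i g h) f k =
    frame_comp n (m + l - 1) i g (frame_comp m l j h f) k"
  proof (cases "k \<in> {1..n + m - 1 + l - 1}")
    case True
    consider "k < i" | "i \<le> k" "k < i + j - 1" | "i + j - 1 \<le> k" "k < i + j + l - 1"
      | "i + j + l - 1 \<le> k" "k < i + m + l - 1" | "i + m + l - 1 \<le> k"
      by linarith
    then show ?thesis
    proof cases
      case 1
      have "frame_comp (n + m - 1) l (i + j - 1) (frame_comp n m i g h) f k = frame_comp n m i g h k"
        by (rule frame_comp_left) (use 1 True assms in auto)
      moreover have "frame_comp n m i g h k = g k"
        by (rule frame_comp_left) (use 1 True assms in auto)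
      moreover have "frame_comp n (m + l - 1) i g (frame_comp m l j h f) k = g k"
        by (rule frame_comp_left) (use 1 True assms in auto)
      ultimately show ?thesis
        by (simp only:)
    next
      case 2
      have "frame_comp (n + m - 1) l (i + j - 1) (frame_comp n m i g h) f k = frame_comp n m i g h k"
        by (rule frame_comp_left) (use 2 True assms in auto)
      moreover have "frame_comp n m i g h k = g i * h (k + 1 - i)"
        by (rule frame_comp_mid) (use 2 True assms in auto)
      moreover have "frame_comp n (m + l - 1) i g (frame_comp m l j h f) k = g i * frame_comp m l j h f (k + 1 - i)"
        by (rule frame_comp_mid) (use 2 True assms in auto)
      moreover have "frame_comp m l j h f (k + 1 - i) = h (k + 1 - i)"
        by (rule frame_comp_left) (use 2 True assms in auto)
      ultimately show ?thesis
        by (simp only:)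
    next
      case 3
      have "frame_comp (n + m - 1) l (i + j - 1) (frame_comp n m i g h) f k = frame_comp n m i g h (i + j - 1) * f (k + 2 - i - j)"
        by (rule frame_comp_mid) (use 3 True assms in auto)
      moreover have "frame_comp n m i g h (i + j - 1) = g i * h j"
        by (rule frame_comp_mid) (use 3 True assms in auto)
      moreover have "frame_comp n (m + l - 1) i g (frame_comp m l j h f) k = g i * frame_comp m l j h f (k + 1 - i)"
        by (rule frame_comp_mid) (use 3 True assms in auto)
      moreover have "frame_comp m l j h f (k + 1 - i) = h j * f (k + 2 - i - j)"
        by (rule frame_comp_mid) (use 3 True assms in auto)
      ultimately show ?thesis
        by (simp only: mult.assoc)
    next
      case 4
      have "frame_comp (n + m - 1) l (i + j - 1) (frame_comp n m i g h) f k = frame_comp n m i g h (k + 1 - l)"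
        by (rule frame_comp_right) (use 4 True assms in auto)
      moreover have "frame_comp n m i g h (k + 1 - l) = g i * h (k + 2 - i - l)"
        by (rule frame_comp_mid) (use 4 True assms in auto)
      moreover have "frame_comp n (m + l - 1) i g (frame_comp m l j h f) k = g i * frame_comp m l j h f (k + 1 - i)"
        by (rule frame_comp_mid) (use 4 True assms in auto)
      moreover have "frame_comp m l j h f (k + 1 - i) = h (k + 2 - i - l)"
        by (rule frame_comp_right) (use 4 True assms in auto)
      ultimately show ?thesis
        by (simp only:)
    next
      case 5
      have "frame_comp (n + m - 1) l (i + j - 1) (frame_comp n m i g h) f k = frame_comp n m i g h (k + 1 - l)"
        by (rule frame_comp_right) (use 5 True assms in auto)
      moreover have "frame_comp n m i g h (k + 1 - l) = g (k + 2 - m - l)"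
        by (rule frame_comp_right) (use 5 True assms in auto)
      moreover have "frame_comp n (m + l - 1) i g (frame_comp m l j h f) k = g (k + 2 - m - l)"
        by (rule frame_comp_right) (use 5 True assms in auto)
      ultimately show ?thesis
        by (simp only:)
    qed
  next
    case False
    then have "k \<notin> {1..n + (m + l - 1) - 1}"
      using assms by auto
    with False show ?thesis
      by (simp only: frame_comp_outside not_False_eq_True)
  qed
qed

lemma frame_comp_parallel:
  assumes "1 \<le> i" "i < k" "k \<le> n" "1 \<le> m" "1 \<le> l"
  shows "frame_comp (n + m - 1) l (k + m - 1) (frame_comp n m i g h) f =
    frame_comp (n + l - 1) m i (frame_comp n l k g f) h"
proof
  fix a
  show "frame_comp (n + m - 1) l (k + m - 1) (frame_comp n m i g h) f a =
    frame_comp (n + l - 1) m i (frame_comp n l k g f) h a"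
  proof (cases "a \<in> {1..n + m - 1 + l - 1}")
    case True
    consider "a < i" | "i \<le> a" "a < i + m" | "i + m \<le> a" "a < k + m - 1"
      | "k + m - 1 \<le> a" "a < k + m + l - 1" | "k + m + l - 1 \<le> a"
      by linarith
    then show ?thesis
    proof cases
      case 1
      have "frame_comp (n + m - 1) l (k + m - 1) (frame_comp n m i g h) f a = frame_comp n m i g h a"
        by (rule frame_comp_left) (use 1 True assms in auto)
      moreover have "frame_comp n m i g h a = g a"
        by (rule frame_comp_left) (use 1 True assms in auto)
      moreover have "frame_comp (n + l - 1) m i (frame_comp n l k g f) h a = frame_comp n l k g f a"
        by (rule frame_comp_left) (use 1 True assms in auto)
      moreover have "frame_comp n l k g f a = g a"
        by (rule frame_comp_left) (use 1 True assms in auto)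
      ultimately show ?thesis
        by (simp only:)
    next
      case 2
      have "frame_comp (n + m - 1) l (k + m - 1) (frame_comp n m i g h) f a = frame_comp n m i g h a"
        by (rule frame_comp_left) (use 2 True assms in auto)
      moreover have "frame_comp n m i g h a = g i * h (a + 1 - i)"
        by (rule frame_comp_mid) (use 2 True assms in auto)
      moreover have "frame_comp (n + l - 1) m i (frame_comp n l k g f) h a = frame_comp n l k g f i * h (a + 1 - i)"
        by (rule frame_comp_mid) (use 2 True assms in auto)
      moreover have "frame_comp n l k g f i = g i"
        by (rule frame_comp_left) (use 2 True assms in auto)
      ultimately show ?thesis
        by (simp only:)
    next
      case 3
      have "frame_comp (n + m - 1) l (k + m - 1) (frame_comp n m i g h) f a = frame_comp n m i g h a"
        by (rule frame_comp_left) (use 3 True assms in auto)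
      moreover have "frame_comp n m i g h a = g (a + 1 - m)"
        by (rule frame_comp_right) (use 3 True assms in auto)
      moreover have "frame_comp (n + l - 1) m i (frame_comp n l k g f) h a = frame_comp n l k g f (a + 1 - m)"
        by (rule frame_comp_right) (use 3 True assms in auto)
      moreover have "frame_comp n l k g f (a + 1 - m) = g (a + 1 - m)"
        by (rule frame_comp_left) (use 3 True assms in auto)
      ultimately show ?thesis
        by (simp only:)
    next
      case 4
      have "frame_comp (n + m - 1) l (k + m - 1) (frame_comp n m i g h) f a = frame_comp n m i g h (k + m - 1) * f (a + 2 - k - m)"
        by (rule frame_comp_mid) (use 4 True assms in auto)
      moreover have "frame_comp n m i g h (k + m - 1) = g k"
        by (rule frame_comp_right) (use 4 True assms in auto)
      moreover have "frame_comp (n + l - 1) m i (frame_comp n l k g f) h a = frame_comp n l k g f (a + 1 - m)"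
        by (rule frame_comp_right) (use 4 True assms in auto)
      moreover have "frame_comp n l k g f (a + 1 - m) = g k * f (a + 2 - k - m)"
        by (rule frame_comp_mid) (use 4 True assms in auto)
      ultimately show ?thesis
        by (simp only:)
    next
      case 5
      have "frame_comp (n + m - 1) l (k + m - 1) (frame_comp n m i g h) f a = frame_comp n m i g h (a + 1 - l)"
        by (rule frame_comp_right) (use 5 True assms in auto)
      moreover have "frame_comp n m i g h (a + 1 - l) = g (a + 2 - m - l)"
        by (rule frame_comp_right) (use 5 True assms in auto)
      moreover have "frame_comp (n + l - 1) m i (frame_comp n l k g f) h a = frame_comp n l k g f (a + 1 - m)"
        by (rule frame_comp_right) (use 5 True assms in auto)
      moreover have "frame_comp n l k g f (a + 1 - m) = g (a + 2 - m - l)"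
        by (rule frame_comp_right) (use 5 True assms in auto)
      ultimately show ?thesis
        by (simp only:)
    qed
  next
    case False
    then have "a \<notin> {1..n + l - 1 + m - 1}"
      using assms by auto
    with False show ?thesis
      by (simp only: frame_comp_outside not_False_eq_True)
  qed
qed

lemma topspace_AsS1_semidirect:
  "(p, g) \<in> topspace (tspace AsS1_semidirect n) \<longleftrightarrow>
     p \<in> topspace (AsS1_space n) \<and> g \<in> extensional {1..n} \<and> (\<forall>k\<in>{1..n}. g k \<noteq> 0)"
  by (auto simp: AsS1_semidirect_simps PiE_def)

lemma continuous_map_frame_coord: "k \<in> {1..n} \<Longrightarrow> continuous_map (product_topology (\<lambda>_. Cstar) {1..n}) Cstar (\<lambda>z. z k)"
  by (rule continuous_map_product_projection)

lemma top_ns_operad_AsS1_semidirect: "top_ns_operad AsS1_semidirect"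
proof
  fix i n m :: nat assume i: "1 \<le> i" "i \<le> n"
  let ?T = "prod_topology (tspace AsS1_semidirect n) (tspace AsS1_semidirect m)"
  show "continuous_map ?T (tspace AsS1_semidirect (n + m - 1)) (\<lambda>(x, y). tcomp AsS1_semidirect n m i x y)"
  proof (cases "m = 0")
    case True
    then have "topspace ?T = {}"
      by (simp add: AsS1_semidirect_simps AsS1_space_def)
    then show ?thesis
      unfolding null_topspace_iff_trivial by (simp only: continuous_map_on_empty)
  next
    case False
    then have m: "1 \<le> m" by simp
    have fst1: "continuous_map ?T (AsS1_space n) (\<lambda>x. fst (fst x))"
      and snd1: "continuous_map ?T (product_topology (\<lambda>_. Cstar) {1..n}) (\<lambda>x. snd (fst x))"
      and fst2: "continuous_map ?T (AsS1_space m) (\<lambda>x. fst (snd x))"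
      and snd2: "continuous_map ?T (product_topology (\<lambda>_. Cstar) {1..m}) (\<lambda>x. snd (snd x))"
      unfolding AsS1_semidirect_simps
      by (intro continuous_map_compose[OF continuous_map_fst continuous_map_fst, unfolded comp_def]
        continuous_map_compose[OF continuous_map_fst continuous_map_snd, unfolded comp_def]
        continuous_map_compose[OF continuous_map_snd continuous_map_fst, unfolded comp_def]
        continuous_map_compose[OF continuous_map_snd continuous_map_snd, unfolded comp_def])+
    have gi: "continuous_map ?T Cstar (\<lambda>x. snd (fst x) k)" if "k \<in> {1..n}" for k
      by (rule continuous_map_of_component[OF snd1 continuous_map_frame_coord[OF that]])
    have hj: "continuous_map ?T Cstar (\<lambda>x. snd (snd x) k)" if "k \<in> {1..m}" for k
      by (rule continuous_map_of_component[OF snd2 continuous_map_frame_coord[OF that]])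
    have act: "continuous_map ?T Cstar (\<lambda>x. AsS1_action m (snd (fst x) i) (fst (snd x)) k)" if k: "k \<in> {1..<m}" for k
      using continuous_map_Cstar_mult[OF gi[of i] continuous_map_of_component[OF fst2 continuous_map_AsS1_coord[OF k]]] i k
      by (simp add: AsS1_action_def)
    have 1: "continuous_map ?T (AsS1_space (n + m - 1))
        (\<lambda>x. AsS1_comp n m i (fst (fst x)) (AsS1_action m (snd (fst x) i) (fst (snd x))))"
      by (rule continuous_AsS1_comp[OF i m fst1]) (rule act)
    have 2: "continuous_map ?T (product_topology (\<lambda>_. Cstar) {1..n + m - 1})
        (\<lambda>x. frame_comp n m i (snd (fst x)) (snd (snd x)))"
      unfolding continuous_map_componentwise
    proof (intro conjI ballI)
      show "(\<lambda>x. frame_comp n m i (snd (fst x)) (snd (snd x))) ` topspace ?T \<subseteq> extensional {1..n + m - 1}"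
        by (auto simp: frame_comp_def)
      fix k assume k: "k \<in> {1..n + m - 1}"
      consider "k < i" | "i \<le> k" "k < i + m" | "i + m \<le> k"
        by linarith
      then show "continuous_map ?T Cstar (\<lambda>x. frame_comp n m i (snd (fst x)) (snd (snd x)) k)"
      proof cases
        case 1
        then show ?thesis
          using k i gi[of k] by (simp add: frame_comp_def)
      next
        case 2
        then have "k + 1 - i \<in> {1..m}" "i \<in> {1..n}"
          using i by auto
        from continuous_map_Cstar_mult[OF gi[OF this(2)] hj[OF this(1)]] show ?thesis
          using 2 k i by (simp add: frame_comp_def)
      next
        case 3
        then have "k + 1 - m \<in> {1..n}"
          using k i m by auto
        from gi[OF this] show ?thesis
          using 3 k i m by (simp add: frame_comp_def)
      qed
    qed
    have "(\<lambda>(x, y). tcomp AsS1_semidirect n m i x y) = (\<lambda>x.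
        (AsS1_comp n m i (fst (fst x)) (AsS1_action m (snd (fst x) i) (fst (snd x))),
         frame_comp n m i (snd (fst x)) (snd (snd x))))"
      by (auto simp: AsS1_semidirect_simps fun_eq_iff)
    then show ?thesis
      using 1 2 unfolding AsS1_semidirect_simps(1)[of "n + m - 1"] by (simp add: continuous_map_paired)
  qed
next
  show "tunit AsS1_semidirect \<in> topspace (tspace AsS1_semidirect 1)"
    by (simp add: AsS1_semidirect_simps topspace_AsS1_space)
next
  fix x n assume "x \<in> topspace (tspace AsS1_semidirect n)"
  moreover obtain p g where "x = (p, g)"
    by fastforce
  ultimately have x: "x = (p, g)" "p \<in> extensional {1..<n}" "g \<in> extensional {1..n}"
    by (auto simp: topspace_AsS1_semidirect topspace_AsS1_space)
  then have "frame_comp 1 n 1 (\<lambda>k\<in>{1}. 1) g = g"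
    by (auto simp: frame_comp_def extensional_def fun_eq_iff)
  then show "tcomp AsS1_semidirect 1 n 1 (tunit AsS1_semidirect) x = x"
    using AsS1_comp_unit_left[OF x(2)] AsS1_action_1[OF x(2)] x(1) by (simp add: AsS1_semidirect_simps)
next
  fix i n x assume i: "1 \<le> i" "i \<le> n" and "x \<in> topspace (tspace AsS1_semidirect n)"
  moreover obtain p g where "x = (p, g)"
    by fastforce
  ultimately have x: "x = (p, g)" "p \<in> extensional {1..<n}" "g \<in> extensional {1..n}"
    by (auto simp: topspace_AsS1_semidirect topspace_AsS1_space)
  then have "frame_comp n 1 i g (\<lambda>k\<in>{1}. 1) = g"
    using i by (auto simp: frame_comp_def extensional_def fun_eq_iff less_Suc_eq)
  then show "tcomp AsS1_semidirect n 1 i x (tunit AsS1_semidirect) = x"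
    using AsS1_comp_unit_right[OF x(2)] x(1) by (simp add: AsS1_semidirect_simps)
next
  fix i n j m l :: nat and x y z
  assume ij: "1 \<le> i" "i \<le> n" "1 \<le> j" "j \<le> m" and "x \<in> topspace (tspace AsS1_semidirect n)"
    "y \<in> topspace (tspace AsS1_semidirect m)" and z: "z \<in> topspace (tspace AsS1_semidirect l)"
  obtain p g q h r f where eq: "x = (p, g)" "y = (q, h)" "z = (r, f)"
    by fastforce
  then have l: "1 \<le> l"
    using z by (auto simp: topspace_AsS1_semidirect topspace_AsS1_space)
  \<comment> \<open>The frame at the position where \<open>z\<close> is inserted into the composite
    is the product of two frames, which matches acting by h_j first and by g_i afterwards.\<close>
  have "frame_comp n m i g h (i + j - 1) = g i * h j"
    using ij by (auto simp: frame_comp_def)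
  then show "tcomp AsS1_semidirect (n + m - 1) l (i + j - 1) (tcomp AsS1_semidirect n m i x y) z =
      tcomp AsS1_semidirect n (m + l - 1) i x (tcomp AsS1_semidirect m l j y z)"
    unfolding eq AsS1_semidirect_simps
    by (simp only: AsS1_comp_sequential[OF ij l] frame_comp_sequential[OF ij l]
        AsS1_action_comp[OF ij(3,4) l] AsS1_action_action)
next
  fix i k n m l :: nat and x y z
  assume ik: "1 \<le> i" "i < k" "k \<le> n" and "x \<in> topspace (tspace AsS1_semidirect n)"
    and y: "y \<in> topspace (tspace AsS1_semidirect m)" and z: "z \<in> topspace (tspace AsS1_semidirect l)"
  obtain p g q h r f where eq: "x = (p, g)" "y = (q, h)" "z = (r, f)"
    by fastforce
  then have ml: "1 \<le> m" "1 \<le> l"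
    using y z by (auto simp: topspace_AsS1_semidirect topspace_AsS1_space)
  \<comment> \<open>Insertions at different positions leave each other's frames alone, so both
    orders rotate the inserted points by the same elements.\<close>
  have "frame_comp n m i g h (k + m - 1) = g k" "frame_comp n l k g f i = g i"
    using ik ml by (auto simp: frame_comp_def)
  then show "tcomp AsS1_semidirect (n + m - 1) l (k + m - 1) (tcomp AsS1_semidirect n m i x y) z =
      tcomp AsS1_semidirect (n + l - 1) m i (tcomp AsS1_semidirect n l k x z) y"
    unfolding eq AsS1_semidirect_simps
    by (simp only: AsS1_comp_parallel[OF ik ml] frame_comp_parallel[OF ik ml])
qed

text \<open>The n - 1 operadic coordinates come first and the n frames after them, so frame k has
  index n + k - 2 and the rank is 2n - 1.\<close>

definition semidirect_coords :: "nat \<Rightarrow> (nat \<Rightarrow> complex) \<times> (nat \<Rightarrow> complex) \<Rightarrow> nat \<Rightarrow> complex" where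
  "semidirect_coords n x = (\<lambda>j\<in>{..<2 * n - 1}. if j < n - 1 then fst x (j + 1) else snd x (j + 2 - n))"

definition semidirect_of_coords :: "nat \<Rightarrow> (nat \<Rightarrow> complex) \<Rightarrow> (nat \<Rightarrow> complex) \<times> (nat \<Rightarrow> complex)" where
  "semidirect_of_coords n w = (\<lambda>k\<in>{1..<n}. w (k - 1), \<lambda>k\<in>{1..n}. w (n + k - 2))"

lemma semidirect_coords_fst: "k \<in> {1..<n} \<Longrightarrow> semidirect_coords n x (k - 1) = fst x k"
  by (auto simp: semidirect_coords_def)

lemma semidirect_coords_snd:
  assumes "k \<in> {1..n}"
  shows "semidirect_coords n x (n + k - 2) = snd x k"
proof -
  have "n + k - 2 < 2 * n - 1" "\<not> n + k - 2 < n - 1" "n + k - 2 + 2 - n = k"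
    using assms by auto
  then show ?thesis
    by (simp add: semidirect_coords_def)
qed

lemma semidirect_index:
  fixes j n :: nat
  assumes "j < 2 * n - 1"
  obtains k where "k \<in> {1..<n}" "j = k - 1" | k where "k \<in> {1..n}" "j = n + k - 2" "n - 1 \<le> j"
proof (cases "j < n - 1")
  case True
  then show thesis
    by (intro that(1)[of "j + 1"]) auto
next
  case False
  then show thesis
    using assms by (intro that(2)[of "j + 2 - n"]) auto
qed

lemma torus_operad_AsS1_semidirect:
  "torus_operad AsS1_semidirect (\<lambda>n. 2 * n - 1) semidirect_coords semidirect_of_coords"
proof (rule torus_operad.intro[OF top_ns_operad_AsS1_semidirect], rule torus_operad_axioms.intro)
  show "topspace (tspace AsS1_semidirect 0) = {}"
    by (simp add: AsS1_semidirect_simps AsS1_space_def)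
next
  fix n :: nat assume n: "1 \<le> n"
  let ?T = "tspace AsS1_semidirect n"
  have fst: "continuous_map ?T Cstar (\<lambda>x. fst x k)" if "k \<in> {1..<n}" for k
    unfolding AsS1_semidirect_simps
    by (rule continuous_map_of_component[OF continuous_map_fst continuous_map_AsS1_coord[OF that]])
  have snd: "continuous_map ?T Cstar (\<lambda>x. snd x k)" if "k \<in> {1..n}" for k
    unfolding AsS1_semidirect_simps
    by (rule continuous_map_of_component[OF continuous_map_snd continuous_map_frame_coord[OF that]])
  have "continuous_map ?T (torus (2 * n - 1)) (semidirect_coords n)"
  proof (rule continuous_map_into_torus)
    fix j assume "j < 2 * n - 1"
    then show "continuous_map ?T Cstar (\<lambda>x. semidirect_coords n x j)"
      by (cases rule: semidirect_index) (simp_all add: semidirect_coords_fst semidirect_coords_snd fst snd del: One_nat_def)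
  qed (auto simp: semidirect_coords_def)
  moreover have "continuous_map (torus (2 * n - 1)) ?T (semidirect_of_coords n)"
    unfolding AsS1_semidirect_simps semidirect_of_coords_def continuous_map_paired
  proof
    show "continuous_map (torus (2 * n - 1)) (AsS1_space n) (\<lambda>w. \<lambda>k\<in>{1..<n}. w (k - 1))"
      by (rule continuous_map_into_AsS1_space[OF n]) (auto intro!: continuous_map_torus_coord)
    show "continuous_map (torus (2 * n - 1)) (product_topology (\<lambda>_. Cstar) {1..n}) (\<lambda>w. \<lambda>k\<in>{1..n}. w (n + k - 2))"
      unfolding continuous_map_componentwise by (auto intro!: continuous_map_torus_coord)
  qed
  moreover have "semidirect_of_coords n (semidirect_coords n x) = x" if "x \<in> topspace ?T" for x
  proof -
    obtain p g where x: "x = (p, g)"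
      by fastforce
    have "p \<in> extensional {1..<n}" "g \<in> extensional {1..n}"
      using that unfolding x topspace_AsS1_semidirect topspace_AsS1_space by auto
    then show ?thesis
      unfolding semidirect_of_coords_def x
      by (auto simp: semidirect_coords_fst[simplified] semidirect_coords_snd[simplified] extensional_def fun_eq_iff)
  qed
  moreover have "semidirect_coords n (semidirect_of_coords n w) = w" if w: "w \<in> topspace (torus (2 * n - 1))" for w
  proof
    fix j
    show "semidirect_coords n (semidirect_of_coords n w) j = w j"
    proof (cases "j < 2 * n - 1")
      case True
      then show ?thesis
        by (cases rule: semidirect_index)
          (simp_all add: semidirect_coords_fst semidirect_coords_snd semidirect_of_coords_def del: One_nat_def)
    next
      case False
      then show ?thesis
        using w by (auto simp: semidirect_coords_def topspace_torus extensional_def)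
    qed
  qed
  ultimately show "homeomorphic_maps ?T (torus (2 * n - 1)) (semidirect_coords n) (semidirect_of_coords n)"
    by (simp add: homeomorphic_maps_def)
next
  fix i n m :: nat assume i: "1 \<le> i" "i \<le> n" and m: "1 \<le> m"
  \<comment> \<open>Indices below n + m - 2 are operadic coordinates of the composite. The others
    are frames, and solving j = (n + m - 1) + k - 2 gives the frame number k = j + 3 - (n + m). In
    both ranges the inserted block is multiplied by g_i, whose index is n + i - 2.\<close>
  let ?A = "\<lambda>j. if j < n + m - 2
    then (if j + 1 < i then Some j else if j + 1 < i + m - 1 then Some (n + i - 2) else Some (j + 1 - m))
    else (let k = j + 3 - (n + m) in
      if k < i then Some (n + k - 2) else if k < i + m then Some (n + i - 2) else Some (n + (k + 1 - m) - 2))"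
  let ?B = "\<lambda>j. if j < n + m - 2
    then (if j + 1 < i then None else if j + 1 < i + m - 1 then Some (j + 1 - i) else None)
    else (let k = j + 3 - (n + m) in
      if k < i then None else if k < i + m then Some (m + (k + 1 - i) - 2) else None)"
  let ?C = "\<lambda>n j x. semidirect_coords n x j"
  have ab: "(\<forall>a. ?A j = Some a \<longrightarrow> a < 2 * n - 1) \<and> (\<forall>b. ?B j = Some b \<longrightarrow> b < 2 * m - 1) \<and>
      ?C (n + m - 1) j (tcomp AsS1_semidirect n m i x y) = monomial (?A j) (?C n) x * monomial (?B j) (?C m) y"
    if j: "j < 2 * (n + m - 1) - 1" for j x y
  proof -
    obtain p g q h where xy: "x = (p, g)" "y = (q, h)"
      by fastforce
    have gi: "semidirect_coords n x (n + i - 2) = g i" "n + i - 2 < 2 * n - 1"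
      using semidirect_coords_snd[of i n x] i xy by auto
    from j show ?thesis
    proof (cases rule: semidirect_index)
      case (1 k)
      have jk: "j < n + m - 2" "j + 1 = k"
        using 1 by auto
      have val: "?C (n + m - 1) j (tcomp AsS1_semidirect n m i x y) = AsS1_comp n m i p (AsS1_action m (g i) q) k"
        using semidirect_coords_fst[OF 1(1), of "tcomp AsS1_semidirect n m i x y"] 1(2) xy
        by (simp add: AsS1_semidirect_simps)
      consider "k < i" | "i \<le> k" "k < i + m - 1" | "i \<le> k" "i + m - 1 \<le> k"
        using m by linarith
      then show ?thesis
      proof cases
        case a: 1
        have k: "k \<in> {1..<n}" "j = k - 1"
          using a 1 i by auto
        have "semidirect_coords n x j = p k" "j < 2 * n - 1"
          using semidirect_coords_fst[OF k(1), of x] k xy by auto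
        moreover have "?A j = Some j" "?B j = None"
          using a jk by auto
        moreover have "AsS1_comp n m i p (AsS1_action m (g i) q) k = p k"
          by (rule AsS1_comp_left) (use a 1 in auto)
        ultimately show ?thesis
          unfolding val by (simp only: monomial_def option.case option.inject mult_1_right) auto
      next
        case a: 2
        have k: "k + 1 - i \<in> {1..<m}"
          using a by auto
        have "semidirect_coords m y (k - i) = q (k + 1 - i)" "k - i < 2 * m - 1"
          using semidirect_coords_fst[OF k, of y] a xy by auto
        moreover have "?A j = Some (n + i - 2)" "?B j = Some (k - i)"
          using a jk by auto
        moreover have "AsS1_comp n m i p (AsS1_action m (g i) q) k = AsS1_action m (g i) q (k + 1 - i)"
          by (rule AsS1_comp_mid) (use a 1 in auto)
        moreover have "AsS1_action m (g i) q (k + 1 - i) = g i * q (k + 1 - i)"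
          using k by (simp add: AsS1_action_def)
        ultimately show ?thesis
          using gi unfolding val by (simp only: monomial_def option.case option.inject) auto
      next
        case a: 3
        have k: "k + 1 - m \<in> {1..<n}"
          using a 1 i m by auto
        have "semidirect_coords n x (k - m) = p (k + 1 - m)" "k - m < 2 * n - 1"
          using semidirect_coords_fst[OF k, of x] a i k xy by auto
        moreover have "?A j = Some (k - m)" "?B j = None"
          using a jk by auto
        moreover have "AsS1_comp n m i p (AsS1_action m (g i) q) k = p (k + 1 - m)"
          by (rule AsS1_comp_right) (use a 1 in auto)
        ultimately show ?thesis
          unfolding val by (simp only: monomial_def option.case option.inject mult_1_right) auto
      qed
    next
      case (2 k)
      have jk: "\<not> j < n + m - 2" "j + 3 - (n + m) = k"
        using 2 i m by auto
      have val: "?C (n + m - 1) j (tcomp AsS1_semidirect n m i x y) = frame_comp n m i g h k"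
        using semidirect_coords_snd[OF 2(1), of "tcomp AsS1_semidirect n m i x y"] 2(2) xy
        by (simp add: AsS1_semidirect_simps)
      consider "k < i" | "i \<le> k" "k < i + m" | "i \<le> k" "i + m \<le> k"
        using m by linarith
      then show ?thesis
      proof cases
        case a: 1
        have "k \<in> {1..n}"
          using a 2 i by auto
        then have "semidirect_coords n x (n + k - 2) = g k" "n + k - 2 < 2 * n - 1"
          using semidirect_coords_snd[of k n x] xy by auto
        then show ?thesis
          using a jk 2(1) unfolding val by (simp add: monomial_def frame_comp_def Let_def)
      next
        case a: 2
        have "k + 1 - i \<in> {1..m}"
          using a by auto
        then have "semidirect_coords m y (m + (k + 1 - i) - 2) = h (k + 1 - i)" "m + (k + 1 - i) - 2 < 2 * m - 1"
          using semidirect_coords_snd[of "k + 1 - i" m y] xy by auto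
        then show ?thesis
          using a jk 2(1) gi unfolding val by (simp add: monomial_def frame_comp_def Let_def)
      next
        case a: 3
        have "k + 1 - m \<in> {1..n}"
          using a 2(1) i m by auto
        then have "semidirect_coords n x (n + (k + 1 - m) - 2) = g (k + 1 - m)" "n + (k + 1 - m) - 2 < 2 * n - 1"
          using semidirect_coords_snd[of "k + 1 - m" n x] xy by auto
        then show ?thesis
          using a jk 2(1) unfolding val by (simp add: monomial_def frame_comp_def Let_def)
      qed
    qed
  qed
  have "monomial_map (tspace AsS1_semidirect n) (2 * n - 1) (?C n) ?A (tspace AsS1_semidirect m) (2 * m - 1) (?C m) ?B
      (2 * (n + m - 1) - 1) (?C (n + m - 1)) (\<lambda>(x, y). tcomp AsS1_semidirect n m i x y)"
    unfolding monomial_map_def case_prod_conv by (intro allI impI conjI ballI) (use ab in blast)+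
  then show "\<exists>A B. monomial_map (tspace AsS1_semidirect n) (2 * n - 1) (?C n) A (tspace AsS1_semidirect m) (2 * m - 1) (?C m) B
      (2 * (n + m - 1) - 1) (?C (n + m - 1)) (\<lambda>(x, y). tcomp AsS1_semidirect n m i x y)"
    by blast
qed

theorem theorem7p4:
  shows "formal_operad (singular_operad AsS1) \<and> formal_operad (singular_operad AsS1_semidirect)"
  using torus_operad.formal_singular_operad[OF torus_operad_AsS1]
    torus_operad.formal_singular_operad[OF torus_operad_AsS1_semidirect] ..

end
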